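(* Let $A\in\mathcal K(\mathbb C^n)$ be such that $\dim_{\mathbb R}A=2n-1$ and let $H\subset\mathbb C^n$ be a real affine hyperplane such that $E_A\cap E_H=E_A^{\mathbb C}$. Let $H^+,H^-$ be the two closed half-spaces bounded by $H$. Then $P_n(A\cap H)=0$ and $$P_n(A)=P_n(A\cap H^+)+P_n(A\cap H^-).$$ In particular, $P_n(A)\geq\max\{P_n(A\cap H^+),P_n(A\cap H^-)\}$.
   Context: $\mathbb C^n$ carries the Hermitian product $\langle z,w\rangle=\sum_\ell z_\ell\bar w_\ell$. $\mathcal K(\mathbb C^n)$ is the set of convex bodies (non-empty compact convex subsets) of $\mathbb C^n$, with support function $h_A(z)=\max_{v\in A}\operatorname{Re}\langle z,v\rangle$. For a non-empty subset $S\subset\mathbb C^n$, $E_S$ is the real linear subspace parallel to the real affine span of $S$, $\dim_{\mathbb R}S=\dim_{\mathbb R}E_S$, and $E_S^{\mathbb C}=E_S\cap iE_S$. $B_{2n}$ is the closed unit ball centred at the origin, $\varkappa_n$ the Lebesgue measure of the unit ball of $\mathbb R^n$, $d^c=i(\bar\partial-\partial)$, so $dd^c=2i\partial\bar\partial$. The Kazarnovskiĭ pseudovolume is $$P_n(A)=\frac1{n!\,\varkappa_n}\int_{B_{2n}}(dd^ch_A)^{\wedge n},$$ with the wedge power of the positive current $dd^ch_A$ taken in the Bedford–Taylor sense (a positive measure), and $P_n(\varnothing)=0$. *)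

theory Defs
  imports "HOL-Analysis.Analysis"
begin

definition herm :: "complex^'n::finite \<Rightarrow> complex^'n \<Rightarrow> complex" where
  "herm z w = (\<Sum>l\<in>UNIV. z $ l * cnj (w $ l))"

definition convex_body :: "(complex^'n::finite) set \<Rightarrow> bool" where
  "convex_body A \<longleftrightarrow> A \<noteq> {} \<and> compact A \<and> convex A"

definition support_fun :: "(complex^'n::finite) set \<Rightarrow> complex^'n \<Rightarrow> real" where
  "support_fun A z = (SUP v\<in>A. Re (herm z v))"

definition parallel_space :: "(complex^'n::finite) set \<Rightarrow> (complex^'n) set" where
  "parallel_space S = {x - y | x y. x \<in> affine hull S \<and> y \<in> affine hull S}"

definition real_dim :: "(complex^'n::finite) set \<Rightarrow> nat" where
  "real_dim S = dim (parallel_space S)"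

definition complex_part :: "(complex^'n::finite) set \<Rightarrow> (complex^'n) set" where
  "complex_part S = parallel_space S \<inter> (\<lambda>v. \<i> *s v) ` parallel_space S"

text \<open>
  A form of degree \<open>d\<close> sends a point \<open>x\<close> and a list of \<open>d\<close> tangent vectors to a complex number,
  with the determinant normalisation: \<open>(\<alpha> \<and> \<beta>) [v, w] = \<alpha> v * \<beta> w - \<alpha> w * \<beta> v\<close> for one-forms.
  Forms vanish on lists of any length other than \<open>d\<close>.
\<close>

type_synonym 'n form = "complex^'n \<Rightarrow> (complex^'n) list \<Rightarrow> complex"

definition alternating :: "nat \<Rightarrow> ((complex^'n::finite) list \<Rightarrow> complex) \<Rightarrow> bool" where
  "alternating d \<alpha> \<longleftrightarrow>
     (\<forall>vs. length vs \<noteq> d \<longrightarrow> \<alpha> vs = 0) \<and>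
     (\<forall>us ws. length us + length ws + 1 = d \<longrightarrow> linear (\<lambda>v. \<alpha> (us @ v # ws))) \<and>
     (\<forall>vs. \<not> distinct vs \<longrightarrow> \<alpha> vs = 0)"

definition Cc_forms :: "nat \<Rightarrow> 'n::finite form set" where
  "Cc_forms d = {\<omega>. (\<forall>x. alternating d (\<omega> x)) \<and>
                    (\<forall>vs. continuous_on UNIV (\<lambda>x. \<omega> x vs)) \<and>
                    (\<exists>K. compact K \<and> (\<forall>x. x \<notin> K \<longrightarrow> \<omega> x = (\<lambda>_. 0)))}"

definition dir_deriv ::
    "complex^'n::finite \<Rightarrow> (complex^'n \<Rightarrow> complex) \<Rightarrow> complex^'n \<Rightarrow> complex" where
  "dir_deriv v g x = frechet_derivative g (at x) v"

definition smooth_fun :: "(complex^'n::finite \<Rightarrow> complex) \<Rightarrow> bool" where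
  "smooth_fun g \<longleftrightarrow> (\<forall>vs x. foldr dir_deriv vs g differentiable (at x))"

definition test_forms :: "nat \<Rightarrow> 'n::finite form set" where
  "test_forms d = {\<omega> \<in> Cc_forms d. \<forall>vs. smooth_fun (\<lambda>x. \<omega> x vs)}"

text \<open>
  For a scalar function \<open>g\<close>, \<open>del_deriv v g\<close> and \<open>delbar_deriv v g\<close> are the values on \<open>v\<close> of the
  one-forms \<open>\<partial>g = \<Sum>\<^sub>j (\<partial>g/\<partial>z\<^sub>j) dz\<^sub>j\<close> and \<open>\<Sum>\<^sub>j (\<partial>g/\<partial>(cnj z\<^sub>j)) d(cnj z\<^sub>j)\<close>, i.e. the complex linear
  and the complex antilinear part of the real differential of \<open>g\<close>.
\<close>

definition del_deriv ::
    "complex^'n::finite \<Rightarrow> (complex^'n \<Rightarrow> complex) \<Rightarrow> complex^'n \<Rightarrow> complex" where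
  "del_deriv v g x = (dir_deriv v g x - \<i> * dir_deriv (\<i> *s v) g x) / 2"

definition delbar_deriv ::
    "complex^'n::finite \<Rightarrow> (complex^'n \<Rightarrow> complex) \<Rightarrow> complex^'n \<Rightarrow> complex" where
  "delbar_deriv v g x = (dir_deriv v g x + \<i> * dir_deriv (\<i> *s v) g x) / 2"

text \<open>
  The extension to forms of a first-order operator \<open>D\<close> on functions, \<open>D v g\<close> being linear in the
  direction \<open>v\<close>: differentiate the coefficients and wedge the resulting one-form from the left.
\<close>

definition form_deriv ::
    "(complex^'n \<Rightarrow> (complex^'n \<Rightarrow> complex) \<Rightarrow> complex^'n \<Rightarrow> complex)
      \<Rightarrow> 'n::finite form \<Rightarrow> 'n form" where
  "form_deriv D \<omega> x vs =
     (\<Sum>i<length vs. (-1)^i * D (vs ! i) (\<lambda>y. \<omega> y (take i vs @ drop (Suc i) vs)) x)"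

definition ext_d :: "'n::finite form \<Rightarrow> 'n form" where
  "ext_d = form_deriv dir_deriv"

definition del :: "'n::finite form \<Rightarrow> 'n form" where
  "del = form_deriv del_deriv"

definition delbar :: "'n::finite form \<Rightarrow> 'n form" where
  "delbar = form_deriv delbar_deriv"

definition ext_dc :: "'n::finite form \<Rightarrow> 'n form" where
  "ext_dc \<omega> x vs = \<i> * (delbar \<omega> x vs - del \<omega> x vs)"

definition ddc :: "'n::finite form \<Rightarrow> 'n form" where
  "ddc \<omega> = ext_d (ext_dc \<omega>)"

text \<open>
  A current acting on forms of degree \<open>d\<close> is an element of the dual of the test forms. Those with
  (complex Radon) measure coefficients are the ones of order zero, and these act on all continuous
  compactly supported forms. Functionals are set to zero off that space.
\<close>

type_synonym 'n current = "'n form \<Rightarrow> complex"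

definition order_zero_current :: "nat \<Rightarrow> 'n::finite current \<Rightarrow> bool" where
  "order_zero_current d T \<longleftrightarrow>
     (\<forall>\<omega>. \<omega> \<notin> Cc_forms d \<longrightarrow> T \<omega> = 0) \<and>
     (\<forall>\<omega>\<in>Cc_forms d. \<forall>\<eta>\<in>Cc_forms d. T (\<lambda>x vs. \<omega> x vs + \<eta> x vs) = T \<omega> + T \<eta>) \<and>
     (\<forall>c. \<forall>\<omega>\<in>Cc_forms d. T (\<lambda>x vs. c * \<omega> x vs) = c * T \<omega>) \<and>
     (\<forall>K. compact K \<longrightarrow> (\<exists>C. \<forall>\<omega>\<in>Cc_forms d. \<forall>M.
         (\<forall>x. x \<notin> K \<longrightarrow> \<omega> x = (\<lambda>_. 0)) \<and>
         (\<forall>x vs. (\<forall>v\<in>set vs. norm v \<le> 1) \<longrightarrow> norm (\<omega> x vs) \<le> M)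
         \<longrightarrow> norm (T \<omega>) \<le> C * M))"

text \<open>
  The positively oriented real basis \<open>e\<^sub>1, i e\<^sub>1, \<dots>, e\<^sub>n, i e\<^sub>n\<close>. The vectors are permuted in pairs
  when another enumeration of the index type is chosen, so the value of a form of top degree on
  the list does not depend on that choice.
\<close>

definition std_frame :: "(complex^'n::finite) list" where
  "std_frame = concat (map (\<lambda>j. [axis j 1, axis j \<i>]) (SOME js. distinct js \<and> set js = UNIV))"

definition integration_current :: "'n::finite current" where
  "integration_current \<omega> =
     (if \<omega> \<in> Cc_forms (2 * CARD('n)) then (LINT x|lborel. \<omega> x std_frame) else 0)"

text \<open>
  The Bedford--Taylor product of \<open>dd\<^sup>c u\<close> with a closed positive current \<open>T\<close> is the current
  \<open>dd\<^sup>c (u T)\<close>, where \<open>u T\<close> makes sense because \<open>T\<close> has measure coefficients. On test forms, the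
  current \<open>dd\<^sup>c (u T)\<close> is \<open>\<phi> \<mapsto> T (u dd\<^sup>c \<phi>)\<close>. It is again positive, hence of order zero, and is
  therefore the unique order zero current with these values. Here \<open>d\<close> is the degree of the
  forms on which the product acts; \<open>T\<close> acts on forms of degree \<open>d + 2\<close>.
\<close>

definition ddc_wedge ::
    "nat \<Rightarrow> (complex^'n::finite \<Rightarrow> real) \<Rightarrow> 'n current \<Rightarrow> 'n current" where
  "ddc_wedge d u T =
     (THE S. order_zero_current d S \<and>
             (\<forall>\<phi>\<in>test_forms d. S \<phi> = T (\<lambda>x vs. of_real (u x) * ddc \<phi> x vs)))"

text \<open>The wedge power \<open>(dd\<^sup>c u)\<^sup>k\<close>, acting on forms of degree \<open>2n - 2k\<close>.\<close>

primrec ddc_power :: "(complex^'n::finite \<Rightarrow> real) \<Rightarrow> nat \<Rightarrow> 'n current" where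
  "ddc_power u 0 = integration_current"
| "ddc_power u (Suc k) = ddc_wedge (2 * CARD('n) - 2 * Suc k) u (ddc_power u k)"

text \<open>The top power acts on functions (forms of degree zero) and is positive, so it is integration
  against a unique Radon measure.\<close>

definition monge_ampere :: "(complex^'n::finite \<Rightarrow> real) \<Rightarrow> (complex^'n) measure" where
  "monge_ampere u =
     (THE \<mu>. sets \<mu> = sets borel \<and>
             (\<forall>K. compact K \<longrightarrow> emeasure \<mu> K < \<infinity>) \<and>
             (\<forall>\<omega>\<in>Cc_forms 0. ddc_power u CARD('n) \<omega> = (LINT x|\<mu>. \<omega> x [])))"

definition pseudovolume :: "(complex^'n::finite) set \<Rightarrow> real" where
  "pseudovolume A =
     (if A = {} then 0
      else measure (monge_ampere (support_fun A)) (cball 0 1)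
             / (fact CARD('n) * measure lborel (cball (0 :: real^'n) 1)))"

end

(*
  Mollified convex functions are smooth with positive semidefinite real Hessian, so at each point dd^c u
  is a sum of forms e_q \<and> e_(iq), where e_q v = q \<bullet> v. Gram-Schmidt over C reduces wedge products of
  such forms to multiples of unitary ones, hence they are dominated by their products with powers of the
  Kaehler form. This gives the Chern-Levine-Nirenberg mass bounds, and the powers (dd^c u)^k are limits
  of their smooth counterparts.

  Write w, u, v, z for the support functions of A and of its intersections with the two half-spaces and
  with H. Then w = max u v and z = min u v, and (w - u) (w - v) = 0 makes dd^c (w - u) \<and> dd^c (w - v)
  vanish; as w + z = u + v, algebra gives
    (dd^c w)^n + (dd^c z)^n = (dd^c u)^n + (dd^c v)^n.
  A normal \<nu> of A satisfies that z is affine along \<nu> and i \<nu>, because E_A \<inter> E_H is a complex subspace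
  orthogonal to \<nu>. So all q that occur for z are orthogonal to a complex line, and (dd^c z)^n = 0.
*)
theory Submission
  imports Defs
begin

text \<open>The wedge powers and the measure are definite descriptions, so nothing is known about
  them before existence and uniqueness are proved. Uniform mass bounds make the smooth currents
  converge on all continuous forms once they converge on test forms; mollified forms give
  uniqueness; the measure is built from the resulting positive functional. In the limit only powers
  of a single function are constructed. Mixed products such as dd^c (w - u) \<and> dd^c (w - v)
  exist on the mollified level alone. This suffices because mollification is linear: w_m + z_m = u_m
  + v_m holds exactly, and the ring identity is used before the limit. The obstacle is that
  mollification destroys (w - u) (w - v) = 0. A quantitative remnant survives: where the Hessian of
  the mollified w - v is non-zero, there is a point at distance of order 1/m with w - v \<noteq> 0,
  hence w - u = 0, and the Lipschitz bound makes the mollified w - u of order 1/m. Integration by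
  parts moves dd^c off this factor onto the test form, and the mass bounds make the whole integral
  O(1/m).\<close>

section \<open>Exterior multiplication by one-forms\<close>

text \<open>The wedge product from the left with the one-form \<open>v \<mapsto> a \<bullet> v\<close>.\<close>

fun ewedge :: "'a::real_inner \<Rightarrow> ('a list \<Rightarrow> complex) \<Rightarrow> 'a list \<Rightarrow> complex" where
  "ewedge a \<alpha> [] = 0"
| "ewedge a \<alpha> (v # vs) = of_real (a \<bullet> v) * \<alpha> vs - ewedge a (\<lambda>ws. \<alpha> (v # ws)) vs"

lemma ewedge_add: "ewedge a (\<lambda>ws. \<alpha> ws + \<beta> ws) vs = ewedge a \<alpha> vs + ewedge a \<beta> vs"
  by (induction vs arbitrary: \<alpha> \<beta>) (auto simp: algebra_simps)

lemma ewedge_scale: "ewedge a (\<lambda>ws. c * \<alpha> ws) vs = c * ewedge a \<alpha> vs"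
  by (induction vs arbitrary: \<alpha>) (auto simp: algebra_simps)

lemma ewedge_zero [simp]: "ewedge a (\<lambda>ws. 0) vs = 0"
  using ewedge_scale[of a 0 "\<lambda>_. 0" vs] by simp

lemma ewedge_minus: "ewedge a (\<lambda>ws. - \<alpha> ws) vs = - ewedge a \<alpha> vs"
  using ewedge_scale[of a "-1" \<alpha> vs] by simp

lemma ewedge_diff: "ewedge a (\<lambda>ws. \<alpha> ws - \<beta> ws) vs = ewedge a \<alpha> vs - ewedge a \<beta> vs"
  using ewedge_add[of a \<alpha> "\<lambda>ws. - \<beta> ws" vs] by (simp add: ewedge_minus)

lemma ewedge_sum: "ewedge a (\<lambda>ws. \<Sum>i\<in>I. f i ws) vs = (\<Sum>i\<in>I. ewedge a (f i) vs)"
  by (induction I rule: infinite_finite_induct) (auto simp: ewedge_add)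

lemma ewedge_add_left: "ewedge (a + b) \<alpha> vs = ewedge a \<alpha> vs + ewedge b \<alpha> vs"
  by (induction vs arbitrary: \<alpha>) (auto simp: algebra_simps inner_add_left)

lemma ewedge_scaleR_left: "ewedge (r *\<^sub>R a) \<alpha> vs = of_real r * ewedge a \<alpha> vs"
  by (induction vs arbitrary: \<alpha>) (auto simp: algebra_simps)

lemma ewedge_zero_left [simp]: "ewedge 0 \<alpha> vs = 0"
  using ewedge_scaleR_left[of 0 0 \<alpha> vs] by simp

lemma ewedge_minus_left: "ewedge (- a) \<alpha> vs = - ewedge a \<alpha> vs"
  using ewedge_scaleR_left[of "-1" a \<alpha> vs] by simp

lemma ewedge_sum_left: "ewedge (\<Sum>i\<in>I. f i) \<alpha> vs = (\<Sum>i\<in>I. ewedge (f i) \<alpha> vs)"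
  by (induction I rule: infinite_finite_induct) (auto simp: ewedge_add_left)

text \<open>Expanding at the first argument \<open>v\<close> leaves the terms
  \<open>a \<bullet> v\<close> and \<open>b \<bullet> v\<close>, which are antisymmetric in
  \<open>a\<close> and \<open>b\<close>, and a remainder that the induction covers. The exterior
  algebra relations thus hold for arbitrary functions of lists.\<close>

lemma ewedge_anticommute: "ewedge a (ewedge b \<alpha>) vs = - ewedge b (ewedge a \<alpha>) vs"
proof (induction vs arbitrary: \<alpha>)
  case (Cons v vs)
  show ?case
    using Cons.IH[of "\<lambda>ws. \<alpha> (v # ws)"]
    by (simp add: ewedge_diff ewedge_scale)
qed simp

lemma ewedge_same [simp]: "ewedge a (ewedge a \<alpha>) vs = 0"
  using ewedge_anticommute[of a a \<alpha> vs] by simp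

lemma ewedge_inner_zero: "(\<And>v. v \<in> set vs \<Longrightarrow> a \<bullet> v = 0) \<Longrightarrow> ewedge a \<alpha> vs = 0"
  by (induction vs arbitrary: \<alpha>) auto

text \<open>The expansion has \<open>length vs\<close> terms, each with one factor
  \<open>\<bar>a \<bullet> v\<bar> \<le> norm a\<close>. The bound is crude, but the mass estimates
  only need a constant that depends on the dimension.\<close>

lemma ewedge_norm_le:
  assumes "\<And>ws. length ws + 1 = length vs \<Longrightarrow> (\<forall>w\<in>set ws. norm w \<le> 1) \<Longrightarrow> norm (\<alpha> ws) \<le> M"
    and "\<forall>v\<in>set vs. norm v \<le> 1"
  shows "norm (ewedge a \<alpha> vs) \<le> real (length vs) * norm a * M"
  using assms
proof (induction vs arbitrary: \<alpha>)
  case (Cons v vs)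
  have 1: "norm (\<alpha> vs) \<le> M"
    using Cons.prems by simp
  have 2: "\<bar>a \<bullet> v\<bar> \<le> norm a"
    using Cauchy_Schwarz_ineq2[of a v] Cons.prems(2) mult_left_le[of "norm v" "norm a"] by simp
  have "norm (ewedge a (\<lambda>ws. \<alpha> (v # ws)) vs) \<le> real (length vs) * norm a * M"
    by (rule Cons.IH) (use Cons.prems in auto)
  moreover have "norm (of_real (a \<bullet> v) * \<alpha> vs) \<le> norm a * M"
    unfolding norm_mult norm_of_real by (rule mult_mono) (use 1 2 in auto)
  ultimately show ?case
    using norm_triangle_ineq4[of "of_real (a \<bullet> v) * \<alpha> vs" "ewedge a (\<lambda>ws. \<alpha> (v # ws)) vs"]
    by (simp add: algebra_simps)
qed simp

text \<open>This closed form has the shape of \<open>form_deriv\<close> and is the bridge from the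
  given derivatives of forms to wedge products.\<close>

lemma ewedge_removal:
  "ewedge a \<alpha> vs = (\<Sum>i<length vs. (-1)^i * of_real (a \<bullet> vs ! i) * \<alpha> (take i vs @ drop (Suc i) vs))"
proof (induction vs arbitrary: \<alpha>)
  case (Cons v vs)
  show ?case
    by (simp add: sum.lessThan_Suc_shift Cons.IH sum_negf[symmetric] del: sum.lessThan_Suc)
qed simp

section \<open>Alternating multilinear functions of lists\<close>

lemma alternating_length: "alternating d \<alpha> \<Longrightarrow> length vs \<noteq> d \<Longrightarrow> \<alpha> vs = 0"
  by (auto simp: alternating_def)

lemma alternating_linear:
  "alternating d \<alpha> \<Longrightarrow> length us + length ws + 1 = d \<Longrightarrow> linear (\<lambda>v. \<alpha> (us @ v # ws))"
  by (auto simp: alternating_def)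

lemma alternating_not_distinct: "alternating d \<alpha> \<Longrightarrow> \<not> distinct vs \<Longrightarrow> \<alpha> vs = 0"
  by (auto simp: alternating_def)

text \<open>Polarisation: a form vanishes with \<open>v + w\<close> in both slots, and expanding
  leaves just the two mixed terms.\<close>

lemma alternating_swap:
  assumes "alternating d \<alpha>"
  shows "\<alpha> (us @ v # w # ws) = - \<alpha> (us @ w # v # ws)"
proof (cases "length us + length ws + 2 = d")
  case True
  have l1: "linear (\<lambda>v. \<alpha> (us @ v # w # ws))" for w
    using alternating_linear[OF assms, of us "w # ws"] True by simp
  have l2: "linear (\<lambda>w. \<alpha> (us @ v # w # ws))" for v
    using alternating_linear[OF assms, of "us @ [v]" ws] True by simp
  have "0 = \<alpha> (us @ (v + w) # (v + w) # ws)"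
    using alternating_not_distinct[OF assms] by simp
  also have "\<dots> = \<alpha> (us @ v # v # ws) + \<alpha> (us @ v # w # ws) + \<alpha> (us @ w # v # ws) + \<alpha> (us @ w # w # ws)"
    by (simp add: linear_add[OF l1] linear_add[OF l2])
  also have "\<dots> = \<alpha> (us @ v # w # ws) + \<alpha> (us @ w # v # ws)"
    using alternating_not_distinct[OF assms] by simp
  finally show ?thesis
    by (simp add: eq_neg_iff_add_eq_0)
qed (use alternating_length[OF assms] in auto)

lemma alternating_move:
  assumes "alternating d \<alpha>"
  shows "\<alpha> (v # us @ ws) = (-1) ^ length us * \<alpha> (us @ v # ws)"
proof (induction us arbitrary: ws rule: rev_induct)
  case (snoc u us)
  show ?case
    using snoc[of "u # ws"] alternating_swap[OF assms, of us u v ws] by simp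
qed simp

lemma alternating_Cons:
  assumes "alternating (Suc d) \<alpha>"
  shows "alternating d (\<lambda>ws. \<alpha> (v # ws))"
  unfolding alternating_def
proof (intro conjI allI impI)
  fix us ws :: "(complex ^ 'a) list"
  assume "length us + length ws + 1 = d"
  then show "linear (\<lambda>x. \<alpha> (v # us @ x # ws))"
    using alternating_linear[OF assms, of "v # us" ws] by simp
qed (use alternating_length[OF assms] alternating_not_distinct[OF assms] in auto)

text \<open>Every summand that keeps \<open>v\<close> vanishes, so only its removal contributes. The
  lemma is applied to the contraction of an alternating form with \<open>v\<close>, which is zero as
  soon as \<open>v\<close> occurs again.\<close>

lemma ewedge_killed:
  assumes "\<And>us ws. \<alpha> (us @ v # ws) = 0"
  shows "ewedge a \<alpha> (us @ v # ws) = (-1) ^ length us * of_real (a \<bullet> v) * \<alpha> (us @ ws)"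
  using assms
proof (induction us arbitrary: \<alpha>)
  case Nil
  have "ewedge a (\<lambda>ws. \<alpha> (v # ws)) ws = 0"
    using Nil[of "[]"] by simp
  then show ?case by simp
next
  case (Cons u us)
  have "\<And>xs ws. \<alpha> (u # xs @ v # ws) = 0"
    using Cons.prems[of "u # _"] by simp
  then show ?case
    using Cons.IH[of "\<lambda>ws. \<alpha> (u # ws)"] Cons.prems by simp
qed

text \<open>All three properties go by induction on the argument list, contracting the form with the
  first argument and so lowering the degree; in degree 0 every contraction is zero.\<close>

lemma alternating_ewedge:
  assumes "alternating d \<alpha>"
  shows "alternating (Suc d) (ewedge a \<alpha>)"
proof -
  have len: "ewedge a \<alpha> vs = 0" if "length vs \<noteq> Suc d" for vs
    using that assms
  proof (induction vs arbitrary: d \<alpha>)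
    case (Cons v vs)
    then have "\<alpha> vs = 0"
      using alternating_length by auto
    moreover have "ewedge a (\<lambda>ws. \<alpha> (v # ws)) vs = 0"
    proof (cases d)
      case 0
      then have "(\<lambda>ws. \<alpha> (v # ws)) = (\<lambda>_. 0)"
        using alternating_length[OF Cons.prems(2)] by auto
      then show ?thesis by simp
    next
      case (Suc e)
      then show ?thesis
        using Cons.IH[of e "\<lambda>ws. \<alpha> (v # ws)"] Cons.prems alternating_Cons by auto
    qed
    ultimately show ?case by simp
  qed simp
  have lin: "linear (\<lambda>v. ewedge a \<alpha> (us @ v # ws))" if "length us + length ws = d" for us ws
    using that assms
  proof (induction us arbitrary: d \<alpha>)
    case Nil
    show ?case
    proof (cases d)
      case 0
      then show ?thesis
        using Nil by (auto intro!: linearI simp: inner_add_right algebra_simps scaleR_conv_of_real[where 'a=complex])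
    next
      case (Suc e)
      have *: "linear (\<lambda>v. \<alpha> (v # us))" if "length us = e" for us
        using alternating_linear[OF Nil(2), of "[]" us] that Suc by simp
      have "ewedge a (\<lambda>ws. \<alpha> ((x + y) # ws)) ws
          = ewedge a (\<lambda>ws. \<alpha> (x # ws)) ws + ewedge a (\<lambda>ws. \<alpha> (y # ws)) ws" for x y
      proof -
        have "\<alpha> ((x + y) # us) = \<alpha> (x # us) + \<alpha> (y # us)" for us
          using linear_add[OF *, of us x y] alternating_length[OF Nil(2)] Suc
          by (cases "length us = e") auto
        then show ?thesis by (simp add: ewedge_add)
      qed
      moreover have "ewedge a (\<lambda>ws. \<alpha> ((r *\<^sub>R x) # ws)) ws
          = of_real r * ewedge a (\<lambda>ws. \<alpha> (x # ws)) ws" for r x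
      proof -
        have "\<alpha> ((r *\<^sub>R x) # us) = of_real r * \<alpha> (x # us)" for us
          using linear_scale[OF *, of us r x] alternating_length[OF Nil(2)] Suc
          by (cases "length us = e") (auto simp: scaleR_conv_of_real[where 'a=complex])
        then show ?thesis by (simp add: ewedge_scale)
      qed
      ultimately show ?thesis
        by (auto intro!: linearI simp: inner_add_right algebra_simps scaleR_conv_of_real[where 'a=complex])
    qed
  next
    case (Cons u us)
    then obtain e where e: "d = Suc e" by (cases d) auto
    have "linear (\<lambda>v. ewedge a (\<lambda>ws. \<alpha> (u # ws)) (us @ v # ws))"
      using Cons.IH[of e "\<lambda>ws. \<alpha> (u # ws)"] alternating_Cons[of e \<alpha> u] Cons.prems e by simp
    moreover have "linear (\<lambda>v. \<alpha> (us @ v # ws))"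
      using alternating_linear[OF Cons.prems(2), of us ws] Cons.prems by simp
    ultimately show ?case
      using linear_compose_sub linear_compose[of _ "(*) (of_real (a \<bullet> u) :: complex)"]
      by (auto simp: o_def intro!: linear_compose_sub linear_compose[of _ "(*) (of_real (a \<bullet> u) :: complex)", unfolded o_def]
          bounded_linear.linear[OF bounded_linear_mult_right])
  qed
  have nd: "ewedge a \<alpha> vs = 0" if "\<not> distinct vs" for vs
    using that assms
  proof (induction vs arbitrary: d \<alpha>)
    case (Cons v vs)
    show ?case
    proof (cases d)
      case 0
      then have "(\<lambda>ws. \<alpha> (v # ws)) = (\<lambda>_. 0)"
        using alternating_length[OF Cons.prems(2)] by auto
      moreover have "\<alpha> vs = 0"
        using Cons.prems alternating_length[OF Cons.prems(2)] 0 by (cases vs) auto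
      ultimately show ?thesis by simp
    next
      case (Suc e)
      then have alt: "alternating e (\<lambda>ws. \<alpha> (v # ws))"
        using Cons.prems(2) alternating_Cons by auto
      show ?thesis
      proof (cases "distinct vs")
        case False
        then show ?thesis
          using Cons.IH[OF False alt] alternating_not_distinct[OF Cons.prems(2)] by simp
      next
        case True
        then have "v \<in> set vs" using Cons.prems(1) by simp
        then obtain us ws where vs: "vs = us @ v # ws"
          by (auto simp: in_set_conv_decomp)
        \<comment> \<open>Here \<open>v\<close> is the first argument and recurs in
          \<open>vs\<close>. Moving the leading \<open>v\<close> to the place of its copy costs the
          same sign as removing that copy, so this term cancels the first summand of the
          recursion.\<close>
        have "ewedge a (\<lambda>ws. \<alpha> (v # ws)) vs = (-1) ^ length us * of_real (a \<bullet> v) * \<alpha> (v # us @ ws)"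
          unfolding vs by (rule ewedge_killed) (use alternating_not_distinct[OF Cons.prems(2)] in auto)
        also have "\<dots> = of_real (a \<bullet> v) * \<alpha> vs"
          unfolding vs alternating_move[OF Cons.prems(2), of v us ws]
          by (simp add: mult.assoc[symmetric] power_add[symmetric])
        finally show ?thesis by simp
      qed
    qed
  qed simp
  show ?thesis
    unfolding alternating_def using len lin nd by auto
qed

lemma alternating_zero: "alternating d (\<lambda>_. 0)"
  by (auto simp: alternating_def linear_zero)

lemma alternating_add: "alternating d \<alpha> \<Longrightarrow> alternating d \<beta> \<Longrightarrow> alternating d (\<lambda>vs. \<alpha> vs + \<beta> vs)"
  by (auto simp: alternating_def intro: linear_compose_add)

lemma alternating_scale: "alternating d \<alpha> \<Longrightarrow> alternating d (\<lambda>vs. c * \<alpha> vs)"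
  unfolding alternating_def
  by (auto intro!: linear_compose[of _ "(*) c", unfolded o_def] bounded_linear.linear[OF bounded_linear_mult_right])

lemma alternating_sum: "(\<And>i. i \<in> I \<Longrightarrow> alternating d (f i)) \<Longrightarrow> alternating d (\<lambda>vs. \<Sum>i\<in>I. f i vs)"
  by (induction I rule: infinite_finite_induct) (auto intro: alternating_add alternating_zero)

text \<open>Expand every argument in the standard basis, with coefficients of absolute value at most
  1. Estimates that are uniform in the arguments thereby reduce to finitely many basis
  lists.\<close>

lemma alternating_norm_le:
  assumes "alternating d \<alpha>" "\<forall>v\<in>set vs. norm v \<le> 1"
  shows "norm (\<alpha> vs) \<le> (\<Sum>bs | set bs \<subseteq> Basis \<and> length bs = d. norm (\<alpha> bs))"
  using assms
proof (induction d arbitrary: \<alpha> vs)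
  case 0
  have "{bs. set bs \<subseteq> Basis \<and> length bs = 0} = {[] :: (complex^'a) list}" by auto
  then show ?case
    using alternating_length[OF 0(1), of vs] by (cases vs) auto
next
  case (Suc d)
  let ?L = "\<lambda>d. {bs. set bs \<subseteq> (Basis :: (complex^'a) set) \<and> length bs = d}"
  have img: "?L (Suc d) = (\<lambda>(b, bs). b # bs) ` (Basis \<times> ?L d)"
    by (auto simp: length_Suc_conv image_iff)
  have "(\<Sum>bs\<in>?L (Suc d). norm (\<alpha> bs)) = (\<Sum>(b, bs)\<in>Basis \<times> ?L d. norm (\<alpha> (b # bs)))"
    unfolding img by (subst sum.reindex) (auto simp: inj_on_def intro!: sum.cong)
  also have "\<dots> = (\<Sum>b\<in>Basis. \<Sum>bs\<in>?L d. norm (\<alpha> (b # bs)))"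
    by (simp add: sum.cartesian_product)
  finally have eq: "(\<Sum>bs\<in>?L (Suc d). norm (\<alpha> bs)) = (\<Sum>b\<in>Basis. \<Sum>bs\<in>?L d. norm (\<alpha> (b # bs)))" .
  show ?case
  proof (cases "length vs = Suc d")
    case False
    then show ?thesis
      using alternating_length[OF Suc.prems(1) False] by (simp add: sum_nonneg)
  next
    case True
    then obtain v ws where vs: "vs = v # ws" "length ws = d" by (cases vs) auto
    have lin: "linear (\<lambda>v. \<alpha> (v # ws))"
      using alternating_linear[OF Suc.prems(1), of "[]" ws] vs by simp
    have "\<alpha> vs = \<alpha> ((\<Sum>b\<in>Basis. (v \<bullet> b) *\<^sub>R b) # ws)"
      using vs by (simp add: euclidean_representation)
    also have "\<dots> = (\<Sum>b\<in>Basis. (v \<bullet> b) *\<^sub>R \<alpha> (b # ws))"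
      by (simp add: linear_sum[OF lin] linear_scale[OF lin])
    finally have "norm (\<alpha> vs) \<le> (\<Sum>b\<in>Basis. norm ((v \<bullet> b) *\<^sub>R \<alpha> (b # ws)))"
      by (simp only: norm_sum)
    also have "\<dots> \<le> (\<Sum>b\<in>Basis. norm (\<alpha> (b # ws)))"
    proof (rule sum_mono)
      fix b :: "complex^'a" assume b: "b \<in> Basis"
      have "\<bar>v \<bullet> b\<bar> \<le> 1"
        using Basis_le_norm[OF b, of v] Suc.prems(2) vs by auto
      then show "norm ((v \<bullet> b) *\<^sub>R \<alpha> (b # ws)) \<le> norm (\<alpha> (b # ws))"
        by (simp add: mult_left_le_one_le)
    qed
    also have "\<dots> \<le> (\<Sum>b\<in>Basis. \<Sum>bs\<in>?L d. norm (\<alpha> (b # bs)))"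
      by (intro sum_mono Suc.IH[of "\<lambda>ws. \<alpha> (_ # ws)"] alternating_Cons[OF Suc.prems(1)])
        (use Suc.prems(2) vs in auto)
    finally show ?thesis unfolding eq .
  qed
qed

section \<open>Products of positive forms of bidegree (1,1)\<close>

lemma imult_inner_left: "(\<i> *s p) \<bullet> q = - (p \<bullet> (\<i> *s q))" for p q :: "complex^'n::finite"
  by (simp add: inner_vec_def inner_complex_def sum_negf[symmetric] algebra_simps)

lemma imult_inner [simp]: "(\<i> *s p) \<bullet> (\<i> *s q) = p \<bullet> q" for p q :: "complex^'n::finite"
  by (simp add: inner_vec_def inner_complex_def algebra_simps)

lemma inner_imult_self [simp]: "p \<bullet> (\<i> *s p) = 0" for p :: "complex^'n::finite"
  using imult_inner_left[of p p] by (simp add: inner_commute)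

lemma norm_imult [simp]: "norm (\<i> *s p) = norm p" for p :: "complex^'n::finite"
  by (simp add: norm_eq_sqrt_inner)

lemma linear_imult: "linear (\<lambda>p::complex^'n::finite. \<i> *s p)"
  by (rule linearI) (auto simp: vec_eq_iff algebra_simps)

lemma imult_scaleR: "\<i> *s (r *\<^sub>R p) = r *\<^sub>R (\<i> *s p)" for p :: "complex^'n::finite"
  by (rule linear_scale[OF linear_imult])

lemma imult_sum: "\<i> *s (\<Sum>i\<in>I. f i) = (\<Sum>i\<in>I. \<i> *s (f i :: complex^'n::finite))"
  by (rule linear_sum[OF linear_imult])

text \<open>For the linear function \<open>\<lambda>x. q \<bullet> x\<close> with differential du,
  this is the exterior product with du \<and> d^c u: the basic positive form of bidegree (1,1), of
  complex rank at most one.\<close>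

definition epair :: "complex^'n::finite \<Rightarrow> ((complex^'n) list \<Rightarrow> complex) \<Rightarrow> (complex^'n) list \<Rightarrow> complex" where
  "epair q \<alpha> = ewedge q (ewedge (\<i> *s q) \<alpha>)"

lemma ewedge_anticommute': "ewedge a (ewedge b \<alpha>) = (\<lambda>vs. - ewedge b (ewedge a \<alpha>) vs)"
  by (rule ext) (rule ewedge_anticommute)

lemma ewedge_epair: "ewedge a (epair q \<alpha>) = epair q (ewedge a \<alpha>)"
  by (rule ext) (simp add: epair_def ewedge_anticommute'[of a] ewedge_minus)

lemma epair_commute: "epair p (epair q \<alpha>) = epair q (epair p \<alpha>)"
  unfolding epair_def[of p] by (simp add: ewedge_epair)

lemma epair_add: "epair q (\<lambda>ws. \<alpha> ws + \<beta> ws) vs = epair q \<alpha> vs + epair q \<beta> vs"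
  by (simp add: epair_def ewedge_add[abs_def])

lemma epair_scale: "epair q (\<lambda>ws. c * \<alpha> ws) vs = c * epair q \<alpha> vs"
  by (simp add: epair_def ewedge_scale[abs_def])

lemma epair_zero [simp]: "epair q (\<lambda>ws. 0) vs = 0"
  by (simp add: epair_def ewedge_zero[abs_def])

lemma epair_sum: "epair q (\<lambda>ws. \<Sum>i\<in>I. f i ws) vs = (\<Sum>i\<in>I. epair q (f i) vs)"
  by (simp add: epair_def ewedge_sum[abs_def])

lemma epair_zero_left [simp]: "epair 0 \<alpha> vs = 0"
  by (simp add: epair_def)

lemma epair_scaleR_left: "epair (r *\<^sub>R q) \<alpha> vs = of_real (r\<^sup>2) * epair q \<alpha> vs"
  by (simp add: epair_def imult_scaleR ewedge_scaleR_left[abs_def] ewedge_scale power2_eq_square)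

lemma epair_imult: "epair (\<i> *s q) \<alpha> = epair q \<alpha>"
  unfolding epair_def
  by (rule ext) (simp add: ewedge_anticommute'[of "\<i> *s q"] ewedge_minus_left[abs_def] ewedge_minus)

section \<open>Products of rank one forms and reduction to unitary systems\<close>

definition epairs :: "(complex^'n::finite) list \<Rightarrow> ((complex^'n) list \<Rightarrow> complex) \<Rightarrow> (complex^'n) list \<Rightarrow> complex" where
  "epairs qs \<alpha> = foldr epair qs \<alpha>"

lemma epairs_simps [simp]:
  "epairs [] \<alpha> = \<alpha>"
  "epairs (q # qs) \<alpha> = epair q (epairs qs \<alpha>)"
  "epairs (ps @ qs) \<alpha> = epairs ps (epairs qs \<alpha>)"
  by (auto simp: epairs_def)

lemma epairs_cong_mset: "mset qs = mset ps \<Longrightarrow> epairs qs = epairs ps"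
  unfolding epairs_def foldr_conv_fold fun_eq_iff
  using fold_multiset_equiv[of "rev qs" epair "rev ps"] by (auto simp: fun_eq_iff epair_commute)

lemma epairs_scale: "epairs qs (\<lambda>ws. c * \<alpha> ws) = (\<lambda>vs. c * epairs qs \<alpha> vs)"
  by (induction qs) (auto simp: epair_scale)

lemma epairs_sum: "epairs qs (\<lambda>ws. \<Sum>i\<in>I. f i ws) = (\<lambda>vs. \<Sum>i\<in>I. epairs qs (f i) vs)"
  by (induction qs) (auto simp: epair_sum)

lemma ewedge_epairs: "ewedge a (epairs qs \<alpha>) = epairs qs (ewedge a \<alpha>)"
  by (induction qs) (auto simp: ewedge_epair)

lemma ewedge_epairs_mem:
  assumes "q \<in> set qs"
  shows "ewedge q (epairs qs \<alpha>) vs = 0" "ewedge (\<i> *s q) (epairs qs \<alpha>) vs = 0"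
proof -
  have *: "epairs qs = epairs (q # remove1 q qs)"
    using assms by (intro epairs_cong_mset) simp
  show "ewedge q (epairs qs \<alpha>) vs = 0"
    unfolding * by (simp add: epair_def)
  show "ewedge (\<i> *s q) (epairs qs \<alpha>) vs = 0"
    unfolding * epairs_simps(2) epair_imult[symmetric, of q] by (simp add: epair_def)
qed

text \<open>The two conditions \<open>p \<bullet> q = 0\<close> and
  \<open>p \<bullet> (\<i> *s q) = 0\<close> are the real and the imaginary part of Hermitian
  orthogonality.\<close>

definition unitary_list :: "(complex^'n::finite) list \<Rightarrow> bool" where
  "unitary_list os \<longleftrightarrow> distinct os \<and> (\<forall>p\<in>set os. norm p = 1) \<and>
     (\<forall>p\<in>set os. \<forall>q\<in>set os. p \<noteq> q \<longrightarrow> p \<bullet> q = 0 \<and> p \<bullet> (\<i> *s q) = 0)"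

definition realify :: "(complex^'n::finite) list \<Rightarrow> (complex^'n) set" where
  "realify os = set os \<union> (\<lambda>p. \<i> *s p) ` set os"

lemma inj_imult: "inj (\<lambda>p::complex^'n::finite. \<i> *s p)"
  by (rule injI) (auto simp: vec_eq_iff)

lemma unitary_list_realify:
  assumes "unitary_list os"
  shows "finite (realify os)" "card (realify os) = 2 * length os"
    and "\<And>f g. f \<in> realify os \<Longrightarrow> g \<in> realify os \<Longrightarrow> f \<bullet> g = (if f = g then 1 else 0)"
    and "independent (realify os)"
proof -
  note u = assms[unfolded unitary_list_def]
  have nrm: "p \<bullet> p = 1" if "p \<in> set os" for p
    using u that by (simp add: norm_eq_1)
  have ne: "p \<noteq> \<i> *s q" if "p \<in> set os" "q \<in> set os" for p q
  proof
    assume eq: "p = \<i> *s q"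
    then have "p \<noteq> q"
      using nrm[OF that(1)] inner_imult_self[of q] by (metis zero_neq_one)
    then have "p \<bullet> (\<i> *s q) = 0"
      using u that by auto
    then show False
      using nrm[OF that(1)] eq by simp
  qed
  show "finite (realify os)" by (simp add: realify_def)
  have "card (realify os) = card (set os) + card ((\<lambda>p. \<i> *s p) ` set os)"
    unfolding realify_def by (rule card_Un_disjoint) (use ne in auto)
  also have "\<dots> = 2 * length os"
    using u by (simp add: card_image inj_on_subset[OF inj_imult] distinct_card)
  finally show "card (realify os) = 2 * length os" .
  show orth: "f \<bullet> g = (if f = g then 1 else 0)" if "f \<in> realify os" "g \<in> realify os" for f g
  proof -
    have "p \<bullet> (\<i> *s q) = 0" if "p \<in> set os" "q \<in> set os" for p q
      using u that by (cases "p = q") auto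
    moreover have "(\<i> *s q) \<bullet> p = 0" if "p \<in> set os" "q \<in> set os" for p q
      using calculation that by (simp add: inner_commute)
    moreover have "p \<bullet> q = (if p = q then 1 else 0)" if "p \<in> set os" "q \<in> set os" for p q
      using u that nrm by auto
    ultimately show ?thesis
      using that unfolding realify_def
      by (auto simp: ne ne[symmetric] inj_eq[OF inj_imult])
  qed
  show "independent (realify os)"
  proof (rule pairwise_orthogonal_independent)
    show "pairwise orthogonal (realify os)"
      unfolding pairwise_def orthogonal_def using orth by auto
    show "0 \<notin> realify os"
      using orth[of 0 0] by auto
  qed
qed

lemma realify_imult: "f \<in> realify os \<Longrightarrow> \<i> *s f \<in> span (realify os)"
  by (auto simp: realify_def intro: span_base intro!: span_neg)

lemma ewedge_epairs_span:
  assumes "p \<in> span (realify os)"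
  shows "ewedge p (epairs os \<alpha>) vs = 0"
  using assms
proof (induction rule: span_induct_alt)
  case (step c x y)
  then have "ewedge x (epairs os \<alpha>) vs = 0"
    using ewedge_epairs_mem by (auto simp: realify_def)
  then show ?case
    using step by (simp add: ewedge_add_left ewedge_scaleR_left)
qed simp

text \<open>The one-forms of \<open>p\<close> and of \<open>\<i> *s p\<close> are combinations of
  factors already present in the product, and squares of one-forms vanish. This is why Gram-Schmidt
  does not change the product.\<close>

lemma epairs_add_span:
  assumes "p \<in> span (realify os)"
  shows "epair (p + r) (epairs os \<alpha>) = epair r (epairs os \<alpha>)"
proof -
  have ip: "\<i> *s p \<in> span (realify os)"
    using assms
  proof (induction rule: span_induct_alt)
    case (step c x y)
    then show ?case
      by (simp add: vector_add_ldistrib imult_scaleR span_add span_scale realify_imult)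
  qed (use linear_0[OF linear_imult] span_zero in simp)
  have "ewedge (\<i> *s (p + r)) (epairs os \<alpha>) = ewedge (\<i> *s r) (epairs os \<alpha>)"
    by (rule ext) (simp add: vector_add_ldistrib ewedge_add_left ewedge_epairs_span[OF ip])
  then show ?thesis
    unfolding epair_def[of "p + r"] epair_def[of r]
    by (simp add: ewedge_add_left[abs_def] ewedge_anticommute'[of p] ewedge_epairs_span[OF assms, abs_def])
qed

lemma unitary_list_Cons:
  assumes "unitary_list os" "norm p = 1" "\<And>f. f \<in> realify os \<Longrightarrow> p \<bullet> f = 0"
  shows "unitary_list (p # os)"
proof -
  have "p \<notin> set os"
    using assms(2) assms(3)[of p] by (auto simp: realify_def norm_eq_1)
  moreover have "q \<bullet> p = 0" "q \<bullet> (\<i> *s p) = 0" "p \<bullet> q = 0" "p \<bullet> (\<i> *s q) = 0" if "q \<in> set os" for q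
  proof -
    show 1: "p \<bullet> q = 0" "p \<bullet> (\<i> *s q) = 0"
      using assms(3) that by (auto simp: realify_def)
    then show "q \<bullet> p = 0" "q \<bullet> (\<i> *s p) = 0"
      using imult_inner_left[of q p] by (auto simp: inner_commute)
  qed
  ultimately show ?thesis
    using assms(1,2) unfolding unitary_list_def by auto
qed

text \<open>Each \<open>q\<close> is replaced by its component \<open>r\<close> orthogonal to the
  complex span of the earlier vectors. If \<open>r = 0\<close>, the product vanishes; otherwise
  normalising \<open>r\<close> contributes \<open>(norm r)\<^sup>2\<close>, as \<open>epair\<close>
  is quadratic. The complex subspace \<open>S\<close> keeps track of where the vectors live: all of
  space for the domination, the complement of a complex line for the degenerate case.\<close>

lemma epairs_gram_schmidt:
  fixes S :: "(complex^'n::finite) set"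
  assumes S: "subspace S" "\<And>v. v \<in> S \<Longrightarrow> \<i> *s v \<in> S" and "set qs \<subseteq> S"
  shows "(\<forall>\<alpha> vs. epairs qs \<alpha> vs = 0) \<or>
    (\<exists>c os. c > 0 \<and> unitary_list os \<and> set os \<subseteq> S \<and> length os = length qs \<and>
        (\<forall>\<alpha> vs. epairs qs \<alpha> vs = of_real c * epairs os \<alpha> vs))"
  using assms(3)
proof (induction qs)
  case Nil
  have "unitary_list ([] :: (complex^'n) list)" by (simp add: unitary_list_def)
  then show ?case by (intro disjI2 exI[of _ 1] exI[of _ "[]"]) auto
next
  case (Cons q qs)
  consider "\<forall>\<alpha> vs. epairs qs \<alpha> vs = 0" |
    c os where "c > 0" "unitary_list os" "set os \<subseteq> S" "length os = length qs"
      "\<And>\<alpha> vs. epairs qs \<alpha> vs = of_real c * epairs os \<alpha> vs"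
    using Cons by auto
  then show ?case
  proof cases
    case 1
    then have "epairs qs \<alpha> = (\<lambda>_. 0)" for \<alpha> by auto
    then show ?thesis by simp
  next
    case 2
    obtain p r where pr: "p \<in> span (realify os)" "\<And>w. w \<in> span (realify os) \<Longrightarrow> orthogonal r w" "q = p + r"
      using orthogonal_subspace_decomp_exists[of "realify os" q] by blast
    have "realify os \<subseteq> S"
      using 2(3) S(2) by (auto simp: realify_def)
    then have "span (realify os) \<subseteq> S"
      using S(1) by (rule span_minimal)
    then have rS: "r \<in> S"
      using pr(1,3) Cons.prems subspace_diff[OF S(1), of q p] by auto
    have eq: "epairs (q # qs) \<alpha> vs = of_real c * epair r (epairs os \<alpha>) vs" for \<alpha> vs
    proof -
      have "epairs qs \<alpha> = (\<lambda>vs. of_real c * epairs os \<alpha> vs)"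
        using 2(5) by auto
      then show ?thesis
        by (simp add: epair_scale pr(3) epairs_add_span[OF pr(1)])
    qed
    show ?thesis
    proof (cases "r = 0")
      case True
      then show ?thesis using eq by simp
    next
      case False
      define p' where "p' = (1 / norm r) *\<^sub>R r"
      have r: "r = norm r *\<^sub>R p'"
        using False by (simp add: p'_def)
      have "unitary_list (p' # os)"
      proof (rule unitary_list_Cons[OF 2(2)])
        show "norm p' = 1" using False by (simp add: p'_def)
        show "p' \<bullet> f = 0" if "f \<in> realify os" for f
          using pr(2)[OF span_base[OF that]] by (simp add: p'_def orthogonal_def)
      qed
      moreover have "set (p' # os) \<subseteq> S"
        using 2(3) rS subspace_scale[OF S(1)] by (auto simp: p'_def)
      moreover have "epairs (q # qs) \<alpha> vs = of_real (c * (norm r)\<^sup>2) * epairs (p' # os) \<alpha> vs" for \<alpha> vs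
        unfolding eq by (subst r, subst epair_scaleR_left) simp
      moreover have "c * (norm r)\<^sup>2 > 0"
        using 2(1) False by simp
      ultimately show ?thesis
        using 2(4) by (intro disjI2 exI[of _ "c * (norm r)\<^sup>2"] exI[of _ "p' # os"]) auto
    qed
  qed
qed

lemma unitary_list_length_le:
  assumes "unitary_list os" "subspace S" "\<And>v. v \<in> S \<Longrightarrow> \<i> *s v \<in> S" "set os \<subseteq> S"
  shows "2 * length os \<le> dim S"
proof -
  have "realify os \<subseteq> S"
    using assms(3,4) by (auto simp: realify_def)
  then show ?thesis
    using independent_card_le_dim[of "realify os" S] unitary_list_realify[OF assms(1)] by simp
qed

lemma unitary_list_extend:
  fixes os :: "(complex^'n::finite) list"
  assumes "unitary_list os"
  obtains rs where "unitary_list (os @ rs)" "length (os @ rs) = CARD('n)"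
proof -
  have "\<exists>rs. unitary_list (os @ rs) \<and> length (os @ rs) = CARD('n)"
    using assms
  proof (induction "CARD('n) - length os" arbitrary: os)
    case 0
    then have "length os = CARD('n)"
      using unitary_list_length_le[of os UNIV] by simp
    then show ?case using 0 by (intro exI[of _ "[]"]) simp
  next
    case (Suc m)
    have "dim (realify os) < DIM(complex^'n)"
      using dim_le_card[of "realify os" "realify os"] unitary_list_realify[OF Suc.prems] Suc(2)
      by (simp add: span_superset)
    then obtain x :: "complex^'n" where x: "x \<noteq> 0" "\<And>y. y \<in> span (realify os) \<Longrightarrow> orthogonal x y"
      using orthogonal_to_subspace_exists[of "realify os"] by auto
    define p where "p = (1 / norm x) *\<^sub>R x"
    have "unitary_list (p # os)"
      by (rule unitary_list_Cons[OF Suc.prems])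
        (use x span_base in \<open>auto simp: p_def orthogonal_def\<close>)
    moreover have "unitary_list (os @ [p]) = unitary_list (p # os)"
      by (auto simp: unitary_list_def)
    ultimately have "unitary_list (os @ [p])" by simp
    moreover have "m = CARD('n) - length (os @ [p])" using Suc(2) by simp
    ultimately obtain rs where
      "unitary_list ((os @ [p]) @ rs)" "length ((os @ [p]) @ rs) = CARD('n)"
      using Suc(1) Suc(2) by (metis Suc(1))
    then show ?case by (intro exI[of _ "p # rs"]) simp
  qed
  then show ?thesis using that by blast
qed

text \<open>Twice the wedge product with the standard Kaehler form, as \<open>b\<close> and \<open>\<i> *s b\<close> contribute equally.\<close>

definition beta :: "((complex^'n::finite) list \<Rightarrow> complex) \<Rightarrow> (complex^'n) list \<Rightarrow> complex" where
  "beta \<alpha> vs = (\<Sum>b\<in>Basis. epair b \<alpha> vs)"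

text \<open>Parseval: the sum over \<open>b\<close> of
  \<open>(b \<bullet> f) * (b \<bullet> g)\<close> is \<open>f \<bullet> g\<close>, so
  \<open>beta\<close> can be computed in any real orthonormal basis, here the one made of
  \<open>p\<close> and \<open>\<i> *s p\<close>. The factor 2 arises since both members of such a
  couple give the same pair.\<close>

lemma beta_unitary:
  fixes os :: "(complex^'n::finite) list"
  assumes "unitary_list os" "length os = CARD('n)"
  shows "beta \<alpha> vs = 2 * (\<Sum>p\<in>set os. epair p \<alpha> vs)"
proof -
  let ?R = "realify os"
  note R = unitary_list_realify[OF assms(1)]
  have "dim ?R = DIM(complex^'n)"
    using dim_eq_card_independent[OF R(4)] R(2) assms(2) by simp
  then have spanR: "span ?R = UNIV"
    using dim_eq_full by blast
  have rep: "x = (\<Sum>f\<in>?R. (x \<bullet> f) *\<^sub>R f)" for x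
  proof -
    have "x - (\<Sum>f\<in>?R. (x \<bullet> f) *\<^sub>R f) = 0"
    proof (rule orthogonal_to_span[of _ ?R "x - (\<Sum>f\<in>?R. (x \<bullet> f) *\<^sub>R f)", unfolded orthogonal_def,
          THEN inner_eq_zero_iff[THEN iffD1]])
      show "x - (\<Sum>f\<in>?R. (x \<bullet> f) *\<^sub>R f) \<in> span ?R" using spanR by simp
      show "(x - (\<Sum>f\<in>?R. (x \<bullet> f) *\<^sub>R f)) \<bullet> g = 0" if "g \<in> ?R" for g
      proof -
        have "(\<Sum>f\<in>?R. (x \<bullet> f) * (f \<bullet> g)) = (\<Sum>f\<in>?R. if f = g then x \<bullet> g else 0)"
          by (intro sum.cong) (auto simp: R(3) that)
        also have "\<dots> = x \<bullet> g" using that R(1) by simp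
        finally show ?thesis
          by (simp add: inner_diff_left inner_sum_left)
      qed
    qed
    then show ?thesis by simp
  qed
  let ?w = "\<lambda>f g. ewedge f (ewedge (\<i> *s g) \<alpha>) vs"
  have "epair b \<alpha> vs = (\<Sum>f\<in>?R. \<Sum>g\<in>?R. of_real ((b \<bullet> f) * (b \<bullet> g)) * ?w f g)" for b
  proof -
    have "epair b \<alpha> vs = epair (\<Sum>f\<in>?R. (b \<bullet> f) *\<^sub>R f) \<alpha> vs"
      by (rule arg_cong[OF rep[of b], of "\<lambda>x. epair x \<alpha> vs"])
    also have "\<dots> = (\<Sum>f\<in>?R. \<Sum>g\<in>?R. of_real ((b \<bullet> f) * (b \<bullet> g)) * ?w f g)"
      unfolding epair_def imult_sum imult_scaleR
      by (simp add: ewedge_sum_left[abs_def] ewedge_sum ewedge_scaleR_left[abs_def] ewedge_scale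
          sum_distrib_left mult.assoc)
    finally show ?thesis .
  qed
  then have "beta \<alpha> vs = (\<Sum>b\<in>Basis. \<Sum>f\<in>?R. \<Sum>g\<in>?R. of_real ((b \<bullet> f) * (b \<bullet> g)) * ?w f g)"
    unfolding beta_def by simp
  also have "\<dots> = (\<Sum>f\<in>?R. \<Sum>b\<in>Basis. \<Sum>g\<in>?R. of_real ((b \<bullet> f) * (b \<bullet> g)) * ?w f g)"
    by (rule sum.swap)
  also have "\<dots> = (\<Sum>f\<in>?R. \<Sum>g\<in>?R. \<Sum>b\<in>Basis. of_real ((b \<bullet> f) * (b \<bullet> g)) * ?w f g)"
    by (intro sum.cong refl sum.swap)
  also have "\<dots> = (\<Sum>f\<in>?R. \<Sum>g\<in>?R. if f = g then ?w f g else 0)"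
  proof (intro sum.cong refl)
    fix f g assume fg: "f \<in> ?R" "g \<in> ?R"
    have "(\<Sum>b\<in>Basis. (b \<bullet> f) * (b \<bullet> g)) = f \<bullet> g"
      by (subst euclidean_inner) (simp add: inner_commute)
    then have "(\<Sum>b\<in>Basis. of_real ((b \<bullet> f) * (b \<bullet> g)) * ?w f g) = of_real (f \<bullet> g) * ?w f g"
      by (simp only: of_real_sum[symmetric] sum_distrib_right[symmetric])
    then show "(\<Sum>b\<in>Basis. of_real ((b \<bullet> f) * (b \<bullet> g)) * ?w f g) = (if f = g then ?w f g else 0)"
      using R(3)[OF fg] by simp
  qed
  also have "\<dots> = (\<Sum>f\<in>?R. epair f \<alpha> vs)"
    using R(1) by (simp add: epair_def)
  also have "\<dots> = (\<Sum>f\<in>set os. epair f \<alpha> vs) + (\<Sum>f\<in>(\<lambda>p. \<i> *s p) ` set os. epair f \<alpha> vs)"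
    unfolding realify_def
  proof (rule sum.union_disjoint)
    have "card (set os \<union> (\<lambda>p. \<i> *s p) ` set os) = card (set os) + card ((\<lambda>p. \<i> *s p) ` set os)"
      using R(2) assms(1) unfolding realify_def unitary_list_def
      by (simp add: card_image inj_on_subset[OF inj_imult] distinct_card)
    then show "set os \<inter> (\<lambda>p. \<i> *s p) ` set os = {}"
      using card_Un_Int[of "set os" "(\<lambda>p. \<i> *s p) ` set os"] by simp
  qed auto
  also have "(\<Sum>f\<in>(\<lambda>p. \<i> *s p) ` set os. epair f \<alpha> vs) = (\<Sum>f\<in>set os. epair f \<alpha> vs)"
    by (subst sum.reindex) (auto simp: inj_on_subset[OF inj_imult] epair_imult)
  finally show ?thesis by simp
qed

text \<open>In the sum that represents \<open>beta\<close>, the vectors of \<open>ps\<close> are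
  killed by the factors present, and each vector of \<open>rs\<close> can be chosen once. The
  possible orders of choice give the factorial, and each \<open>beta\<close> gives a 2.\<close>

lemma epairs_beta_power:
  fixes ps rs :: "(complex^'n::finite) list"
  assumes "unitary_list (ps @ rs)" "length (ps @ rs) = CARD('n)"
  shows "epairs ps ((beta ^^ length rs) \<alpha>) vs = 2 ^ length rs * fact (length rs) * epairs (ps @ rs) \<alpha> vs"
  using assms
proof (induction "length rs" arbitrary: ps rs)
  case (Suc m)
  let ?\<gamma> = "(beta ^^ m) \<alpha>"
  have d: "distinct (ps @ rs)" using Suc.prems by (simp add: unitary_list_def)
  have fn: "(beta ^^ Suc m) \<alpha> = (\<lambda>vs. \<Sum>p\<in>set (ps @ rs). 2 * epair p ?\<gamma> vs)"
    by (rule ext) (simp add: beta_unitary[OF Suc.prems] sum_distrib_left)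
  have "epairs ps ((beta ^^ Suc m) \<alpha>) vs = (\<Sum>p\<in>set (ps @ rs). 2 * epairs ps (epair p ?\<gamma>) vs)"
    unfolding fn epairs_sum by (simp add: epairs_scale)
  also have "\<dots> = (\<Sum>p\<in>set rs. 2 * epairs ps (epair p ?\<gamma>) vs)"
  proof (rule sum.mono_neutral_right)
    show "\<forall>p\<in>set (ps @ rs) - set rs. 2 * epairs ps (epair p ?\<gamma>) vs = 0"
    proof
      fix p assume "p \<in> set (ps @ rs) - set rs"
      then have "p \<in> set ps" by auto
      then have "epairs ps (epair p ?\<gamma>) vs = 0"
        using ewedge_epairs_mem(1)[of p ps "ewedge (\<i> *s p) ?\<gamma>" vs]
        by (simp add: epair_def ewedge_epairs)
      then show "2 * epairs ps (epair p ?\<gamma>) vs = 0" by simp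
    qed
  qed auto
  also have "\<dots> = (\<Sum>p\<in>set rs. 2 * (2 ^ m * fact m * epairs (ps @ rs) \<alpha> vs))"
  proof (intro sum.cong refl arg_cong[of _ _ "(*) 2"])
    fix p assume p: "p \<in> set rs"
    let ?rs = "remove1 p rs"
    have ms: "mset ((ps @ [p]) @ ?rs) = mset (ps @ rs)" using p by simp
    have len: "m = length ?rs" using p Suc(2) by (simp add: length_remove1)
    have st: "set ((ps @ [p]) @ ?rs) = set (ps @ rs)" using ms by (rule mset_eq_setD)
    have "unitary_list ((ps @ [p]) @ ?rs)"
      using Suc.prems(1) unfolding unitary_list_def st using mset_eq_imp_distinct_iff[OF ms] by blast
    moreover have "length ((ps @ [p]) @ ?rs) = CARD('n)"
      using mset_eq_length[OF ms] Suc.prems(2) by simp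
    ultimately have "epairs (ps @ [p]) ((beta ^^ length ?rs) \<alpha>) vs
        = 2 ^ length ?rs * fact (length ?rs) * epairs ((ps @ [p]) @ ?rs) \<alpha> vs"
      using Suc(1)[OF len] by blast
    then show "epairs ps (epair p ?\<gamma>) vs = 2 ^ m * fact m * epairs (ps @ rs) \<alpha> vs"
      unfolding epairs_cong_mset[OF ms] len[symmetric] by simp
  qed
  also have "\<dots> = 2 ^ length rs * fact (length rs) * epairs (ps @ rs) \<alpha> vs"
    using d Suc(2)[symmetric] by (simp add: distinct_card)
  finally show ?case using Suc(2) by simp
qed simp

section \<open>Evaluation on the standard frame and domination\<close>

definition one_form0 :: "'a list \<Rightarrow> complex" where
  "one_form0 vs = (if vs = [] then 1 else 0)"

text \<open>The enumeration of the index type is the same choice term as in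
  \<open>std_frame\<close>, so that both lists run in the same order.\<close>

definition axes :: "(complex^'n::finite) list" where
  "axes = map (\<lambda>j. axis j 1) (SOME js. distinct js \<and> set js = UNIV)"

lemma axes_enum:
  obtains js where "distinct js" "set js = (UNIV :: 'n::finite set)"
    "(axes :: (complex^'n) list) = map (\<lambda>j. axis j 1) js"
    "(std_frame :: (complex^'n) list) = concat (map (\<lambda>j. [axis j 1, axis j \<i>]) js)"
proof -
  have "\<exists>js. distinct js \<and> set js = (UNIV :: 'n set)"
    using finite_distinct_list[of "UNIV :: 'n set"] by auto
  then have "distinct (SOME js. distinct js \<and> set js = (UNIV :: 'n set)) \<and>
      set (SOME js. distinct js \<and> set js = (UNIV :: 'n set)) = UNIV"
    by (rule someI_ex)
  then show ?thesis
    by (intro that[of "SOME js. distinct js \<and> set js = (UNIV :: 'n set)"]) (auto simp: axes_def std_frame_def)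
qed

lemma imult_axis: "\<i> *s axis j 1 = (axis j \<i> :: complex^'n::finite)"
  by (auto simp: vec_eq_iff axis_def)

lemma unitary_axes: "unitary_list (axes :: (complex^'n::finite) list)"
  "length (axes :: (complex^'n::finite) list) = CARD('n)"
proof -
  obtain js where js: "distinct js" "set js = (UNIV :: 'n set)"
    "(axes :: (complex^'n) list) = map (\<lambda>j. axis j 1) js"
    "(std_frame :: (complex^'n) list) = concat (map (\<lambda>j. [axis j 1, axis j \<i>]) js)"
    by (rule axes_enum)
  show "unitary_list (axes :: (complex^'n) list)"
    unfolding unitary_list_def js(3)
    using js(1) by (auto simp: distinct_map inj_on_def axis_eq_axis inner_axis_axis imult_axis)
  show "length (axes :: (complex^'n) list) = CARD('n)"
    unfolding js(3) using js(1,2) distinct_card[of js] by simp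
qed

text \<open>In each wedge only the leading argument has a non-zero inner product with the current
  axis. This fixes the orientation sign as +1.\<close>

lemma epairs_axes_std: "epairs axes one_form0 (std_frame :: (complex^'n::finite) list) = 1"
proof -
  obtain js where js: "distinct js" "set js = (UNIV :: 'n set)"
    "(axes :: (complex^'n) list) = map (\<lambda>j. axis j 1) js"
    "(std_frame :: (complex^'n) list) = concat (map (\<lambda>j. [axis j 1, axis j \<i>]) js)"
    by (rule axes_enum)
  have "epairs (map (\<lambda>j. axis j 1) ks) one_form0 (concat (map (\<lambda>j. [axis j 1, axis j \<i> :: complex^'n]) ks)) = 1"
    if "distinct ks" for ks :: "'n list"
    using that
  proof (induction ks)
    case (Cons k ks)
    let ?l = "concat (map (\<lambda>j. [axis j 1, axis j \<i> :: complex^'n]) ks)"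
    have z: "ewedge (axis k c) \<alpha> ?l = 0" for c :: complex and \<alpha>
      using Cons.prems by (intro ewedge_inner_zero) (auto simp: inner_axis_axis)
    have "ewedge (axis k c) \<alpha> (v # ?l) = of_real (axis k c \<bullet> v) * \<alpha> ?l" for c :: complex and \<alpha> and v :: "complex^'n"
      by (simp add: z)
    then show ?case
      using Cons by (simp add: epair_def imult_axis inner_axis_axis z)
  qed (simp add: one_form0_def)
  then show ?thesis unfolding js(3,4) using js(1) by blast
qed

text \<open>This avoids computing a determinant: the list and the axes both express the same full
  power of \<open>beta\<close>, with the same constant, so their values on the frame agree.\<close>

lemma epairs_unitary_std:
  assumes "unitary_list (os :: (complex^'n::finite) list)" "length os = CARD('n)"
  shows "epairs os one_form0 std_frame = 1"
proof -
  have "2 ^ CARD('n) * fact (CARD('n)) * epairs os one_form0 std_frame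
      = (beta ^^ CARD('n)) one_form0 (std_frame :: (complex^'n) list)"
    using epairs_beta_power[of "[]" os one_form0 std_frame] assms by simp
  also have "\<dots> = 2 ^ CARD('n) * fact (CARD('n)) * epairs axes one_form0 (std_frame :: (complex^'n) list)"
    using epairs_beta_power[of "[]" "axes :: (complex^'n) list" one_form0 std_frame] unitary_axes by simp
  finally show ?thesis by (simp add: epairs_axes_std)
qed

lemma std_frame_norm: "v \<in> set (std_frame :: (complex^'n::finite) list) \<Longrightarrow> norm v \<le> 1"
  by (auto simp: std_frame_def)

lemma length_std_frame: "length (std_frame :: (complex^'n::finite) list) = 2 * CARD('n)"
proof -
  obtain js where js: "distinct js" "set js = (UNIV :: 'n set)"
    "(axes :: (complex^'n) list) = map (\<lambda>j. axis j 1) js"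
    "(std_frame :: (complex^'n) list) = concat (map (\<lambda>j. [axis j 1, axis j \<i>]) js)"
    by (rule axes_enum)
  have "length (concat (map (\<lambda>j. [axis j 1, axis j \<i> :: complex^'n]) ks)) = 2 * length ks" for ks
    by (induction ks) auto
  then show ?thesis unfolding js(4) using js(1,2) distinct_card[of js] by simp
qed

lemma epairs_norm_le:
  fixes os :: "(complex^'n::finite) list"
  assumes "\<forall>p\<in>set os. norm p = 1" "\<And>ws. \<forall>w\<in>set ws. norm w \<le> 1 \<Longrightarrow> norm (\<alpha> ws) \<le> M"
    and "\<forall>v\<in>set vs. norm v \<le> 1" "length vs \<le> N"
  shows "norm (epairs os \<alpha> vs) \<le> real N ^ (2 * length os) * M"
  using assms(1,3,4)
proof (induction os arbitrary: vs)
  case (Cons p os)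
  have M: "0 \<le> real N ^ k * M" for k
    using order_trans[OF norm_ge_zero assms(2)[of "[]"]] by (intro mult_nonneg_nonneg) auto
  have 1: "norm (ewedge (\<i> *s p) (epairs os \<alpha>) ws) \<le> real N * (real N ^ (2 * length os) * M)"
    if "\<forall>w\<in>set ws. norm w \<le> 1" "length ws \<le> N" for ws
  proof -
    have "norm (ewedge (\<i> *s p) (epairs os \<alpha>) ws)
        \<le> real (length ws) * norm (\<i> *s p) * (real N ^ (2 * length os) * M)"
      by (rule ewedge_norm_le) (use Cons that in auto)
    also have "\<dots> \<le> real N * (real N ^ (2 * length os) * M)"
      using Cons.prems(1) that(2) M by (auto intro!: mult_right_mono)
    finally show ?thesis .
  qed
  have "norm (epairs (p # os) \<alpha> vs)
      \<le> real (length vs) * norm p * (real N * (real N ^ (2 * length os) * M))"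
    unfolding epairs_simps epair_def by (rule ewedge_norm_le) (use 1 Cons.prems in auto)
  also have "\<dots> \<le> real N * (real N * (real N ^ (2 * length os) * M))"
    using Cons.prems M[of "Suc (2 * length os)"] by (auto intro!: mult_right_mono simp: mult.assoc)
  finally show ?case by (simp add: algebra_simps)
qed (use assms(2) in auto)

text \<open>After Gram-Schmidt with factor \<open>c\<close>, completing to a unitary basis shows
  that the product with the power of \<open>beta\<close> equals \<open>c * (2 ^ m * fact m)\<close>,
  while a form bounded by \<open>M\<close> yields at most \<open>c * M\<close> times a constant of
  the dimension. The factor \<open>c\<close> scales both sides, so the comparison is uniform in
  \<open>qs\<close>.\<close>

lemma epairs_dominated:
  fixes qs :: "(complex^'n::finite) list"
  assumes "length qs + m = CARD('n)"
  obtains r where "r \<ge> 0" "epairs qs ((beta ^^ m) one_form0) std_frame = of_real r"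
    "\<And>\<alpha> M. (\<And>ws. \<forall>w\<in>set ws. norm w \<le> 1 \<Longrightarrow> norm (\<alpha> ws) \<le> M) \<Longrightarrow>
        norm (epairs qs \<alpha> std_frame) \<le> real (2 * CARD('n)) ^ (2 * CARD('n)) * M * r"
proof -
  consider "\<forall>\<alpha> vs. epairs qs \<alpha> vs = 0" |
    c os where "c > 0" "unitary_list os" "length os = length qs"
      "\<And>\<alpha> vs. epairs qs \<alpha> vs = of_real c * epairs os \<alpha> vs"
    using epairs_gram_schmidt[of UNIV qs] by auto
  then show ?thesis
  proof cases
    case 1
    then show ?thesis by (intro that[of 0]) auto
  next
    case 2
    obtain rs where rs: "unitary_list (os @ rs)" "length (os @ rs) = CARD('n)"
      using unitary_list_extend[OF 2(2)] by blast
    have m: "m = length rs" using rs 2(3) assms by simp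
    let ?r = "c * (2 ^ m * fact m)"
    have ge: "?r \<ge> c * 1"
      using 2(1) mult_mono[of 1 "2 ^ m :: real" 1 "fact m"] by (intro mult_left_mono) (auto simp: fact_ge_1)
    show ?thesis
    proof (rule that[of ?r])
      show "?r \<ge> 0" using 2(1) by simp
      show "epairs qs ((beta ^^ m) one_form0) std_frame = of_real ?r"
        using epairs_beta_power[OF rs, of one_form0 std_frame] epairs_unitary_std[OF rs]
        by (simp add: 2(4) m)
      fix \<alpha> :: "(complex^'n) list \<Rightarrow> complex" and M
      assume M: "\<And>ws. \<forall>w\<in>set ws. norm w \<le> 1 \<Longrightarrow> norm (\<alpha> ws) \<le> M"
      have M0: "0 \<le> M" using M[of "[]"] by (auto intro: order_trans[OF norm_ge_zero])
      let ?N = "real (2 * CARD('n))"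
      have N1: "?N \<ge> 1" using zero_less_card_finite[where 'a='n] by linarith
      have "norm (epairs os \<alpha> std_frame) \<le> ?N ^ (2 * length os) * M"
        by (rule epairs_norm_le)
          (use 2(2) M std_frame_norm length_std_frame[where 'n='n] in \<open>auto simp: unitary_list_def\<close>)
      also have "\<dots> \<le> ?N ^ (2 * CARD('n)) * M"
        using rs(2) M0 N1 by (intro mult_right_mono power_increasing) auto
      finally have *: "norm (epairs os \<alpha> std_frame) \<le> ?N ^ (2 * CARD('n)) * M" .
      have "norm (epairs qs \<alpha> std_frame) = c * norm (epairs os \<alpha> std_frame)"
        using 2(1) by (simp add: 2(4) norm_mult)
      also have "\<dots> \<le> ?r * (?N ^ (2 * CARD('n)) * M)"
        using * ge 2(1) by (intro mult_mono) auto
      finally show "norm (epairs qs \<alpha> std_frame) \<le> ?N ^ (2 * CARD('n)) * M * ?r"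
        by (simp add: mult.commute)
    qed
  qed
qed

text \<open>A non-zero product would give a unitary list of length n inside the orthogonal
  complement of the complex line of \<open>\<nu>\<close>, hence real dimension at least 2n
  there.\<close>

lemma epairs_degenerate:
  fixes qs :: "(complex^'n::finite) list"
  assumes "length qs = CARD('n)" "\<nu> \<noteq> 0" "\<And>q. q \<in> set qs \<Longrightarrow> q \<bullet> \<nu> = 0 \<and> q \<bullet> (\<i> *s \<nu>) = 0"
  shows "epairs qs \<alpha> vs = 0"
proof (rule ccontr)
  assume nz: "epairs qs \<alpha> vs \<noteq> 0"
  let ?S = "{v. v \<bullet> \<nu> = 0 \<and> v \<bullet> (\<i> *s \<nu>) = 0}"
  have S: "subspace ?S" unfolding subspace_def by (auto simp: inner_add_left)
  have SJ: "\<i> *s v \<in> ?S" if "v \<in> ?S" for v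
    using that by (simp add: imult_inner_left)
  from epairs_gram_schmidt[OF S SJ, of qs] nz assms(3) obtain os where
    os: "unitary_list os" "set os \<subseteq> ?S" "length os = length qs"
    by blast
  have "2 * length os \<le> dim ?S"
    by (rule unitary_list_length_le[OF os(1) S SJ os(2)])
  moreover have "dim ?S < DIM(complex^'n)"
  proof -
    have "\<nu> \<notin> ?S" using assms(2) by simp
    then have "?S \<noteq> UNIV" by blast
    then have "dim ?S \<noteq> DIM(complex^'n)"
      using dim_eq_full[of ?S] span_eq_iff[of ?S] S by metis
    then show ?thesis
      using dim_subset_UNIV[of ?S] by linarith
  qed
  ultimately show False using os(3) assms(1) by simp
qed

text \<open>Completing the square one basis vector at a time; \<open>B\<close> holds the basis
  vectors that have not been eliminated yet. Applied to real Hessians, it produces the vectors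
  \<open>q\<close> of the rank one forms.\<close>

lemma psd_sum_squares:
  fixes Q :: "'a::euclidean_space \<Rightarrow> 'a \<Rightarrow> real"
  assumes "bilinear Q" "\<And>x y. Q x y = Q y x" "\<And>x. Q x x \<ge> 0"
  obtains qs where "\<And>x y. Q x y = (\<Sum>q\<leftarrow>qs. (q \<bullet> x) * (q \<bullet> y))"
proof -
  have "\<exists>qs. \<forall>x y. Q x y = (\<Sum>q\<leftarrow>qs. (q \<bullet> x) * (q \<bullet> y))"
    if "finite B" "B \<subseteq> Basis" "bilinear Q" "\<And>x y. Q x y = Q y x" "\<And>x. Q x x \<ge> 0"
      "\<And>b y. b \<in> Basis - B \<Longrightarrow> Q b y = 0" for B and Q :: "'a \<Rightarrow> 'a \<Rightarrow> real"
    using that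
  proof (induction B arbitrary: Q rule: finite_induct)
    case empty
    have "Q x y = 0" for x y
    proof -
      interpret l: linear "\<lambda>x. Q x y" using empty(2) by (simp add: bilinear_def)
      have "Q x y = Q (\<Sum>b\<in>Basis. (x \<bullet> b) *\<^sub>R b) y" by (simp add: euclidean_representation)
      also have "\<dots> = 0" by (simp add: l.sum l.scale empty(5))
      finally show ?thesis .
    qed
    then show ?case by (intro exI[of _ "[]"]) simp
  next
    case (insert b B)
    have lin1: "linear (\<lambda>x. Q x y)" and lin2: "linear (\<lambda>y. Q x y)" for x y
      using insert.prems(2) by (auto simp: bilinear_def)
    note Qs = linear_add[OF lin1] linear_add[OF lin2] linear_scale[OF lin1] linear_scale[OF lin2]
      linear_diff[OF lin1] linear_diff[OF lin2]
    have quad: "Q (x + t *\<^sub>R b) (x + t *\<^sub>R b) = Q x x + 2 * t * Q x b + t\<^sup>2 * Q b b" for x t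
      using insert.prems(3)[of x b] by (simp add: Qs power2_eq_square algebra_simps)
    show ?case
    proof (cases "Q b b = 0")
      case True
      have "Q x b = 0" for x
      proof (rule ccontr)
        assume nz: "Q x b \<noteq> 0"
        \<comment> \<open>With \<open>Q b b = 0\<close> the quadratic form is affine in
          \<open>t\<close> along \<open>x + t *\<^sub>R b\<close>; this value of \<open>t\<close>
          would make it equal to -1.\<close>
        have "Q x x + 2 * (- (Q x x + 1) / (2 * Q x b)) * Q x b \<ge> 0"
          using quad[of x "- (Q x x + 1) / (2 * Q x b)"] insert.prems(4) True by (metis add.right_neutral mult_zero_right)
        moreover have "2 * (- (Q x x + 1) / (2 * Q x b)) * Q x b = - (Q x x + 1)"
          using nz by (simp add: field_simps)
        ultimately show False by simp
      qed
      then have "Q c y = 0" if "c \<in> Basis - B" for c y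
        using that insert.prems(3)[of b y] insert.prems(5)[of c] by (cases "c = b") auto
      then show ?thesis
        using insert.IH[of Q] insert.prems by auto
    next
      case False
      then have pos: "Q b b > 0" using insert.prems(4)[of b] by simp
      define Q' where "Q' x y = Q x y - Q x b * Q y b / Q b b" for x y
      define q where "q = (\<Sum>c\<in>Basis. (Q c b / sqrt (Q b b)) *\<^sub>R c)"
      have q: "q \<bullet> x = Q x b / sqrt (Q b b)" for x
      proof -
        have "Q x b = Q (\<Sum>c\<in>Basis. (x \<bullet> c) *\<^sub>R c) b" by (simp add: euclidean_representation)
        also have "\<dots> = (\<Sum>c\<in>Basis. (x \<bullet> c) * Q c b)"
          by (simp add: linear_sum[OF lin1] linear_scale[OF lin1])
        finally show ?thesis
          by (simp add: q_def inner_sum_left sum_divide_distrib inner_commute[of x] mult.commute)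
      qed
      have "bilinear Q'"
        unfolding bilinear_def Q'_def
        by (auto intro!: linearI simp: Qs algebra_simps add_divide_distrib)
      moreover have "Q' x y = Q' y x" for x y
        using insert.prems(3) by (simp add: Q'_def mult.commute)
      moreover have "Q' x x \<ge> 0" for x
      proof -
        \<comment> \<open>The parameter \<open>t = - Q x b / Q b b\<close> minimises the quadratic
          polynomial, and the minimum is \<open>Q' x x\<close>.\<close>
        have "0 \<le> Q x x + 2 * (- Q x b / Q b b) * Q x b + (- Q x b / Q b b)\<^sup>2 * Q b b"
          using quad[of x "- Q x b / Q b b"] insert.prems(4) by metis
        also have "\<dots> = Q' x x"
          using pos by (simp add: Q'_def power2_eq_square field_simps)
        finally show ?thesis .
      qed
      moreover have "Q' c y = 0" if "c \<in> Basis - B" for c y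
      proof (cases "c = b")
        case True
        then show ?thesis using pos insert.prems(3)[of b y] by (simp add: Q'_def)
      next
        case False
        then show ?thesis using that insert.prems(5)[of c] by (simp add: Q'_def)
      qed
      ultimately obtain qs where "\<forall>x y. Q' x y = (\<Sum>q\<leftarrow>qs. (q \<bullet> x) * (q \<bullet> y))"
        using insert.IH[of Q'] insert.prems(1) by auto
      then have "Q x y = (\<Sum>q\<leftarrow>q # qs. (q \<bullet> x) * (q \<bullet> y))" for x y
        using pos by (simp add: q) (metis Q'_def add.commute diff_add_cancel less_eq_real_def real_sqrt_mult_self)
      then show ?thesis by blast
    qed
  qed
  from this[of Basis Q] assms that show ?thesis by auto
qed

section \<open>Smooth functions and convolution\<close>

lemma differentiable_dir_deriv:
  assumes "f differentiable (at x)"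
  shows "(f has_derivative (\<lambda>v. dir_deriv v f x)) (at x)"
  using assms unfolding frechet_derivative_works dir_deriv_def .

lemma dir_deriv_eq: "(f has_derivative f') (at x) \<Longrightarrow> dir_deriv v f x = f' v"
  unfolding dir_deriv_def using frechet_derivative_at by metis

lemma linear_dir_deriv: "f differentiable (at x) \<Longrightarrow> linear (\<lambda>v. dir_deriv v f x)"
  using differentiable_dir_deriv has_derivative_linear by blast

lemma dir_deriv_basis:
  assumes "f differentiable (at x)"
  shows "dir_deriv v f x = (\<Sum>b\<in>Basis. of_real (v \<bullet> b) * dir_deriv b f x)"
proof -
  note l = linear_dir_deriv[OF assms]
  have "dir_deriv v f x = dir_deriv (\<Sum>b\<in>Basis. (v \<bullet> b) *\<^sub>R b) f x"
    by (simp add: euclidean_representation)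
  then show ?thesis
    by (simp add: linear_sum[OF l] linear_scale[OF l] scaleR_conv_of_real[where 'a=complex])
qed

lemma smooth_fun_iff:
  "smooth_fun g \<longleftrightarrow> (\<forall>x. g differentiable (at x)) \<and> (\<forall>v. smooth_fun (dir_deriv v g))"
proof (intro iffI conjI allI)
  assume g: "smooth_fun g"
  show "g differentiable (at x)" for x
    using g[unfolded smooth_fun_def, rule_format, of "[]" x] by simp
  show "smooth_fun (dir_deriv v g)" for v
    unfolding smooth_fun_def
  proof (intro allI)
    fix vs x
    show "foldr dir_deriv vs (dir_deriv v g) differentiable (at x)"
      using g[unfolded smooth_fun_def, rule_format, of "vs @ [v]" x] by simp
  qed
next
  assume g: "(\<forall>x. g differentiable (at x)) \<and> (\<forall>v. smooth_fun (dir_deriv v g))"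
  show "smooth_fun g"
    unfolding smooth_fun_def
  proof (intro allI)
    fix vs x
    show "foldr dir_deriv vs g differentiable (at x)"
      using g by (cases vs rule: rev_cases) (auto simp: smooth_fun_def)
  qed
qed

text \<open>Higher derivatives of products, bumps and convolutions have no convenient closed form.
  It is enough to find a class of functions that differentiation does not leave.\<close>

lemma smooth_fun_coinduct:
  assumes "g \<in> F"
    and "\<And>g. g \<in> F \<Longrightarrow> (\<forall>x. g differentiable (at x)) \<and> (\<forall>v. dir_deriv v g \<in> F)"
  shows "smooth_fun g"
proof -
  have "foldr dir_deriv vs g \<in> F" for vs
    by (induction vs) (use assms in auto)
  then show ?thesis
    using assms(2) by (auto simp: smooth_fun_def)
qed

lemma smooth_differentiable: "smooth_fun g \<Longrightarrow> g differentiable (at x)"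
  using smooth_fun_iff by blast

lemma smooth_dir_deriv: "smooth_fun g \<Longrightarrow> smooth_fun (dir_deriv v g)"
  using smooth_fun_iff by blast

lemma smooth_continuous: "smooth_fun g \<Longrightarrow> continuous_on UNIV g"
  by (intro continuous_at_imp_continuous_on ballI differentiable_imp_continuous_within smooth_differentiable)

lemma smooth_measurable [measurable_dest]: "smooth_fun g \<Longrightarrow> g \<in> borel_measurable borel"
  by (intro borel_measurable_continuous_onI smooth_continuous)

lemma dir_deriv_sum_list_mult:
  assumes "\<forall>(f, g)\<in>set ps. f differentiable (at x) \<and> g differentiable (at x)"
  shows "((\<lambda>x. \<Sum>(f, g)\<leftarrow>ps. f x * g x) has_derivative
    (\<lambda>v. \<Sum>(f, g)\<leftarrow>map (\<lambda>(f, g). (dir_deriv v f, g)) ps @ map (\<lambda>(f, g). (f, dir_deriv v g)) ps. f x * g x)) (at x)"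
  using assms
proof (induction ps)
  case (Cons p ps)
  obtain f g where p: "p = (f, g)" by (cases p)
  have "((\<lambda>x. f x * g x) has_derivative (\<lambda>v. f x * dir_deriv v g x + dir_deriv v f x * g x)) (at x)"
    using Cons.prems p by (intro has_derivative_mult differentiable_dir_deriv) auto
  from has_derivative_add[OF this Cons.IH] Cons.prems show ?case
    by (simp add: p algebra_simps)
qed simp

text \<open>Single products are not closed under the Leibniz rule, finite sums of products
  are.\<close>

lemma smooth_sum_list_mult:
  assumes "\<forall>(f, g)\<in>set ps. smooth_fun f \<and> smooth_fun g"
  shows "smooth_fun (\<lambda>x. \<Sum>(f, g)\<leftarrow>ps. f x * g x)"
proof (rule smooth_fun_coinduct)
  let ?F = "{h. \<exists>ps. (\<forall>(f, g)\<in>set ps. smooth_fun f \<and> smooth_fun g) \<and> h = (\<lambda>x. \<Sum>(f, g)\<leftarrow>ps. f x * g x)}"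
  show "(\<lambda>x. \<Sum>(f, g)\<leftarrow>ps. f x * g x) \<in> ?F" using assms by blast
  fix h assume "h \<in> ?F"
  then obtain ps where ps: "\<forall>(f, g)\<in>set ps. smooth_fun f \<and> smooth_fun g"
    "h = (\<lambda>x. \<Sum>(f, g)\<leftarrow>ps. f x * g x)" by blast
  let ?D = "\<lambda>v. map (\<lambda>(f, g). (dir_deriv v f, g)) ps @ map (\<lambda>(f, g). (f, dir_deriv v g)) ps"
  have d: "(h has_derivative (\<lambda>v. \<Sum>(f, g)\<leftarrow>?D v. f x * g x)) (at x)" for x
    unfolding ps(2) by (rule dir_deriv_sum_list_mult) (use ps(1) in \<open>fastforce intro: smooth_differentiable\<close>)
  have "dir_deriv v h \<in> ?F" for v
  proof -
    have "dir_deriv v h = (\<lambda>x. \<Sum>(f, g)\<leftarrow>?D v. f x * g x)"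
      by (rule ext) (rule dir_deriv_eq[OF d])
    moreover have "\<forall>(f, g)\<in>set (?D v). smooth_fun f \<and> smooth_fun g"
      using ps(1) by (fastforce intro: smooth_dir_deriv)
    ultimately show ?thesis by blast
  qed
  then show "(\<forall>x. h differentiable (at x)) \<and> (\<forall>v. dir_deriv v h \<in> ?F)"
    using d unfolding differentiable_def by blast
qed

lemma dir_deriv_const [simp]: "dir_deriv v (\<lambda>x. c) = (\<lambda>x. 0)"
  by (rule ext, subst dir_deriv_eq[OF has_derivative_const]) simp

lemma smooth_const [simp]: "smooth_fun (\<lambda>x. c)"
  by (rule smooth_fun_coinduct[of _ "range (\<lambda>c x. c)"]) auto

lemma smooth_mult: "smooth_fun f \<Longrightarrow> smooth_fun g \<Longrightarrow> smooth_fun (\<lambda>x. f x * g x)"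
  using smooth_sum_list_mult[of "[(f, g)]"] by simp

lemma smooth_add: "smooth_fun f \<Longrightarrow> smooth_fun g \<Longrightarrow> smooth_fun (\<lambda>x. f x + g x)"
  using smooth_sum_list_mult[of "[(\<lambda>x. 1, f), (\<lambda>x. 1, g)]"] by simp

lemma smooth_minus: "smooth_fun f \<Longrightarrow> smooth_fun (\<lambda>x. - f x)"
  using smooth_mult[of "\<lambda>x. -1" f] by simp

lemma smooth_diff: "smooth_fun f \<Longrightarrow> smooth_fun g \<Longrightarrow> smooth_fun (\<lambda>x. f x - g x)"
  using smooth_add[of f "\<lambda>x. - g x"] by (simp add: smooth_minus)

lemma smooth_sum: "(\<And>i. i \<in> I \<Longrightarrow> smooth_fun (f i)) \<Longrightarrow> smooth_fun (\<lambda>x. \<Sum>i\<in>I. f i x)"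
  by (induction I rule: infinite_finite_induct) (auto intro: smooth_add)

lemma smooth_inner: "smooth_fun (\<lambda>x. of_real (a \<bullet> x))"
proof -
  have "((\<lambda>x. complex_of_real (a \<bullet> x)) has_derivative (\<lambda>v. of_real (a \<bullet> v))) (at x)" for x
    by (auto intro!: derivative_eq_intros)
  moreover from this have "dir_deriv v (\<lambda>x. of_real (a \<bullet> x)) = (\<lambda>x. of_real (a \<bullet> v))" for v
    by (auto intro!: ext dir_deriv_eq)
  ultimately show ?thesis
    by (subst smooth_fun_iff) (auto simp: differentiable_def)
qed

lemma dir_deriv_add:
  "smooth_fun f \<Longrightarrow> smooth_fun g \<Longrightarrow> dir_deriv v (\<lambda>x. f x + g x) x = dir_deriv v f x + dir_deriv v g x"
  by (rule dir_deriv_eq) (intro has_derivative_add differentiable_dir_deriv smooth_differentiable)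

lemma dir_deriv_diff:
  "smooth_fun f \<Longrightarrow> smooth_fun g \<Longrightarrow> dir_deriv v (\<lambda>x. f x - g x) x = dir_deriv v f x - dir_deriv v g x"
  by (rule dir_deriv_eq) (intro has_derivative_diff differentiable_dir_deriv smooth_differentiable)

lemma dir_deriv_mult:
  assumes "smooth_fun f" "smooth_fun g"
  shows "dir_deriv v (\<lambda>x. f x * g x) x = f x * dir_deriv v g x + dir_deriv v f x * g x"
  by (rule dir_deriv_eq) (intro has_derivative_mult differentiable_dir_deriv smooth_differentiable assms)

lemma dir_deriv_sum:
  "(\<And>i. i \<in> I \<Longrightarrow> smooth_fun (f i)) \<Longrightarrow> dir_deriv v (\<lambda>x. \<Sum>i\<in>I. f i x) x = (\<Sum>i\<in>I. dir_deriv v (f i) x)"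
  by (rule dir_deriv_eq) (intro has_derivative_sum differentiable_dir_deriv smooth_differentiable)

lemma dir_deriv_cmult:
  assumes "smooth_fun g"
  shows "dir_deriv v (\<lambda>x. c * g x) x = c * dir_deriv v g x"
  using dir_deriv_mult[OF smooth_const[of c] assms] by simp

lemma dir_deriv_line:
  assumes "smooth_fun f" "bounded_linear L"
  shows "((\<lambda>s. L (f (x + s *\<^sub>R a)) :: real) has_real_derivative L (dir_deriv a f (x + s *\<^sub>R a))) (at s)"
proof -
  have "((\<lambda>s. f (x + s *\<^sub>R a)) has_derivative (\<lambda>h. dir_deriv (h *\<^sub>R a) f (x + s *\<^sub>R a))) (at s)"
    by (rule has_derivative_compose[of "\<lambda>s. x + s *\<^sub>R a"])
      (auto intro!: derivative_eq_intros differentiable_dir_deriv smooth_differentiable assms)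
  from bounded_linear.has_derivative[OF assms(2) this] show ?thesis
    unfolding has_field_derivative_def
    using linear_scale[OF linear_dir_deriv[OF smooth_differentiable[OF assms(1)]]]
      linear_scale[OF bounded_linear.linear[OF assms(2)]]
    by (simp add: mult_commute_abs)
qed

text \<open>The mean value theorem is applied twice, along \<open>a\<close> and then along
  \<open>b\<close>; the functional \<open>L\<close> reduces complex values to real ones. The left
  side is symmetric in \<open>a\<close> and \<open>b\<close>, which yields the symmetry of second
  derivatives, and the case \<open>a = b\<close> yields the sign of the Hessian of a convex
  function.\<close>

lemma second_difference:
  assumes f: "smooth_fun f" and L: "bounded_linear L" and t: "t > 0"
  obtains p where "dist p x \<le> t * (norm a + norm b)"
    "L (f (x + t *\<^sub>R a + t *\<^sub>R b)) - L (f (x + t *\<^sub>R a)) - L (f (x + t *\<^sub>R b)) + L (f x)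
      = t\<^sup>2 * (L (dir_deriv b (dir_deriv a f) p) :: real)"
proof -
  let ?\<phi> = "\<lambda>s. L (f ((x + t *\<^sub>R b) + s *\<^sub>R a)) - L (f (x + s *\<^sub>R a))"
  have "\<exists>z>0. z < t \<and> ?\<phi> t - ?\<phi> 0 = (t - 0) * (L (dir_deriv a f ((x + t *\<^sub>R b) + z *\<^sub>R a)) - L (dir_deriv a f (x + z *\<^sub>R a)))"
    using t by (intro MVT2 DERIV_diff dir_deriv_line[OF f L]) auto
  then obtain z where z: "0 < z" "z < t"
    "?\<phi> t - ?\<phi> 0 = t * (L (dir_deriv a f ((x + z *\<^sub>R a) + t *\<^sub>R b)) - L (dir_deriv a f (x + z *\<^sub>R a)))"
    by (auto simp: algebra_simps)
  have "\<exists>w>0. w < t \<and> L (dir_deriv a f ((x + z *\<^sub>R a) + t *\<^sub>R b)) - L (dir_deriv a f ((x + z *\<^sub>R a) + 0 *\<^sub>R b))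
      = (t - 0) * L (dir_deriv b (dir_deriv a f) ((x + z *\<^sub>R a) + w *\<^sub>R b))"
    using t by (intro MVT2 dir_deriv_line smooth_dir_deriv f L) auto
  then obtain w where w: "0 < w" "w < t"
    "L (dir_deriv a f ((x + z *\<^sub>R a) + t *\<^sub>R b)) - L (dir_deriv a f (x + z *\<^sub>R a))
      = t * L (dir_deriv b (dir_deriv a f) (x + z *\<^sub>R a + w *\<^sub>R b))"
    by auto
  show ?thesis
  proof (rule that)
    have "dist (x + z *\<^sub>R a + w *\<^sub>R b) x = norm (z *\<^sub>R a + w *\<^sub>R b)"
      by (simp add: dist_norm)
    also have "\<dots> \<le> z * norm a + w * norm b"
      using norm_triangle_ineq[of "z *\<^sub>R a" "w *\<^sub>R b"] z w by simp
    also have "\<dots> \<le> t * (norm a + norm b)"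
      unfolding distrib_left by (intro add_mono mult_right_mono) (use z w in auto)
    finally show "dist (x + z *\<^sub>R a + w *\<^sub>R b) x \<le> t * (norm a + norm b)" .
    show "L (f (x + t *\<^sub>R a + t *\<^sub>R b)) - L (f (x + t *\<^sub>R a)) - L (f (x + t *\<^sub>R b)) + L (f x)
      = t\<^sup>2 * L (dir_deriv b (dir_deriv a f) (x + z *\<^sub>R a + w *\<^sub>R b))"
      using z(3) unfolding w(3) by (simp add: power2_eq_square algebra_simps)
  qed
qed

text \<open>The same second difference is represented by either mixed derivative, at points that
  tend to \<open>x\<close> with the step size; continuity of the derivatives finishes the argument,
  separately for real and imaginary part.\<close>

lemma dir_deriv_commute:
  assumes f: "smooth_fun f"
  shows "dir_deriv a (dir_deriv b f) x = dir_deriv b (dir_deriv a f) x"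
proof -
  have key: "L (dir_deriv a (dir_deriv b f) x) = L (dir_deriv b (dir_deriv a f) x)"
    if L: "bounded_linear L" for L :: "complex \<Rightarrow> real"
  proof -
    define t where "t n = inverse (real (Suc n))" for n
    have t: "t n > 0" for n by (simp add: t_def)
    have "\<forall>n. \<exists>p q. dist p x \<le> t n * (norm a + norm b) \<and> dist q x \<le> t n * (norm a + norm b) \<and>
        L (dir_deriv a (dir_deriv b f) p) = L (dir_deriv b (dir_deriv a f) q)"
    proof
      fix n
      obtain p where p: "dist p x \<le> t n * (norm b + norm a)"
        "L (f (x + t n *\<^sub>R b + t n *\<^sub>R a)) - L (f (x + t n *\<^sub>R b)) - L (f (x + t n *\<^sub>R a)) + L (f x)
          = (t n)\<^sup>2 * L (dir_deriv a (dir_deriv b f) p)"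
        by (rule second_difference[OF f L t])
      obtain q where q: "dist q x \<le> t n * (norm a + norm b)"
        "L (f (x + t n *\<^sub>R a + t n *\<^sub>R b)) - L (f (x + t n *\<^sub>R a)) - L (f (x + t n *\<^sub>R b)) + L (f x)
          = (t n)\<^sup>2 * L (dir_deriv b (dir_deriv a f) q)"
        by (rule second_difference[OF f L t])
      have "(t n)\<^sup>2 * L (dir_deriv a (dir_deriv b f) p) = (t n)\<^sup>2 * L (dir_deriv b (dir_deriv a f) q)"
        unfolding p(2)[symmetric] q(2)[symmetric] by (simp add: algebra_simps)
      then show "\<exists>p q. dist p x \<le> t n * (norm a + norm b) \<and> dist q x \<le> t n * (norm a + norm b) \<and>
          L (dir_deriv a (dir_deriv b f) p) = L (dir_deriv b (dir_deriv a f) q)"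
        using p(1) q(1) t[of n] by (auto simp: add.commute)
    qed
    then obtain p q where pq: "\<And>n. dist (p n) x \<le> t n * (norm a + norm b)"
      "\<And>n. dist (q n) x \<le> t n * (norm a + norm b)"
      "\<And>n. L (dir_deriv a (dir_deriv b f) (p n)) = L (dir_deriv b (dir_deriv a f) (q n))"
      by metis
    have t0: "(\<lambda>n. t n * (norm a + norm b)) \<longlonglongrightarrow> 0"
      unfolding t_def by (intro tendsto_mult_left_zero LIMSEQ_inverse_real_of_nat)
    have lim: "r \<longlonglongrightarrow> x" if "\<And>n. dist (r n) x \<le> t n * (norm a + norm b)" for r
      by (rule tendsto_dist_iff[THEN iffD2], rule Lim_null_comparison[OF always_eventually t0]) (use that in simp)
    have "isCont (dir_deriv c (dir_deriv d f)) x" for c d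
      using smooth_continuous[OF smooth_dir_deriv[OF smooth_dir_deriv[OF f]]]
      by (simp add: continuous_on_eq_continuous_at)
    then have "(\<lambda>n. L (dir_deriv c (dir_deriv d f) (r n))) \<longlonglongrightarrow> L (dir_deriv c (dir_deriv d f) x)"
      if "r \<longlonglongrightarrow> x" for c d r
      by (intro bounded_linear.tendsto[OF L] isCont_tendsto_compose[OF _ that])
    from this[OF lim[OF pq(1)], of a b] this[OF lim[OF pq(2)], of b a] show ?thesis
      unfolding pq(3) by (rule LIMSEQ_unique)
  qed
  show ?thesis
    using key[OF bounded_linear_Re] key[OF bounded_linear_Im] by (simp add: complex_eq_iff)
qed

section \<open>A smooth bump function\<close>

definition expinv :: "nat \<Rightarrow> real \<Rightarrow> real" where
  "expinv m t = (if t > 0 then exp (- (1 / t)) / t ^ m else 0)"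

text \<open>The family, with all powers of \<open>t\<close> in the denominator, is closed under
  differentiation. Its member \<open>m = 0\<close> is the classical flat function.\<close>

lemma expinv_DERIV: "(expinv m has_real_derivative (expinv (m + 2) t - m * expinv (m + 1) t)) (at t)"
proof -
  consider "t > 0" | "t < 0" | "t = 0" by linarith
  then show ?thesis
  proof cases
    case 1
    have "((\<lambda>t. exp (- (1 / t))) has_real_derivative exp (- (1 / t)) * (1 / t\<^sup>2)) (at t)"
      using 1 by (auto intro!: derivative_eq_intros simp: field_simps power2_eq_square)
    from DERIV_divide[OF this DERIV_pow[of m]] 1
    have "((\<lambda>t. exp (- (1 / t)) / t ^ m) has_real_derivative
        (exp (- (1 / t)) * (1 / t\<^sup>2) * t ^ m - exp (- (1 / t)) * (real m * t ^ (m - Suc 0))) / (t ^ m * t ^ m)) (at t)"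
      by simp
    moreover have "(exp (- (1 / t)) * (1 / t\<^sup>2) * t ^ m - exp (- (1 / t)) * (real m * t ^ (m - Suc 0))) / (t ^ m * t ^ m)
        = expinv (m + 2) t - m * expinv (m + 1) t"
      using 1 by (cases m) (simp_all add: expinv_def field_simps power2_eq_square)
    ultimately have "((\<lambda>t. exp (- (1 / t)) / t ^ m) has_real_derivative (expinv (m + 2) t - m * expinv (m + 1) t)) (at t)"
      by simp
    then show ?thesis
      by (rule has_field_derivative_transform_within_open[of _ _ _ "{0<..}"]) (use 1 in \<open>auto simp: expinv_def\<close>)
  next
    case 2
    have "((\<lambda>t. 0) has_real_derivative (expinv (m + 2) t - m * expinv (m + 1) t)) (at t)"
      using 2 by (simp add: expinv_def)
    then show ?thesis
      by (rule has_field_derivative_transform_within_open[of _ _ _ "{..<0}"]) (use 2 in \<open>auto simp: expinv_def\<close>)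
  next
    case 3
    \<comment> \<open>With \<open>y = inverse h\<close>, this is the difference quotient from the
      right at 0.\<close>
    have "((\<lambda>y. y ^ (m + 1) / exp y) \<longlongrightarrow> (0::real)) at_top"
      by (rule tendsto_power_div_exp_0)
    then have "((\<lambda>h. inverse h ^ (m + 1) / exp (inverse h)) \<longlongrightarrow> (0::real)) (at_right 0)"
      by (rule filterlim_compose[OF _ filterlim_inverse_at_top_right])
    then have r: "((\<lambda>h. (expinv m (0 + h) - expinv m 0) / h) \<longlongrightarrow> 0) (at_right 0)"
      by (rule Lim_transform_eventually)
        (auto simp: eventually_at_right_field expinv_def exp_minus field_simps intro!: exI[of _ 1])
    have l: "((\<lambda>h. (expinv m (0 + h) - expinv m 0) / h) \<longlongrightarrow> 0) (at_left 0)"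
      by (rule Lim_transform_eventually[OF tendsto_const])
        (auto simp: eventually_at_left_field expinv_def intro!: exI[of _ "-1"])
    show ?thesis
      using 3 filterlim_split_at[OF l r] by (simp add: DERIV_def expinv_def)
  qed
qed

definition bump :: "real \<Rightarrow> complex^'n::finite \<Rightarrow> real" where
  "bump r x = expinv 0 (r\<^sup>2 - x \<bullet> x)"

text \<open>The invariant class consists of sums of smooth functions times \<open>expinv m\<close>
  of \<open>r\<^sup>2 - x \<bullet> x\<close>. The chain rule contributes
  \<open>- 2 * (v \<bullet> x)\<close> and raises the index by 1 or 2, which accounts for the three
  summands produced from each one.\<close>

lemma smooth_bump: "smooth_fun (\<lambda>x::complex^'n::finite. of_real (bump r x))"
proof -
  let ?s = "\<lambda>x::complex^'n. r\<^sup>2 - x \<bullet> x"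
  let ?T = "\<lambda>ps x. \<Sum>(P, m)\<leftarrow>ps. P x * complex_of_real (expinv m (?s x))"
  let ?F = "{h. \<exists>ps. (\<forall>(P, m)\<in>set ps. smooth_fun P) \<and> h = ?T ps}"
  let ?D = "\<lambda>v ps. concat (map (\<lambda>(P, m). [(dir_deriv v P, m),
        (\<lambda>x. P x * (of_real (- 2 * (v \<bullet> x)) * - of_nat m), m + 1), (\<lambda>x. P x * of_real (- 2 * (v \<bullet> x)), m + 2)]) ps)"
  have d1: "((\<lambda>x. P x * complex_of_real (expinv m (?s x))) has_derivative (\<lambda>v. ?T (?D v [(P, m)]) x)) (at x)"
    if "smooth_fun P" for P m x
  proof -
    have "(?s has_derivative (\<lambda>v. - 2 * (v \<bullet> x))) (at x)"
      by (auto intro!: derivative_eq_intros simp: inner_commute)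
    from has_derivative_compose[OF this expinv_DERIV[unfolded has_field_derivative_def], of m]
    have "((\<lambda>x. expinv m (?s x)) has_derivative
        (\<lambda>v. (- 2 * (v \<bullet> x)) * (expinv (m + 2) (?s x) - m * expinv (m + 1) (?s x)))) (at x)"
      by (simp add: mult.commute)
    from has_derivative_mult[OF differentiable_dir_deriv[OF smooth_differentiable[OF that]] has_derivative_of_real[OF this]]
    show ?thesis
      by (rule has_derivative_eq_rhs) (auto simp: algebra_simps)
  qed
  have d: "(?T ps has_derivative (\<lambda>v. ?T (?D v ps) x)) (at x)" if "\<forall>(P, m)\<in>set ps. smooth_fun P" for ps x
    using that
  proof (induction ps)
    case (Cons p ps)
    obtain P m where p: "p = (P, m)" by (cases p)
    have "smooth_fun P" "\<forall>(P, m)\<in>set ps. smooth_fun P" using Cons.prems p by auto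
    from has_derivative_add[OF d1[OF this(1), of m] Cons.IH[OF this(2)]] show ?case
      by (simp add: p algebra_simps)
  qed simp
  show ?thesis
  proof (rule smooth_fun_coinduct)
    show "(\<lambda>x. of_real (bump r x)) \<in> ?F"
      by (rule CollectI, rule exI[of _ "[(\<lambda>x. 1, 0)]"]) (simp add: bump_def)
    fix h assume "h \<in> ?F"
    then obtain ps where ps: "\<forall>(P, m)\<in>set ps. smooth_fun P" "h = ?T ps" by blast
    have "dir_deriv v h \<in> ?F" for v
    proof -
      have "dir_deriv v h = ?T (?D v ps)"
        unfolding ps(2) by (rule ext) (rule dir_deriv_eq[OF d[OF ps(1)]])
      moreover have "smooth_fun (\<lambda>x. complex_of_real (- 2 * (v \<bullet> x)))"
        using smooth_mult[OF smooth_const[of "-2"] smooth_inner[of v]] by simp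
      then have "\<forall>(P, m)\<in>set (?D v ps). smooth_fun P"
        using ps(1) by (auto intro!: smooth_mult smooth_dir_deriv smooth_minus smooth_inner)
      ultimately show ?thesis by blast
    qed
    then show "(\<forall>x. h differentiable (at x)) \<and> (\<forall>v. dir_deriv v h \<in> ?F)"
      using d[OF ps(1)] ps(2) unfolding differentiable_def by blast
  qed
qed

lemma bump_nonneg: "bump r x \<ge> 0"
  by (simp add: bump_def expinv_def)

lemma bump_pos: "norm x < r \<Longrightarrow> bump r x > 0"
  using power_strict_mono[of "norm x" r 2] by (simp add: bump_def expinv_def power2_norm_eq_inner)

lemma bump_zero: "0 < r \<Longrightarrow> r \<le> norm x \<Longrightarrow> bump r x = 0"
  using power_mono[of r "norm x" 2] by (simp add: bump_def expinv_def power2_norm_eq_inner)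

lemma continuous_bump: "continuous_on UNIV (bump r)"
  using continuous_on_Re[OF smooth_continuous[OF smooth_bump[of r]]] by simp

section \<open>Integrals of compactly supported functions\<close>

lemma lborel_integral_shift:
  fixes f :: "'a::euclidean_space \<Rightarrow> 'b::{banach, second_countable_topology}"
  assumes [measurable]: "f \<in> borel_measurable borel"
  shows "(LINT x|lborel. f (x + c)) = (LINT x|lborel. f x)"
proof -
  have "(LINT x|lborel. f x) = integral\<^sup>L (distr lborel borel ((+) c)) f"
    by (simp add: lborel_distr_plus)
  also have "\<dots> = (LINT x|lborel. f (c + x))"
    by (rule integral_distr) auto
  finally show ?thesis by (simp add: add.commute)
qed

lemma lborel_distr_reflect: "distr lborel borel (\<lambda>x. c - x) = (lborel :: 'a::euclidean_space measure)"
  by (subst (2) lborel_affine[of "-1" c]) (simp_all add: density_1)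

lemma lborel_integral_reflect:
  fixes f :: "'a::euclidean_space \<Rightarrow> 'b::{banach, second_countable_topology}"
  assumes [measurable]: "f \<in> borel_measurable borel"
  shows "(LINT x|lborel. f (c - x)) = (LINT x|lborel. f x)"
  using integral_distr[of "\<lambda>x. c - x" lborel borel f] by (simp add: lborel_distr_reflect)

lemma integrable_continuous_compact:
  fixes f :: "'a::euclidean_space \<Rightarrow> 'b::euclidean_space"
  assumes "continuous_on UNIV f" "compact K" "\<And>x. x \<notin> K \<Longrightarrow> f x = 0"
  shows "integrable lborel f"
proof -
  have "integrable lborel (\<lambda>x. indicator K x *\<^sub>R f x)"
    using borel_integrable_compact[OF assms(2) continuous_on_subset[OF assms(1)]]
    by (simp add: set_integrable_def)
  also have "(\<lambda>x. indicator K x *\<^sub>R f x) = f"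
    using assms(3) by (auto simp: indicator_def)
  finally show ?thesis .
qed

lemma compact_support_bounded:
  fixes f :: "'a::euclidean_space \<Rightarrow> 'b::real_normed_vector"
  assumes "continuous_on UNIV f" "compact K" "\<And>x. x \<notin> K \<Longrightarrow> f x = 0"
  obtains C where "C > 0" "\<And>x. norm (f x) \<le> C"
proof -
  have "bounded (f ` K)"
    by (rule compact_imp_bounded[OF compact_continuous_image[OF continuous_on_subset[OF assms(1)] assms(2)]]) simp
  then obtain C where "C > 0" "\<And>x. x \<in> K \<Longrightarrow> norm (f x) \<le> C"
    unfolding bounded_pos by auto
  then show ?thesis
    using assms(3) that[of C] by (metis norm_zero less_imp_le)
qed

lemma compact_subset_cball_0:
  fixes K :: "'a::real_normed_vector set"
  assumes "compact K"
  obtains R where "K \<subseteq> cball 0 R"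
proof -
  obtain R where "\<forall>x\<in>K. norm x \<le> R"
    using compact_imp_bounded[OF assms] unfolding bounded_iff by blast
  then show ?thesis by (intro that[of R]) auto
qed

lemma compact_support_uniformly_continuous:
  fixes f :: "'a::euclidean_space \<Rightarrow> 'b::real_normed_vector"
  assumes "continuous_on UNIV f" "compact K" "\<And>x. x \<notin> K \<Longrightarrow> f x = 0"
  shows "uniformly_continuous_on UNIV f"
proof -
  obtain R where R: "K \<subseteq> cball 0 R"
    using compact_subset_cball_0[OF assms(2)] .
  have uc: "uniformly_continuous_on (cball 0 (R + 1)) f"
    by (rule compact_uniformly_continuous[OF continuous_on_subset[OF assms(1)]]) auto
  show ?thesis
    unfolding uniformly_continuous_on_def
  proof (intro allI impI)
    fix e :: real assume "e > 0"
    then obtain d where d: "d > 0"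
      "\<And>x y. x \<in> cball 0 (R + 1) \<Longrightarrow> y \<in> cball 0 (R + 1) \<Longrightarrow> dist y x < d \<Longrightarrow> dist (f y) (f x) < e"
      using uniformly_continuous_onE[OF uc] by metis
    have "dist (f y) (f x) < e" if "dist y x < min d 1" for x y
    proof (cases "x \<in> cball 0 R \<or> y \<in> cball 0 R")
      case True
      then have "norm x \<le> R + 1" "norm y \<le> R + 1"
        using that norm_triangle_ineq2[of x y] norm_triangle_ineq2[of y x]
        by (auto simp: dist_norm norm_minus_commute)
      then show ?thesis using d(2)[of x y] that by auto
    next
      case False
      then have "f x = 0" "f y = 0" using assms(3) R by blast+
      then show ?thesis using \<open>e > 0\<close> by simp
    qed
    then show "\<exists>d>0. \<forall>x\<in>UNIV. \<forall>x'\<in>UNIV. dist x' x < d \<longrightarrow> dist (f x') (f x) < e"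
      using d(1) by (intro exI[of _ "min d 1"]) auto
  qed
qed

lemma dir_deriv_outside:
  assumes "compact K" "\<And>x. x \<notin> K \<Longrightarrow> f x = 0" "x \<notin> K"
  shows "dir_deriv v f x = 0"
proof -
  have "(f has_derivative (\<lambda>v. 0)) (at x)"
    by (rule has_derivative_transform_within_open[of "\<lambda>x. 0" _ _ UNIV "- K"])
      (use assms compact_imp_closed in auto)
  then show ?thesis by (rule dir_deriv_eq)
qed

lemma onorm_dir_deriv_le:
  assumes "f differentiable (at x)"
  shows "onorm (\<lambda>v. dir_deriv v f x) \<le> (\<Sum>b\<in>Basis. norm (dir_deriv b f x))"
proof (rule onorm_le)
  fix v
  have "norm (dir_deriv v f x) \<le> (\<Sum>b\<in>Basis. norm (of_real (v \<bullet> b) * dir_deriv b f x))"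
    unfolding dir_deriv_basis[OF assms, of v] by (rule norm_sum)
  also have "\<dots> \<le> (\<Sum>b\<in>Basis. norm (dir_deriv b f x) * norm v)"
    by (intro sum_mono) (auto simp: norm_mult mult.commute[of _ "norm v"] intro!: mult_right_mono Basis_le_norm)
  finally show "norm (dir_deriv v f x) \<le> (\<Sum>b\<in>Basis. norm (dir_deriv b f x)) * norm v"
    by (simp add: sum_distrib_right)
qed

lemma smooth_lipschitz:
  assumes f: "smooth_fun f" and K: "compact K" "\<And>x. x \<notin> K \<Longrightarrow> f x = 0"
  obtains C where "C \<ge> 0" "\<And>x y. norm (f x - f y) \<le> C * norm (x - y)"
proof -
  have "\<forall>b. \<exists>C>0. \<forall>x. norm (dir_deriv b f x) \<le> C"
    using compact_support_bounded[OF smooth_continuous[OF smooth_dir_deriv[OF f]] K(1) dir_deriv_outside[OF K]]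
    by metis
  then obtain C where C: "\<And>b. C b > 0" "\<And>b x. norm (dir_deriv b f x) \<le> C b" by metis
  show ?thesis
  proof (rule that)
    show "(\<Sum>b\<in>Basis. C b) \<ge> 0" by (intro sum_nonneg less_imp_le C(1))
    show "norm (f x - f y) \<le> (\<Sum>b\<in>Basis. C b) * norm (x - y)" for x y
    proof (rule differentiable_bound[of UNIV f "\<lambda>x v. dir_deriv v f x"])
      show "onorm (\<lambda>v. dir_deriv v f z) \<le> (\<Sum>b\<in>Basis. C b)" for z
        by (rule order_trans[OF onorm_dir_deriv_le[OF smooth_differentiable[OF f]] sum_mono]) (rule C(2))
    qed (auto intro!: differentiable_dir_deriv smooth_differentiable f)
  qed
qed

text \<open>By translation invariance every difference quotient has integral 0. The Lipschitz
  constant together with the compact support dominates the quotients, so the limit may be taken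
  under the integral.\<close>

lemma integral_dir_deriv_zero:
  fixes f :: "complex^'n::finite \<Rightarrow> complex"
  assumes f: "smooth_fun f" and K: "compact K" "\<And>x. x \<notin> K \<Longrightarrow> f x = 0"
  shows "(LINT x|lborel. dir_deriv b f x) = 0"
proof -
  obtain C where C: "C \<ge> 0" "\<And>x y. norm (f x - f y) \<le> C * norm (x - y)"
    using smooth_lipschitz[OF f K] by blast
  obtain R where R: "K \<subseteq> cball 0 R"
    using compact_subset_cball_0[OF K(1)] .
  note [measurable] = smooth_measurable[OF f] smooth_measurable[OF smooth_dir_deriv[OF f]]
  define t where "t n = inverse (real (Suc n))" for n
  let ?s = "\<lambda>n x. (f (x + t n *\<^sub>R b) - f x) / of_real (t n)"
  have t: "0 < t n" "t n \<le> 1" for n by (auto simp: t_def field_simps)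
  have intf: "integrable lborel f"
    by (rule integrable_continuous_compact[OF smooth_continuous[OF f] K])
  have "(\<lambda>n. LINT x|lborel. ?s n x) \<longlonglongrightarrow> (LINT x|lborel. dir_deriv b f x)"
  \<comment> \<open>Since \<open>t n \<le> 1\<close>, neither \<open>f\<close> nor its translate is
    non-zero outside the ball of radius \<open>R + norm b\<close>.\<close>
  proof (rule integral_dominated_convergence[where w = "\<lambda>x. indicator (cball 0 (R + norm b)) x * (C * norm b)"])
    show "integrable lborel (\<lambda>x::complex^'n. indicator (cball 0 (R + norm b)) x * (C * norm b))"
      by (rule integrable_mult_left, rule integrable_real_indicator, simp, rule emeasure_lborel_cball_finite)
    show "AE x in lborel. (\<lambda>n. ?s n x) \<longlonglongrightarrow> dir_deriv b f x"
    proof (rule AE_I2)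
      fix x
      have *: "((\<lambda>s. L (f (x + s *\<^sub>R b))) has_real_derivative L (dir_deriv b f x)) (at 0)" if "bounded_linear L" for L
        using dir_deriv_line[OF f that, of x b 0] by simp
      have t0: "filterlim t (at 0) sequentially"
        unfolding filterlim_at using LIMSEQ_inverse_real_of_nat t by (auto simp: t_def[abs_def])
      have "(\<lambda>n. (L (f (x + t n *\<^sub>R b)) - L (f x)) / t n) \<longlonglongrightarrow> L (dir_deriv b f x)" if "bounded_linear L" for L
        using filterlim_compose[OF *[OF that, unfolded DERIV_def] t0] by simp
      note tendsto_Complex[OF this[OF bounded_linear_Re] this[OF bounded_linear_Im]]
      moreover have "(\<lambda>n. Complex ((Re (f (x + t n *\<^sub>R b)) - Re (f x)) / t n)
          ((Im (f (x + t n *\<^sub>R b)) - Im (f x)) / t n)) = (\<lambda>n. ?s n x)"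
        by (rule ext) (simp add: complex_eq_iff)
      ultimately show "(\<lambda>n. ?s n x) \<longlonglongrightarrow> dir_deriv b f x"
        by simp
    qed
    show "AE x in lborel. norm (?s n x) \<le> indicator (cball 0 (R + norm b)) x * (C * norm b)" for n
    proof (rule AE_I2)
      fix x
      show "norm (?s n x) \<le> indicator (cball 0 (R + norm b)) x * (C * norm b)"
      proof (cases "x \<in> cball 0 (R + norm b)")
        case True
        have "norm (?s n x) \<le> C * norm (t n *\<^sub>R b) / t n"
          using divide_right_mono[OF C(2)[of "x + t n *\<^sub>R b" x], of "t n"] t[of n] by (simp add: norm_divide)
        then show ?thesis using True t[of n] by simp
      next
        case False
        then have "norm x > R + norm b" by simp
        moreover have "norm (t n *\<^sub>R b) \<le> norm b"
          using t[of n] by (simp add: mult_left_le_one_le)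
        ultimately have "norm (x + t n *\<^sub>R b) > R" "norm x > R"
          using norm_triangle_ineq2[of x "- (t n *\<^sub>R b)"] norm_ge_zero[of b]
          unfolding norm_minus_cancel diff_minus_eq_add by linarith+
        then have "x + t n *\<^sub>R b \<notin> K" "x \<notin> K" using R by auto
        then have "f (x + t n *\<^sub>R b) = 0" "f x = 0" using K(2) by auto
        then show ?thesis using C(1) by simp
      qed
    qed
  qed auto
  moreover have "(LINT x|lborel. ?s n x) = 0" for n
  proof -
    have 2: "integrable lborel (\<lambda>x. f (x + t n *\<^sub>R b))"
      using integrable_distr_eq[of "(+) (t n *\<^sub>R b)" lborel borel f] intf
      by (simp add: lborel_distr_plus add.commute)
    have "(LINT x|lborel. ?s n x) = (LINT x|lborel. f (x + t n *\<^sub>R b) - f x) / of_real (t n)"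
      by simp
    also have "(LINT x|lborel. f (x + t n *\<^sub>R b) - f x) = 0"
      using intf 2 by (simp add: lborel_integral_shift)
    finally show ?thesis by simp
  qed
  ultimately have "(\<lambda>n::nat. 0::complex) \<longlonglongrightarrow> (LINT x|lborel. dir_deriv b f x)"
    by (simp only:)
  then show ?thesis
    by (simp add: LIMSEQ_const_iff)
qed

section \<open>Convolution with smooth compactly supported kernels\<close>

definition conv :: "(complex^'n::finite \<Rightarrow> complex) \<Rightarrow> (complex^'n \<Rightarrow> complex) \<Rightarrow> complex^'n \<Rightarrow> complex" where
  "conv \<rho> f x = (LINT y|lborel. \<rho> (x - y) * f y)"

lemma conv_integrable:
  fixes \<rho> f :: "complex^'n::finite \<Rightarrow> complex"
  assumes "continuous_on UNIV \<rho>" "\<And>x. r < norm x \<Longrightarrow> \<rho> x = 0" "continuous_on UNIV f"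
  shows "integrable lborel (\<lambda>y. \<rho> (x - y) * f y)"
proof (rule integrable_continuous_compact[of _ "cball x r"])
  show "continuous_on UNIV (\<lambda>y. \<rho> (x - y) * f y)"
    by (intro continuous_intros continuous_on_compose2[OF assms(1)] assms(3)) auto
  show "\<rho> (x - y) * f y = 0" if "y \<notin> cball x r" for y
    using assms(2)[of "x - y"] that by (simp add: dist_norm)
qed auto

lemma conv_altdef:
  assumes [measurable]: "\<rho> \<in> borel_measurable borel" "f \<in> borel_measurable borel"
  shows "conv \<rho> f x = (LINT y|lborel. \<rho> y * f (x - y))"
  unfolding conv_def using lborel_integral_reflect[of "\<lambda>y. \<rho> (x - y) * f y" x] by simp

text \<open>The derivative falls on the kernel alone, as \<open>f\<close> is merely continuous.
  Derivatives of \<open>\<rho>\<close> are uniformly continuous, so the first order remainder of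
  \<open>\<rho>\<close> is uniformly small compared with \<open>norm h\<close>.\<close>

lemma conv_has_derivative:
  assumes \<rho>: "smooth_fun \<rho>" "\<And>x. r < norm x \<Longrightarrow> \<rho> x = 0" and f: "continuous_on UNIV f"
  shows "(conv \<rho> f has_derivative (\<lambda>h. conv (dir_deriv h \<rho>) f x)) (at x)"
proof -
  have K: "\<And>x. x \<notin> cball 0 r \<Longrightarrow> \<rho> x = 0" using \<rho>(2) by simp
  have D0: "dir_deriv h \<rho> z = 0" if "r < norm z" for h z
    using dir_deriv_outside[OF compact_cball[of 0 r], of \<rho> z h] K that by simp
  note cD = smooth_continuous[OF smooth_dir_deriv[OF \<rho>(1)]]
  have iD: "integrable lborel (\<lambda>y. dir_deriv h \<rho> (x - y) * f y)" for h x
    by (rule conv_integrable[OF cD D0 f])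
  have i\<rho>: "integrable lborel (\<lambda>y. \<rho> (x - y) * f y)" for x
    by (rule conv_integrable[OF smooth_continuous[OF \<rho>(1)] \<rho>(2) f])
  have la: "dir_deriv (a + b) \<rho> z = dir_deriv a \<rho> z + dir_deriv b \<rho> z" for a b z
    by (rule linear_add[OF linear_dir_deriv[OF smooth_differentiable[OF \<rho>(1)]]])
  have lin: "linear (\<lambda>h. conv (dir_deriv h \<rho>) f x)"
  proof (rule linearI)
    fix a b c
    show "conv (dir_deriv (a + b) \<rho>) f x = conv (dir_deriv a \<rho>) f x + conv (dir_deriv b \<rho>) f x"
      unfolding conv_def la distrib_right by (rule Bochner_Integration.integral_add[OF iD iD])
    show "conv (dir_deriv (c *\<^sub>R a) \<rho>) f x = c *\<^sub>R conv (dir_deriv a \<rho>) f x"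
      unfolding conv_def
      by (subst integral_scaleR_right[symmetric])
        (simp add: linear_scale[OF linear_dir_deriv[OF smooth_differentiable[OF \<rho>(1)]]])
  qed
  \<comment> \<open>The ball of radius \<open>r + 1\<close> contains the supports of the kernel
    centred at \<open>x\<close> and of its translates by less than 1. The \<open>max 1\<close> makes
    \<open>I\<close> a legitimate divisor in \<open>e'\<close>, where the dimension factor pays for
    the sum over basis directions.\<close>
  define I where "I = max 1 (LINT y|lborel. indicator (cball x (r + 1)) y * norm (f y))"
  have I: "I > 0" "(LINT y|lborel. indicator (cball x (r + 1)) y * norm (f y)) \<le> I"
    by (auto simp: I_def)
  have intI: "integrable lborel (\<lambda>y. indicator (cball x (r + 1)) y * norm (f y))"
    using borel_integrable_compact[OF compact_cball continuous_on_norm[OF continuous_on_subset[OF f]], of x "r + 1"]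
    by (simp add: set_integrable_def)
  show ?thesis
    unfolding has_derivative_at_alt
  proof (intro conjI allI impI)
    show "bounded_linear (\<lambda>h. conv (dir_deriv h \<rho>) f x)"
      using lin linear_conv_bounded_linear by blast
    fix e :: real assume e: "e > 0"
    define e' where "e' = e / (I * real (DIM(complex^'a)))"
    have e': "e' > 0" using e I(1) by (simp add: e'_def)
    have "\<forall>b. \<exists>d>0. \<forall>z w. dist z w < d \<longrightarrow> dist (dir_deriv b \<rho> z) (dir_deriv b \<rho> w) < e'"
    proof
      fix b
      have "uniformly_continuous_on UNIV (dir_deriv b \<rho>)"
        by (rule compact_support_uniformly_continuous[OF cD compact_cball[of 0 r]]) (simp add: D0)
      from uniformly_continuous_onE[OF this e']
      show "\<exists>d>0. \<forall>z w. dist z w < d \<longrightarrow> dist (dir_deriv b \<rho> z) (dir_deriv b \<rho> w) < e'"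
        by (metis UNIV_I)
    qed
    then obtain d where d: "\<And>b. d b > 0"
      "\<And>b z w. dist z w < d b \<Longrightarrow> dist (dir_deriv b \<rho> z) (dir_deriv b \<rho> w) < e'"
      by metis
    define d0 where "d0 = min 1 (Min (d ` Basis))"
    have d0: "d0 > 0" "d0 \<le> 1" "\<And>b. b \<in> Basis \<Longrightarrow> d0 \<le> d b"
      using d(1) by (auto simp: d0_def intro: min.coboundedI2)
    have rem: "norm (\<rho> (z + h) - \<rho> z - dir_deriv h \<rho> z) \<le> norm h * (e' * real (DIM(complex^'a)))"
      if "norm h < d0" for h z
    proof -
      have "norm (\<rho> (z + h) - \<rho> z - dir_deriv (z + h - z) \<rho> z) \<le> norm (z + h - z) * (\<Sum>b\<in>(Basis::(complex^'a) set). e')"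
      proof (rule differentiable_bound_linearization[of z "z + h" "ball z d0" \<rho> "\<lambda>x v. dir_deriv v \<rho> x" z])
        show "z + t *\<^sub>R (z + h - z) \<in> ball z d0" if "t \<in> {0..1}" for t
          using that \<open>norm h < d0\<close> mult_left_le_one_le[of "norm h" t] by (simp add: dist_norm)
        show "z \<in> ball z d0" using d0 by simp
        show "(\<rho> has_derivative (\<lambda>v. dir_deriv v \<rho> y)) (at y within ball z d0)" for y
          by (rule has_derivative_at_withinI[OF differentiable_dir_deriv[OF smooth_differentiable[OF \<rho>(1)]]])
        show "onorm ((\<lambda>v. dir_deriv v \<rho> y) - (\<lambda>v. dir_deriv v \<rho> z)) \<le> (\<Sum>b\<in>(Basis::(complex^'a) set). e')"
          if "y \<in> ball z d0" for y
        proof (rule onorm_le)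
          fix v
          have "((\<lambda>v. dir_deriv v \<rho> y) - (\<lambda>v. dir_deriv v \<rho> z)) v
              = (\<Sum>b\<in>Basis. of_real (v \<bullet> b) * (dir_deriv b \<rho> y - dir_deriv b \<rho> z))"
            unfolding fun_diff_def dir_deriv_basis[OF smooth_differentiable[OF \<rho>(1)], of v]
            by (simp add: sum_subtractf algebra_simps)
          also have "norm \<dots> \<le> (\<Sum>b\<in>(Basis::(complex^'a) set). norm v * e')"
          proof (rule sum_norm_le)
            fix b :: "complex^'a" assume b: "b \<in> Basis"
            have "dist y z < d b" using that d0(3)[OF b] by (simp add: dist_commute)
            then have "norm (dir_deriv b \<rho> y - dir_deriv b \<rho> z) \<le> e'"
              using d(2) by (force simp: dist_norm)
            then show "norm (of_real (v \<bullet> b) * (dir_deriv b \<rho> y - dir_deriv b \<rho> z)) \<le> norm v * e'"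
              unfolding norm_mult using Basis_le_norm[OF b, of v] by (intro mult_mono) auto
          qed
          finally show "norm (((\<lambda>v. dir_deriv v \<rho> y) - (\<lambda>v. dir_deriv v \<rho> z)) v) \<le> (\<Sum>b\<in>(Basis::(complex^'a) set). e') * norm v"
            by (simp add: mult.commute mult.left_commute)
        qed
      qed
      then show ?thesis by (simp add: mult.commute)
    qed
    show "\<exists>d>0. \<forall>y. norm (y - x) < d \<longrightarrow> norm (conv \<rho> f y - conv \<rho> f x - conv (dir_deriv (y - x) \<rho>) f x) \<le> e * norm (y - x)"
    proof (intro exI[of _ d0] conjI allI impI d0(1))
      fix y assume y: "norm (y - x) < d0"
      define h where "h = y - x"
      have h: "norm h < d0" "y = x + h" using y by (auto simp: h_def)
      let ?g = "\<lambda>z. (\<rho> (x - z + h) - \<rho> (x - z) - dir_deriv h \<rho> (x - z)) * f z"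
      have "conv \<rho> f y - conv \<rho> f x - conv (dir_deriv h \<rho>) f x
          = (LINT z|lborel. \<rho> (y - z) * f z - \<rho> (x - z) * f z - dir_deriv h \<rho> (x - z) * f z)"
        unfolding conv_def
        by (simp add: Bochner_Integration.integral_diff i\<rho> iD)
      also have "\<dots> = (LINT z|lborel. ?g z)"
        by (intro Bochner_Integration.integral_cong refl) (simp add: h(2) algebra_simps)
      also have "norm \<dots> \<le> (LINT z|lborel. norm h * (e' * real (DIM(complex^'a))) * (indicator (cball x (r + 1)) z * norm (f z)))"
      proof (rule order_trans[OF Bochner_Integration.integral_norm_bound integral_mono])
        have "integrable lborel ?g"
          using Bochner_Integration.integrable_diff[OF Bochner_Integration.integrable_diff[OF i\<rho>[of y] i\<rho>[of x]] iD[of h x]]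
          by (rule back_subst[of "integrable lborel"]) (auto simp: h(2) algebra_simps)
        then show "integrable lborel (\<lambda>z. norm (?g z))" by (rule integrable_norm)
        show "integrable lborel (\<lambda>z. norm h * (e' * real (DIM(complex^'a))) * (indicator (cball x (r + 1)) z * norm (f z)))"
          using intI by (rule integrable_mult_right)
        fix z
        show "norm (?g z) \<le> norm h * (e' * real (DIM(complex^'a))) * (indicator (cball x (r + 1)) z * norm (f z))"
        proof (cases "z \<in> cball x (r + 1)")
          case True
          then show ?thesis
            using mult_right_mono[OF rem[OF h(1), of "x - z"] norm_ge_zero[of "f z"]] by (simp add: norm_mult)
        next
          case False
          then have *: "norm (x - z) > r + 1" by (simp add: dist_norm)
          then have "norm (x - z + h) > r"
            using norm_triangle_ineq2[of "x - z" "- h"] h(1) d0(2) by simp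
          then show ?thesis
            using * False by (simp add: \<rho>(2) D0)
        qed
      qed
      also have "\<dots> \<le> norm h * (e' * real (DIM(complex^'a))) * I"
        unfolding integral_mult_right_zero using I(2) e' by (intro mult_left_mono) auto
      also have "\<dots> = e * norm h"
        using I(1) by (simp add: e'_def)
      finally show "norm (conv \<rho> f y - conv \<rho> f x - conv (dir_deriv (y - x) \<rho>) f x) \<le> e * norm (y - x)"
        by (simp add: h_def)
    qed
  qed
qed

lemma smooth_conv:
  assumes \<rho>: "smooth_fun \<rho>" "\<And>x. r < norm x \<Longrightarrow> \<rho> x = 0" and f: "continuous_on UNIV f"
  shows "smooth_fun (conv \<rho> f)"
proof (rule smooth_fun_coinduct)
  let ?F = "{conv \<rho> f | \<rho>. smooth_fun \<rho> \<and> (\<forall>x. r < norm x \<longrightarrow> \<rho> x = 0)}"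
  show "conv \<rho> f \<in> ?F" using \<rho> by blast
  fix g assume "g \<in> ?F"
  then obtain \<rho> where \<rho>: "g = conv \<rho> f" "smooth_fun \<rho>" "\<And>x. r < norm x \<Longrightarrow> \<rho> x = 0" by blast
  note d = conv_has_derivative[OF \<rho>(2,3) f]
  have "dir_deriv v g \<in> ?F" for v
  proof -
    have "dir_deriv v g = conv (dir_deriv v \<rho>) f"
      unfolding \<rho>(1) by (rule ext) (rule dir_deriv_eq[OF d])
    moreover have "dir_deriv v \<rho> x = 0" if "r < norm x" for x
      using dir_deriv_outside[OF compact_cball, of 0 r \<rho>] \<rho>(3) that by simp
    ultimately show ?thesis using smooth_dir_deriv[OF \<rho>(2)] by blast
  qed
  then show "(\<forall>x. g differentiable (at x)) \<and> (\<forall>v. dir_deriv v g \<in> ?F)"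
    using d \<rho>(1) unfolding differentiable_def by blast
qed

definition moll :: "nat \<Rightarrow> complex^'n::finite \<Rightarrow> real" where
  "moll m x = bump (inverse (real (Suc m))) x / (LINT y|lborel. bump (inverse (real (Suc m))) (y :: complex^'n))"

lemma bump_integral_pos:
  assumes "r > 0"
  shows "integrable lborel (bump r :: complex^'n::finite \<Rightarrow> real)" "(LINT y|lborel. bump r (y :: complex^'n)) > 0"
proof -
  show i: "integrable lborel (bump r :: complex^'n::finite \<Rightarrow> real)"
    by (rule integrable_continuous_compact[OF continuous_bump compact_cball[of 0 r]])
      (auto simp: bump_zero assms)
  have "(LINT y|lborel. bump r (y :: complex^'n)) \<noteq> 0"
  proof
    assume "(LINT y|lborel. bump r (y :: complex^'n)) = 0"
    then have ae: "AE y in lborel. bump r (y :: complex^'n) = 0"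
      using integral_nonneg_eq_0_iff_AE[OF i] by (simp add: bump_nonneg)
    have eq: "{x \<in> space lborel. \<not> bump r x = 0} = ball (0::complex^'n) r"
      using assms bump_pos[of _ r] bump_zero[of r] by (force simp: not_le[symmetric])
    from ae have "emeasure lborel (ball (0::complex^'n) r) = 0"
      by (subst (asm) AE_iff_measurable[OF _ eq]) auto
    then show False
      using content_ball_pos[OF assms, of "0::complex^'n"] by (simp add: measure_def)
  qed
  then show "(LINT y|lborel. bump r (y :: complex^'n)) > 0"
    using Bochner_Integration.integral_nonneg[where M = lborel and f = "bump r :: complex^'n \<Rightarrow> real"]
    by (simp add: bump_nonneg less_le)
qed

section \<open>Exterior derivatives and Stokes' theorem\<close>

definition smooth_form :: "'n::finite form \<Rightarrow> bool" where
  "smooth_form \<omega> \<longleftrightarrow> (\<forall>vs. smooth_fun (\<lambda>x. \<omega> x vs))"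

definition cont_form :: "'n::finite form \<Rightarrow> bool" where
  "cont_form \<omega> \<longleftrightarrow> (\<forall>vs. continuous_on UNIV (\<lambda>x. \<omega> x vs))"

definition fderiv :: "complex^'n::finite \<Rightarrow> 'n form \<Rightarrow> 'n form" where
  "fderiv b \<omega> x vs = dir_deriv b (\<lambda>y. \<omega> y vs) x"

lemma smooth_formD: "smooth_form \<omega> \<Longrightarrow> smooth_fun (\<lambda>x. \<omega> x vs)"
  by (simp add: smooth_form_def)

lemma smooth_form_cont: "smooth_form \<omega> \<Longrightarrow> cont_form \<omega>"
  by (simp add: smooth_form_def cont_form_def smooth_continuous)

lemma smooth_ewedge: "smooth_form \<omega> \<Longrightarrow> smooth_form (\<lambda>x. ewedge a (\<omega> x))"
proof -
  have "smooth_fun (\<lambda>x. ewedge a (\<omega> x) vs)" if "smooth_form \<omega>" for vs and \<omega> :: "'a form"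
    using that
  proof (induction vs arbitrary: \<omega>)
    case (Cons v vs)
    have "smooth_form (\<lambda>x ws. \<omega> x (v # ws))"
      using Cons.prems by (simp add: smooth_form_def)
    from Cons.IH[OF this] show ?case
      using smooth_formD[OF Cons.prems] by (auto intro!: smooth_diff smooth_mult)
  qed simp
  then show "smooth_form \<omega> \<Longrightarrow> smooth_form (\<lambda>x. ewedge a (\<omega> x))"
    by (simp add: smooth_form_def)
qed

lemma cont_ewedge: "cont_form \<omega> \<Longrightarrow> cont_form (\<lambda>x. ewedge a (\<omega> x))"
proof -
  have "continuous_on UNIV (\<lambda>x. ewedge a (\<omega> x) vs)" if "cont_form \<omega>" for vs and \<omega> :: "'a form"
    using that
  proof (induction vs arbitrary: \<omega>)
    case (Cons v vs)
    have "cont_form (\<lambda>x ws. \<omega> x (v # ws))"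
      using Cons.prems by (simp add: cont_form_def)
    from Cons.IH[OF this] Cons.prems show ?case
      by (auto intro!: continuous_intros simp: cont_form_def)
  qed simp
  then show "cont_form \<omega> \<Longrightarrow> cont_form (\<lambda>x. ewedge a (\<omega> x))"
    by (simp add: cont_form_def)
qed

lemma fderiv_ewedge:
  assumes "smooth_form \<omega>"
  shows "fderiv c (\<lambda>x. ewedge a (\<omega> x)) x vs = ewedge a (fderiv c \<omega> x) vs"
  using assms
proof (induction vs arbitrary: \<omega>)
  case (Cons v vs)
  have s: "smooth_form (\<lambda>x ws. \<omega> x (v # ws))"
    using Cons.prems by (simp add: smooth_form_def)
  have f: "fderiv c (\<lambda>x ws. \<omega> x (v # ws)) x = (\<lambda>ws. fderiv c \<omega> x (v # ws))"
    by (simp add: fderiv_def fun_eq_iff)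
  have "fderiv c (\<lambda>x. ewedge a (\<omega> x)) x (v # vs)
      = dir_deriv c (\<lambda>y. of_real (a \<bullet> v) * \<omega> y vs) x - dir_deriv c (\<lambda>y. ewedge a (\<lambda>ws. \<omega> y (v # ws)) vs) x"
    unfolding fderiv_def ewedge.simps
    by (intro dir_deriv_diff smooth_mult smooth_const smooth_formD[OF Cons.prems]
        smooth_formD[OF smooth_ewedge[OF s]])
  also have "\<dots> = of_real (a \<bullet> v) * fderiv c \<omega> x vs - ewedge a (\<lambda>ws. fderiv c \<omega> x (v # ws)) vs"
    using Cons.IH[OF s] f smooth_formD[OF Cons.prems]
    by (simp add: fderiv_def[of c "\<lambda>x. ewedge a (\<lambda>ws. \<omega> x (v # ws))"] dir_deriv_cmult) (simp add: fderiv_def)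
  finally show ?case by simp
qed (simp add: fderiv_def)

lemma smooth_fderiv: "smooth_form \<omega> \<Longrightarrow> smooth_form (fderiv b \<omega>)"
  unfolding smooth_form_def fderiv_def by (auto intro: smooth_dir_deriv)

text \<open>Where \<open>ext_d\<close> sums over argument positions, this sums over basis
  directions. The derivative becomes a combination of wedge products, to which the algebra of
  \<open>ewedge\<close> applies.\<close>

definition dform :: "'n::finite form \<Rightarrow> 'n form" where
  "dform \<omega> x vs = (\<Sum>b\<in>Basis. ewedge b (fderiv b \<omega> x) vs)"

text \<open>By the conventions for \<open>ext_dc\<close>, \<open>d\<^sup>c u\<close> sends \<open>v\<close> to \<open>- du (\<i> *s v)\<close>, and \<open>(\<i> *s b) \<bullet> v = - (b \<bullet> (\<i> *s v))\<close>.\<close>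

definition dcform :: "'n::finite form \<Rightarrow> 'n form" where
  "dcform \<omega> x vs = (\<Sum>b\<in>Basis. ewedge (\<i> *s b) (fderiv b \<omega> x) vs)"

lemma ext_d_eq_dform:
  fixes \<omega> :: "'n::finite form"
  assumes "smooth_form \<omega>"
  shows "ext_d \<omega> = dform \<omega>"
proof (intro ext)
  fix x :: "complex^'n" and vs :: "(complex^'n) list"
  let ?r = "\<lambda>i. take i vs @ drop (Suc i) vs"
  have "ext_d \<omega> x vs = (\<Sum>i<length vs. \<Sum>b\<in>Basis. (-1) ^ i * (of_real (b \<bullet> vs ! i) * fderiv b \<omega> x (?r i)))"
    unfolding ext_d_def form_deriv_def
    by (subst dir_deriv_basis[OF smooth_differentiable[OF smooth_formD[OF assms]]])
      (simp add: sum_distrib_left fderiv_def inner_commute)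
  also have "\<dots> = dform \<omega> x vs"
    unfolding dform_def ewedge_removal
    by (subst sum.swap) (simp add: mult.assoc)
  finally show "ext_d \<omega> x vs = dform \<omega> x vs" .
qed

lemma ext_dc_eq_dcform:
  fixes \<omega> :: "'n::finite form"
  assumes "smooth_form \<omega>"
  shows "ext_dc \<omega> = dcform \<omega>"
proof (intro ext)
  fix x :: "complex^'n" and vs :: "(complex^'n) list"
  let ?r = "\<lambda>i. take i vs @ drop (Suc i) vs"
  \<comment> \<open>With \<open>a\<close> and \<open>c\<close> the derivatives along
    \<open>v\<close> and \<open>\<i> *s v\<close>, the complex linear and antilinear parts combine
    to \<open>- c\<close> alone.\<close>
  have *: "\<i> * ((a + \<i> * c) / 2 - (a - \<i> * c) / 2) = - c" for a c
    by (simp add: field_simps)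
  have "ext_dc \<omega> x vs = (\<Sum>i<length vs. (-1) ^ i * (\<i> * (delbar_deriv (vs ! i) (\<lambda>y. \<omega> y (?r i)) x - del_deriv (vs ! i) (\<lambda>y. \<omega> y (?r i)) x)))"
    unfolding ext_dc_def delbar_def del_def form_deriv_def
    by (simp add: sum_subtractf[symmetric] sum_distrib_left algebra_simps)
  also have "\<dots> = (\<Sum>i<length vs. (-1) ^ i * (- dir_deriv (\<i> *s (vs ! i)) (\<lambda>y. \<omega> y (?r i)) x))"
    unfolding delbar_deriv_def del_deriv_def * ..
  also have "\<dots> = (\<Sum>i<length vs. \<Sum>b\<in>Basis. (-1) ^ i * (of_real ((\<i> *s b) \<bullet> vs ! i) * fderiv b \<omega> x (?r i)))"
  proof (intro sum.cong refl)
    fix i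
    have "- dir_deriv (\<i> *s (vs ! i)) (\<lambda>y. \<omega> y (?r i)) x
        = (\<Sum>b\<in>Basis. of_real ((\<i> *s b) \<bullet> vs ! i) * fderiv b \<omega> x (?r i))"
      by (subst dir_deriv_basis[OF smooth_differentiable[OF smooth_formD[OF assms]]])
        (simp add: fderiv_def imult_inner_left inner_commute sum_negf[symmetric])
    then show "(-1) ^ i * (- dir_deriv (\<i> *s (vs ! i)) (\<lambda>y. \<omega> y (?r i)) x)
        = (\<Sum>b\<in>Basis. (-1) ^ i * (of_real ((\<i> *s b) \<bullet> vs ! i) * fderiv b \<omega> x (?r i)))"
      by (simp add: sum_distrib_left)
  qed
  also have "\<dots> = dcform \<omega> x vs"
    unfolding dcform_def ewedge_removal
    by (subst sum.swap) (simp add: mult.assoc)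
  finally show "ext_dc \<omega> x vs = dcform \<omega> x vs" .
qed

lemma smooth_dcform: "smooth_form \<omega> \<Longrightarrow> smooth_form (dcform \<omega>)"
  unfolding dcform_def smooth_form_def
  by (intro allI smooth_sum smooth_formD[OF smooth_ewedge[OF smooth_fderiv]]) (simp add: smooth_form_def)

lemma smooth_dform: "smooth_form \<omega> \<Longrightarrow> smooth_form (dform \<omega>)"
  unfolding dform_def smooth_form_def
  by (intro allI smooth_sum smooth_formD[OF smooth_ewedge[OF smooth_fderiv]]) (simp add: smooth_form_def)

lemma ddc_eq: "smooth_form \<omega> \<Longrightarrow> ddc \<omega> = dform (dcform \<omega>)"
  by (simp add: ddc_def ext_dc_eq_dcform ext_d_eq_dform smooth_dcform)

lemma smooth_ddc: "smooth_form \<omega> \<Longrightarrow> smooth_form (ddc \<omega>)"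
  by (simp add: ddc_eq smooth_dform smooth_dcform)

section \<open>The product with dd^c w\<close>

definition hess :: "(complex^'n::finite \<Rightarrow> complex) \<Rightarrow> complex^'n \<Rightarrow> complex^'n \<Rightarrow> complex^'n \<Rightarrow> complex" where
  "hess w x a b = dir_deriv a (dir_deriv b w) x"

lemma hess_commute: "smooth_fun w \<Longrightarrow> hess w x a b = hess w x b a"
  unfolding hess_def by (rule dir_deriv_commute)

lemma smooth_hess: "smooth_fun w \<Longrightarrow> smooth_fun (\<lambda>x. hess w x a b)"
  unfolding hess_def by (intro smooth_dir_deriv)

text \<open>The matrix is kept as a parameter because differentiating dd^c w \<and> \<omega> puts
  third derivatives of w in the place of its Hessian.\<close>

definition levi_at :: "(complex^'n::finite \<Rightarrow> complex^'n \<Rightarrow> complex) \<Rightarrow> ((complex^'n) list \<Rightarrow> complex) \<Rightarrow> (complex^'n) list \<Rightarrow> complex" where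
  "levi_at H \<alpha> vs = (\<Sum>a\<in>Basis. \<Sum>b\<in>Basis. H a b * ewedge a (ewedge (\<i> *s b) \<alpha>) vs)"

text \<open>This is \<open>dd\<^sup>c w \<and> \<omega>\<close>.\<close>

definition levi :: "(complex^'n::finite \<Rightarrow> complex) \<Rightarrow> 'n form \<Rightarrow> 'n form" where
  "levi w \<omega> x = levi_at (hess w x) (\<omega> x)"

lemma levi_at_add: "levi_at H (\<lambda>ws. \<alpha> ws + \<beta> ws) vs = levi_at H \<alpha> vs + levi_at H \<beta> vs"
  by (simp add: levi_at_def ewedge_add[abs_def] sum.distrib distrib_left)

lemma levi_at_scale: "levi_at H (\<lambda>ws. c * \<alpha> ws) vs = c * levi_at H \<alpha> vs"
  by (simp add: levi_at_def ewedge_scale[abs_def] sum_distrib_left mult.left_commute)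

lemma levi_at_zero [simp]: "levi_at H (\<lambda>ws. 0) = (\<lambda>vs. 0)"
  by (simp add: levi_at_def[abs_def] ewedge_zero[abs_def])

lemma levi_at_sum: "levi_at H (\<lambda>ws. \<Sum>i\<in>I. f i ws) vs = (\<Sum>i\<in>I. levi_at H (f i) vs)"
  by (induction I rule: infinite_finite_induct) (auto simp: levi_at_add)

lemma levi_at_ewedge: "levi_at H (ewedge c \<alpha>) vs = ewedge c (levi_at H \<alpha>) vs"
proof -
  have "ewedge c (levi_at H \<alpha>) vs = (\<Sum>a\<in>Basis. \<Sum>b\<in>Basis. H a b * ewedge c (ewedge a (ewedge (\<i> *s b) \<alpha>)) vs)"
    unfolding levi_at_def[abs_def] by (simp add: ewedge_sum ewedge_scale)
  also have "\<dots> = levi_at H (ewedge c \<alpha>) vs"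
    unfolding levi_at_def
    by (intro sum.cong refl) (simp add: ewedge_anticommute'[of c] ewedge_minus)
  finally show ?thesis ..
qed

lemma levi_at_commute: "levi_at H (levi_at G \<alpha>) vs = levi_at G (levi_at H \<alpha>) vs"
  unfolding levi_at_def[of G "levi_at H \<alpha>"] levi_at_def[of G \<alpha>, abs_def]
  by (simp add: levi_at_sum levi_at_scale levi_at_ewedge levi_at_ewedge[abs_def])

lemma levi_commute: "levi u (levi v \<omega>) = levi v (levi u \<omega>)"
  by (intro ext) (simp add: levi_def levi_at_commute)

lemma smooth_levi:
  assumes "smooth_fun w" "smooth_form \<omega>"
  shows "smooth_form (levi w \<omega>)"
  unfolding smooth_form_def levi_def levi_at_def
  by (intro allI smooth_sum smooth_mult smooth_hess assms(1)
      smooth_formD[OF smooth_ewedge[OF smooth_ewedge[OF assms(2)]]])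

lemma cont_levi:
  assumes "smooth_fun w" "cont_form \<omega>"
  shows "cont_form (levi w \<omega>)"
proof -
  have "continuous_on UNIV (\<lambda>x. ewedge a (ewedge (\<i> *s b) (\<omega> x)) vs)" for a b vs
    using cont_ewedge[OF cont_ewedge[OF assms(2)]] by (simp add: cont_form_def)
  then show ?thesis
    unfolding cont_form_def levi_def levi_at_def
    by (intro allI continuous_on_sum continuous_on_mult smooth_continuous[OF smooth_hess[OF assms(1)]])
qed

lemma fderiv_levi:
  assumes w: "smooth_fun w" and \<omega>: "smooth_form \<omega>"
  shows "fderiv c (levi w \<omega>) x vs
    = levi_at (\<lambda>a b. dir_deriv c (\<lambda>y. hess w y a b) x) (\<omega> x) vs + levi_at (hess w x) (fderiv c \<omega> x) vs"
proof -
  note s = smooth_ewedge[OF smooth_ewedge[OF \<omega>]]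
  have *: "dir_deriv c (\<lambda>y. hess w y a b * ewedge a (ewedge (\<i> *s b) (\<omega> y)) vs) x
     = dir_deriv c (\<lambda>y. hess w y a b) x * ewedge a (ewedge (\<i> *s b) (\<omega> x)) vs
       + hess w x a b * ewedge a (ewedge (\<i> *s b) (fderiv c \<omega> x)) vs" for a b
  proof -
    have "dir_deriv c (\<lambda>y. ewedge a (ewedge (\<i> *s b) (\<omega> y)) vs) x
        = ewedge a (ewedge (\<i> *s b) (fderiv c \<omega> x)) vs"
      using fderiv_ewedge[OF smooth_ewedge[OF \<omega>], of c a "\<i> *s b" x vs]
      unfolding fderiv_ewedge[OF \<omega>, abs_def]
      by (simp add: fderiv_def[of _ "\<lambda>x. ewedge a (ewedge (\<i> *s b) (\<omega> x))"])
    then show ?thesis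
      by (simp add: dir_deriv_mult[OF smooth_hess[OF w] smooth_formD[OF s]])
  qed
  show ?thesis
    unfolding fderiv_def[of c "levi w \<omega>"] levi_def levi_at_def
    by (subst dir_deriv_sum, intro smooth_sum smooth_mult smooth_hess w smooth_formD[OF s],
        subst dir_deriv_sum, intro smooth_mult smooth_hess w smooth_formD[OF s])
      (simp add: * sum.distrib)
qed

lemma sum_antisymmetric:
  fixes f :: "'a \<Rightarrow> 'a \<Rightarrow> complex"
  assumes "\<And>a b. f a b = - f b a"
  shows "(\<Sum>a\<in>I. \<Sum>b\<in>I. f a b) = 0"
proof -
  have "(\<Sum>a\<in>I. \<Sum>b\<in>I. f a b) = - (\<Sum>a\<in>I. \<Sum>b\<in>I. f b a)"
    by (subst assms) (simp add: sum_negf)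
  also have "(\<Sum>a\<in>I. \<Sum>b\<in>I. f b a) = (\<Sum>a\<in>I. \<Sum>b\<in>I. f a b)"
    by (rule sum.swap)
  finally show ?thesis by simp
qed

text \<open>The form dd^c w is d-closed: its third derivatives are symmetric in \<open>c\<close> and
  \<open>a\<close>, whereas the wedge of the corresponding one-forms is antisymmetric.\<close>

lemma dform_levi:
  assumes w: "smooth_fun w" and \<omega>: "smooth_form \<omega>"
  shows "dform (levi w \<omega>) = levi w (dform \<omega>)"
proof (intro ext)
  fix x vs
  let ?h = "\<lambda>c a b. dir_deriv c (\<lambda>y. hess w y a b) x"
  have sym: "?h c a b = ?h a c b" for a b c
    unfolding hess_def using dir_deriv_commute[OF smooth_dir_deriv[OF w]] by simp
  have "dform (levi w \<omega>) x vs = (\<Sum>c\<in>Basis. ewedge c (levi_at (?h c) (\<omega> x)) vs)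
      + (\<Sum>c\<in>Basis. levi_at (hess w x) (ewedge c (fderiv c \<omega> x)) vs)"
    unfolding dform_def fderiv_levi[OF assms, abs_def]
    by (simp add: ewedge_add sum.distrib levi_at_ewedge)
  also have "(\<Sum>c\<in>Basis. ewedge c (levi_at (?h c) (\<omega> x)) vs)
      = (\<Sum>c\<in>Basis. \<Sum>a\<in>Basis. \<Sum>b\<in>Basis. ?h c a b * ewedge c (ewedge a (ewedge (\<i> *s b) (\<omega> x))) vs)"
    unfolding levi_at_def[abs_def] by (simp add: ewedge_sum ewedge_scale)
  also have "\<dots> = 0"
  proof (rule sum_antisymmetric)
    fix c a
    show "(\<Sum>b\<in>Basis. ?h c a b * ewedge c (ewedge a (ewedge (\<i> *s b) (\<omega> x))) vs)
        = - (\<Sum>b\<in>Basis. ?h a c b * ewedge a (ewedge c (ewedge (\<i> *s b) (\<omega> x))) vs)"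
      unfolding sum_negf[symmetric]
      by (intro sum.cong refl) (simp add: sym[of c a] ewedge_anticommute[of c a])
  qed
  also have "(\<Sum>c\<in>Basis. levi_at (hess w x) (ewedge c (fderiv c \<omega> x)) vs) = levi w (dform \<omega>) x vs"
    unfolding levi_def dform_def[abs_def] by (simp add: levi_at_sum)
  finally show "dform (levi w \<omega>) x vs = levi w (dform \<omega>) x vs" by simp
qed

text \<open>The form dd^c w is also d^c-closed. The symmetry is now that of \<open>c\<close> and
  \<open>b\<close>, the two directions that enter the wedge through \<open>\<i> *s c\<close> and
  \<open>\<i> *s b\<close>.\<close>

lemma dcform_levi:
  assumes w: "smooth_fun w" and \<omega>: "smooth_form \<omega>"
  shows "dcform (levi w \<omega>) = levi w (dcform \<omega>)"
proof (intro ext)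
  fix x vs
  let ?h = "\<lambda>c a b. dir_deriv c (\<lambda>y. hess w y a b) x"
  have com: "dir_deriv a (dir_deriv b f) = dir_deriv b (dir_deriv a f)" if "smooth_fun f" for a b f
    by (rule ext) (rule dir_deriv_commute[OF that])
  have sym: "?h c a b = ?h b a c" for a b c
    unfolding hess_def com[OF w, of a b] com[OF smooth_dir_deriv[OF w, of a], of c b] com[OF w, of c a] ..
  have "dcform (levi w \<omega>) x vs = (\<Sum>c\<in>Basis. ewedge (\<i> *s c) (levi_at (?h c) (\<omega> x)) vs)
      + (\<Sum>c\<in>Basis. levi_at (hess w x) (ewedge (\<i> *s c) (fderiv c \<omega> x)) vs)"
    unfolding dcform_def fderiv_levi[OF assms, abs_def]
    by (simp add: ewedge_add sum.distrib levi_at_ewedge)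
  also have "(\<Sum>c\<in>Basis. ewedge (\<i> *s c) (levi_at (?h c) (\<omega> x)) vs)
      = (\<Sum>c\<in>Basis. \<Sum>a\<in>Basis. \<Sum>b\<in>Basis. ?h c a b * ewedge (\<i> *s c) (ewedge a (ewedge (\<i> *s b) (\<omega> x))) vs)"
    unfolding levi_at_def[abs_def] by (simp add: ewedge_sum ewedge_scale)
  also have "\<dots> = (\<Sum>c\<in>Basis. \<Sum>b\<in>Basis. \<Sum>a\<in>Basis. ?h c a b * ewedge (\<i> *s c) (ewedge a (ewedge (\<i> *s b) (\<omega> x))) vs)"
    by (intro sum.cong refl sum.swap)
  also have "\<dots> = 0"
  proof (rule sum_antisymmetric)
    fix c b
    show "(\<Sum>a\<in>Basis. ?h c a b * ewedge (\<i> *s c) (ewedge a (ewedge (\<i> *s b) (\<omega> x))) vs)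
        = - (\<Sum>a\<in>Basis. ?h b a c * ewedge (\<i> *s b) (ewedge a (ewedge (\<i> *s c) (\<omega> x))) vs)"
      unfolding sum_negf[symmetric]
    proof (intro sum.cong refl)
      fix a
      have "ewedge (\<i> *s c) (ewedge a (ewedge (\<i> *s b) (\<omega> x))) vs
          = - ewedge (\<i> *s b) (ewedge a (ewedge (\<i> *s c) (\<omega> x))) vs"
        unfolding ewedge_anticommute[of "\<i> *s c" a] ewedge_anticommute'[of "\<i> *s c" "\<i> *s b"]
          ewedge_minus ewedge_anticommute[of a "\<i> *s b"] by simp
      then show "?h c a b * ewedge (\<i> *s c) (ewedge a (ewedge (\<i> *s b) (\<omega> x))) vs
          = - (?h b a c * ewedge (\<i> *s b) (ewedge a (ewedge (\<i> *s c) (\<omega> x))) vs)"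
        by (simp add: sym[of c a b])
    qed
  qed
  also have "(\<Sum>c\<in>Basis. levi_at (hess w x) (ewedge (\<i> *s c) (fderiv c \<omega> x)) vs) = levi w (dcform \<omega>) x vs"
    unfolding levi_def dcform_def[abs_def] by (simp add: levi_at_sum)
  finally show "dcform (levi w \<omega>) x vs = levi w (dcform \<omega>) x vs" by simp
qed

definition dwedge :: "(complex^'n::finite \<Rightarrow> complex) \<Rightarrow> 'n form \<Rightarrow> 'n form" where
  "dwedge u \<omega> x vs = (\<Sum>a\<in>Basis. dir_deriv a u x * ewedge a (\<omega> x) vs)"

lemma smooth_dwedge: "smooth_fun u \<Longrightarrow> smooth_form \<omega> \<Longrightarrow> smooth_form (dwedge u \<omega>)"
  unfolding smooth_form_def dwedge_def
  by (intro allI smooth_sum smooth_mult smooth_dir_deriv smooth_formD[OF smooth_ewedge])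
    (simp_all add: smooth_form_def)

lemma smooth_form_mult: "smooth_fun u \<Longrightarrow> smooth_form \<omega> \<Longrightarrow> smooth_form (\<lambda>x vs. u x * \<omega> x vs)"
  unfolding smooth_form_def by (auto intro: smooth_mult)

text \<open>Two product rules: d (u d^c \<omega>) = du \<and> d^c \<omega> + u dd^c \<omega> and d^c
  (du \<and> \<omega>) = - du \<and> d^c \<omega> - dd^c u \<and> \<omega>. Adding them cancels the
  mixed term.\<close>

lemma mult_ddc_eq:
  assumes u: "smooth_fun u" and \<omega>: "smooth_form \<omega>"
  shows "u x * ddc \<omega> x vs
    = levi u \<omega> x vs + dform (\<lambda>y ws. u y * dcform \<omega> y ws) x vs + dcform (dwedge u \<omega>) x vs"
proof -
  let ?Q = "\<Sum>a\<in>Basis. dir_deriv a u x * ewedge a (dcform \<omega> x) vs"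
  have "fderiv a (\<lambda>y ws. u y * dcform \<omega> y ws) x
      = (\<lambda>ws. u x * fderiv a (dcform \<omega>) x ws + dir_deriv a u x * dcform \<omega> x ws)" for a
    unfolding fderiv_def using dir_deriv_mult[OF u smooth_formD[OF smooth_dcform[OF \<omega>]]] by auto
  then have 1: "dform (\<lambda>y ws. u y * dcform \<omega> y ws) x vs = u x * ddc \<omega> x vs + ?Q"
    unfolding ddc_eq[OF \<omega>] dform_def
    by (simp add: ewedge_add ewedge_scale sum.distrib sum_distrib_left)
  have "fderiv b (dwedge u \<omega>) x
      = (\<lambda>ws. \<Sum>a\<in>Basis. dir_deriv a u x * ewedge a (fderiv b \<omega> x) ws + hess u x b a * ewedge a (\<omega> x) ws)" for b
  proof
    fix ws
    have "dir_deriv b (\<lambda>y. ewedge a (\<omega> y) ws) x = ewedge a (fderiv b \<omega> x) ws" for a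
      using fderiv_ewedge[OF \<omega>, of b a x ws] by (simp add: fderiv_def[of b "\<lambda>x. ewedge a (\<omega> x)"])
    then show "fderiv b (dwedge u \<omega>) x ws
      = (\<Sum>a\<in>Basis. dir_deriv a u x * ewedge a (fderiv b \<omega> x) ws + hess u x b a * ewedge a (\<omega> x) ws)"
      unfolding fderiv_def[of b "dwedge u \<omega>"] dwedge_def hess_def
      by (simp add: dir_deriv_sum dir_deriv_mult smooth_mult smooth_dir_deriv u smooth_formD[OF smooth_ewedge[OF \<omega>]])
  qed
  then have "dcform (dwedge u \<omega>) x vs = (\<Sum>b\<in>Basis. \<Sum>a\<in>Basis.
      dir_deriv a u x * ewedge (\<i> *s b) (ewedge a (fderiv b \<omega> x)) vs + hess u x b a * ewedge (\<i> *s b) (ewedge a (\<omega> x)) vs)"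
    unfolding dcform_def by (simp add: ewedge_sum ewedge_add ewedge_scale)
  also have "\<dots> = (\<Sum>b\<in>Basis. \<Sum>a\<in>Basis.
      - (dir_deriv a u x * ewedge a (ewedge (\<i> *s b) (fderiv b \<omega> x)) vs) - hess u x a b * ewedge a (ewedge (\<i> *s b) (\<omega> x)) vs)"
    by (intro sum.cong refl) (simp add: ewedge_anticommute[of "\<i> *s _"] hess_commute[OF u])
  also have "\<dots> = (\<Sum>a\<in>Basis. \<Sum>b\<in>Basis.
      - (dir_deriv a u x * ewedge a (ewedge (\<i> *s b) (fderiv b \<omega> x)) vs) - hess u x a b * ewedge a (ewedge (\<i> *s b) (\<omega> x)) vs)"
    by (rule sum.swap)
  also have "\<dots> = - ?Q - levi u \<omega> x vs"
    unfolding levi_def levi_at_def dcform_def[abs_def]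
    by (simp add: sum_subtractf sum_negf sum_distrib_left ewedge_sum)
  finally show ?thesis using 1 by simp
qed

section \<open>Products of several factors and integration by parts\<close>

definition levis :: "(complex^'n::finite \<Rightarrow> complex) list \<Rightarrow> 'n form \<Rightarrow> 'n form" where
  "levis us \<omega> = foldr levi us \<omega>"

lemma levis_simps [simp]:
  "levis [] \<omega> = \<omega>" "levis (u # us) \<omega> = levi u (levis us \<omega>)" "levis (us @ ws) \<omega> = levis us (levis ws \<omega>)"
  by (auto simp: levis_def)

lemma levis_add: "levis us (\<lambda>x vs. \<omega> x vs + \<eta> x vs) = (\<lambda>x vs. levis us \<omega> x vs + levis us \<eta> x vs)"
  by (induction us) (auto simp: levi_def levi_at_add intro!: ext)

lemma levis_scale: "levis us (\<lambda>x vs. c x * \<omega> x vs) = (\<lambda>x vs. c x * levis us \<omega> x vs)"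
  by (induction us) (auto simp: levi_def levi_at_scale intro!: ext)

lemma levis_zero: "\<omega> x = (\<lambda>_. 0) \<Longrightarrow> levis us \<omega> x = (\<lambda>_. 0)"
  by (induction us) (auto simp: levi_def)

lemma levis_cong_mset: "mset us = mset ws \<Longrightarrow> levis us = levis ws"
  unfolding levis_def foldr_conv_fold fun_eq_iff
  using fold_multiset_equiv[of "rev us" levi "rev ws"] by (auto simp: fun_eq_iff levi_commute)

lemma smooth_levis: "(\<And>u. u \<in> set us \<Longrightarrow> smooth_fun u) \<Longrightarrow> smooth_form \<omega> \<Longrightarrow> smooth_form (levis us \<omega>)"
  by (induction us) (auto intro: smooth_levi)

lemma cont_levis: "(\<And>u. u \<in> set us \<Longrightarrow> smooth_fun u) \<Longrightarrow> cont_form \<omega> \<Longrightarrow> cont_form (levis us \<omega>)"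
  by (induction us) (auto intro: cont_levi)

lemma dform_levis:
  "(\<And>u. u \<in> set us \<Longrightarrow> smooth_fun u) \<Longrightarrow> smooth_form \<omega> \<Longrightarrow> dform (levis us \<omega>) = levis us (dform \<omega>)"
  by (induction us) (auto simp: dform_levi smooth_levis)

lemma dcform_levis:
  "(\<And>u. u \<in> set us \<Longrightarrow> smooth_fun u) \<Longrightarrow> smooth_form \<omega> \<Longrightarrow> dcform (levis us \<omega>) = levis us (dcform \<omega>)"
  by (induction us) (auto simp: dcform_levi smooth_levis)

lemma integrable_form:
  assumes "cont_form \<omega>" "compact K" "\<And>x. x \<notin> K \<Longrightarrow> \<omega> x = (\<lambda>_. 0)"
  shows "integrable lborel (\<lambda>x. \<omega> x vs)"
  using assms by (intro integrable_continuous_compact[of _ K]) (auto simp: cont_form_def)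

lemma fderiv_outside:
  assumes "compact K" "\<And>x. x \<notin> K \<Longrightarrow> \<omega> x = (\<lambda>_. 0)" "x \<notin> K"
  shows "fderiv b \<omega> x = (\<lambda>_. 0)"
  unfolding fderiv_def using assms by (intro ext dir_deriv_outside[of K]) auto

lemma integral_fderiv_zero:
  assumes "smooth_form \<omega>" "compact K" "\<And>x. x \<notin> K \<Longrightarrow> \<omega> x = (\<lambda>_. 0)"
  shows "integrable lborel (\<lambda>x. ewedge a (fderiv b \<omega> x) vs)" "(LINT x|lborel. ewedge a (fderiv b \<omega> x) vs) = 0"
proof -
  have e: "ewedge a (fderiv b \<omega> x) vs = dir_deriv b (\<lambda>y. ewedge a (\<omega> y) vs) x" for x
    using fderiv_ewedge[OF assms(1), of b a x vs] by (simp add: fderiv_def[of b "\<lambda>x. ewedge a (\<omega> x)"])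
  have z: "ewedge a (\<omega> x) vs = 0" if "x \<notin> K" for x
    using assms(3)[OF that] by simp
  note s = smooth_formD[OF smooth_ewedge[OF assms(1)]]
  show "integrable lborel (\<lambda>x. ewedge a (fderiv b \<omega> x) vs)"
    unfolding e
    by (rule integrable_continuous_compact[OF smooth_continuous[OF smooth_dir_deriv[OF s]] assms(2)])
      (rule dir_deriv_outside[OF assms(2) z])
  show "(LINT x|lborel. ewedge a (fderiv b \<omega> x) vs) = 0"
    unfolding e by (rule integral_dir_deriv_zero[OF s assms(2) z])
qed

lemma integral_dform_zero:
  assumes "smooth_form \<omega>" "compact K" "\<And>x. x \<notin> K \<Longrightarrow> \<omega> x = (\<lambda>_. 0)"
  shows "integrable lborel (\<lambda>x. dform \<omega> x vs)" "(LINT x|lborel. dform \<omega> x vs) = 0"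
    "integrable lborel (\<lambda>x. dcform \<omega> x vs)" "(LINT x|lborel. dcform \<omega> x vs) = 0"
  unfolding dform_def dcform_def
  by (auto simp: integral_fderiv_zero[OF assms] Bochner_Integration.integral_sum)

text \<open>Stokes: the form \<open>u dd\<^sup>c \<omega> - dd\<^sup>c u \<and> \<omega>\<close> is a sum of a \<open>d\<close>-exact and a \<open>d\<^sup>c\<close>-exact form.\<close>

lemma integral_levis_ddc:
  assumes us: "\<And>u. u \<in> set us \<Longrightarrow> smooth_fun u" and u: "smooth_fun u" and \<omega>: "smooth_form \<omega>"
    and K: "compact K" "\<And>x. x \<notin> K \<Longrightarrow> \<omega> x = (\<lambda>_. 0)"
  shows "(LINT x|lborel. levis us (\<lambda>x vs. u x * ddc \<omega> x vs) x vs) = (LINT x|lborel. levis us (levi u \<omega>) x vs)"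
proof -
  let ?A = "\<lambda>y ws. u y * dcform \<omega> y ws" and ?B = "dwedge u \<omega>"
  have sA: "smooth_form ?A" by (intro smooth_form_mult smooth_dcform u \<omega>)
  have sB: "smooth_form ?B" by (intro smooth_dwedge u \<omega>)
  have zA: "?A x = (\<lambda>_. 0)" if "x \<notin> K" for x
    using fderiv_outside[OF K that] by (simp add: dcform_def)
  have zB: "?B x = (\<lambda>_. 0)" if "x \<notin> K" for x
    using K(2)[OF that] by (simp add: dwedge_def[abs_def])
  have zW: "levi u \<omega> x = (\<lambda>_. 0)" if "x \<notin> K" for x
    using K(2)[OF that] by (simp add: levi_def)
  have "(\<lambda>x vs. u x * ddc \<omega> x vs) = (\<lambda>x vs. levi u \<omega> x vs + dform ?A x vs + dcform ?B x vs)"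
    by (intro ext) (rule mult_ddc_eq[OF u \<omega>])
  then have eq: "levis us (\<lambda>x vs. u x * ddc \<omega> x vs) x vs
      = levis us (levi u \<omega>) x vs + dform (levis us ?A) x vs + dcform (levis us ?B) x vs" for x
    by (simp add: levis_add dform_levis[OF us sA] dcform_levis[OF us sB])
  have "integrable lborel (\<lambda>x. levis us (levi u \<omega>) x vs)"
    by (rule integrable_form[OF smooth_form_cont[OF smooth_levis[OF us smooth_levi[OF u \<omega>]]] K(1)])
      (auto intro: levis_zero zW)
  then show ?thesis
    unfolding eq
    using integral_dform_zero[OF smooth_levis[OF us sA] K(1) levis_zero[OF zA]]
      integral_dform_zero[OF smooth_levis[OF us sB] K(1) levis_zero[OF zB]]
    by simp
qed

lemma alternating_fderiv:
  assumes "\<And>x. alternating d (\<omega> x)" "smooth_form \<omega>"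
  shows "alternating d (fderiv b \<omega> x)"
  unfolding alternating_def
proof (intro conjI allI impI)
  fix vs :: "(complex ^ 'a) list" assume "length vs \<noteq> d"
  then have "(\<lambda>y. \<omega> y vs) = (\<lambda>y. 0)" using alternating_length[OF assms(1)] by auto
  then show "fderiv b \<omega> x vs = 0" by (simp add: fderiv_def)
next
  fix vs :: "(complex ^ 'a) list" assume "\<not> distinct vs"
  then have "(\<lambda>y. \<omega> y vs) = (\<lambda>y. 0)" using alternating_not_distinct[OF assms(1)] by auto
  then show "fderiv b \<omega> x vs = 0" by (simp add: fderiv_def)
next
  fix us ws :: "(complex ^ 'a) list" assume "length us + length ws + 1 = d"
  note l = alternating_linear[OF assms(1) this]
  show "linear (\<lambda>v. fderiv b \<omega> x (us @ v # ws))"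
  proof (rule linearI)
    fix v w and r :: real
    show "fderiv b \<omega> x (us @ (v + w) # ws) = fderiv b \<omega> x (us @ v # ws) + fderiv b \<omega> x (us @ w # ws)"
      unfolding fderiv_def linear_add[OF l]
      by (rule dir_deriv_add) (intro smooth_formD assms)+
    show "fderiv b \<omega> x (us @ (r *\<^sub>R v) # ws) = r *\<^sub>R fderiv b \<omega> x (us @ v # ws)"
      unfolding fderiv_def linear_scale[OF l] scaleR_conv_of_real[where 'a=complex]
      by (rule dir_deriv_cmult) (intro smooth_formD assms)
  qed
qed

lemma alternating_dform:
  assumes "\<And>x. alternating d (\<omega> x)" "smooth_form \<omega>"
  shows "alternating (Suc d) (dform \<omega> x)" "alternating (Suc d) (dcform \<omega> x)"
  unfolding dform_def[abs_def] dcform_def[abs_def]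
  by (auto intro!: alternating_sum alternating_ewedge alternating_fderiv assms)

lemma test_formsD:
  assumes "\<omega> \<in> test_forms d"
  shows "smooth_form \<omega>" "\<omega> \<in> Cc_forms d"
  using assms by (auto simp: test_forms_def smooth_form_def)

lemma Cc_formsD:
  assumes "\<omega> \<in> Cc_forms d"
  shows "\<And>x. alternating d (\<omega> x)" "cont_form \<omega>"
    and "\<exists>R>0. \<forall>x. x \<notin> cball 0 R \<longrightarrow> \<omega> x = (\<lambda>_. 0)"
proof -
  show "\<And>x. alternating d (\<omega> x)" "cont_form \<omega>"
    using assms by (auto simp: Cc_forms_def cont_form_def)
  obtain K where K: "compact K" "\<And>x. x \<notin> K \<Longrightarrow> \<omega> x = (\<lambda>_. 0)"
    using assms by (auto simp: Cc_forms_def)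
  obtain R where "K \<subseteq> cball 0 R" using compact_subset_cball_0[OF K(1)] .
  then have "\<forall>x. x \<notin> cball 0 (max R 1) \<longrightarrow> \<omega> x = (\<lambda>_. 0)"
    using K(2) by force
  then show "\<exists>R>0. \<forall>x. x \<notin> cball 0 R \<longrightarrow> \<omega> x = (\<lambda>_. 0)"
    by (intro exI[of _ "max R 1"]) auto
qed

lemma Cc_formsI:
  assumes "\<And>x. alternating d (\<omega> x)" "cont_form \<omega>" "\<And>x. x \<notin> cball 0 R \<Longrightarrow> \<omega> x = (\<lambda>_. 0)"
  shows "\<omega> \<in> Cc_forms d"
  unfolding Cc_forms_def
proof (intro CollectI conjI allI)
  show "alternating d (\<omega> x)" for x by (rule assms(1))
  show "continuous_on UNIV (\<lambda>x. \<omega> x vs)" for vs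
    using assms(2) by (simp add: cont_form_def)
  show "\<exists>K. compact K \<and> (\<forall>x. x \<notin> K \<longrightarrow> \<omega> x = (\<lambda>_. 0))"
    using assms(3) by (intro exI[of _ "cball 0 R"]) simp
qed

lemma ddc_outside:
  assumes "smooth_form \<omega>" "compact K" "\<And>x. x \<notin> K \<Longrightarrow> \<omega> x = (\<lambda>_. 0)" "x \<notin> K"
  shows "ddc \<omega> x = (\<lambda>_. 0)"
proof -
  have "dcform \<omega> x = (\<lambda>_. 0)" if "x \<notin> K" for x
    using fderiv_outside[OF assms(2,3) that] by (simp add: dcform_def[abs_def])
  from fderiv_outside[OF assms(2) this assms(4)] show ?thesis
    by (simp add: ddc_eq[OF assms(1)] dform_def[abs_def])
qed

text \<open>Functionals are zero by convention off \<open>Cc_forms\<close>. Membership guarantees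
  that evaluating a current on \<open>u dd^c \<phi>\<close>, with \<open>u\<close> only continuous,
  is meaningful in \<open>ddc_wedge\<close>.\<close>

lemma mult_ddc_in_Cc_forms:
  assumes "\<omega> \<in> test_forms d" "continuous_on UNIV u"
  shows "(\<lambda>x vs. u x * ddc \<omega> x vs) \<in> Cc_forms (d + 2)"
proof -
  note s = test_formsD(1)[OF assms(1)] and C = Cc_formsD[OF test_formsD(2)[OF assms(1)]]
  obtain R where R: "\<And>x. x \<notin> cball 0 R \<Longrightarrow> \<omega> x = (\<lambda>_. 0)" using C(3) by blast
  show ?thesis
  proof (rule Cc_formsI[of _ _ R])
    have "alternating (Suc (Suc d)) (ddc \<omega> x)" for x
      unfolding ddc_eq[OF s] by (intro alternating_dform smooth_dcform s C(1))
    then show "alternating (d + 2) (\<lambda>vs. u x * ddc \<omega> x vs)" for x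
      by (simp add: alternating_scale)
    show "cont_form (\<lambda>x vs. u x * ddc \<omega> x vs)"
      using smooth_form_cont[OF smooth_ddc[OF s]] assms(2)
      unfolding cont_form_def by (auto intro!: continuous_intros)
    show "(\<lambda>vs. u x * ddc \<omega> x vs) = (\<lambda>_. 0)" if "x \<notin> cball 0 R" for x
      using ddc_outside[OF s compact_cball R that] by simp
  qed
qed

section \<open>Mollification and currents of order zero\<close>

lemma moll_nonneg: "moll m x \<ge> 0"
  unfolding moll_def by (intro divide_nonneg_nonneg bump_nonneg less_imp_le bump_integral_pos(2)) simp

lemma moll_outside: "inverse (real (Suc m)) < norm x \<Longrightarrow> moll m x = 0"
  by (simp add: moll_def bump_zero)

lemma smooth_moll: "smooth_fun (\<lambda>x::complex^'n::finite. of_real (moll m x))"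
  using smooth_mult[OF smooth_bump smooth_const[of "of_real (1 / (LINT y|lborel. bump (inverse (real (Suc m))) (y :: complex^'n)))"]]
  by (simp add: moll_def)

lemma continuous_moll: "continuous_on UNIV (moll m :: complex^'n::finite \<Rightarrow> real)"
  using continuous_on_Re[OF smooth_continuous[OF smooth_moll[of m]]] by simp

lemma moll_integral:
  "integrable lborel (moll m :: complex^'n::finite \<Rightarrow> real)" "(LINT y|lborel. moll m (y :: complex^'n)) = 1"
proof -
  have "inverse (real (Suc m)) > 0" by simp
  note b = bump_integral_pos[OF this, where 'n='n]
  show "integrable lborel (moll m :: complex^'n \<Rightarrow> real)"
    unfolding moll_def[abs_def] using b(1) by simp
  show "(LINT y|lborel. moll m (y :: complex^'n)) = 1"
    unfolding moll_def using b(2) by simp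
qed

definition mollify :: "nat \<Rightarrow> (complex^'n::finite \<Rightarrow> complex) \<Rightarrow> complex^'n \<Rightarrow> complex" where
  "mollify m f = conv (\<lambda>x. of_real (moll m x)) f"

lemma smooth_mollify: "continuous_on UNIV f \<Longrightarrow> smooth_fun (mollify m f)"
  unfolding mollify_def
  by (rule smooth_conv[where r = "inverse (real (Suc m))", OF smooth_moll]) (auto simp: moll_outside)

lemma mollify_integrable:
  fixes f :: "complex^'n::finite \<Rightarrow> complex"
  assumes "continuous_on UNIV f"
  shows "integrable lborel (\<lambda>y. of_real (moll m y) * f (x - y))"
proof (rule integrable_continuous_compact[of _ "cball 0 (inverse (real (Suc m)))"])
  show "continuous_on UNIV (\<lambda>y. of_real (moll m y) * f (x - y))"
    by (intro continuous_intros continuous_moll continuous_on_compose2[OF assms]) auto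
qed (auto simp: moll_outside)

lemma mollify_eq:
  assumes "continuous_on UNIV f"
  shows "mollify m f x = (LINT y|lborel. of_real (moll m y) * f (x - y))"
  unfolding mollify_def
  by (rule conv_altdef) (use borel_measurable_continuous_onI[OF assms] in \<open>auto simp: smooth_measurable[OF smooth_moll]\<close>)

lemma mollify_const: "(LINT y|lborel. of_real (moll m (y::complex^'n::finite)) * c) = (c :: complex)"
  using moll_integral[where 'n='n, of m] by simp

text \<open>The mollifier is a probability density carried by the ball of radius
  \<open>inverse (real (Suc m))\<close>, and an average of values within \<open>e\<close> of
  \<open>f x\<close> stays within \<open>e\<close>.\<close>

lemma mollify_close:
  assumes "continuous_on UNIV f" "\<And>y. dist x y \<le> inverse (real (Suc m)) \<Longrightarrow> norm (f x - f y) \<le> e"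
  shows "norm (mollify m f x - f x) \<le> e"
proof -
  have i2: "integrable lborel (\<lambda>y::complex^'a. of_real (moll m y) * f x)"
    using moll_integral(1)[where 'n='a, of m] by simp
  have "mollify m f x - f x = (LINT y|lborel. of_real (moll m y) * f (x - y)) - (LINT y|lborel. of_real (moll m (y::complex^'a)) * f x)"
    unfolding mollify_eq[OF assms(1)] mollify_const ..
  also have "\<dots> = (LINT y|lborel. of_real (moll m y) * f (x - y) - of_real (moll m y) * f x)"
    by (rule Bochner_Integration.integral_diff[symmetric, OF mollify_integrable[OF assms(1)] i2])
  also have "norm \<dots> \<le> (LINT y|lborel. moll m (y::complex^'a) * e)"
  proof (rule order_trans[OF Bochner_Integration.integral_norm_bound integral_mono])
    show "integrable lborel (\<lambda>y. norm (of_real (moll m y) * f (x - y) - of_real (moll m y) * f x))"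
      by (intro integrable_norm Bochner_Integration.integrable_diff mollify_integrable assms(1) i2)
    show "integrable lborel (\<lambda>y::complex^'a. moll m y * e)"
      using moll_integral(1)[where 'n='a, of m] by simp
    fix y :: "complex^'a"
    show "norm (of_real (moll m y) * f (x - y) - of_real (moll m y) * f x) \<le> moll m y * e"
    proof (cases "norm y \<le> inverse (real (Suc m))")
      case True
      have "norm (of_real (moll m y) * f (x - y) - of_real (moll m y) * f x) = moll m y * norm (f x - f (x - y))"
        by (simp add: right_diff_distrib[symmetric] norm_mult moll_nonneg norm_minus_commute)
      also have "\<dots> \<le> moll m y * e"
        by (intro mult_left_mono assms(2) moll_nonneg) (use True in \<open>simp add: dist_norm\<close>)
      finally show ?thesis .
    qed (simp add: moll_outside)
  qed
  also have "\<dots> = e" using moll_integral[where 'n='a, of m] by simp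
  finally show ?thesis .
qed

text \<open>All mollifiers live in the unit ball. The radius \<open>R + 1\<close> serves every
  \<open>m\<close>, so the mollified forms share one compact support and one continuity constant of
  a current applies to all of them.\<close>

lemma mollify_outside:
  assumes "continuous_on UNIV f" "\<And>x. x \<notin> cball 0 R \<Longrightarrow> f x = 0" "x \<notin> cball 0 (R + 1)"
  shows "mollify m f x = 0"
proof -
  have 0: "f y = 0" if "dist x y \<le> 1" for y
  proof (rule assms(2))
    show "y \<notin> cball 0 R"
      using assms(3) that norm_triangle_ineq2[of x y] by (simp add: dist_norm)
  qed
  have i: "inverse (real (Suc m)) \<le> 1" by (simp add: field_simps)
  have "norm (mollify m f x - f x) \<le> 0"
    by (rule mollify_close[OF assms(1)]) (use 0 i in force)
  then show ?thesis using 0[of x] by simp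
qed

lemma mollify_add:
  assumes "continuous_on UNIV f" "continuous_on UNIV g"
  shows "mollify m (\<lambda>x. f x + g x) x = mollify m f x + mollify m g x"
  using mollify_integrable[OF assms(1)] mollify_integrable[OF assms(2)]
  by (simp add: mollify_eq assms continuous_on_add distrib_left)

lemma mollify_diff:
  assumes "continuous_on UNIV f" "continuous_on UNIV g"
  shows "mollify m (\<lambda>x. f x - g x) x = mollify m f x - mollify m g x"
  using mollify_integrable[OF assms(1)] mollify_integrable[OF assms(2)]
  by (simp add: mollify_eq assms continuous_on_diff right_diff_distrib)

lemma mollify_cmult:
  assumes "continuous_on UNIV f"
  shows "mollify m (\<lambda>x. c * f x) x = c * mollify m f x"
  by (simp add: mollify_eq assms continuous_on_mult_left mult.left_commute[of _ c])

definition mollify_form :: "nat \<Rightarrow> 'n::finite form \<Rightarrow> 'n form" where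
  "mollify_form m \<omega> x vs = mollify m (\<lambda>y. \<omega> y vs) x"

lemma alternating_mollify:
  assumes "\<And>x. alternating d (\<omega> x)" "cont_form \<omega>"
  shows "alternating d (mollify_form m \<omega> x)"
  unfolding alternating_def
proof (intro conjI allI impI)
  note c = assms(2)[unfolded cont_form_def, rule_format]
  have 0: "mollify m (\<lambda>y. 0) x = 0" by (simp add: mollify_eq)
  fix vs :: "(complex ^ 'a) list"
  show "length vs \<noteq> d \<Longrightarrow> mollify_form m \<omega> x vs = 0"
    using alternating_length[OF assms(1)] 0 by (simp add: mollify_form_def)
  show "\<not> distinct vs \<Longrightarrow> mollify_form m \<omega> x vs = 0"
    using alternating_not_distinct[OF assms(1)] 0 by (simp add: mollify_form_def)
  fix us ws :: "(complex ^ 'a) list" assume "length us + length ws + 1 = d"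
  note l = alternating_linear[OF assms(1) this]
  show "linear (\<lambda>v. mollify_form m \<omega> x (us @ v # ws))"
    unfolding mollify_form_def
    by (rule linearI)
      (simp_all add: linear_add[OF l] linear_scale[OF l] scaleR_conv_of_real[where 'a=complex] mollify_add mollify_cmult c)
qed

lemma mollify_form_test:
  assumes "\<omega> \<in> Cc_forms d" "\<And>x. x \<notin> cball 0 R \<Longrightarrow> \<omega> x = (\<lambda>_. 0)"
  shows "mollify_form m \<omega> \<in> test_forms d" "\<And>x. x \<notin> cball 0 (R + 1) \<Longrightarrow> mollify_form m \<omega> x = (\<lambda>_. 0)"
proof -
  note C = Cc_formsD[OF assms(1)]
  note c = C(2)[unfolded cont_form_def, rule_format]
  show out: "mollify_form m \<omega> x = (\<lambda>_. 0)" if "x \<notin> cball 0 (R + 1)" for x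
    unfolding mollify_form_def by (rule ext, rule mollify_outside[OF c _ that]) (use assms(2) in simp)
  have s: "smooth_form (mollify_form m \<omega>)"
    unfolding smooth_form_def mollify_form_def
  proof
    fix vs
    show "smooth_fun (\<lambda>x. mollify m (\<lambda>y. \<omega> y vs) x)" using smooth_mollify[OF c, of m vs] .
  qed
  have "mollify_form m \<omega> \<in> Cc_forms d"
    by (rule Cc_formsI[OF alternating_mollify[OF C(1,2)] smooth_form_cont[OF s] out])
  then show "mollify_form m \<omega> \<in> test_forms d"
    using s by (simp add: test_forms_def smooth_form_def)
qed

definition bounded_form :: "real \<Rightarrow> 'n::finite form \<Rightarrow> bool" where
  "bounded_form M \<omega> \<longleftrightarrow> (\<forall>x vs. (\<forall>v\<in>set vs. norm v \<le> 1) \<longrightarrow> norm (\<omega> x vs) \<le> M)"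

text \<open>Uniform continuity on each of finitely many basis lists is enough by
  \<open>alternating_norm_le\<close>. The difference is written with \<open>(-1) *\<close> so that
  the additivity and homogeneity clauses of currents apply literally.\<close>

lemma bounded_form_mollify:
  assumes \<omega>: "\<omega> \<in> Cc_forms d" and e: "e > 0"
  shows "eventually (\<lambda>m. bounded_form e (\<lambda>x vs. mollify_form m \<omega> x vs + (-1) * \<omega> x vs)) sequentially"
proof -
  note C = Cc_formsD[OF \<omega>]
  note c = C(2)[unfolded cont_form_def, rule_format]
  obtain R where R: "\<And>x. x \<notin> cball 0 R \<Longrightarrow> \<omega> x = (\<lambda>_. 0)" using C(3) by blast
  let ?L = "{bs. set bs \<subseteq> (Basis :: (complex^'a) set) \<and> length bs = d}"
  have fin: "finite ?L" by (rule finite_lists_length_eq) simp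
  define e' where "e' = e / (real (card ?L) + 1)"
  have e': "e' > 0" using e by (simp add: e'_def)
  have "eventually (\<lambda>m. \<forall>x. norm (mollify_form m \<omega> x bs - \<omega> x bs) \<le> e') sequentially" for bs
  proof -
    have "uniformly_continuous_on UNIV (\<lambda>x. \<omega> x bs)"
      by (rule compact_support_uniformly_continuous[OF c compact_cball[of 0 R]]) (simp add: R)
    from uniformly_continuous_onE[OF this e'] obtain \<delta> where \<delta>: "\<delta> > 0"
      "\<And>x y. dist x y < \<delta> \<Longrightarrow> dist (\<omega> x bs) (\<omega> y bs) < e'"
      by (metis UNIV_I)
    have "eventually (\<lambda>m. inverse (real (Suc m)) < \<delta>) sequentially"
      using LIMSEQ_inverse_real_of_nat \<delta>(1) by (rule order_tendstoD(2))
    then show ?thesis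
    proof eventually_elim
      case (elim m)
      show ?case
      proof
        fix x
        show "norm (mollify_form m \<omega> x bs - \<omega> x bs) \<le> e'"
          unfolding mollify_form_def
        proof (rule mollify_close[OF c])
          fix y assume "dist x y \<le> inverse (real (Suc m))"
          then have "dist x y < \<delta>" using elim by simp
          from \<delta>(2)[OF this] show "norm (\<omega> x bs - \<omega> y bs) \<le> e'" by (simp add: dist_norm)
        qed
      qed
    qed
  qed
  then have "eventually (\<lambda>m. \<forall>bs\<in>?L. \<forall>x. norm (mollify_form m \<omega> x bs - \<omega> x bs) \<le> e') sequentially"
    using fin by (intro eventually_ball_finite) auto
  then show ?thesis
  proof eventually_elim
    case (elim m)
    show ?case
      unfolding bounded_form_def
    proof (intro allI impI)
      fix x and vs :: "(complex^'a) list" assume vs: "\<forall>v\<in>set vs. norm v \<le> 1"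
      have "alternating d (\<lambda>vs. mollify_form m \<omega> x vs + (-1) * \<omega> x vs)"
        by (intro alternating_add alternating_scale alternating_mollify C(1,2))
      from alternating_norm_le[OF this vs]
      have "norm (mollify_form m \<omega> x vs + (-1) * \<omega> x vs) \<le> (\<Sum>bs\<in>?L. norm (mollify_form m \<omega> x bs - \<omega> x bs))"
        by simp
      also have "\<dots> \<le> (\<Sum>bs\<in>?L. e')" by (rule sum_mono) (use elim in auto)
      also have "\<dots> = real (card ?L) * e'" by simp
      also have "\<dots> \<le> e" using e by (simp add: e'_def field_simps)
      finally show "norm (mollify_form m \<omega> x vs + (-1) * \<omega> x vs) \<le> e" .
    qed
  qed
qed

lemma Cc_forms_add: "\<omega> \<in> Cc_forms d \<Longrightarrow> \<eta> \<in> Cc_forms d \<Longrightarrow> (\<lambda>x vs. \<omega> x vs + \<eta> x vs) \<in> Cc_forms d"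
proof -
  assume a: "\<omega> \<in> Cc_forms d" "\<eta> \<in> Cc_forms d"
  obtain R where R1: "\<forall>x. x \<notin> cball 0 R \<longrightarrow> \<omega> x = (\<lambda>_. 0)"
    using Cc_formsD(3)[OF a(1)] by blast
  obtain S where R2: "\<forall>x. x \<notin> cball 0 S \<longrightarrow> \<eta> x = (\<lambda>_. 0)"
    using Cc_formsD(3)[OF a(2)] by blast
  note R = R1 R2
  show ?thesis
  proof (rule Cc_formsI[of _ _ "max R S"])
    show "cont_form (\<lambda>x vs. \<omega> x vs + \<eta> x vs)"
      using Cc_formsD(2)[OF a(1)] Cc_formsD(2)[OF a(2)] by (auto simp: cont_form_def intro: continuous_on_add)
    show "(\<lambda>vs. \<omega> x vs + \<eta> x vs) = (\<lambda>_. 0)" if "x \<notin> cball 0 (max R S)" for x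
      using R that by simp
  qed (intro alternating_add Cc_formsD(1) a)
qed

lemma Cc_forms_mult:
  assumes "\<omega> \<in> Cc_forms d" "continuous_on UNIV f"
  shows "(\<lambda>x vs. f x * \<omega> x vs) \<in> Cc_forms d"
proof -
  obtain R where R: "\<forall>x. x \<notin> cball 0 R \<longrightarrow> \<omega> x = (\<lambda>_. 0)"
    using Cc_formsD(3)[OF assms(1)] by blast
  show ?thesis
  proof (rule Cc_formsI[of _ _ R])
    show "cont_form (\<lambda>x vs. f x * \<omega> x vs)"
      using Cc_formsD(2)[OF assms(1)] assms(2) by (auto simp: cont_form_def intro!: continuous_intros)
    show "(\<lambda>vs. f x * \<omega> x vs) = (\<lambda>_. 0)" if "x \<notin> cball 0 R" for x
      using R that by simp
  qed (intro alternating_scale Cc_formsD(1) assms)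
qed

lemma Cc_forms_scale: "\<omega> \<in> Cc_forms d \<Longrightarrow> (\<lambda>x vs. c * \<omega> x vs) \<in> Cc_forms d"
  by (rule Cc_forms_mult) auto

lemma Cc_forms_bounded:
  fixes \<omega> :: "'n::finite form"
  assumes "\<omega> \<in> Cc_forms d"
  obtains M where "M > 0" "bounded_form M \<omega>"
proof -
  note C = Cc_formsD[OF assms]
  obtain R where R: "\<And>x. x \<notin> cball 0 R \<Longrightarrow> \<omega> x = (\<lambda>_. 0)" using C(3) by blast
  let ?L = "{bs. set bs \<subseteq> (Basis :: (complex^'n) set) \<and> length bs = d}"
  have "\<exists>B>0. \<forall>x. norm (\<omega> x bs) \<le> B" for bs
  proof -
    have "continuous_on UNIV (\<lambda>x. \<omega> x bs)" using C(2) by (simp add: cont_form_def)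
    then obtain B where "B > 0" "\<And>x. norm (\<omega> x bs) \<le> B"
      by (rule compact_support_bounded[OF _ compact_cball[of 0 R]]) (use R in \<open>simp, blast\<close>)
    then show ?thesis by blast
  qed
  then obtain B where B: "\<And>bs. B bs > 0" "\<And>bs x. norm (\<omega> x bs) \<le> B bs" by metis
  show ?thesis
  proof (rule that[of "1 + (\<Sum>bs\<in>?L. B bs)"])
    show "1 + (\<Sum>bs\<in>?L. B bs) > 0"
      using B(1) by (intro add_pos_nonneg sum_nonneg) (auto intro: less_imp_le)
    show "bounded_form (1 + (\<Sum>bs\<in>?L. B bs)) \<omega>"
      unfolding bounded_form_def
    proof (intro allI impI)
      fix x and vs :: "(complex^'n) list" assume "\<forall>v\<in>set vs. norm v \<le> 1"
      from alternating_norm_le[OF C(1) this, of x]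
      have "norm (\<omega> x vs) \<le> (\<Sum>bs\<in>?L. norm (\<omega> x bs))" by simp
      also have "\<dots> \<le> (\<Sum>bs\<in>?L. B bs)" by (rule sum_mono) (rule B(2))
      finally show "norm (\<omega> x vs) \<le> 1 + (\<Sum>bs\<in>?L. B bs)" by simp
    qed
  qed
qed

section \<open>Uniqueness and limits of currents of order zero\<close>

lemma order_zero_currentD:
  assumes "order_zero_current d T"
  shows "\<omega> \<notin> Cc_forms d \<Longrightarrow> T \<omega> = 0"
    and "\<omega> \<in> Cc_forms d \<Longrightarrow> \<eta> \<in> Cc_forms d \<Longrightarrow> T (\<lambda>x vs. \<omega> x vs + \<eta> x vs) = T \<omega> + T \<eta>"
    and "\<omega> \<in> Cc_forms d \<Longrightarrow> T (\<lambda>x vs. c * \<omega> x vs) = c * T \<omega>"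
  using assms by (auto simp: order_zero_current_def)

lemma order_zero_current_bound:
  assumes "order_zero_current d T"
  obtains C where "C > 0" "\<And>\<omega> M. \<omega> \<in> Cc_forms d \<Longrightarrow> (\<And>x. x \<notin> cball 0 R \<Longrightarrow> \<omega> x = (\<lambda>_. 0)) \<Longrightarrow>
    bounded_form M \<omega> \<Longrightarrow> norm (T \<omega>) \<le> C * M"
proof -
  from assms[unfolded order_zero_current_def, THEN conjunct2, THEN conjunct2, THEN conjunct2,
      THEN spec, of "cball 0 R", THEN mp, OF compact_cball]
  obtain C where C: "\<forall>\<omega>\<in>Cc_forms d. \<forall>M. (\<forall>x. x \<notin> cball 0 R \<longrightarrow> \<omega> x = (\<lambda>_. 0)) \<and>
         (\<forall>x vs. (\<forall>v\<in>set vs. norm v \<le> 1) \<longrightarrow> norm (\<omega> x vs) \<le> M) \<longrightarrow> norm (T \<omega>) \<le> C * M" ..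
  show ?thesis
  proof (rule that[of "max C 1"])
    fix \<omega> :: "'a form" and M
    assume a: "\<omega> \<in> Cc_forms d" "\<And>x. x \<notin> cball 0 R \<Longrightarrow> \<omega> x = (\<lambda>_. 0)" "bounded_form M \<omega>"
    have "norm (T \<omega>) \<le> C * M"
      using C a unfolding bounded_form_def by blast
    also have "\<dots> \<le> max C 1 * M"
    proof (rule mult_right_mono)
      have "norm (\<omega> 0 []) \<le> M" using a(3) unfolding bounded_form_def by simp
      then show "0 \<le> M" using norm_ge_zero order_trans by blast
    qed simp
    finally show "norm (T \<omega>) \<le> max C 1 * M" .
  qed simp
qed

lemma current_mollify_tendsto:
  assumes T: "order_zero_current d T" and \<omega>: "\<omega> \<in> Cc_forms d"
  shows "(\<lambda>m. T (mollify_form m \<omega>)) \<longlonglongrightarrow> T \<omega>"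
proof (rule LIMSEQ_I)
  fix r :: real assume r: "r > 0"
  obtain R where R: "R > 0" "\<And>x. x \<notin> cball 0 R \<Longrightarrow> \<omega> x = (\<lambda>_. 0)" using Cc_formsD(3)[OF \<omega>] by blast
  obtain C where C: "C > 0" "\<And>\<omega> M. \<omega> \<in> Cc_forms d \<Longrightarrow> (\<And>x. x \<notin> cball 0 (R + 1) \<Longrightarrow> \<omega> x = (\<lambda>_. 0)) \<Longrightarrow>
    bounded_form M \<omega> \<Longrightarrow> norm (T \<omega>) \<le> C * M"
    using order_zero_current_bound[OF T, of "R + 1"] by blast
  note D = order_zero_currentD[OF T]
  have "r / (2 * C) > 0" using r C(1) by simp
  from bounded_form_mollify[OF \<omega> this] obtain N where N: "\<And>m. m \<ge> N \<Longrightarrow>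
      bounded_form (r / (2 * C)) (\<lambda>x vs. mollify_form m \<omega> x vs + (-1) * \<omega> x vs)"
    unfolding eventually_sequentially by blast
  show "\<exists>N. \<forall>m\<ge>N. norm (T (mollify_form m \<omega>) - T \<omega>) < r"
  proof (intro exI[of _ N] allI impI)
    fix m assume m: "m \<ge> N"
    have mt: "mollify_form m \<omega> \<in> test_forms d" "\<And>x. x \<notin> cball 0 (R + 1) \<Longrightarrow> mollify_form m \<omega> x = (\<lambda>_. 0)"
      using mollify_form_test[where R = R and m = m, OF \<omega> R(2)] by blast+
    note mc = test_formsD(2)[OF mt(1)]
    have "norm (T (\<lambda>x vs. mollify_form m \<omega> x vs + (-1) * \<omega> x vs)) \<le> C * (r / (2 * C))"
    proof (rule C(2)[OF Cc_forms_add[OF mc Cc_forms_scale[OF \<omega>]] _ N[OF m]])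
      fix x :: "complex^'a" assume "x \<notin> cball 0 (R + 1)"
      then show "(\<lambda>vs. mollify_form m \<omega> x vs + (-1) * \<omega> x vs) = (\<lambda>_. 0)"
        using mt(2) R(2)[of x] by simp
    qed
    then show "norm (T (mollify_form m \<omega>) - T \<omega>) < r"
      using D(2)[OF mc Cc_forms_scale[OF \<omega>], of "-1"] D(3)[OF \<omega>, of "-1"] C(1) r by simp
  qed
qed

text \<open>Mollified forms are test forms, and currents of order zero are continuous along them.
  This is the uniqueness behind the definite description in \<open>ddc_wedge\<close>.\<close>

lemma order_zero_current_unique:
  assumes "order_zero_current d S" "order_zero_current d T" "\<And>\<phi>. \<phi> \<in> test_forms d \<Longrightarrow> S \<phi> = T \<phi>"
  shows "S = T"
proof
  fix \<omega>
  show "S \<omega> = T \<omega>"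
  proof (cases "\<omega> \<in> Cc_forms d")
    case True
    obtain R where "\<And>x. x \<notin> cball 0 R \<Longrightarrow> \<omega> x = (\<lambda>_. 0)" using Cc_formsD(3)[OF True] by blast
    from assms(3)[OF mollify_form_test(1)[OF True this]]
    have "(\<lambda>m. S (mollify_form m \<omega>)) = (\<lambda>m. T (mollify_form m \<omega>))" by blast
    then show ?thesis
      using current_mollify_tendsto[OF assms(1) True] current_mollify_tendsto[OF assms(2) True] LIMSEQ_unique by metis
  next
    case False
    then show ?thesis using order_zero_currentD(1) assms(1,2) by metis
  qed
qed

text \<open>The constant \<open>C\<close> serves the whole sequence. Vanishing off
  \<open>Cc_forms\<close> is left to the limit, because the approximating currents are plain
  integrals.\<close>

definition uniformly_order_zero :: "nat \<Rightarrow> (nat \<Rightarrow> 'n::finite current) \<Rightarrow> bool" where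
  "uniformly_order_zero d T \<longleftrightarrow>
     (\<forall>m. \<forall>\<omega>\<in>Cc_forms d. \<forall>\<eta>\<in>Cc_forms d. T m (\<lambda>x vs. \<omega> x vs + \<eta> x vs) = T m \<omega> + T m \<eta>) \<and>
     (\<forall>m c. \<forall>\<omega>\<in>Cc_forms d. T m (\<lambda>x vs. c * \<omega> x vs) = c * T m \<omega>) \<and>
     (\<forall>R. \<exists>C>0. \<forall>m. \<forall>\<omega>\<in>Cc_forms d. \<forall>M. (\<forall>x. x \<notin> cball 0 R \<longrightarrow> \<omega> x = (\<lambda>_. 0)) \<longrightarrow>
        bounded_form M \<omega> \<longrightarrow> norm (T m \<omega>) \<le> C * M)"

text \<open>An argument of Banach-Steinhaus type: every continuous form is uniformly close to a test
  form with controlled support, the common bound makes the error uniform in \<open>m\<close>, and on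
  the test form the sequence is Cauchy. The bound passes to the limit, which therefore again has
  order zero.\<close>

lemma uniformly_order_zero_limit:
  assumes T: "uniformly_order_zero d T" and conv: "\<And>\<phi>. \<phi> \<in> test_forms d \<Longrightarrow> convergent (\<lambda>m. T m \<phi>)"
  obtains S where "order_zero_current d S" "\<And>\<omega>. \<omega> \<in> Cc_forms d \<Longrightarrow> (\<lambda>m. T m \<omega>) \<longlonglongrightarrow> S \<omega>"
proof -
  have Tadd: "\<And>m \<omega> \<eta>. \<omega> \<in> Cc_forms d \<Longrightarrow> \<eta> \<in> Cc_forms d \<Longrightarrow> T m (\<lambda>x vs. \<omega> x vs + \<eta> x vs) = T m \<omega> + T m \<eta>"
    and Tscale: "\<And>m c \<omega>. \<omega> \<in> Cc_forms d \<Longrightarrow> T m (\<lambda>x vs. c * \<omega> x vs) = c * T m \<omega>"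
    and Tb: "\<And>R. \<exists>C>0. \<forall>m. \<forall>\<omega>\<in>Cc_forms d. \<forall>M. (\<forall>x. x \<notin> cball 0 R \<longrightarrow> \<omega> x = (\<lambda>_. 0)) \<longrightarrow>
        bounded_form M \<omega> \<longrightarrow> norm (T m \<omega>) \<le> C * M"
    using T unfolding uniformly_order_zero_def by blast+
  have lim: "convergent (\<lambda>m. T m \<omega>)" if \<omega>: "\<omega> \<in> Cc_forms d" for \<omega>
  proof -
    obtain R where R: "R > 0" "\<And>x. x \<notin> cball 0 R \<Longrightarrow> \<omega> x = (\<lambda>_. 0)" using Cc_formsD(3)[OF \<omega>] by blast
    obtain C where C: "C > 0" "\<And>m \<omega> M. \<omega> \<in> Cc_forms d \<Longrightarrow> (\<forall>x. x \<notin> cball 0 (R + 1) \<longrightarrow> \<omega> x = (\<lambda>_. 0)) \<Longrightarrow>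
        bounded_form M \<omega> \<Longrightarrow> norm (T m \<omega>) \<le> C * M"
      using Tb[of "R + 1"] by blast
    have "Cauchy (\<lambda>m. T m \<omega>)"
    proof (rule metric_CauchyI)
      fix e :: real assume e: "e > 0"
      have "e / (4 * C) > 0" using e C(1) by simp
      from eventually_happens[OF bounded_form_mollify[OF \<omega> this]] obtain k where k:
        "bounded_form (e / (4 * C)) (\<lambda>x vs. mollify_form k \<omega> x vs + (-1) * \<omega> x vs)"
        by (auto simp: trivial_limit_sequentially)
      have mt: "mollify_form k \<omega> \<in> test_forms d" "\<And>x. x \<notin> cball 0 (R + 1) \<Longrightarrow> mollify_form k \<omega> x = (\<lambda>_. 0)"
        using mollify_form_test[where R = R and m = k, OF \<omega> R(2)] by blast+
      note mc = test_formsD(2)[OF mt(1)]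
      have close: "norm (T m (mollify_form k \<omega>) - T m \<omega>) \<le> e / 4" for m
      proof -
        have "norm (T m (\<lambda>x vs. mollify_form k \<omega> x vs + (-1) * \<omega> x vs)) \<le> C * (e / (4 * C))"
          by (rule C(2)[OF Cc_forms_add[OF mc Cc_forms_scale[OF \<omega>]] _ k]) (use mt(2) R(2) in auto)
        then show ?thesis
          using Tadd[OF mc Cc_forms_scale[OF \<omega>], of m "-1"] Tscale[OF \<omega>, of m "-1"] C(1) by simp
      qed
      from conv[OF mt(1)] have "Cauchy (\<lambda>m. T m (mollify_form k \<omega>))"
        by (simp add: Cauchy_convergent_iff)
      from metric_CauchyD[OF this, of "e / 4"] e obtain N where N:
        "\<And>m m'. m \<ge> N \<Longrightarrow> m' \<ge> N \<Longrightarrow> dist (T m (mollify_form k \<omega>)) (T m' (mollify_form k \<omega>)) < e / 4"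
        by auto
      show "\<exists>N. \<forall>m\<ge>N. \<forall>m'\<ge>N. dist (T m \<omega>) (T m' \<omega>) < e"
      proof (intro exI[of _ N] allI impI)
        fix m m' assume "m \<ge> N" "m' \<ge> N"
        have "dist (T m \<omega>) (T m' \<omega>) \<le> dist (T m \<omega>) (T m (mollify_form k \<omega>)) +
            dist (T m (mollify_form k \<omega>)) (T m' (mollify_form k \<omega>)) + dist (T m' (mollify_form k \<omega>)) (T m' \<omega>)"
          by (meson add_right_mono dist_triangle order_trans)
        also have "\<dots> < e / 4 + e / 4 + e / 2"
          using N[OF \<open>m \<ge> N\<close> \<open>m' \<ge> N\<close>] close[of m] close[of m'] e by (simp add: dist_norm norm_minus_commute)
        finally show "dist (T m \<omega>) (T m' \<omega>) < e" by simp
      qed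
    qed
    then show ?thesis by (simp add: Cauchy_convergent_iff)
  qed
  define S where "S \<omega> = (if \<omega> \<in> Cc_forms d then Topological_Spaces.lim (\<lambda>m. T m \<omega>) else 0)" for \<omega>
  have S: "(\<lambda>m. T m \<omega>) \<longlonglongrightarrow> S \<omega>" if "\<omega> \<in> Cc_forms d" for \<omega>
    using lim[OF that] that unfolding S_def by (simp add: convergent_LIMSEQ_iff)
  have "order_zero_current d S"
    unfolding order_zero_current_def
  proof (intro conjI allI impI ballI)
    show "S \<omega> = 0" if "\<omega> \<notin> Cc_forms d" for \<omega> using that by (simp add: S_def)
    show "S (\<lambda>x vs. \<omega> x vs + \<eta> x vs) = S \<omega> + S \<eta>" if "\<omega> \<in> Cc_forms d" "\<eta> \<in> Cc_forms d" for \<omega> \<eta>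
      using S[OF Cc_forms_add[OF that]] tendsto_add[OF S[OF that(1)] S[OF that(2)]]
      unfolding Tadd[OF that] by (rule LIMSEQ_unique)
    show "S (\<lambda>x vs. c * \<omega> x vs) = c * S \<omega>" if "\<omega> \<in> Cc_forms d" for c \<omega>
      using S[OF Cc_forms_scale[OF that]] tendsto_mult_left[OF S[OF that]]
      unfolding Tscale[OF that] by (rule LIMSEQ_unique)
    fix K :: "(complex^'a) set" assume "compact K"
    then obtain R where R: "K \<subseteq> cball 0 R" by (rule compact_subset_cball_0)
    obtain C where C: "C > 0" "\<And>m \<omega> M. \<omega> \<in> Cc_forms d \<Longrightarrow> (\<forall>x. x \<notin> cball 0 R \<longrightarrow> \<omega> x = (\<lambda>_. 0)) \<Longrightarrow>
        bounded_form M \<omega> \<Longrightarrow> norm (T m \<omega>) \<le> C * M"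
      using Tb[of R] by blast
    show "\<exists>C. \<forall>\<omega>\<in>Cc_forms d. \<forall>M. (\<forall>x. x \<notin> K \<longrightarrow> \<omega> x = (\<lambda>_. 0)) \<and>
         (\<forall>x vs. (\<forall>v\<in>set vs. norm v \<le> 1) \<longrightarrow> norm (\<omega> x vs) \<le> M) \<longrightarrow> norm (S \<omega>) \<le> C * M"
    proof (intro exI[of _ C] ballI allI impI)
      fix \<omega> :: "'a form" and M
      assume \<omega>: "\<omega> \<in> Cc_forms d" and "(\<forall>x. x \<notin> K \<longrightarrow> \<omega> x = (\<lambda>_. 0)) \<and>
         (\<forall>x vs. (\<forall>v\<in>set vs. norm v \<le> 1) \<longrightarrow> norm (\<omega> x vs) \<le> M)"
      then have "norm (T m \<omega>) \<le> C * M" for m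
        by (intro C(2)) (use R in \<open>auto simp: bounded_form_def\<close>)
      then show "norm (S \<omega>) \<le> C * M"
        by (intro LIMSEQ_le_const2[OF tendsto_norm[OF S[OF \<omega>]]]) auto
    qed
  qed
  then show ?thesis using S that by blast
qed

text \<open>Positivity is recorded as a pointwise sum of squares, the shape in which it enters wedge
  products. The list may vary with the point without any regularity, since it is only used for
  estimates at one point at a time.\<close>

definition psd_smooth :: "(complex^'n::finite \<Rightarrow> complex) \<Rightarrow> bool" where
  "psd_smooth w \<longleftrightarrow> smooth_fun w \<and>
     (\<forall>x. \<exists>qs. \<forall>a b. hess w x a b = of_real (\<Sum>q\<leftarrow>qs. (q \<bullet> a) * (q \<bullet> b)))"

lemma dir_deriv_real:
  assumes "smooth_fun f" "\<And>x. Im (f x) = 0"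
  shows "Im (dir_deriv b f x) = 0"
  using DERIV_unique[OF dir_deriv_line[OF assms(1) bounded_linear_Im, of x b 0, unfolded assms(2)] DERIV_const]
  by simp

text \<open>Midpoint convexity makes second differences non-negative. By
  \<open>second_difference\<close> they are, up to a positive factor, Hessian values at points
  tending to \<open>x\<close>, so continuity gives the sign at \<open>x\<close> itself.\<close>

lemma psd_smoothI:
  fixes w :: "complex^'n::finite \<Rightarrow> complex"
  assumes w: "smooth_fun w" and real: "\<And>x. Im (w x) = 0"
    and mid: "\<And>x v. 2 * Re (w (x + v)) \<le> Re (w (x + v + v)) + Re (w x)"
  shows "psd_smooth w"
  unfolding psd_smooth_def
proof (intro conjI w allI)
  fix x
  let ?Q = "\<lambda>a b. Re (hess w x a b)"
  have im: "Im (hess w x a b) = 0" for a b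
    unfolding hess_def by (intro dir_deriv_real smooth_dir_deriv w real)
  have l1: "linear (\<lambda>a. ?Q a b)" for b
    using linear_compose[OF linear_dir_deriv[OF smooth_differentiable[OF smooth_dir_deriv[OF w]]] bounded_linear.linear[OF bounded_linear_Re], of b x]
    by (simp add: hess_def o_def)
  have "bilinear ?Q"
    unfolding bilinear_def using l1 hess_commute[OF w] by simp
  moreover have "?Q a b = ?Q b a" for a b by (simp add: hess_commute[OF w])
  moreover have "?Q v v \<ge> 0" for v
  proof -
    define t where "t n = inverse (real (Suc n))" for n
    have t: "t n > 0" for n by (simp add: t_def)
    have "\<exists>p. dist p x \<le> t n * (norm v + norm v) \<and> Re (hess w p v v) \<ge> 0" for n
    proof -
      obtain p where p: "dist p x \<le> t n * (norm v + norm v)"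
        "Re (w (x + t n *\<^sub>R v + t n *\<^sub>R v)) - Re (w (x + t n *\<^sub>R v)) - Re (w (x + t n *\<^sub>R v)) + Re (w x)
          = (t n)\<^sup>2 * Re (dir_deriv v (dir_deriv v w) p)"
        by (rule second_difference[OF w bounded_linear_Re t])
      have "(t n)\<^sup>2 * Re (hess w p v v) \<ge> 0"
        using mid[of x "t n *\<^sub>R v"] unfolding hess_def p(2)[symmetric] by simp
      then show ?thesis using p(1) t[of n] by (auto simp: zero_le_mult_iff)
    qed
    then obtain p where p: "\<And>n. dist (p n) x \<le> t n * (norm v + norm v)" "\<And>n. Re (hess w (p n) v v) \<ge> 0"
      by metis
    have t0: "(\<lambda>n. t n * (norm v + norm v)) \<longlonglongrightarrow> 0"
      unfolding t_def by (intro tendsto_mult_left_zero LIMSEQ_inverse_real_of_nat)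
    have lim: "p \<longlonglongrightarrow> x"
      by (rule tendsto_dist_iff[THEN iffD2], rule Lim_null_comparison[OF always_eventually t0]) (use p(1) in simp)
    have "isCont (\<lambda>x. hess w x v v) x"
      using smooth_continuous[OF smooth_hess[OF w]] by (simp add: continuous_on_eq_continuous_at)
    from tendsto_Re[OF isCont_tendsto_compose[OF this lim]] show ?thesis
      by (rule LIMSEQ_le_const) (use p(2) in blast)
  qed
  ultimately obtain qs where qs: "\<And>a b. ?Q a b = (\<Sum>q\<leftarrow>qs. (q \<bullet> a) * (q \<bullet> b))"
    by (rule psd_sum_squares) blast
  then show "\<exists>qs. \<forall>a b. hess w x a b = of_real (\<Sum>q\<leftarrow>qs. (q \<bullet> a) * (q \<bullet> b))"
    using im by (intro exI[of _ qs]) (auto simp: complex_eq_iff)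
qed

lemma mollify_of_real:
  assumes "continuous_on UNIV u"
  shows "integrable lborel (\<lambda>y. moll m y * u (x - y))"
    "mollify m (\<lambda>x. of_real (u x)) x = of_real (LINT y|lborel. moll m y * u (x - y))"
proof -
  have c: "continuous_on UNIV (\<lambda>x. complex_of_real (u x))" using assms by (intro continuous_intros)
  show i: "integrable lborel (\<lambda>y. moll m y * u (x - y))"
  proof -
    have "(\<lambda>y. Re (of_real (moll m y) * of_real (u (x - y)))) = (\<lambda>y. moll m y * u (x - y))"
      by (rule ext) simp
    then show ?thesis
      using integrable_Re[OF mollify_integrable[OF c, of m x]] by (simp only:)
  qed
  show "mollify m (\<lambda>x. of_real (u x)) x = of_real (LINT y|lborel. moll m y * u (x - y))"
    unfolding mollify_eq[OF c] of_real_mult[symmetric] by (rule integral_of_real[OF i])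
qed

lemma psd_smooth_mollify:
  assumes "convex_on UNIV u" "continuous_on UNIV u"
  shows "psd_smooth (mollify m (\<lambda>x. of_real (u x)))"
proof (rule psd_smoothI)
  note r = mollify_of_real[OF assms(2)]
  show "smooth_fun (mollify m (\<lambda>x. of_real (u x)))"
    using assms(2) by (intro smooth_mollify continuous_intros)
  show "Im (mollify m (\<lambda>x. of_real (u x)) x) = 0" for x
    by (simp add: r)
  fix x v
  have "(LINT y|lborel. 2 * (moll m y * u (x + v - y)))
      \<le> (LINT y|lborel. moll m y * u (x + v + v - y) + moll m y * u (x - y))"
  proof (rule integral_mono)
    show "integrable lborel (\<lambda>y. 2 * (moll m y * u (x + v - y)))"
      by (rule integrable_mult_right[OF r(1)])
    show "integrable lborel (\<lambda>y. moll m y * u (x + v + v - y) + moll m y * u (x - y))"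
      by (rule Bochner_Integration.integrable_add[OF r(1) r(1)])
    fix y
    have "u ((1/2) *\<^sub>R (x + v + v - y) + (1/2) *\<^sub>R (x - y)) \<le> (1/2) * u (x + v + v - y) + (1/2) * u (x - y)"
      using convex_onD[OF assms(1), of "1/2" "x + v + v - y" "x - y"] by simp
    moreover have "(1/2) *\<^sub>R (x + v + v - y) + (1/2) *\<^sub>R (x - y) = (1/2) *\<^sub>R (2 *\<^sub>R (x + v - y))"
      by (simp add: scaleR_2 algebra_simps)
    ultimately have "2 * u (x + v - y) \<le> u (x + v + v - y) + u (x - y)"
      by simp
    from mult_left_mono[OF this moll_nonneg[of m y]]
    show "2 * (moll m y * u (x + v - y)) \<le> moll m y * u (x + v + v - y) + moll m y * u (x - y)"
      by (simp add: algebra_simps)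
  qed
  then show "2 * Re (mollify m (\<lambda>x. of_real (u x)) (x + v))
      \<le> Re (mollify m (\<lambda>x. of_real (u x)) (x + v + v)) + Re (mollify m (\<lambda>x. of_real (u x)) x)"
    by (simp add: r)
qed

lemma epair_expand:
  "epair q \<alpha> vs = (\<Sum>a\<in>Basis. \<Sum>b\<in>Basis. of_real ((q \<bullet> a) * (q \<bullet> b)) * ewedge a (ewedge (\<i> *s b) \<alpha>) vs)"
proof -
  have "epair q \<alpha> vs = epair (\<Sum>b\<in>Basis. (q \<bullet> b) *\<^sub>R b) \<alpha> vs"
    by (simp add: euclidean_representation)
  also have "\<dots> = (\<Sum>a\<in>Basis. \<Sum>b\<in>Basis. of_real ((q \<bullet> a) * (q \<bullet> b)) * ewedge a (ewedge (\<i> *s b) \<alpha>) vs)"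
    unfolding epair_def imult_sum imult_scaleR
    by (simp add: ewedge_sum_left[abs_def] ewedge_sum ewedge_scaleR_left[abs_def] ewedge_scale
        sum_distrib_left mult.assoc)
  finally show ?thesis .
qed

lemma levi_at_squares:
  assumes "\<And>a b. H a b = of_real (\<Sum>q\<leftarrow>qs. (q \<bullet> a) * (q \<bullet> b))"
  shows "levi_at H \<alpha> vs = (\<Sum>q\<leftarrow>qs. epair q \<alpha> vs)"
  unfolding levi_at_def assms
  by (induction qs) (auto simp: epair_expand sum.distrib distrib_right)

lemma epair_sum_list: "epair q (\<lambda>vs. \<Sum>p\<leftarrow>ps. f p vs) vs = (\<Sum>p\<leftarrow>ps. epair q (f p) vs)"
  by (induction ps) (auto simp: epair_add)

text \<open>Multiply out the sums of squares of the factors. The last clause is for the degenerate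
  case: a direction \<open>v\<close> in which all Hessians vanish satisfies that a sum of squares
  \<open>(q \<bullet> v) * (q \<bullet> v)\<close> is 0, so each \<open>q\<close> is orthogonal to
  \<open>v\<close>.\<close>

lemma levis_psd:
  fixes us :: "(complex^'n::finite \<Rightarrow> complex) list"
  assumes "\<And>u. u \<in> set us \<Longrightarrow> psd_smooth u"
  obtains pss where "\<And>ps. ps \<in> set pss \<Longrightarrow> length ps = length us"
    "\<And>\<omega> vs. levis us \<omega> x vs = (\<Sum>ps\<leftarrow>pss. epairs ps (\<omega> x) vs)"
    "\<And>ps q v. ps \<in> set pss \<Longrightarrow> q \<in> set ps \<Longrightarrow> (\<And>u. u \<in> set us \<Longrightarrow> hess u x v v = 0) \<Longrightarrow> q \<bullet> v = 0"
proof -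
  have "\<exists>pss. (\<forall>ps\<in>set pss. length ps = length us) \<and>
      (\<forall>\<omega> vs. levis us \<omega> x vs = (\<Sum>ps\<leftarrow>pss. epairs ps (\<omega> x) vs)) \<and>
      (\<forall>ps\<in>set pss. \<forall>q\<in>set ps. \<forall>v. (\<forall>u\<in>set us. hess u x v v = 0) \<longrightarrow> q \<bullet> v = 0)"
    using assms
  proof (induction us)
    case Nil
    show ?case by (intro exI[of _ "[[]]"]) auto
  next
    case (Cons u us)
    then obtain pss where pss: "\<forall>ps\<in>set pss. length ps = length us"
      "\<And>\<omega> vs. levis us \<omega> x vs = (\<Sum>ps\<leftarrow>pss. epairs ps (\<omega> x) vs)"
      "\<forall>ps\<in>set pss. \<forall>q\<in>set ps. \<forall>v. (\<forall>u\<in>set us. hess u x v v = 0) \<longrightarrow> q \<bullet> v = 0"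
      by auto
    have "psd_smooth u" using Cons.prems by simp
    then have "\<exists>qs. \<forall>a b. hess u x a b = of_real (\<Sum>q\<leftarrow>qs. (q \<bullet> a) * (q \<bullet> b))"
      unfolding psd_smooth_def by blast
    then obtain qs where qs: "\<And>a b. hess u x a b = of_real (\<Sum>q\<leftarrow>qs. (q \<bullet> a) * (q \<bullet> b))"
      by blast
    have "levis us \<omega> x = (\<lambda>vs. \<Sum>ps\<leftarrow>pss. epairs ps (\<omega> x) vs)" for \<omega>
      using pss(2) by blast
    then have "levis (u # us) \<omega> x vs = (\<Sum>q\<leftarrow>qs. \<Sum>ps\<leftarrow>pss. epairs (q # ps) (\<omega> x) vs)" for \<omega> vs
      by (simp add: levi_def levi_at_squares[OF qs] epair_sum_list)
    moreover have "(\<Sum>q\<leftarrow>qs. \<Sum>ps\<leftarrow>pss. epairs (q # ps) \<alpha> vs)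
        = (\<Sum>ps\<leftarrow>concat (map (\<lambda>q. map ((#) q) pss) qs). epairs ps \<alpha> vs)" for \<alpha> vs
      by (induction qs) (auto simp: o_def)
    moreover have "q \<bullet> v = 0" if "q \<in> set qs" "hess u x v v = 0" for q v
    proof -
      have "(\<Sum>q\<leftarrow>qs. (q \<bullet> v) * (q \<bullet> v)) = 0"
        using that(2) unfolding qs by simp
      then have "(q \<bullet> v) * (q \<bullet> v) = 0"
        using that(1) by (subst (asm) sum_list_nonneg_eq_0_iff) auto
      then show ?thesis by simp
    qed
    ultimately show ?case
      using pss(1,3) by (intro exI[of _ "concat (map (\<lambda>q. map ((#) q) pss) qs)"]) auto
  qed
  then show ?thesis using that by blast
qed

text \<open>The density of the mass of \<open>dd\<^sup>c u\<^sub>1 \<and> \<dots> \<and> dd\<^sup>c u\<^sub>k\<close> up to a constant factor.\<close>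

definition dens :: "(complex^'n::finite \<Rightarrow> complex) list \<Rightarrow> complex^'n \<Rightarrow> real" where
  "dens us x = Re (levis us (\<lambda>x. (beta ^^ (CARD('n) - length us)) one_form0) x std_frame)"

text \<open>The comparison \<open>epairs_dominated\<close> holds summand by summand. As all the
  reference values are non-negative, they add up without cancellation to the density.\<close>

lemma dens_dominates:
  fixes us :: "(complex^'n::finite \<Rightarrow> complex) list"
  assumes us: "\<And>u. u \<in> set us \<Longrightarrow> psd_smooth u" and len: "length us \<le> CARD('n)"
  shows "dens us x \<ge> 0"
    and "levis us (\<lambda>x. (beta ^^ (CARD('n) - length us)) one_form0) x std_frame = of_real (dens us x)"
    and "(\<And>vs. \<forall>v\<in>set vs. norm v \<le> 1 \<Longrightarrow> norm (\<omega> x vs) \<le> M) \<Longrightarrow>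
      norm (levis us \<omega> x std_frame) \<le> real (2 * CARD('n)) ^ (2 * CARD('n)) * M * dens us x"
proof -
  let ?m = "CARD('n) - length us" and ?K = "real (2 * CARD('n)) ^ (2 * CARD('n))"
  obtain pss where pss: "\<And>ps. ps \<in> set pss \<Longrightarrow> length ps = length us"
    "\<And>\<omega> vs. levis us \<omega> x vs = (\<Sum>ps\<leftarrow>pss. epairs ps (\<omega> x) vs)"
    by (rule levis_psd[OF us, of us x]) blast+
  have "\<forall>ps\<in>set pss. \<exists>r\<ge>0. epairs ps ((beta ^^ ?m) one_form0) std_frame = of_real r \<and>
      (\<forall>\<alpha> M. (\<forall>ws. (\<forall>w\<in>set ws. norm w \<le> 1) \<longrightarrow> norm (\<alpha> ws) \<le> M) \<longrightarrow>
        norm (epairs ps \<alpha> std_frame) \<le> ?K * M * r)"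
  proof
    fix ps assume "ps \<in> set pss"
    then have "length ps + ?m = CARD('n)" using pss(1) len by simp
    then obtain r where "r \<ge> 0" "epairs ps ((beta ^^ ?m) one_form0) std_frame = of_real r"
      "\<And>\<alpha> M. (\<And>ws. \<forall>w\<in>set ws. norm w \<le> 1 \<Longrightarrow> norm (\<alpha> ws) \<le> M) \<Longrightarrow>
        norm (epairs ps \<alpha> std_frame) \<le> ?K * M * r"
      by (rule epairs_dominated) blast
    then show "\<exists>r\<ge>0. epairs ps ((beta ^^ ?m) one_form0) std_frame = of_real r \<and>
      (\<forall>\<alpha> M. (\<forall>ws. (\<forall>w\<in>set ws. norm w \<le> 1) \<longrightarrow> norm (\<alpha> ws) \<le> M) \<longrightarrow>
        norm (epairs ps \<alpha> std_frame) \<le> ?K * M * r)"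
      by (intro exI[of _ r]) auto
  qed
  then obtain r where r: "\<And>ps. ps \<in> set pss \<Longrightarrow> r ps \<ge> 0"
    "\<And>ps. ps \<in> set pss \<Longrightarrow> epairs ps ((beta ^^ ?m) one_form0) std_frame = of_real (r ps)"
    "\<And>ps \<alpha> M. ps \<in> set pss \<Longrightarrow> (\<And>ws. \<forall>w\<in>set ws. norm w \<le> 1 \<Longrightarrow> norm (\<alpha> ws) \<le> M) \<Longrightarrow>
        norm (epairs ps \<alpha> std_frame) \<le> ?K * M * r ps"
    by metis
  have "(\<Sum>ps\<leftarrow>qss. epairs ps ((beta ^^ ?m) one_form0) std_frame) = of_real (\<Sum>ps\<leftarrow>qss. r ps)"
    if "set qss \<subseteq> set pss" for qss
    using that by (induction qss) (auto simp: r(2))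
  then have eq: "levis us (\<lambda>x. (beta ^^ ?m) one_form0) x std_frame = of_real (\<Sum>ps\<leftarrow>pss. r ps)"
    unfolding pss(2) by simp
  then have d: "dens us x = (\<Sum>ps\<leftarrow>pss. r ps)" by (simp add: dens_def)
  show "dens us x \<ge> 0" unfolding d by (rule sum_list_nonneg) (use r(1) in auto)
  show "levis us (\<lambda>x. (beta ^^ ?m) one_form0) x std_frame = of_real (dens us x)"
    unfolding d by (rule eq)
  assume M: "\<And>vs. \<forall>v\<in>set vs. norm v \<le> 1 \<Longrightarrow> norm (\<omega> x vs) \<le> M"
  have "norm (levis us \<omega> x std_frame) \<le> (\<Sum>ps\<leftarrow>pss. norm (epairs ps (\<omega> x) std_frame))"
    unfolding pss(2) by (induction pss) (auto intro: norm_triangle_le)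
  also have "\<dots> \<le> (\<Sum>ps\<leftarrow>pss. ?K * M * r ps)"
    by (rule sum_list_mono) (rule r(3)[OF _ M])
  also have "\<dots> = ?K * M * dens us x"
    by (simp add: d sum_list_const_mult)
  finally show "norm (levis us \<omega> x std_frame) \<le> ?K * M * dens us x" .
qed

section \<open>Mass bounds and Bedford--Taylor powers\<close>

text \<open>For smooth \<open>us\<close>, the current dd^c u_1 \<and> ... \<and> dd^c u_k;
  evaluation on the standard frame gives the Lebesgue density, as in
  \<open>integration_current\<close>.\<close>

definition cur :: "(complex^'n::finite \<Rightarrow> complex) list \<Rightarrow> 'n current" where
  "cur us \<omega> = (LINT x|lborel. levis us \<omega> x std_frame)"

lemma cur_integrable:
  assumes "\<And>u. u \<in> set us \<Longrightarrow> smooth_fun u" "\<omega> \<in> Cc_forms d"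
  shows "integrable lborel (\<lambda>x. levis us \<omega> x vs)"
proof -
  obtain R where R: "\<forall>x. x \<notin> cball 0 R \<longrightarrow> \<omega> x = (\<lambda>_. 0)"
    using Cc_formsD(3)[OF assms(2)] by blast
  show ?thesis
    by (rule integrable_form[OF cont_levis[OF assms(1) Cc_formsD(2)[OF assms(2)]] compact_cball[of 0 R]])
      (use R in \<open>auto intro: levis_zero\<close>)
qed

lemma cur_add:
  assumes "\<And>u. u \<in> set us \<Longrightarrow> smooth_fun u" "\<omega> \<in> Cc_forms d" "\<eta> \<in> Cc_forms d"
  shows "cur us (\<lambda>x vs. \<omega> x vs + \<eta> x vs) = cur us \<omega> + cur us \<eta>"
  unfolding cur_def levis_add
  by (rule Bochner_Integration.integral_add[OF cur_integrable[OF assms(1,2)] cur_integrable[OF assms(1,3)]])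

lemma cur_scale: "cur us (\<lambda>x vs. c * \<omega> x vs) = c * cur us \<omega>"
  unfolding cur_def levis_scale by simp

lemma psd_smoothD: "psd_smooth u \<Longrightarrow> smooth_fun u"
  by (simp add: psd_smooth_def)

lemma cont_form_const: "cont_form (\<lambda>x. \<alpha>)"
  by (simp add: cont_form_def)

lemma smooth_form_const: "smooth_form (\<lambda>x. \<alpha>)"
  by (simp add: smooth_form_def)

lemma dens_integrable:
  assumes "\<And>u. u \<in> set us \<Longrightarrow> smooth_fun u"
  shows "integrable lborel (\<lambda>x. indicator (cball 0 R) x * dens us x)"
proof -
  have "continuous_on UNIV (dens us)"
    unfolding dens_def[abs_def]
    using cont_levis[OF assms cont_form_const] by (intro continuous_on_Re) (simp add: cont_form_def)
  then have "continuous_on (cball 0 R) (dens us)" by (rule continuous_on_subset) simp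
  from borel_integrable_compact[OF compact_cball this] show ?thesis
    by (simp add: set_integrable_def)
qed

lemma cur_bound:
  fixes us :: "(complex^'n::finite \<Rightarrow> complex) list"
  assumes us: "\<And>u. u \<in> set us \<Longrightarrow> psd_smooth u" "length us \<le> CARD('n)"
    and \<omega>: "\<And>x. x \<notin> cball 0 R \<Longrightarrow> \<omega> x = (\<lambda>_. 0)" "bounded_form M \<omega>"
  shows "norm (cur us \<omega>) \<le> real (2 * CARD('n)) ^ (2 * CARD('n)) * M * (LINT x|lborel. indicator (cball 0 R) x * dens us x)"
proof -
  let ?K = "real (2 * CARD('n)) ^ (2 * CARD('n))"
  have i: "integrable lborel (\<lambda>x. ?K * M * (indicator (cball 0 R) x * dens us x))"
    by (intro integrable_mult_right dens_integrable psd_smoothD us(1))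
  have le: "norm (levis us \<omega> x std_frame) \<le> ?K * M * (indicator (cball 0 R) x * dens us x)" for x
  proof (cases "x \<in> cball 0 R")
    case True
    then show ?thesis
      using dens_dominates(3)[OF us, where \<omega> = \<omega> and x = x and M = M] \<omega>(2) by (simp add: bounded_form_def)
  next
    case False
    then show ?thesis using levis_zero[where \<omega> = \<omega> and x = x and us = us] \<omega>(1)[of x] by simp
  qed
  have "norm (cur us \<omega>) \<le> (LINT x|lborel. norm (levis us \<omega> x std_frame))"
    unfolding cur_def by (rule Bochner_Integration.integral_norm_bound)
  also have "\<dots> \<le> (LINT x|lborel. ?K * M * (indicator (cball 0 R) x * dens us x))"
    by (rule integral_mono'[OF i le order_trans[OF norm_ge_zero le]])
  also have "\<dots> = ?K * M * (LINT x|lborel. indicator (cball 0 R) x * dens us x)"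
    by simp
  finally show ?thesis .
qed

lemma alternating_beta: "alternating d \<alpha> \<Longrightarrow> alternating (Suc (Suc d)) (beta \<alpha>)"
  unfolding beta_def[abs_def] epair_def by (intro alternating_sum alternating_ewedge)

lemma alternating_beta_power: "alternating (2 * k) ((beta ^^ k) one_form0)"
proof (induction k)
  case 0
  show ?case by (auto simp: alternating_def one_form0_def)
next
  case (Suc k)
  from alternating_beta[OF this] show ?case by simp
qed

text \<open>Local boundedness uniform in \<open>m\<close> is the quantitative input of the mass
  bounds; no derivative is controlled.\<close>

definition psd_seq :: "(nat \<Rightarrow> complex^'n::finite \<Rightarrow> complex) \<Rightarrow> bool" where
  "psd_seq f \<longleftrightarrow> (\<forall>m. psd_smooth (f m)) \<and> (\<forall>R. \<exists>C. \<forall>m. \<forall>x\<in>cball 0 R. norm (f m x) \<le> C)"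

text \<open>Integration by parts moves dd^c from the test form to the potential. This is the smooth
  counterpart of the defining property of \<open>ddc_wedge\<close>.\<close>

lemma cur_ddc:
  assumes "\<And>u. u \<in> set us \<Longrightarrow> smooth_fun u" "smooth_fun u" "\<phi> \<in> test_forms d"
  shows "cur us (\<lambda>x vs. u x * ddc \<phi> x vs) = cur (us @ [u]) \<phi>"
proof -
  obtain R where R: "\<And>x. x \<notin> cball 0 R \<Longrightarrow> \<phi> x = (\<lambda>_. 0)"
    using Cc_formsD(3)[OF test_formsD(2)[OF assms(3)]] by blast
  show ?thesis
    unfolding cur_def levis_simps
    by (rule integral_levis_ddc[OF assms(1,2) test_formsD(1)[OF assms(3)] compact_cball R])
qed

text \<open>The Chern--Levine--Nirenberg estimate: integrate one of the factors by parts against a cut-off.\<close>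

lemma mass_bound:
  fixes fs :: "(nat \<Rightarrow> complex^'n::finite \<Rightarrow> complex) list"
  assumes "\<And>f. f \<in> set fs \<Longrightarrow> psd_seq f" "length fs \<le> CARD('n)"
  shows "\<exists>C. \<forall>m. (LINT x|lborel. indicator (cball 0 R) x * dens (map (\<lambda>f. f m) fs) x) \<le> C"
  using assms
\<comment> \<open>Integration by parts strips the last factor, and the cut-off needs a larger ball
  for the remaining ones, so \<open>R\<close> must vary.\<close>
proof (induction fs arbitrary: R rule: rev_induct)
  case Nil
  show ?case by (intro exI[of _ "LINT x|lborel. indicator (cball 0 R) x * dens [] (x::complex^'n)"]) simp
next
  case (snoc f fs)
  let ?us = "\<lambda>m. map (\<lambda>f. f m) fs" and ?K = "real (2 * CARD('n)) ^ (2 * CARD('n))"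
  define \<rho> where "\<rho> = max R 0"
  define r where "r = \<rho> + 1"
  have r: "\<rho> \<ge> 0" "r > 0" "R \<le> \<rho>" by (auto simp: \<rho>_def r_def)
  define k where "k = CARD('n) - Suc (length fs)"
  \<comment> \<open>A cut-off times the constant form that completes the degree. Its pairing with
    the current is the integral of \<open>bump r\<close> against the density, and dd^c
    \<open>\<phi>\<close> is bounded independently of \<open>m\<close>.\<close>
  define \<phi> :: "'n form" where "\<phi> x vs = of_real (bump r x) * (beta ^^ k) one_form0 vs" for x vs
  have \<phi>0: "\<phi> x = (\<lambda>_. 0)" if "x \<notin> cball 0 r" for x
    using that r by (simp add: \<phi>_def[abs_def] bump_zero)
  have s\<phi>: "smooth_form \<phi>"
    unfolding \<phi>_def[abs_def] by (intro smooth_form_mult smooth_bump smooth_form_const)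
  have "\<phi> \<in> Cc_forms (2 * k)"
  proof (rule Cc_formsI[OF _ smooth_form_cont[OF s\<phi>] \<phi>0])
    show "alternating (2 * k) (\<phi> x)" for x
      unfolding \<phi>_def[abs_def] by (rule alternating_scale[OF alternating_beta_power])
  qed
  then have t\<phi>: "\<phi> \<in> test_forms (2 * k)"
    using s\<phi> by (simp add: test_forms_def smooth_form_def)
  have "(\<lambda>x vs. 1 * ddc \<phi> x vs) \<in> Cc_forms (2 * k + 2)"
    by (rule mult_ddc_in_Cc_forms[OF t\<phi>]) simp
  then have "ddc \<phi> \<in> Cc_forms (2 * k + 2)" by simp
  then obtain M where M: "M > 0" "bounded_form M (ddc \<phi>)" by (rule Cc_forms_bounded)
  have psd: "psd_smooth u" if "u \<in> set (?us m @ [f m])" for u m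
    using that snoc.prems(1) by (auto simp: psd_seq_def)
  obtain Cf where Cf: "\<And>m x. x \<in> cball 0 r \<Longrightarrow> norm (f m x) \<le> Cf"
    using snoc.prems(1)[of f] unfolding psd_seq_def by (metis list.set_intros(1) in_set_conv_decomp)
  have Cf0: "Cf \<ge> 0"
    using order_trans[OF norm_ge_zero Cf[of 0]] r by simp
  obtain D where D: "\<And>m. (LINT x|lborel. indicator (cball 0 r) x * dens (?us m) x) \<le> D"
    using snoc.IH[of r] snoc.prems by auto
  \<comment> \<open>The minimum of \<open>r\<^sup>2 - x \<bullet> x\<close> over the ball of radius
    \<open>\<rho>\<close>. It makes \<open>c\<close> below a positive lower bound of the cut-off
    there.\<close>
  define t0 where "t0 = r\<^sup>2 - \<rho>\<^sup>2"
  have t0: "t0 > 0" using r by (simp add: t0_def r_def power2_eq_square algebra_simps)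
  define c where "c = exp (- (1 / t0))"
  have c: "c \<le> bump r x" if "x \<in> cball 0 R" for x :: "complex^'n"
  proof -
    have "norm x \<le> \<rho>" using that r by simp
    then have "(norm x)\<^sup>2 \<le> \<rho>\<^sup>2" by (rule power_mono) simp
    then have "t0 \<le> r\<^sup>2 - x \<bullet> x" by (simp add: t0_def power2_norm_eq_inner)
    then show ?thesis
      using t0 by (simp add: bump_def expinv_def c_def frac_le)
  qed
  have main: "(LINT x|lborel. indicator (cball 0 R) x * dens (?us m @ [f m]) x) \<le> ?K * (Cf * M) * D / c" for m
  proof -
    let ?D = "dens (?us m @ [f m])"
    have len: "length (?us m @ [f m]) \<le> CARD('n)" using snoc.prems(2) by simp
    have psdm: "\<And>u. u \<in> set (?us m @ [f m]) \<Longrightarrow> psd_smooth u" using psd by blast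
    note dd = dens_dominates(1,2)[OF psdm len]
    have eq: "levis (?us m @ [f m]) \<phi> x std_frame = of_real (bump r x * ?D x)" for x
    proof -
      have "levis (?us m @ [f m]) \<phi> x std_frame
          = of_real (bump r x) * levis (?us m @ [f m]) (\<lambda>x. (beta ^^ k) one_form0) x std_frame"
        unfolding \<phi>_def[abs_def] levis_scale ..
      also have "k = CARD('n) - length (?us m @ [f m])" by (simp add: k_def)
      finally show ?thesis using dd(2)[of x] by simp
    qed
    have "integrable lborel (\<lambda>x. levis (?us m @ [f m]) \<phi> x std_frame)"
      by (rule cur_integrable[OF _ test_formsD(2)[OF t\<phi>]]) (rule psd_smoothD[OF psdm])
    from integrable_Re[OF this] have i: "integrable lborel (\<lambda>x. bump r x * ?D x)"
      unfolding eq by simp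
    have "c * (LINT x|lborel. indicator (cball 0 R) x * ?D x) = (LINT x|lborel. c * (indicator (cball 0 R) x * ?D x))"
      by simp
    also have "\<dots> \<le> (LINT x|lborel. bump r x * ?D x)"
    proof (rule integral_mono'[OF i])
      fix x
      show "0 \<le> bump r x * ?D x" by (intro mult_nonneg_nonneg bump_nonneg dd(1))
      then show "c * (indicator (cball 0 R) x * ?D x) \<le> bump r x * ?D x"
        using c[of x] dd(1)[of x] by (cases "x \<in> cball 0 R") (auto intro: mult_right_mono)
    qed
    also have "\<dots> = Re (cur (?us m @ [f m]) \<phi>)"
      unfolding cur_def eq integral_of_real[OF i] by (simp only: Re_complex_of_real)
    also have "\<dots> \<le> norm (cur (?us m) (\<lambda>x vs. f m x * ddc \<phi> x vs))"
    proof -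
      have "cur (?us m) (\<lambda>x vs. f m x * ddc \<phi> x vs) = cur (?us m @ [f m]) \<phi>"
        by (rule cur_ddc[OF _ _ t\<phi>]) (simp_all add: psd_smoothD psdm)
      then show ?thesis by (simp add: complex_Re_le_cmod)
    qed
    also have "\<dots> \<le> ?K * (Cf * M) * (LINT x|lborel. indicator (cball 0 r) x * dens (?us m) x)"
    proof (rule cur_bound)
      show "(\<lambda>vs. f m x * ddc \<phi> x vs) = (\<lambda>_. 0)" if "x \<notin> cball 0 r" for x
        using ddc_outside[OF s\<phi> compact_cball \<phi>0 that] by simp
      show "bounded_form (Cf * M) (\<lambda>x vs. f m x * ddc \<phi> x vs)"
        unfolding bounded_form_def
      proof (intro allI impI)
        fix x and vs :: "(complex^'n) list" assume "\<forall>v\<in>set vs. norm v \<le> 1"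
        then have "norm (ddc \<phi> x vs) \<le> M" using M(2) by (simp add: bounded_form_def)
        then show "norm (f m x * ddc \<phi> x vs) \<le> Cf * M"
        proof (cases "x \<in> cball 0 r")
          case True
          then show ?thesis
            unfolding norm_mult using Cf[OF True] Cf0 \<open>norm (ddc \<phi> x vs) \<le> M\<close> by (intro mult_mono) auto
        next
          case False
          then show ?thesis using ddc_outside[OF s\<phi> compact_cball \<phi>0 False] Cf0 M(1) by simp
        qed
      qed
      show "psd_smooth u" if "u \<in> set (?us m)" for u using psdm[of u] that by simp
      show "length (?us m) \<le> CARD('n)" using snoc.prems(2) by simp
    qed
    also have "\<dots> \<le> ?K * (Cf * M) * D"
      by (intro mult_left_mono D) (use Cf0 M(1) in auto)
    finally have "c * (LINT x|lborel. indicator (cball 0 R) x * ?D x) \<le> ?K * (Cf * M) * D" .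
    moreover have "c > 0" by (simp add: c_def)
    ultimately show ?thesis
      by (simp only: pos_le_divide_eq mult.commute[of _ c])
  qed
  then show ?case by auto
qed

lemma cur_uniformly_order_zero:
  fixes fs :: "(nat \<Rightarrow> complex^'n::finite \<Rightarrow> complex) list"
  assumes fs: "\<And>f. f \<in> set fs \<Longrightarrow> psd_seq f" "length fs \<le> CARD('n)"
  shows "uniformly_order_zero d (\<lambda>m. cur (map (\<lambda>f. f m) fs))"
proof -
  have psd: "psd_smooth u" if "u \<in> set (map (\<lambda>f. f m) fs)" for u m
    using that fs(1) by (auto simp: psd_seq_def)
  note s = psd_smoothD[OF psd]
  show ?thesis
    unfolding uniformly_order_zero_def
  proof (intro conjI allI ballI)
    show "cur (map (\<lambda>f. f m) fs) (\<lambda>x vs. \<omega> x vs + \<eta> x vs) = cur (map (\<lambda>f. f m) fs) \<omega> + cur (map (\<lambda>f. f m) fs) \<eta>"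
      if "\<omega> \<in> Cc_forms d" "\<eta> \<in> Cc_forms d" for m \<omega> \<eta>
      by (rule cur_add[OF s that])
    show "cur (map (\<lambda>f. f m) fs) (\<lambda>x vs. c * \<omega> x vs) = c * cur (map (\<lambda>f. f m) fs) \<omega>" for m c \<omega>
      by (rule cur_scale)
    fix R
    let ?K = "real (2 * CARD('n)) ^ (2 * CARD('n))"
    obtain D where D: "\<And>m. (LINT x|lborel. indicator (cball 0 R) x * dens (map (\<lambda>f. f m) fs) x) \<le> D"
      using mass_bound[OF fs, of R] by blast
    show "\<exists>C>0. \<forall>m. \<forall>\<omega>\<in>Cc_forms d. \<forall>M. (\<forall>x. x \<notin> cball 0 R \<longrightarrow> \<omega> x = (\<lambda>_. 0)) \<longrightarrow>
        bounded_form M \<omega> \<longrightarrow> norm (cur (map (\<lambda>f. f m) fs) \<omega>) \<le> C * M"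
    proof (intro exI[of _ "?K * max D 1"] conjI allI ballI impI)
      show "?K * max D 1 > 0" by simp
      fix m and \<omega> :: "'n form" and M
      assume \<omega>: "\<forall>x. x \<notin> cball 0 R \<longrightarrow> \<omega> x = (\<lambda>_. 0)" and M: "bounded_form M \<omega>"
      have M0: "M \<ge> 0"
        using M[unfolded bounded_form_def, rule_format, of "[]"] order_trans[OF norm_ge_zero] by auto
      have "norm (cur (map (\<lambda>f. f m) fs) \<omega>)
          \<le> ?K * M * (LINT x|lborel. indicator (cball 0 R) x * dens (map (\<lambda>f. f m) fs) x)"
        by (rule cur_bound[OF psd _ _ M]) (use \<omega> fs(2) in auto)
      also have "\<dots> \<le> ?K * M * max D 1"
        by (intro mult_left_mono) (use D[of m] M0 in auto)
      finally show "norm (cur (map (\<lambda>f. f m) fs) \<omega>) \<le> ?K * max D 1 * M"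
        by (simp add: mult_ac)
    qed
  qed
qed

definition unif_loc :: "(nat \<Rightarrow> complex^'n::finite \<Rightarrow> complex) \<Rightarrow> (complex^'n \<Rightarrow> real) \<Rightarrow> bool" where
  "unif_loc f u \<longleftrightarrow> (\<forall>R e. e > 0 \<longrightarrow> eventually (\<lambda>m. \<forall>x\<in>cball 0 R. norm (f m x - of_real (u x)) \<le> e) sequentially)"

lemma uniformly_order_zero_bound:
  assumes "uniformly_order_zero d T"
  obtains C where "C > 0" "\<And>m \<omega> M. \<omega> \<in> Cc_forms d \<Longrightarrow> (\<And>x. x \<notin> cball 0 R \<Longrightarrow> \<omega> x = (\<lambda>_. 0)) \<Longrightarrow>
    bounded_form M \<omega> \<Longrightarrow> norm (T m \<omega>) \<le> C * M"
proof -
  from assms[unfolded uniformly_order_zero_def, THEN conjunct2, THEN conjunct2, THEN spec, of R]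
  obtain C where C: "C > 0" "\<forall>m. \<forall>\<omega>\<in>Cc_forms d. \<forall>M. (\<forall>x. x \<notin> cball 0 R \<longrightarrow> \<omega> x = (\<lambda>_. 0)) \<longrightarrow>
        bounded_form M \<omega> \<longrightarrow> norm (T m \<omega>) \<le> C * M" by blast
  show ?thesis by (rule that[OF C(1)]) (use C(2) in simp)
qed

text \<open>Existence and approximation are proved together by induction on \<open>k\<close>. In
  \<open>f m dd^c \<phi>\<close>, split \<open>f m\<close> into \<open>u\<close> and
  \<open>f m - u\<close>: the first part converges by induction, the second tends to 0 because the
  masses are bounded and \<open>f m\<close> converges locally uniformly. The limit current has the
  values that \<open>ddc_wedge\<close> prescribes, and uniqueness identifies the two.\<close>

lemma ddc_power_limit:
  fixes u :: "complex^'n::finite \<Rightarrow> real"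
  assumes f: "psd_seq f" "unif_loc f u" and u: "continuous_on UNIV u" and "k \<le> CARD('n)"
  shows "order_zero_current (2 * CARD('n) - 2 * k) (ddc_power u k)"
    and "\<And>\<omega>. \<omega> \<in> Cc_forms (2 * CARD('n) - 2 * k) \<Longrightarrow> (\<lambda>m. cur (replicate k (f m)) \<omega>) \<longlonglongrightarrow> ddc_power u k \<omega>"
proof -
  have u0: "uniformly_order_zero d (\<lambda>m. cur (replicate k (f m)))" if "k \<le> CARD('n)" for d k
    using cur_uniformly_order_zero[of "replicate k f" d] f(1) that by auto
  have sf: "smooth_fun (f m)" for m using f(1) by (simp add: psd_seq_def psd_smoothD)
  have uc: "continuous_on UNIV (\<lambda>x. complex_of_real (u x))" using u by (intro continuous_intros)
  have "order_zero_current (2 * CARD('n) - 2 * k) (ddc_power u k) \<and>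
    (\<forall>\<omega>\<in>Cc_forms (2 * CARD('n) - 2 * k). (\<lambda>m. cur (replicate k (f m)) \<omega>) \<longlonglongrightarrow> ddc_power u k \<omega>)"
    using assms(4)
  proof (induction k)
    case 0
    obtain S where S: "order_zero_current (2 * CARD('n)) S"
      "\<And>\<omega>. \<omega> \<in> Cc_forms (2 * CARD('n)) \<Longrightarrow> (\<lambda>m. cur (replicate 0 (f m)) \<omega>) \<longlonglongrightarrow> S \<omega>"
      by (rule uniformly_order_zero_limit[OF u0[of 0 "2 * CARD('n)"]]) (auto intro: convergent_const)
    have "S \<omega> = integration_current \<omega>" for \<omega>
    proof (cases "\<omega> \<in> Cc_forms (2 * CARD('n))")
      case True
      then show ?thesis using S(2)[OF True] by (simp add: LIMSEQ_const_iff cur_def integration_current_def)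
    next
      case False
      then show ?thesis using order_zero_currentD(1)[OF S(1) False] by (simp add: integration_current_def)
    qed
    then have "S = ddc_power u 0" by auto
    then show ?case using S by auto
  next
    case (Suc k)
    define d where "d = 2 * CARD('n) - 2 * Suc k"
    \<comment> \<open>The subtraction is on natural numbers; the bound on \<open>Suc k\<close> keeps
      the degrees from being truncated.\<close>
    have d2: "d + 2 = 2 * CARD('n) - 2 * k" using Suc.prems by (simp add: d_def)
    let ?T = "ddc_power u k"
    have IH: "order_zero_current (d + 2) ?T"
      "\<And>\<omega>. \<omega> \<in> Cc_forms (d + 2) \<Longrightarrow> (\<lambda>m. cur (replicate k (f m)) \<omega>) \<longlonglongrightarrow> ?T \<omega>"
      using Suc unfolding d2 by auto
    have lim: "(\<lambda>m. cur (replicate (Suc k) (f m)) \<phi>) \<longlonglongrightarrow> ?T (\<lambda>x vs. of_real (u x) * ddc \<phi> x vs)"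
      if \<phi>: "\<phi> \<in> test_forms d" for \<phi>
    proof -
      let ?\<psi> = "\<lambda>x vs. complex_of_real (u x) * ddc \<phi> x vs"
      let ?\<delta> = "\<lambda>m x vs. (f m x - of_real (u x)) * ddc \<phi> x vs"
      have \<psi>: "?\<psi> \<in> Cc_forms (d + 2)" by (rule mult_ddc_in_Cc_forms[OF \<phi> uc])
      have \<delta>: "?\<delta> m \<in> Cc_forms (d + 2)" for m
        by (rule mult_ddc_in_Cc_forms[OF \<phi>]) (intro continuous_on_diff smooth_continuous sf uc)
      obtain R where R: "\<And>x. x \<notin> cball 0 R \<Longrightarrow> \<phi> x = (\<lambda>_. 0)"
        using Cc_formsD(3)[OF test_formsD(2)[OF \<phi>]] by blast
      note R' = ddc_outside[OF test_formsD(1)[OF \<phi>] compact_cball R]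
      have "(\<lambda>x vs. 1 * ddc \<phi> x vs) \<in> Cc_forms (d + 2)"
        by (rule mult_ddc_in_Cc_forms[OF \<phi>]) simp
      then have "ddc \<phi> \<in> Cc_forms (d + 2)" by simp
      then obtain M where M: "M > 0" "bounded_form M (ddc \<phi>)" by (rule Cc_forms_bounded)
      obtain C where C: "C > 0" "\<And>m \<omega> M. \<omega> \<in> Cc_forms (d + 2) \<Longrightarrow> (\<And>x. x \<notin> cball 0 R \<Longrightarrow> \<omega> x = (\<lambda>_. 0)) \<Longrightarrow>
          bounded_form M \<omega> \<Longrightarrow> norm (cur (replicate k (f m)) \<omega>) \<le> C * M"
        using uniformly_order_zero_bound[OF u0[of k "d + 2"], of R] Suc.prems by auto
      have eq: "cur (replicate (Suc k) (f m)) \<phi> = cur (replicate k (f m)) ?\<psi> + cur (replicate k (f m)) (?\<delta> m)" for m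
      proof -
        have "cur (replicate (Suc k) (f m)) \<phi> = cur (replicate k (f m) @ [f m]) \<phi>"
          by (simp only: replicate_append_same replicate_Suc)
        also have "\<dots> = cur (replicate k (f m)) (\<lambda>x vs. f m x * ddc \<phi> x vs)"
          by (rule cur_ddc[symmetric, OF _ _ \<phi>]) (use sf in auto)
        also have "(\<lambda>x vs. f m x * ddc \<phi> x vs) = (\<lambda>x vs. ?\<psi> x vs + ?\<delta> m x vs)"
          by (simp add: algebra_simps)
        also have "cur (replicate k (f m)) (\<lambda>x vs. ?\<psi> x vs + ?\<delta> m x vs)
            = cur (replicate k (f m)) ?\<psi> + cur (replicate k (f m)) (?\<delta> m)"
          by (rule cur_add[OF _ \<psi> \<delta>]) (use sf in auto)
        finally show ?thesis .
      qed
      have "(\<lambda>m. cur (replicate k (f m)) (?\<delta> m)) \<longlonglongrightarrow> 0"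
      proof (rule LIMSEQ_I)
        fix e :: real assume e: "e > 0"
        define e' where "e' = e / (2 * C * M)"
        have e': "e' > 0" using e C(1) M(1) by (simp add: e'_def)
        from f(2)[unfolded unif_loc_def, rule_format, OF e', of R]
        obtain N where N: "\<And>m x. m \<ge> N \<Longrightarrow> x \<in> cball 0 R \<Longrightarrow> norm (f m x - of_real (u x)) \<le> e'"
          unfolding eventually_sequentially by blast
        show "\<exists>N. \<forall>m\<ge>N. norm (cur (replicate k (f m)) (?\<delta> m) - 0) < e"
        proof (intro exI[of _ N] allI impI)
          fix m assume m: "m \<ge> N"
          have "norm (cur (replicate k (f m)) (?\<delta> m)) \<le> C * (e' * M)"
          proof (rule C(2)[OF \<delta>])
            show "(\<lambda>vs. (f m x - of_real (u x)) * ddc \<phi> x vs) = (\<lambda>_. 0)" if "x \<notin> cball 0 R" for x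
              using R'[OF _ that] by simp
            show "bounded_form (e' * M) (?\<delta> m)"
              unfolding bounded_form_def
            proof (intro allI impI)
              fix x and vs :: "(complex^'n) list" assume "\<forall>v\<in>set vs. norm v \<le> 1"
              then have b: "norm (ddc \<phi> x vs) \<le> M" using M(2) by (simp add: bounded_form_def)
              show "norm ((f m x - of_real (u x)) * ddc \<phi> x vs) \<le> e' * M"
              proof (cases "x \<in> cball 0 R")
                case True
                show ?thesis unfolding norm_mult using N[OF m True] b e' by (intro mult_mono) auto
              next
                case False
                then show ?thesis using R'[OF _ False] e' M(1) by simp
              qed
            qed
          qed
          also have "C * (e' * M) < e" using C(1) M(1) e by (simp add: e'_def)
          finally show "norm (cur (replicate k (f m)) (?\<delta> m) - 0) < e" by simp
        qed
      qed
      from tendsto_add[OF IH(2)[OF \<psi>] this] show ?thesis unfolding eq by simp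
    qed
    obtain S where S: "order_zero_current d S"
      "\<And>\<omega>. \<omega> \<in> Cc_forms d \<Longrightarrow> (\<lambda>m. cur (replicate (Suc k) (f m)) \<omega>) \<longlonglongrightarrow> S \<omega>"
      by (rule uniformly_order_zero_limit[OF u0[OF Suc.prems, of d]]) (use lim in \<open>auto simp: convergent_def\<close>)
    have S\<phi>: "S \<phi> = ?T (\<lambda>x vs. of_real (u x) * ddc \<phi> x vs)" if "\<phi> \<in> test_forms d" for \<phi>
      using LIMSEQ_unique[OF S(2)[OF test_formsD(2)[OF that]] lim[OF that]] .
    have "ddc_wedge d u ?T = S"
      unfolding ddc_wedge_def
    proof (rule the_equality)
      show "order_zero_current d S \<and> (\<forall>\<phi>\<in>test_forms d. S \<phi> = ?T (\<lambda>x vs. of_real (u x) * ddc \<phi> x vs))"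
        using S(1) S\<phi> by blast
      show "S' = S" if "order_zero_current d S' \<and> (\<forall>\<phi>\<in>test_forms d. S' \<phi> = ?T (\<lambda>x vs. of_real (u x) * ddc \<phi> x vs))" for S'
        by (rule order_zero_current_unique[of d]) (use that S(1) S\<phi> in auto)
    qed
    then have "ddc_power u (Suc k) = S" by (simp add: d_def)
    then show ?case using S by (simp add: d_def)
  qed
  then show "order_zero_current (2 * CARD('n) - 2 * k) (ddc_power u k)"
    "\<And>\<omega>. \<omega> \<in> Cc_forms (2 * CARD('n) - 2 * k) \<Longrightarrow> (\<lambda>m. cur (replicate k (f m)) \<omega>) \<longlonglongrightarrow> ddc_power u k \<omega>"
    by auto
qed

definition convex_lipschitz :: "real \<Rightarrow> (complex^'n::finite \<Rightarrow> real) \<Rightarrow> bool" where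
  "convex_lipschitz L u \<longleftrightarrow> convex_on UNIV u \<and> (\<forall>x y. \<bar>u x - u y\<bar> \<le> L * dist x y)"

lemma convex_lipschitz_continuous:
  assumes "convex_lipschitz L u"
  shows "continuous_on UNIV u"
proof -
  have "(max L 0)-lipschitz_on UNIV u"
  proof (rule lipschitz_onI)
    fix x y
    have "dist (u x) (u y) \<le> L * dist x y"
      using assms by (simp add: convex_lipschitz_def dist_real_def)
    also have "\<dots> \<le> max L 0 * dist x y" by (rule mult_right_mono) auto
    finally show "dist (u x) (u y) \<le> max L 0 * dist x y" .
  qed simp
  then show ?thesis by (rule lipschitz_on_continuous_on)
qed

definition mseq :: "(complex^'n::finite \<Rightarrow> real) \<Rightarrow> nat \<Rightarrow> complex^'n \<Rightarrow> complex" where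
  "mseq u m = mollify m (\<lambda>x. of_real (u x))"

text \<open>A global Lipschitz bound gives convergence at rate 1/m, uniformly on the whole space.
  The rate itself, not just the convergence, is what controls the mixed terms later.\<close>

lemma mseq_close:
  assumes "\<And>x y. \<bar>u x - u y\<bar> \<le> L * dist x y" "continuous_on UNIV u" "L \<ge> 0"
  shows "norm (mseq u m x - of_real (u x)) \<le> L * inverse (real (Suc m))"
  unfolding mseq_def
proof (rule mollify_close)
  show "continuous_on UNIV (\<lambda>x. complex_of_real (u x))" using assms(2) by (intro continuous_intros)
  fix y assume "dist x y \<le> inverse (real (Suc m))"
  then have "L * dist x y \<le> L * inverse (real (Suc m))" using assms(3) by (rule mult_left_mono)
  then show "norm (complex_of_real (u x) - complex_of_real (u y)) \<le> L * inverse (real (Suc m))"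
    using assms(1)[of x y] by (simp flip: of_real_diff)
qed

lemma mseq_convex_lipschitz:
  assumes "convex_lipschitz L u"
  shows "psd_seq (mseq u)" "unif_loc (mseq u) u"
proof -
  have L: "\<bar>u x - u y\<bar> \<le> max L 0 * dist x y" for x y
  proof -
    have "\<bar>u x - u y\<bar> \<le> L * dist x y" using assms by (simp add: convex_lipschitz_def)
    also have "\<dots> \<le> max L 0 * dist x y" by (rule mult_right_mono) auto
    finally show ?thesis .
  qed
  note c = convex_lipschitz_continuous[OF assms]
  have close: "norm (mseq u m x - of_real (u x)) \<le> max L 0 * inverse (real (Suc m))" for m x
    by (rule mseq_close[OF L c]) simp
  show "psd_seq (mseq u)"
    unfolding psd_seq_def
  proof (intro conjI allI)
    show "psd_smooth (mseq u m)" for m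
      unfolding mseq_def by (rule psd_smooth_mollify[OF _ c]) (use assms in \<open>simp add: convex_lipschitz_def\<close>)
    fix R
    have "norm (mseq u m x) \<le> max L 0 + (\<bar>u 0\<bar> + max L 0 * R)" if "x \<in> cball 0 R" for m x
    proof -
      have "max L 0 * inverse (real (Suc m)) \<le> max L 0 * 1"
        by (rule mult_left_mono) (auto simp: field_simps)
      moreover have "\<bar>u x\<bar> \<le> \<bar>u 0\<bar> + max L 0 * R"
      proof -
        have "max L 0 * dist x 0 \<le> max L 0 * R" by (rule mult_left_mono) (use that in auto)
        then show ?thesis using L[of x 0] by linarith
      qed
      moreover have "norm (mseq u m x) \<le> norm (mseq u m x - of_real (u x)) + \<bar>u x\<bar>"
        using norm_triangle_ineq[of "mseq u m x - of_real (u x)" "of_real (u x)"] by simp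
      ultimately show ?thesis using close[of m x] by linarith
    qed
    then show "\<exists>C. \<forall>m. \<forall>x\<in>cball 0 R. norm (mseq u m x) \<le> C" by blast
  qed
  show "unif_loc (mseq u) u"
    unfolding unif_loc_def
  proof (intro allI impI)
    fix R e :: real assume "e > 0"
    have "(\<lambda>m. max L 0 * inverse (real (Suc m))) \<longlonglongrightarrow> 0"
      by (intro tendsto_mult_right_zero LIMSEQ_inverse_real_of_nat)
    from order_tendstoD(2)[OF this \<open>e > 0\<close>]
    show "eventually (\<lambda>m. \<forall>x\<in>cball 0 R. norm (mseq u m x - of_real (u x)) \<le> e) sequentially"
    proof eventually_elim
      case (elim m)
      show ?case
      proof
        fix x
        show "norm (mseq u m x - of_real (u x)) \<le> e" using close[of m x] elim by linarith
      qed
    qed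
  qed
qed

section \<open>The Riesz representation theorem\<close>

definition Cc_fun :: "('a::euclidean_space \<Rightarrow> real) set" where
  "Cc_fun = {f. continuous_on UNIV f \<and> (\<exists>R. \<forall>x. x \<notin> cball 0 R \<longrightarrow> f x = 0)}"

lemma Cc_funI: "continuous_on UNIV f \<Longrightarrow> (\<And>x. x \<notin> cball 0 R \<Longrightarrow> f x = 0) \<Longrightarrow> f \<in> Cc_fun"
  unfolding Cc_fun_def by blast

lemma Cc_fun_cont: "f \<in> Cc_fun \<Longrightarrow> continuous_on UNIV f"
  by (simp add: Cc_fun_def)

lemma Cc_fun_supp: "f \<in> Cc_fun \<Longrightarrow> \<exists>R>0. \<forall>x. x \<notin> cball 0 R \<longrightarrow> f x = 0"
proof -
  assume "f \<in> Cc_fun"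
  then obtain R where "\<forall>x. x \<notin> cball 0 R \<longrightarrow> f x = 0" by (auto simp: Cc_fun_def)
  then show ?thesis by (intro exI[of _ "max R 1"]) auto
qed

lemma Cc_fun_mult:
  assumes "f \<in> Cc_fun" "continuous_on UNIV g"
  shows "(\<lambda>x. f x * g x) \<in> Cc_fun"
proof -
  obtain R where R: "\<forall>x. x \<notin> cball 0 R \<longrightarrow> f x = 0" using Cc_fun_supp[OF assms(1)] by blast
  show ?thesis
  proof (rule Cc_funI[of _ R])
    show "continuous_on UNIV (\<lambda>x. f x * g x)"
      by (intro continuous_on_mult Cc_fun_cont[OF assms(1)] assms(2))
    show "f x * g x = 0" if "x \<notin> cball 0 R" for x using R that by simp
  qed
qed

lemma Cc_fun_add:
  assumes "f \<in> Cc_fun" "g \<in> Cc_fun"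
  shows "(\<lambda>x. f x + g x) \<in> Cc_fun"
proof -
  obtain R where R: "\<forall>x. x \<notin> cball 0 R \<longrightarrow> f x = 0" using Cc_fun_supp[OF assms(1)] by blast
  obtain S where S: "\<forall>x. x \<notin> cball 0 S \<longrightarrow> g x = 0" using Cc_fun_supp[OF assms(2)] by blast
  show ?thesis
  proof (rule Cc_funI[of _ "max R S"])
    show "continuous_on UNIV (\<lambda>x. f x + g x)"
      by (intro continuous_on_add Cc_fun_cont assms)
    show "f x + g x = 0" if "x \<notin> cball 0 (max R S)" for x using R S that by simp
  qed
qed

lemma Cc_fun_scale: "f \<in> Cc_fun \<Longrightarrow> (\<lambda>x. c * f x) \<in> Cc_fun"
  using Cc_fun_mult[of f "\<lambda>_. c"] by (simp add: mult.commute)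

lemma Cc_fun_sum: "(\<And>i. i \<in> I \<Longrightarrow> f i \<in> Cc_fun) \<Longrightarrow> (\<lambda>x. \<Sum>i\<in>I. f i x) \<in> Cc_fun"
proof (induction I rule: infinite_finite_induct)
  case (insert i I)
  then show ?case by (simp add: Cc_fun_add)
qed (auto simp: Cc_fun_def)

lemma Cc_fun_dominated:
  assumes "g \<in> Cc_fun" "continuous_on UNIV f" "\<And>x. g x = 0 \<Longrightarrow> f x = 0"
  shows "f \<in> Cc_fun"
proof -
  obtain R where R: "\<forall>x. x \<notin> cball 0 R \<longrightarrow> g x = 0" using Cc_fun_supp[OF assms(1)] by blast
  show ?thesis by (rule Cc_funI[OF assms(2)]) (use R assms(3) in blast)
qed

definition cutoff :: "real \<Rightarrow> 'a::euclidean_space \<Rightarrow> real" where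
  "cutoff R x = max 0 (min 1 (R + 1 - norm x))"

lemma cutoff:
  "cutoff R \<in> Cc_fun" "0 \<le> cutoff R x" "cutoff R x \<le> 1" "norm x \<le> R \<Longrightarrow> cutoff R x = 1"
proof -
  show "cutoff R \<in> Cc_fun"
    unfolding cutoff_def[abs_def] by (rule Cc_funI[of _ "R + 1"]) (auto intro!: continuous_intros)
qed (auto simp: cutoff_def)

section \<open>The outer measure of a positive functional\<close>

locale positive_functional =
  fixes \<Lambda> :: "('a::euclidean_space \<Rightarrow> real) \<Rightarrow> real"
  assumes add: "\<And>f g. f \<in> Cc_fun \<Longrightarrow> g \<in> Cc_fun \<Longrightarrow> \<Lambda> (\<lambda>x. f x + g x) = \<Lambda> f + \<Lambda> g"
    and scale: "\<And>c f. f \<in> Cc_fun \<Longrightarrow> \<Lambda> (\<lambda>x. c * f x) = c * \<Lambda> f"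
    and nonneg: "\<And>f. f \<in> Cc_fun \<Longrightarrow> (\<And>x. 0 \<le> f x) \<Longrightarrow> 0 \<le> \<Lambda> f"
begin

lemma zero: "\<Lambda> (\<lambda>x. 0) = 0"
  using scale[of "\<lambda>x. 0" 0] by (simp add: Cc_fun_def)

lemma diff: "f \<in> Cc_fun \<Longrightarrow> g \<in> Cc_fun \<Longrightarrow> \<Lambda> (\<lambda>x. f x - g x) = \<Lambda> f - \<Lambda> g"
  using add[of f "\<lambda>x. (-1) * g x"] scale[of g "-1"] Cc_fun_scale[of g "-1"] by simp

lemma mono:
  assumes "f \<in> Cc_fun" "g \<in> Cc_fun" "\<And>x. f x \<le> g x"
  shows "\<Lambda> f \<le> \<Lambda> g"
proof -
  have "(\<lambda>x. g x + (-1) * f x) \<in> Cc_fun" by (intro Cc_fun_add Cc_fun_scale assms)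
  then have "(\<lambda>x. g x - f x) \<in> Cc_fun" by simp
  from nonneg[OF this] assms show ?thesis by (simp add: diff)
qed

lemma sum: "(\<And>i. i \<in> I \<Longrightarrow> f i \<in> Cc_fun) \<Longrightarrow> \<Lambda> (\<lambda>x. \<Sum>i\<in>I. f i x) = (\<Sum>i\<in>I. \<Lambda> (f i))"
proof (induction I rule: infinite_finite_induct)
  case (insert i I)
  then show ?case by (simp add: add Cc_fun_sum)
qed (auto simp: zero)

text \<open>A Daniell type construction: sets are covered by series of non-negative continuous
  functions that sum to at least 1 on them. Countable subadditivity becomes a rearrangement of
  double series, with sums in \<open>ennreal\<close> as they may diverge.\<close>

definition covers :: "'a set \<Rightarrow> (nat \<Rightarrow> 'a \<Rightarrow> real) set" where
  "covers E = {F. (\<forall>i. F i \<in> Cc_fun \<and> (\<forall>x. 0 \<le> F i x)) \<and> (\<forall>x\<in>E. 1 \<le> (\<Sum>i. ennreal (F i x)))}"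

definition outer :: "'a set \<Rightarrow> ennreal" where
  "outer E = (INF F\<in>covers E. \<Sum>i. ennreal (\<Lambda> (F i)))"

lemma coversD:
  assumes "F \<in> covers E"
  shows "F i \<in> Cc_fun" "0 \<le> F i x" "x \<in> E \<Longrightarrow> 1 \<le> (\<Sum>i. ennreal (F i x))"
  using assms by (auto simp: covers_def)

lemma outer_le: "F \<in> covers E \<Longrightarrow> outer E \<le> (\<Sum>i. ennreal (\<Lambda> (F i)))"
  unfolding outer_def by (rule INF_lower)

lemma outer_single:
  assumes "f \<in> Cc_fun" "\<And>x. 0 \<le> f x" "\<And>x. x \<in> E \<Longrightarrow> 1 \<le> f x"
  shows "outer E \<le> ennreal (\<Lambda> f)"
proof -
  let ?F = "\<lambda>i::nat. if i = 0 then f else (\<lambda>x. 0)"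
  have s: "(\<Sum>i. ennreal (?F i x)) = ennreal (f x)" for x
    by (subst suminf_finite[of "{0}"]) auto
  have "?F \<in> covers E"
    unfolding covers_def using assms s by (auto simp: Cc_fun_def)
  from outer_le[OF this] have "outer E \<le> (\<Sum>i. ennreal (\<Lambda> (?F i)))" .
  also have "\<dots> = ennreal (\<Lambda> f)"
    by (subst suminf_finite[of "{0}"]) (auto simp: zero)
  finally show ?thesis .
qed

lemma outer_empty: "outer {} = 0"
  using outer_single[of "\<lambda>x. 0" "{}"] by (simp add: zero Cc_fun_def)

lemma outer_mono: "A \<subseteq> B \<Longrightarrow> outer A \<le> outer B"
  unfolding outer_def by (rule INF_superset_mono) (auto simp: covers_def)

lemma outer_countably_subadditive: "outer (\<Union>i. A i) \<le> (\<Sum>i. outer (A i))"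
proof (cases "(\<Sum>i. outer (A i)) = top")
  case False
  then have fin: "outer (A i) \<noteq> top" for i
    using sum_le_suminf[of "\<lambda>i. outer (A i)" "{i}"] by (auto simp: top_unique)
  show ?thesis
  proof (rule ennreal_le_epsilon)
    fix e :: real assume e: "0 < e"
    have "\<exists>F\<in>covers (A i). (\<Sum>j. ennreal (\<Lambda> (F j))) \<le> outer (A i) + ennreal (e * (1 / 2) ^ Suc i)" for i
    proof (rule ccontr)
      assume "\<not> ?thesis"
      then have "outer (A i) + ennreal (e * (1 / 2) ^ Suc i) \<le> outer (A i)"
        unfolding outer_def[of "A i"] by (intro INF_greatest) (auto simp: outer_def)
      then have "outer (A i) + ennreal (e * (1 / 2) ^ Suc i) \<le> outer (A i) + 0" by simp
      then have "ennreal (e * (1 / 2) ^ Suc i) \<le> 0"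
        using fin[of i] unfolding ennreal_add_left_cancel_le by simp
      moreover have "0 < e * (1 / 2) ^ Suc i" using e by simp
      ultimately show False by (simp add: ennreal_eq_0_iff)
    qed
    then obtain F where F: "\<And>i. F i \<in> covers (A i)"
      "\<And>i. (\<Sum>j. ennreal (\<Lambda> (F i j))) \<le> outer (A i) + ennreal (e * (1 / 2) ^ Suc i)"
      by metis
    let ?G = "\<lambda>n. case_prod F (prod_decode n)"
    have "?G \<in> covers (\<Union>i. A i)"
      unfolding covers_def
    proof (intro CollectI conjI allI ballI)
      show "?G n \<in> Cc_fun" "0 \<le> ?G n x" for n x
        using coversD[OF F(1)] by (auto simp: split_beta)
      fix x assume "x \<in> (\<Union>i. A i)"
      then obtain i where i: "x \<in> A i" by blast
      have "1 \<le> (\<Sum>j. ennreal (F i j x))" using coversD(3)[OF F(1) i] .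
      also have "\<dots> \<le> (\<Sum>i. \<Sum>j. ennreal (F i j x))"
        using sum_le_suminf[of "\<lambda>i. \<Sum>j. ennreal (F i j x)" "{i}"] by simp
      also have "\<dots> = (\<Sum>n. (\<lambda>(i, j). ennreal (F i j x)) (prod_decode n))"
        by (rule suminf_ennreal_2dimen[symmetric]) simp
      finally show "1 \<le> (\<Sum>n. ennreal (?G n x))" by (simp add: split_beta)
    qed
    from outer_le[OF this] have "outer (\<Union>i. A i) \<le> (\<Sum>n. (\<lambda>(i, j). ennreal (\<Lambda> (F i j))) (prod_decode n))"
      by (simp add: split_beta)
    also have "\<dots> = (\<Sum>i. \<Sum>j. ennreal (\<Lambda> (F i j)))"
      by (rule suminf_ennreal_2dimen) simp
    also have "\<dots> \<le> (\<Sum>i. outer (A i) + ennreal (e * (1 / 2) ^ Suc i))"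
      by (intro suminf_le F(2)) auto
    also have "\<dots> = (\<Sum>i. outer (A i)) + (\<Sum>i. ennreal (e * (1 / 2) ^ Suc i))"
      by (rule suminf_add[symmetric]) auto
    also have "(\<Sum>i. ennreal (e * (1 / 2) ^ Suc i)) = ennreal e"
      using e sums_mult[OF power_half_series, of e] by (intro suminf_ennreal_eq) auto
    finally show "outer (\<Union>i. A i) \<le> (\<Sum>i. outer (A i)) + ennreal e" .
  qed
qed simp

lemma outer_measure_space: "outer_measure_space UNIV outer"
  unfolding outer_measure_space_def positive_def increasing_def countably_subadditive_def
  by (auto simp: outer_empty outer_mono outer_countably_subadditive)

text \<open>Caratheodory's condition for open \<open>G\<close>. The functions \<open>H k\<close>
  increase to the indicator of \<open>G\<close> and vanish off \<open>G\<close>. For a cover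
  \<open>F\<close>, the products with \<open>1 - H k\<close> cover \<open>E - G\<close> for each
  \<open>k\<close>, while the products with the increments of \<open>H\<close> jointly cover
  \<open>E \<inter> G\<close> at a cost equal to the supremum of the costs \<open>a k\<close>. Since
  \<open>a k + b k\<close> is the cost of \<open>F\<close>, the two parts together cost no more than
  \<open>F\<close>.\<close>

lemma outer_open_split:
  assumes "open G"
  shows "outer (E \<inter> G) + outer (E - G) \<le> outer E"
\<comment> \<open>The distance to the empty set is 0 by convention, so \<open>h\<close> would not
  detect membership in \<open>G = UNIV\<close>.\<close>
proof (cases "G = UNIV")
  case True
  then show ?thesis by (simp add: outer_empty)
next
  case False
  define h where "h x = infdist x (- G)" for x
  have ch: "continuous_on UNIV h"
    unfolding h_def[abs_def] by (rule continuous_on_infdist) (rule continuous_on_id)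
  have h0: "h x \<ge> 0" for x by (simp add: h_def infdist_nonneg)
  have hG: "h x = 0 \<longleftrightarrow> x \<notin> G" for x
    using in_closed_iff_infdist_zero[of "- G" x] assms False by (auto simp: h_def)
  define H where "H k x = min 1 (real k * h x)" for k x
  have cH: "continuous_on UNIV (H k)" for k
    unfolding H_def[abs_def] by (intro continuous_intros ch)
  have H: "0 \<le> H k x" "H k x \<le> 1" "H k x \<le> H (Suc k) x" "H 0 x = 0" for k x
    using h0[of x] by (auto simp: H_def algebra_simps intro: min.coboundedI2)
  have "outer (E \<inter> G) + outer (E - G) \<le> (\<Sum>i. ennreal (\<Lambda> (F i)))" if F: "F \<in> covers E" for F
  proof -
    note Fc = coversD(1)[OF F] and F0 = coversD(2)[OF F] and F1 = coversD(3)[OF F]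
    define a where "a k = (\<Sum>i. ennreal (\<Lambda> (\<lambda>x. F i x * H k x)))" for k
    define b where "b k = (\<Sum>i. ennreal (\<Lambda> (\<lambda>x. F i x * (1 - H k x))))" for k
    have c1: "(\<lambda>x. F i x * H k x) \<in> Cc_fun" and c2: "(\<lambda>x. F i x * (1 - H k x)) \<in> Cc_fun"
      and c3: "(\<lambda>x. F i x * (H (Suc k) x - H k x)) \<in> Cc_fun" for i k
      by (intro Cc_fun_mult Fc continuous_intros cH)+
    have n1: "0 \<le> \<Lambda> (\<lambda>x. F i x * H k x)" and n2: "0 \<le> \<Lambda> (\<lambda>x. F i x * (1 - H k x))"
      and n3: "0 \<le> \<Lambda> (\<lambda>x. F i x * (H (Suc k) x - H k x))" for i k
      using F0 H by (auto intro!: nonneg c1 c2 c3 mult_nonneg_nonneg)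
    have ab: "a k + b k = (\<Sum>i. ennreal (\<Lambda> (F i)))" for k
    proof -
      have "a k + b k = (\<Sum>i. ennreal (\<Lambda> (\<lambda>x. F i x * H k x)) + ennreal (\<Lambda> (\<lambda>x. F i x * (1 - H k x))))"
        unfolding a_def b_def by (rule suminf_add) auto
      also have "\<dots> = (\<Sum>i. ennreal (\<Lambda> (F i)))"
      proof (rule suminf_cong)
        fix i
        have "\<Lambda> (F i) = \<Lambda> (\<lambda>x. F i x * H k x + F i x * (1 - H k x))" by (simp add: algebra_simps)
        also have "\<dots> = \<Lambda> (\<lambda>x. F i x * H k x) + \<Lambda> (\<lambda>x. F i x * (1 - H k x))" by (rule add[OF c1 c2])
        finally show "ennreal (\<Lambda> (\<lambda>x. F i x * H k x)) + ennreal (\<Lambda> (\<lambda>x. F i x * (1 - H k x))) = ennreal (\<Lambda> (F i))"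
          using n1 n2 by (simp add: ennreal_plus)
      qed
      finally show ?thesis .
    qed
    have b: "outer (E - G) \<le> b k" for k
      unfolding b_def
    proof (rule outer_le)
      have "H k x = 0" if "x \<notin> G" for x using hG[of x] that by (simp add: H_def)
      then show "(\<lambda>i x. F i x * (1 - H k x)) \<in> covers (E - G)"
        unfolding covers_def using c2 F0 H F1 by auto
    qed
    have a: "outer (E \<inter> G) \<le> (SUP k. a k)"
    proof -
      let ?P = "\<lambda>(i, k) x. F i x * (H (Suc k) x - H k x)"
      have tele: "(\<Sum>k. ennreal (F i x * (H (Suc k) x - H k x))) \<ge> ennreal (F i x)" if "x \<in> G" for i x
      proof -
        have "h x > 0" using hG[of x] that h0[of x] by (simp add: less_le)
        then obtain n where "real n * h x \<ge> 1"
          using reals_Archimedean3[of "h x"] less_imp_le by blast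
        then have n: "H n x = 1" by (simp add: H_def)
        have "(\<Sum>k<n. F i x * (H (Suc k) x - H k x)) = F i x"
          unfolding sum_distrib_left[symmetric] sum_lessThan_telescope[of "\<lambda>k. H k x" n] by (simp add: n H(4))
        then have "ennreal (F i x) = (\<Sum>k<n. ennreal (F i x * (H (Suc k) x - H k x)))"
          using F0 H by (subst sum_ennreal) auto
        also have "\<dots> \<le> (\<Sum>k. ennreal (F i x * (H (Suc k) x - H k x)))"
          by (rule sum_le_suminf) auto
        finally show ?thesis .
      qed
      have "(\<lambda>n. ?P (prod_decode n)) \<in> covers (E \<inter> G)"
        unfolding covers_def
      proof (intro CollectI conjI allI ballI)
        show "?P (prod_decode n) \<in> Cc_fun" "0 \<le> ?P (prod_decode n) x" for n x
          using c3 F0 H by (auto simp: split_beta)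
        fix x assume x: "x \<in> E \<inter> G"
        have "1 \<le> (\<Sum>i. ennreal (F i x))" using F1 x by blast
        also have "\<dots> \<le> (\<Sum>i. \<Sum>k. ennreal (F i x * (H (Suc k) x - H k x)))"
          by (intro suminf_le tele) (use x in auto)
        also have "\<dots> = (\<Sum>n. (\<lambda>(i, k). ennreal (F i x * (H (Suc k) x - H k x))) (prod_decode n))"
          by (rule suminf_ennreal_2dimen[symmetric]) simp
        finally show "1 \<le> (\<Sum>n. ennreal (?P (prod_decode n) x))" by (simp add: split_beta)
      qed
      from outer_le[OF this] have "outer (E \<inter> G)
          \<le> (\<Sum>n. (\<lambda>(i, k). ennreal (\<Lambda> (\<lambda>x. F i x * (H (Suc k) x - H k x)))) (prod_decode n))"
        by (simp add: split_beta)
      also have "\<dots> = (\<Sum>i. \<Sum>k. ennreal (\<Lambda> (\<lambda>x. F i x * (H (Suc k) x - H k x))))"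
        by (rule suminf_ennreal_2dimen) simp
      also have "\<dots> = (\<Sum>i. SUP n. ennreal (\<Lambda> (\<lambda>x. F i x * H n x)))"
      proof (rule suminf_cong)
        fix i
        have "(\<Sum>k<n. ennreal (\<Lambda> (\<lambda>x. F i x * (H (Suc k) x - H k x)))) = ennreal (\<Lambda> (\<lambda>x. F i x * H n x))" for n
        proof -
          have "(\<Sum>k<n. \<Lambda> (\<lambda>x. F i x * (H (Suc k) x - H k x))) = \<Lambda> (\<lambda>x. \<Sum>k<n. F i x * (H (Suc k) x - H k x))"
            by (rule sum[symmetric]) (rule c3)
          also have "\<dots> = \<Lambda> (\<lambda>x. F i x * H n x)"
            unfolding sum_distrib_left[symmetric] sum_lessThan_telescope[of "\<lambda>k. H k _" n] by (simp add: H(4))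
          finally show ?thesis using n3 by (subst sum_ennreal) auto
        qed
        then show "(\<Sum>k. ennreal (\<Lambda> (\<lambda>x. F i x * (H (Suc k) x - H k x)))) = (SUP n. ennreal (\<Lambda> (\<lambda>x. F i x * H n x)))"
          by (subst suminf_eq_SUP) simp
      qed
      also have "\<dots> = (SUP n. \<Sum>i. ennreal (\<Lambda> (\<lambda>x. F i x * H n x)))"
      proof (rule ennreal_suminf_SUP_eq, rule incseq_SucI, rule ennreal_leI)
        show "\<Lambda> (\<lambda>x. F i x * H n x) \<le> \<Lambda> (\<lambda>x. F i x * H (Suc n) x)" for i n
          using F0 H by (intro mono c1) (auto intro: mult_left_mono)
      qed
      finally show ?thesis by (simp add: a_def)
    qed
    have "outer (E \<inter> G) + outer (E - G) \<le> (SUP k. a k) + outer (E - G)"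
      using a by (rule add_right_mono)
    also have "\<dots> = (SUP k. a k + outer (E - G))"
      by (rule ennreal_SUP_add_left[symmetric]) simp
    also have "\<dots> \<le> (\<Sum>i. ennreal (\<Lambda> (F i)))"
    proof (rule SUP_least)
      fix k
      have "a k + outer (E - G) \<le> a k + b k" using b by (rule add_left_mono)
      then show "a k + outer (E - G) \<le> (\<Sum>i. ennreal (\<Lambda> (F i)))" using ab by simp
    qed
    finally show ?thesis .
  qed
  then show ?thesis
    unfolding outer_def[of E] by (intro INF_greatest) auto
qed

definition riesz :: "'a measure" where
  "riesz = measure_of UNIV (sets borel) outer"

lemma sets_riesz [simp]: "sets riesz = sets borel"
  unfolding riesz_def using sets.sigma_sets_eq[of borel] by simp

lemma space_riesz [simp]: "space riesz = UNIV"
  by (simp add: riesz_def)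

text \<open>Open sets satisfy Caratheodory's condition, by \<open>outer_open_split\<close> and
  subadditivity. The sets satisfying it form a sigma-algebra on which \<open>outer\<close> is
  countably additive, so this holds on all Borel sets.\<close>

lemma emeasure_riesz:
  assumes "E \<in> sets borel"
  shows "emeasure riesz E = outer E"
proof -
  interpret P: sigma_algebra UNIV "UNIV :: 'a set set"
    using sigma_algebra_Pow[of "UNIV :: 'a set"] by simp
  let ?L = "lambda_system UNIV UNIV outer"
  have ms: "measure_space UNIV ?L outer"
    by (rule P.caratheodory_lemma[OF outer_measure_space])
  then have sa: "sigma_algebra UNIV ?L" by (simp add: measure_space_def)
  have "G \<in> ?L" if "open G" for G
  proof -
    have "outer (E \<inter> G) + outer (E - G) = outer E" for E
    proof (rule antisym[OF outer_open_split[OF that]])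
      have "outer E \<le> (\<Sum>i. outer ((\<lambda>i::nat. if i = 0 then E \<inter> G else if i = 1 then E - G else {}) i))"
        by (rule order_trans[OF outer_mono outer_countably_subadditive]) force
      also have "\<dots> = outer (E \<inter> G) + outer (E - G)"
        by (subst suminf_finite[of "{0, 1}"]) (auto simp: outer_empty)
      finally show "outer E \<le> outer (E \<inter> G) + outer (E - G)" .
    qed
    then show ?thesis by (simp add: P.lambda_system_eq)
  qed
  then have sub: "sets borel \<subseteq> ?L"
    unfolding borel_def by (simp, intro sigma_algebra.sigma_sets_subset[OF sa]) auto
  have "emeasure riesz E = outer E"
    unfolding riesz_def
  proof (rule emeasure_measure_of_sigma)
    show "sigma_algebra UNIV (sets borel :: 'a set set)"
      using sets.sigma_algebra_axioms[of "borel :: 'a measure"] by simp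
    show "positive (sets borel) outer" by (simp add: positive_def outer_empty)
    show "countably_additive (sets borel) outer"
      using ms sub unfolding measure_space_def countably_additive_def by blast
  qed fact
  then show ?thesis .
qed

lemma emeasure_riesz_compact:
  assumes "compact K"
  shows "emeasure riesz K < \<infinity>"
proof -
  obtain R where R: "K \<subseteq> cball 0 R" using compact_subset_cball_0[OF assms] .
  have "emeasure riesz K = outer K"
    by (rule emeasure_riesz) (use assms in \<open>auto intro: borel_closed compact_imp_closed\<close>)
  also have "\<dots> \<le> ennreal (\<Lambda> (cutoff R))"
    by (rule outer_single) (use R in \<open>auto simp: subset_iff cutoff\<close>)
  also have "\<dots> < \<infinity>" by simp
  finally show ?thesis .
qed

text \<open>By compactness of the support, finitely many members of a cover dominate \<open>f\<close> up to \<open>e\<close> (Dini).\<close>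

lemma le_outer:
  assumes f: "f \<in> Cc_fun" "\<And>x. f x \<le> 1" "\<And>x. x \<notin> E \<Longrightarrow> f x \<le> 0"
  shows "ennreal (\<Lambda> f) \<le> outer E"
  unfolding outer_def
proof (rule INF_greatest)
  fix F assume F: "F \<in> covers E"
  note Fc = coversD(1)[OF F] and F0 = coversD(2)[OF F] and F1 = coversD(3)[OF F]
  obtain R where R: "\<And>x. x \<notin> cball 0 R \<Longrightarrow> f x = 0" using Cc_fun_supp[OF f(1)] by blast
  let ?\<chi> = "cutoff R :: 'a \<Rightarrow> real"
  have \<chi>: "0 \<le> \<Lambda> ?\<chi>" by (intro nonneg cutoff)
  have "ennreal (\<Lambda> f) \<le> (\<Sum>i. ennreal (\<Lambda> (F i))) + ennreal e" if e: "e > 0" for e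
  proof -
    \<comment> \<open>The error \<open>e'\<close> is paid only through a cut-off of the support of
      \<open>f\<close> and costs \<open>e' * \<Lambda> ?\<chi> \<le> e\<close>; the
      \<open>+ 1\<close> avoids a zero divisor.\<close>
    define e' where "e' = e / (\<Lambda> ?\<chi> + 1)"
    have e': "e' > 0" "e' * \<Lambda> ?\<chi> \<le> e"
      using e \<chi> by (auto simp: e'_def field_simps)
    define U where "U N = {x. f x < (\<Sum>i<N. F i x) + e'}" for N
    have U: "open (U N)" for N
      unfolding U_def by (intro open_Collect_less continuous_intros Cc_fun_cont f Fc)
    have "cball 0 R \<subseteq> (\<Union>N. U N)"
    proof
      fix x
      show "x \<in> (\<Union>N. U N)"
      proof (cases "f x \<le> 0")
        case True
        then show ?thesis using e' by (intro UN_I[of 0]) (auto simp: U_def)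
      next
        case False
        then have "x \<in> E" using f(3)[of x] by auto
        then have "1 \<le> (\<Sum>i. ennreal (F i x))" by (rule F1)
        then have "ennreal (1 - e') < (\<Sum>i. ennreal (F i x))"
          using e' by (metis diff_strict_left_mono diff_zero ennreal_1 ennreal_less_one_iff less_le_trans order_less_le_trans)
        then obtain N where "ennreal (1 - e') < (\<Sum>i<N. ennreal (F i x))"
          unfolding suminf_eq_SUP less_SUP_iff by blast
        then have "ennreal (1 - e') < ennreal (\<Sum>i<N. F i x)"
          using F0 by (subst (asm) sum_ennreal) auto
        then have "1 - e' < (\<Sum>i<N. F i x)"
          using F0 by (meson ennreal_leI not_less)
        then show ?thesis using f(2)[of x] by (intro UN_I[of N]) (auto simp: U_def)
      qed
    qed
    from compactE_image[OF compact_cball U this] obtain C where C: "finite C" "cball 0 R \<subseteq> (\<Union>N\<in>C. U N)"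
      by metis
    define N where "N = Max (insert 0 C)"
    have "f x \<le> (\<Sum>i<N. F i x) + e' * ?\<chi> x" for x
    proof (cases "x \<in> cball 0 R")
      case True
      then obtain n where n: "n \<in> C" "x \<in> U n" using C(2) by blast
      then have "n \<le> N" using C(1) by (simp add: N_def)
      then have "(\<Sum>i<n. F i x) \<le> (\<Sum>i<N. F i x)"
        using F0 by (intro sum_mono2) auto
      then show ?thesis using n(2) True by (simp add: U_def cutoff(4))
    next
      case False
      then show ?thesis using R F0 e' cutoff(2)[of R x] by (auto intro!: add_nonneg_nonneg sum_nonneg)
    qed
    then have "\<Lambda> f \<le> \<Lambda> (\<lambda>x. (\<Sum>i<N. F i x) + e' * ?\<chi> x)"
      by (intro mono f(1) Cc_fun_add Cc_fun_sum Fc Cc_fun_scale cutoff(1))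
    also have "\<dots> = (\<Sum>i<N. \<Lambda> (F i)) + e' * \<Lambda> ?\<chi>"
    proof -
      have s1: "(\<lambda>x. \<Sum>i<N. F i x) \<in> Cc_fun" by (rule Cc_fun_sum) (rule Fc)
      have s2: "(\<lambda>x. e' * ?\<chi> x) \<in> Cc_fun" by (rule Cc_fun_scale[OF cutoff(1)])
      have "\<Lambda> (\<lambda>x. \<Sum>i<N. F i x) = (\<Sum>i<N. \<Lambda> (F i))" by (rule sum) (rule Fc)
      then show ?thesis by (simp only: add[OF s1 s2] scale[OF cutoff(1)])
    qed
    also have "\<dots> \<le> (\<Sum>i<N. \<Lambda> (F i)) + e" using e' by simp
    finally have "ennreal (\<Lambda> f) \<le> ennreal ((\<Sum>i<N. \<Lambda> (F i)) + e)" by (rule ennreal_leI)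
    also have "\<dots> = (\<Sum>i<N. ennreal (\<Lambda> (F i))) + ennreal e"
      using e nonneg[OF Fc F0] by (simp add: ennreal_plus sum_nonneg sum_ennreal)
    also have "\<dots> \<le> (\<Sum>i. ennreal (\<Lambda> (F i))) + ennreal e"
      by (intro add_right_mono sum_le_suminf) auto
    finally show ?thesis .
  qed
  then show "ennreal (\<Lambda> f) \<le> (\<Sum>i. ennreal (\<Lambda> (F i)))"
    by (rule ennreal_le_epsilon)
qed

end

lemma Cc_fun_integrable:
  fixes \<mu> :: "'a::euclidean_space measure"
  assumes \<mu>: "sets \<mu> = sets borel" "\<And>K. compact K \<Longrightarrow> emeasure \<mu> K < \<infinity>" and f: "f \<in> Cc_fun"
  shows "integrable \<mu> f"
proof -
  obtain R where R: "\<And>x. x \<notin> cball 0 R \<Longrightarrow> f x = 0" using Cc_fun_supp[OF f] by blast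
  obtain C where C: "C > 0" "\<And>x. norm (f x) \<le> C"
    using compact_support_bounded[OF Cc_fun_cont[OF f] compact_cball R] by blast
  have cb: "cball 0 R \<in> sets \<mu>" by (simp add: \<mu>(1))
  show ?thesis
  proof (rule Bochner_Integration.integrable_bound)
    show "integrable \<mu> (\<lambda>x. C * indicator (cball 0 R) x)"
      by (intro integrable_mult_right integrable_real_indicator cb \<mu>(2) compact_cball)
    show "f \<in> borel_measurable \<mu>"
      using borel_measurable_continuous_onI[OF Cc_fun_cont[OF f]] measurable_cong_sets[OF \<mu>(1) refl] by blast
    show "AE x in \<mu>. norm (f x) \<le> norm (C * indicator (cball 0 R) x)"
      using C R by (intro AE_I2) (auto simp: indicator_def)
  qed
qed

text \<open>The slices \<open>g\<^sub>j\<close> of height \<open>1/N\<close> squeeze both functionals between the measures of superlevel sets.\<close>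

lemma (in positive_functional) riesz_integral_unit:
  assumes f: "f \<in> Cc_fun" "\<And>x. 0 \<le> f x" "\<And>x. f x \<le> 1"
  shows "\<Lambda> f = (LINT x|riesz. f x)"
proof -
  have int: "integrable riesz g" if "g \<in> Cc_fun" for g
    by (rule Cc_fun_integrable[OF sets_riesz _ that]) (rule emeasure_riesz_compact)
  obtain R where R: "\<And>x. x \<notin> cball 0 R \<Longrightarrow> f x = 0" using Cc_fun_supp[OF f(1)] by blast
  define S where "S t = {x. t < f x}" for t
  have So: "open (S t)" for t
    unfolding S_def by (intro open_Collect_less continuous_intros Cc_fun_cont f)
  then have Sb: "S t \<in> sets borel" for t by simp
  have Sfin: "emeasure riesz (S t) < \<infinity>" if "t \<ge> 0" for t
  proof -
    have "S t \<subseteq> cball 0 R" using R that by (force simp: S_def)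
    then have "emeasure riesz (S t) \<le> emeasure riesz (cball 0 R)" by (rule emeasure_mono) simp
    also have "\<dots> < \<infinity>" by (rule emeasure_riesz_compact) simp
    finally show ?thesis .
  qed
  define m where "m t = measure riesz (S t)" for t
  have m: "emeasure riesz (S t) = ennreal (m t)" if "t \<ge> 0" for t
    unfolding m_def using Sfin[OF that] by (simp add: emeasure_eq_ennreal_measure)
  have "\<bar>\<Lambda> f - (LINT x|riesz. f x)\<bar> \<le> m 0 / real N" if N: "N > 0" for N :: nat
  proof -
    define g where "g j x = min (max (f x - real j / real N) 0) (1 / real N)" for j x
    have cg: "g j \<in> Cc_fun" for j
    proof (rule Cc_fun_dominated[OF f(1)])
      show "continuous_on UNIV (g j)"
        unfolding g_def[abs_def]
        by (intro continuous_on_min continuous_on_max continuous_on_diff continuous_on_const Cc_fun_cont[OF f(1)])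
      show "g j x = 0" if "f x = 0" for x using that N by (simp add: g_def)
    qed
    have g0: "0 \<le> g j x" for j x using N by (simp add: g_def)
    have fg: "f x = (\<Sum>j<N. g j x)" for x
    proof -
      have "(\<Sum>j<k. g j x) = min (f x) (real k / real N)" for k
      proof (induction k)
        case 0
        then show ?case using f(2)[of x] by simp
      next
        case (Suc k)
        have "real (Suc k) / real N = real k / real N + 1 / real N" by (simp add: add_divide_distrib)
        moreover have "min y t + min (max (y - t) 0) d = min y (t + d)" if "0 \<le> d" for y t d :: real
          using that by (auto simp: min_def max_def)
        from this[of "1 / real N" "f x" "real k / real N"]
        have "min (f x) (real k / real N) + g k x = min (f x) (real k / real N + 1 / real N)"
          by (simp add: g_def)
        ultimately show ?case using Suc by simp
      qed
      from this[of N] show ?thesis using f(3)[of x] N by simp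
    qed
    define a where "a j = \<Lambda> (g j)" for j
    define b where "b j = (LINT x|riesz. g j x)" for j
    let ?t = "\<lambda>j. real j / real N"
    have up: "N * a j \<le> m (?t j)" "N * b j \<le> m (?t j)" and
      lo: "m (?t (Suc j)) \<le> N * a j" "m (?t (Suc j)) \<le> N * b j" for j
    proof -
      let ?h = "\<lambda>x. real N * g j x"
      have ch: "?h \<in> Cc_fun" by (rule Cc_fun_scale[OF cg])
      have h0: "0 \<le> ?h x" for x using g0 by simp
      have h1: "?h x \<le> 1" for x
      proof -
        have "g j x \<le> 1 / real N" by (simp add: g_def)
        from mult_left_mono[OF this, of "real N"] N show ?thesis by simp
      qed
      have h2: "?h x \<le> 0" if "x \<notin> S (?t j)" for x
        using that N by (simp add: S_def g_def)
      have h3: "1 \<le> ?h x" if "x \<in> S (?t (Suc j))" for x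
      proof -
        have "real (Suc j) / real N = real j / real N + 1 / real N" by (simp add: add_divide_distrib)
        then have "f x - real j / real N \<ge> 1 / real N" using that by (simp add: S_def)
        then have "g j x = 1 / real N" using N by (simp add: g_def)
        then show ?thesis using N by simp
      qed
      have ea: "real N * a j = \<Lambda> ?h" by (simp add: a_def scale[OF cg])
      have eb: "real N * b j = (LINT x|riesz. ?h x)" by (simp add: b_def)
      have "ennreal (\<Lambda> ?h) \<le> ennreal (m (?t j))"
        using le_outer[where E = "S (?t j)", OF ch h1 h2] m[of "?t j"] emeasure_riesz[OF Sb] by simp
      then show "N * a j \<le> m (?t j)" unfolding ea by (simp add: m_def)
      have "ennreal (m (?t (Suc j))) \<le> ennreal (\<Lambda> ?h)"
        using outer_single[where E = "S (?t (Suc j))", OF ch h0 h3] m[of "?t (Suc j)"] emeasure_riesz[OF Sb] by simp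
      then show "m (?t (Suc j)) \<le> N * a j" unfolding ea using nonneg[OF ch h0] by simp
      have i: "integrable riesz (indicat_real (S t))" if "t \<ge> 0" for t
        using Sfin[OF that] Sb by (intro integrable_real_indicator) auto
      have "(LINT x|riesz. ?h x) \<le> (LINT x|riesz. indicat_real (S (?t j)) x)"
        by (rule integral_mono[OF int[OF ch] i]) (use h1 h2 in \<open>auto simp: indicator_def\<close>)
      then show "N * b j \<le> m (?t j)" unfolding eb by (simp add: m_def)
      have "(LINT x|riesz. indicat_real (S (?t (Suc j))) x) \<le> (LINT x|riesz. ?h x)"
        by (rule integral_mono[OF i int[OF ch]]) (use h0 h3 in \<open>auto simp: indicator_def\<close>)
      then show "m (?t (Suc j)) \<le> N * b j" unfolding eb by (simp add: m_def)
    qed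
    have "f = (\<lambda>x. \<Sum>j<N. g j x)" using fg by blast
    then have "\<Lambda> f = \<Lambda> (\<lambda>x. \<Sum>j<N. g j x)" by (rule arg_cong)
    also have "\<dots> = (\<Sum>j<N. a j)"
      unfolding a_def by (rule sum) (rule cg)
    finally have "\<Lambda> f = (\<Sum>j<N. a j)" .
    moreover have "(LINT x|riesz. f x) = (\<Sum>j<N. b j)"
      unfolding b_def fg by (rule Bochner_Integration.integral_sum) (rule int[OF cg])
    ultimately have "\<bar>\<Lambda> f - (LINT x|riesz. f x)\<bar> = \<bar>\<Sum>j<N. a j - b j\<bar>"
      by (simp add: sum_subtractf)
    also have "\<dots> \<le> (\<Sum>j<N. \<bar>a j - b j\<bar>)" by (rule sum_abs)
    \<comment> \<open>Both \<open>N * a j\<close> and \<open>N * b j\<close> lie between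
      \<open>m (?t (Suc j))\<close> and \<open>m (?t j)\<close>. The errors therefore telescope, and
      the total is at most \<open>m 0 / N\<close>.\<close>
    also have "\<dots> \<le> (\<Sum>j<N. (m (?t j) - m (?t (Suc j))) / N)"
    proof (rule sum_mono)
      fix j
      have "real N * \<bar>a j - b j\<bar> = \<bar>N * a j - N * b j\<bar>"
        by (simp add: right_diff_distrib[symmetric] abs_mult)
      also have "\<dots> \<le> m (?t j) - m (?t (Suc j))" using up[of j] lo[of j] by linarith
      finally show "\<bar>a j - b j\<bar> \<le> (m (?t j) - m (?t (Suc j))) / N"
        using N by (simp add: field_simps)
    qed
    also have "\<dots> = (m (?t 0) - m (?t N)) / N"
      using sum_lessThan_telescope'[of "\<lambda>j. m (?t j)" N] by (simp only: sum_divide_distrib[symmetric])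
    also have "\<dots> \<le> m 0 / N"
      using N by (simp add: m_def divide_right_mono)
    finally show ?thesis .
  qed
  then have "\<bar>\<Lambda> f - (LINT x|riesz. f x)\<bar> \<le> m 0 * inverse (real (Suc k))" for k
    by (simp add: divide_inverse[symmetric] del: of_nat_Suc)
  then have "\<bar>\<Lambda> f - (LINT x|riesz. f x)\<bar> \<le> 0"
    by (intro LIMSEQ_le_const[OF tendsto_mult_right_zero[OF LIMSEQ_inverse_real_of_nat, of "m 0"]]) auto
  then show ?thesis by simp
qed

lemma (in positive_functional) riesz_integral:
  assumes f: "f \<in> Cc_fun"
  shows "\<Lambda> f = (LINT x|riesz. f x)"
proof -
  have pos: "\<Lambda> g = (LINT x|riesz. g x)" if g: "g \<in> Cc_fun" "\<And>x. 0 \<le> g x" for g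
  proof -
    obtain R where R: "\<And>x. x \<notin> cball 0 R \<Longrightarrow> g x = 0" using Cc_fun_supp[OF g(1)] by blast
    obtain C where C: "C > 0" "\<And>x. norm (g x) \<le> C"
      using compact_support_bounded[OF Cc_fun_cont[OF g(1)] compact_cball R] by blast
    have "\<Lambda> (\<lambda>x. (1 / C) * g x) = (LINT x|riesz. (1 / C) * g x)"
      by (rule riesz_integral_unit[OF Cc_fun_scale[OF g(1)]])
        (use C g(2) in \<open>auto simp: field_simps intro: order_trans[OF abs_ge_self]\<close>)
    then have "(1 / C) * \<Lambda> g = (1 / C) * (LINT x|riesz. g x)"
      unfolding scale[OF g(1)] integral_mult_right_zero .
    then show ?thesis using C(1) by simp
  qed
  let ?p = "\<lambda>x. max (f x) 0" and ?q = "\<lambda>x. max (- f x) 0"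
  note cf = Cc_fun_cont[OF f]
  have c1: "?p \<in> Cc_fun"
    by (rule Cc_fun_dominated[OF f continuous_on_max[OF cf continuous_on_const]]) simp
  have c2: "?q \<in> Cc_fun"
    by (rule Cc_fun_dominated[OF f continuous_on_max[OF continuous_on_minus[OF cf] continuous_on_const]]) simp
  note c = c1 c2
  have "f = (\<lambda>x. ?p x - ?q x)" by (auto simp: max_def)
  then have "\<Lambda> f = \<Lambda> ?p - \<Lambda> ?q" using diff[OF c] by simp
  also have "\<dots> = (LINT x|riesz. ?p x) - (LINT x|riesz. ?q x)"
    using pos[OF c(1)] pos[OF c(2)] by simp
  also have "\<dots> = (LINT x|riesz. ?p x - ?q x)"
    by (rule Bochner_Integration.integral_diff[symmetric])
      (rule Cc_fun_integrable[OF sets_riesz emeasure_riesz_compact], assumption, rule c)+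
  also have "(\<lambda>x. ?p x - ?q x) = f" by (auto simp: max_def)
  finally show ?thesis .
qed

text \<open>The indicator of an open set is an increasing limit of compactly supported continuous
  functions, so the measures agree on open sets by monotone convergence. These form an
  intersection-stable generator, and balls exhaust the space with finite measure.\<close>

lemma radon_measure_unique:
  fixes \<mu> \<nu> :: "'a::euclidean_space measure"
  assumes \<mu>: "sets \<mu> = sets borel" "\<And>K. compact K \<Longrightarrow> emeasure \<mu> K < \<infinity>"
    and \<nu>: "sets \<nu> = sets borel" "\<And>K. compact K \<Longrightarrow> emeasure \<nu> K < \<infinity>"
    and eq: "\<And>f. f \<in> Cc_fun \<Longrightarrow> (LINT x|\<mu>. f x) = (LINT x|\<nu>. f x)"
  shows "\<mu> = \<nu>"
proof (rule measure_eqI_generator_eq[where E = "{S. open S}" and \<Omega> = UNIV and A = "\<lambda>i. ball 0 (real i)"])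
  show "Int_stable {S :: 'a set. open S}" by (auto simp: Int_stable_def)
  show "sets \<mu> = sigma_sets UNIV {S. open S}" "sets \<nu> = sigma_sets UNIV {S. open S}"
    using \<mu>(1) \<nu>(1) by (simp_all add: borel_def)
  show "(\<Union>i. ball (0::'a) (real i)) = UNIV"
    using reals_Archimedean2 by (auto simp: dist_norm)
  show "emeasure \<mu> (ball 0 (real i)) \<noteq> \<infinity>" for i
  proof -
    have "emeasure \<mu> (ball 0 (real i)) \<le> emeasure \<mu> (cball 0 (real i))"
      by (rule emeasure_mono) (auto simp: \<mu>(1))
    also have "\<dots> < \<infinity>" by (rule \<mu>(2)) simp
    finally show ?thesis by simp
  qed
  fix U :: "'a set" assume "U \<in> {S. open S}"
  then have U: "open U" by simp
  \<comment> \<open>For \<open>U = UNIV\<close> the distance to the empty complement would be 0 by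
    convention, hence the separate value.\<close>
  define h where "h x = (if U = UNIV then 1 else infdist x (- U))" for x
  have ch: "continuous_on UNIV h"
    unfolding h_def[abs_def] by (cases "U = UNIV") (auto intro!: continuous_on_infdist continuous_on_id)
  have h0: "h x \<ge> 0" for x by (simp add: h_def infdist_nonneg)
  have hU: "h x = 0 \<longleftrightarrow> x \<notin> U" for x
    using in_closed_iff_infdist_zero[of "- U" x] U by (auto simp: h_def)
  define \<phi> where "\<phi> k x = min 1 (real k * h x) * cutoff (real k) x" for k x
  have c\<phi>: "\<phi> k \<in> Cc_fun" for k
  proof -
    have "continuous_on UNIV (\<lambda>x. min 1 (real k * h x))" by (intro continuous_intros ch)
    from Cc_fun_mult[OF cutoff(1) this, of "real k"] show ?thesis
      by (simp add: \<phi>_def[abs_def] mult.commute)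
  qed
  have \<phi>0: "0 \<le> \<phi> k x" for k x using h0 by (simp add: \<phi>_def cutoff(2))
  have inc: "\<phi> k x \<le> \<phi> (Suc k) x" for k x
    unfolding \<phi>_def
  proof (rule mult_mono)
    show "min 1 (real k * h x) \<le> min 1 (real (Suc k) * h x)"
      using h0[of x] by (intro min.mono mult_right_mono) auto
    show "cutoff (real k) x \<le> cutoff (real (Suc k)) x" by (auto simp: cutoff_def)
  qed (use h0 in \<open>auto simp: cutoff(2)\<close>)
  have sup: "(SUP k. ennreal (\<phi> k x)) = indicator U x" for x
  proof (rule antisym)
    have "\<phi> k x \<le> indicator U x" for k
      using hU[of x] h0[of x] mult_mono[of "min 1 (real k * h x)" 1 "cutoff (real k) x" 1]
      by (auto simp: \<phi>_def indicator_def cutoff)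
    then show "(SUP k. ennreal (\<phi> k x)) \<le> indicator U x"
      by (intro SUP_least) (metis ennreal_indicator ennreal_leI)
    show "indicator U x \<le> (SUP k. ennreal (\<phi> k x))"
    proof (cases "x \<in> U")
      case True
      then have "h x > 0" using hU h0 by (simp add: less_le)
      obtain n where n: "norm x < real n" using reals_Archimedean2 by blast
      obtain k where k: "1 < real k * h x" using reals_Archimedean3[OF \<open>h x > 0\<close>] by blast
      have "real k * h x \<le> real (max n k) * h x" using h0[of x] by (intro mult_right_mono) auto
      then have "\<phi> (max n k) x = 1"
        using n k by (simp add: \<phi>_def cutoff(4))
      then show ?thesis using True by (intro SUP_upper2[of "max n k"]) auto
    qed simp
  qed
  have "emeasure M U = (SUP k. ennreal (LINT x|M. \<phi> k x))"
    if M: "sets M = sets borel" "\<And>K. compact K \<Longrightarrow> emeasure M K < \<infinity>" for M :: "'a measure"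
  proof -
    have meas: "\<phi> k \<in> borel_measurable M" for k
      using Cc_fun_integrable[OF M c\<phi>] by (rule borel_measurable_integrable)
    have "emeasure M U = (\<integral>\<^sup>+x. indicator U x \<partial>M)"
      using U M(1) by simp
    also have "\<dots> = (\<integral>\<^sup>+x. (SUP k. ennreal (\<phi> k x)) \<partial>M)" by (simp add: sup)
    also have "\<dots> = (SUP k. \<integral>\<^sup>+x. ennreal (\<phi> k x) \<partial>M)"
      by (rule nn_integral_monotone_convergence_SUP)
        (use meas in \<open>auto intro!: incseq_SucI le_funI ennreal_leI inc\<close>)
    also have "\<dots> = (SUP k. ennreal (LINT x|M. \<phi> k x))"
      by (intro SUP_cong refl nn_integral_eq_integral Cc_fun_integrable[OF M c\<phi>]) (auto intro!: AE_I2 \<phi>0)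
    finally show ?thesis .
  qed
  from this[OF \<mu>] this[OF \<nu>] show "emeasure \<mu> U = emeasure \<nu> U"
    by (simp add: eq c\<phi>)
qed auto

text \<open>The sphere may carry mass, so the closed ball is approximated from outside by functions
  that are 1 on it and decrease to its indicator. For \<open>k = 0\<close> the function is the
  constant 1 and has no compact support, hence the restriction to positive \<open>k\<close>.\<close>

lemma radon_measure_cball:
  fixes \<mu> :: "'a::euclidean_space measure"
  assumes \<mu>: "sets \<mu> = sets borel" "\<And>K. compact K \<Longrightarrow> emeasure \<mu> K < \<infinity>"
  shows "(\<lambda>k. LINT x|\<mu>. max 0 (1 - real k * max 0 (norm x - 1))) \<longlonglongrightarrow> measure \<mu> (cball 0 1)"
    and "\<And>k. k > 0 \<Longrightarrow> (\<lambda>x::'a. max 0 (1 - real k * max 0 (norm x - 1))) \<in> Cc_fun"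
proof -
  let ?\<phi> = "\<lambda>k x::'a. max 0 (1 - real k * max 0 (norm x - 1))"
  have out: "?\<phi> k x = 0" if "k > 0" "x \<notin> cball 0 2" for k x
  proof -
    have "real k * (norm x - 1) \<ge> 1 * 1" using that by (intro mult_mono) auto
    then show ?thesis using that by (simp add: max_def)
  qed
  show c: "?\<phi> k \<in> Cc_fun" if "k > 0" for k
    by (rule Cc_funI[OF _ out[OF that]]) (intro continuous_intros)
  have "(\<lambda>k. LINT x|\<mu>. ?\<phi> (Suc k) x) \<longlonglongrightarrow> (LINT x|\<mu>. indicator (cball 0 1) x)"
  proof (rule integral_dominated_convergence[where w = "indicator (cball 0 2)"])
    show "integrable \<mu> (indicat_real (cball 0 2))"
      by (rule integrable_real_indicator) (use \<mu> in auto)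
    show "AE x in \<mu>. (\<lambda>k. ?\<phi> (Suc k) x) \<longlonglongrightarrow> indicator (cball 0 1) x"
    proof (rule AE_I2)
      fix x
      show "(\<lambda>k. ?\<phi> (Suc k) x) \<longlonglongrightarrow> indicator (cball 0 1) x"
      proof (cases "norm x \<le> 1")
        case False
        then obtain n where n: "1 < real n * (norm x - 1)" using reals_Archimedean3[of "norm x - 1"] by auto
        have "?\<phi> (Suc k) x = 0" if "k \<ge> n" for k
        proof -
          have "real n * (norm x - 1) \<le> real (Suc k) * (norm x - 1)"
            using that False by (intro mult_right_mono) auto
          from order.strict_trans2[OF n this] show ?thesis using False by (auto simp: max_def)
        qed
        then have "eventually (\<lambda>k. ?\<phi> (Suc k) x = 0) sequentially"
          unfolding eventually_sequentially by blast
        then show ?thesis using False by (simp add: tendsto_eventually)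
      qed (simp add: max_def)
    qed
    show "AE x in \<mu>. norm (?\<phi> (Suc k) x) \<le> indicator (cball 0 2) x" for k
    proof (rule AE_I2)
      fix x
      show "norm (?\<phi> (Suc k) x) \<le> indicator (cball 0 2) x"
      proof (cases "x \<in> cball 0 2")
        case True
        have "0 \<le> real (Suc k) * max 0 (norm x - 1)" by (intro mult_nonneg_nonneg) auto
        then have "?\<phi> (Suc k) x \<le> 1" by simp
        then show ?thesis using True by simp
      next
        case False
        then show ?thesis using out[of "Suc k" x] by simp
      qed
    qed
    show "?\<phi> (Suc k) \<in> borel_measurable \<mu>" for k
      by (intro borel_measurable_integrable Cc_fun_integrable[OF \<mu>] c) auto
  qed (rule borel_measurable_indicator, simp add: \<mu>(1))
  also have "(LINT x|\<mu>. indicator (cball 0 1) x) = measure \<mu> (cball 0 1)"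
    using \<mu>(1) sets_eq_imp_space_eq[OF \<mu>(1)] by simp
  finally show "(\<lambda>k. LINT x|\<mu>. ?\<phi> k x) \<longlonglongrightarrow> measure \<mu> (cball 0 1)"
    by (rule LIMSEQ_imp_Suc)
qed

section \<open>The Monge--Ampere measure and its valuation property\<close>

definition form0 :: "(complex^'n::finite \<Rightarrow> real) \<Rightarrow> 'n form" where
  "form0 f x vs = of_real (f x) * one_form0 vs"

lemma form0_Cc: "f \<in> Cc_fun \<Longrightarrow> form0 f \<in> Cc_forms 0"
proof -
  assume f: "f \<in> Cc_fun"
  obtain R where R: "\<forall>x. x \<notin> cball 0 R \<longrightarrow> f x = 0" using Cc_fun_supp[OF f] by blast
  show ?thesis
  proof (rule Cc_formsI[of _ _ R])
    show "alternating 0 (form0 f x)" for x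
      using alternating_scale[OF alternating_beta_power[of 0], of "of_real (f x)"] by (simp add: form0_def[abs_def])
    show "cont_form (form0 f)"
      unfolding cont_form_def form0_def by (intro allI continuous_intros Cc_fun_cont f)
    show "form0 f x = (\<lambda>_. 0)" if "x \<notin> cball 0 R" for x
      using R that by (simp add: form0_def[abs_def])
  qed
qed

lemma form0_Nil [simp]: "form0 f x [] = of_real (f x)"
  by (simp add: form0_def one_form0_def)

lemma Cc_forms0_split:
  assumes "\<omega> \<in> Cc_forms 0"
  shows "(\<lambda>x. Re (\<omega> x [])) \<in> Cc_fun" "(\<lambda>x. Im (\<omega> x [])) \<in> Cc_fun"
    "\<omega> = (\<lambda>x vs. form0 (\<lambda>x. Re (\<omega> x [])) x vs + \<i> * form0 (\<lambda>x. Im (\<omega> x [])) x vs)"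
proof -
  note C = Cc_formsD[OF assms]
  obtain R where R: "\<And>x. x \<notin> cball 0 R \<Longrightarrow> \<omega> x = (\<lambda>_. 0)" using C(3) by blast
  have c: "continuous_on UNIV (\<lambda>x. \<omega> x [])" using C(2) by (simp add: cont_form_def)
  show "(\<lambda>x. Re (\<omega> x [])) \<in> Cc_fun"
    by (rule Cc_funI[OF continuous_on_Re[OF c], of R]) (simp add: R)
  show "(\<lambda>x. Im (\<omega> x [])) \<in> Cc_fun"
    by (rule Cc_funI[OF continuous_on_Im[OF c], of R]) (simp add: R)
  have "\<omega> x vs = form0 (\<lambda>x. Re (\<omega> x [])) x vs + \<i> * form0 (\<lambda>x. Im (\<omega> x [])) x vs" for x vs
  proof (cases "vs = []")
    case True
    then show ?thesis by (simp add: complex_eq_iff)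
  next
    case False
    then show ?thesis using alternating_length[OF C(1), of vs x] by (simp add: form0_def one_form0_def)
  qed
  then show "\<omega> = (\<lambda>x vs. form0 (\<lambda>x. Re (\<omega> x [])) x vs + \<i> * form0 (\<lambda>x. Im (\<omega> x [])) x vs)"
    by blast
qed

lemma top_power:
  fixes u :: "complex^'n::finite \<Rightarrow> real"
  assumes "convex_lipschitz L u"
  shows "order_zero_current 0 (ddc_power u CARD('n))"
    and "\<And>\<omega>. \<omega> \<in> Cc_forms 0 \<Longrightarrow> (\<lambda>m. cur (replicate CARD('n) (mseq u m)) \<omega>) \<longlonglongrightarrow> ddc_power u CARD('n) \<omega>"
  using ddc_power_limit[OF mseq_convex_lipschitz[OF assms] convex_lipschitz_continuous[OF assms], of "CARD('n)"]
  by auto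

text \<open>For the mollified function the value is the integral of \<open>f\<close> against the
  non-negative density \<open>dens\<close>. Reality and sign survive the limit.\<close>

lemma top_power_form0:
  fixes u :: "complex^'n::finite \<Rightarrow> real"
  assumes u: "convex_lipschitz L u" and f: "f \<in> Cc_fun"
  shows "ddc_power u CARD('n) (form0 f) = of_real (Re (ddc_power u CARD('n) (form0 f)))"
    and "(\<And>x. 0 \<le> f x) \<Longrightarrow> 0 \<le> Re (ddc_power u CARD('n) (form0 f))"
proof -
  let ?us = "\<lambda>m. replicate CARD('n) (mseq u m)"
  have psd: "psd_smooth w" if "w \<in> set (?us m)" for w m
    using that mseq_convex_lipschitz(1)[OF u] by (auto simp: psd_seq_def)
  have eq: "levis (?us m) (form0 f) x std_frame = of_real (f x * dens (?us m) x)" for m x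
  proof -
    have "levis (?us m) (\<lambda>x. (beta ^^ (CARD('n) - length (?us m))) one_form0) x std_frame = of_real (dens (?us m) x)"
      by (rule dens_dominates(2)) (use psd in auto)
    then show ?thesis
      by (simp add: form0_def[abs_def] levis_scale)
  qed
  have i: "integrable lborel (\<lambda>x. f x * dens (?us m) x)" for m
  proof -
    have "integrable lborel (\<lambda>x. levis (?us m) (form0 f) x std_frame)"
      by (rule cur_integrable[OF _ form0_Cc[OF f]]) (rule psd_smoothD[OF psd])
    from integrable_Re[OF this] show ?thesis unfolding eq by simp
  qed
  have c: "cur (?us m) (form0 f) = of_real (LINT x|lborel. f x * dens (?us m) x)" for m
    unfolding cur_def eq by (rule integral_of_real[OF i])
  note lim = top_power(2)[OF u form0_Cc[OF f], unfolded c]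
  have "(\<lambda>m. Im (complex_of_real (LINT x|lborel. f x * dens (?us m) x))) \<longlonglongrightarrow> Im (ddc_power u CARD('n) (form0 f))"
    by (rule tendsto_Im[OF lim])
  then have "Im (ddc_power u CARD('n) (form0 f)) = 0" by (simp add: LIMSEQ_const_iff)
  then show "ddc_power u CARD('n) (form0 f) = of_real (Re (ddc_power u CARD('n) (form0 f)))"
    by (simp add: complex_eq_iff)
  assume f0: "\<And>x. 0 \<le> f x"
  have "0 \<le> (LINT x|lborel. f x * dens (?us m) x)" for m
  proof (rule Bochner_Integration.integral_nonneg)
    fix x
    have "0 \<le> dens (?us m) x"
      by (rule dens_dominates(1)) (use psd in auto)
    then show "0 \<le> f x * dens (?us m) x" using f0[of x] by simp
  qed
  then show "0 \<le> Re (ddc_power u CARD('n) (form0 f))"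
    using LIMSEQ_le_const[OF tendsto_Re[OF lim], of 0] by simp
qed

text \<open>Resolves the definite description in \<open>monge_ampere\<close>:
  \<open>riesz_integral\<close> supplies existence and \<open>radon_measure_unique\<close>
  uniqueness. Complex-valued forms are treated through their real and imaginary parts.\<close>

lemma monge_ampere_props:
  fixes u :: "complex^'n::finite \<Rightarrow> real"
  assumes u: "convex_lipschitz L u"
  shows "sets (monge_ampere u) = sets borel" "\<And>K. compact K \<Longrightarrow> emeasure (monge_ampere u) K < \<infinity>"
    "\<And>\<omega>. \<omega> \<in> Cc_forms 0 \<Longrightarrow> ddc_power u CARD('n) \<omega> = (LINT x|monge_ampere u. \<omega> x [])"
proof -
  let ?T = "ddc_power u CARD('n)"
  define \<Lambda> where "\<Lambda> f = Re (?T (form0 f))" for f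
  have T: "?T (form0 f) = of_real (\<Lambda> f)" if "f \<in> Cc_fun" for f
    unfolding \<Lambda>_def by (rule top_power_form0(1)[OF u that])
  note D = order_zero_currentD[OF top_power(1)[OF u]]
  interpret P: positive_functional \<Lambda>
  proof
    fix f g :: "complex^'n \<Rightarrow> real" and c
    assume f: "f \<in> Cc_fun"
    show "\<Lambda> (\<lambda>x. f x + g x) = \<Lambda> f + \<Lambda> g" if g: "g \<in> Cc_fun"
    proof -
      have "form0 (\<lambda>x. f x + g x) = (\<lambda>x vs. form0 f x vs + form0 g x vs)"
        by (simp add: form0_def fun_eq_iff algebra_simps)
      then show ?thesis using D(2)[OF form0_Cc[OF f] form0_Cc[OF g]] by (simp add: \<Lambda>_def)
    qed
    have "form0 (\<lambda>x. c * f x) = (\<lambda>x vs. of_real c * form0 f x vs)"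
      by (simp add: form0_def fun_eq_iff)
    then show "\<Lambda> (\<lambda>x. c * f x) = c * \<Lambda> f"
      using D(3)[OF form0_Cc[OF f], of "of_real c"] by (simp add: \<Lambda>_def)
    show "0 \<le> \<Lambda> f" if "\<And>x. 0 \<le> f x"
      unfolding \<Lambda>_def by (rule top_power_form0(2)[OF u f that])
  qed
  let ?Q = "\<lambda>\<mu>. sets \<mu> = sets borel \<and> (\<forall>K. compact K \<longrightarrow> emeasure \<mu> K < \<infinity>) \<and>
      (\<forall>\<omega>\<in>Cc_forms 0. ?T \<omega> = (LINT x|\<mu>. \<omega> x []))"
  have Q: "?Q P.riesz"
  proof (intro conjI allI impI ballI)
    show "sets P.riesz = sets borel" by (rule P.sets_riesz)
    show "emeasure P.riesz K < \<infinity>" if "compact K" for K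
      using that by (rule P.emeasure_riesz_compact)
    fix \<omega> :: "'n form" assume \<omega>: "\<omega> \<in> Cc_forms 0"
    let ?f = "\<lambda>x. Re (\<omega> x [])" and ?g = "\<lambda>x. Im (\<omega> x [])"
    note s = Cc_forms0_split[OF \<omega>]
    have int: "integrable P.riesz g" if "g \<in> Cc_fun" for g
      by (rule Cc_fun_integrable[OF P.sets_riesz _ that]) (rule P.emeasure_riesz_compact)
    have "?T \<omega> = ?T (\<lambda>x vs. form0 ?f x vs + \<i> * form0 ?g x vs)"
      by (rule arg_cong[OF s(3)])
    also have "\<dots> = ?T (form0 ?f) + \<i> * ?T (form0 ?g)"
      using D(2)[OF form0_Cc[OF s(1)] Cc_forms_scale[OF form0_Cc[OF s(2)], of \<i>]] D(3)[OF form0_Cc[OF s(2)], of \<i>]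
      by simp
    also have "\<dots> = of_real (LINT x|P.riesz. ?f x) + \<i> * of_real (LINT x|P.riesz. ?g x)"
      by (simp only: T[OF s(1)] T[OF s(2)] P.riesz_integral[OF s(1)] P.riesz_integral[OF s(2)])
    also have "\<dots> = (LINT x|P.riesz. of_real (?f x)) + (LINT x|P.riesz. \<i> * of_real (?g x))"
      by (simp only: integral_of_real[OF int[OF s(1)]] integral_of_real[OF int[OF s(2)]] integral_mult_right_zero)
    also have "\<dots> = (LINT x|P.riesz. of_real (?f x) + \<i> * of_real (?g x))"
      by (rule Bochner_Integration.integral_add[symmetric])
        (intro integrable_mult_right integrable_of_real int s)+
    also have "\<dots> = (LINT x|P.riesz. \<omega> x [])"
      by (intro Bochner_Integration.integral_cong refl) (simp add: complex_eq_iff)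
    finally show "?T \<omega> = (LINT x|P.riesz. \<omega> x [])" .
  qed
  have uniq: "\<mu> = P.riesz" if \<mu>: "?Q \<mu>" for \<mu>
  proof (rule radon_measure_unique)
    fix f :: "complex^'n \<Rightarrow> real" assume f: "f \<in> Cc_fun"
    have int: "integrable M f" if "?Q M" for M
      by (rule Cc_fun_integrable[OF _ _ f]) (use that in auto)
    have "complex_of_real (LINT x|M. f x) = ?T (form0 f)" if "?Q M" for M
    proof -
      have "?T (form0 f) = (LINT x|M. form0 f x [])" using that form0_Cc[OF f] by blast
      then show ?thesis using integral_of_real[OF int[OF that]] by simp
    qed
    from this[OF \<mu>] this[OF Q] have "complex_of_real (LINT x|\<mu>. f x) = complex_of_real (LINT x|P.riesz. f x)"
      by simp
    then show "(LINT x|\<mu>. f x) = (LINT x|P.riesz. f x)" by simp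
  qed (use \<mu> P.emeasure_riesz_compact in auto)
  have "monge_ampere u = P.riesz"
    unfolding monge_ampere_def by (rule the_equality, rule Q, rule uniq)
  then show "sets (monge_ampere u) = sets borel" "\<And>K. compact K \<Longrightarrow> emeasure (monge_ampere u) K < \<infinity>"
    "\<And>\<omega>. \<omega> \<in> Cc_forms 0 \<Longrightarrow> ?T \<omega> = (LINT x|monge_ampere u. \<omega> x [])"
    using Q by auto
qed

text \<open>Expresses the measure of the ball through values of the top power on functions that do
  not depend on \<open>u\<close>. Linear relations between the currents of different support
  functions thus pass to their measures.\<close>

lemma monge_ampere_cball:
  fixes u :: "complex^'n::finite \<Rightarrow> real"
  assumes u: "convex_lipschitz L u"
  shows "(\<lambda>k. Re (ddc_power u CARD('n) (form0 (\<lambda>x. max 0 (1 - real (Suc k) * max 0 (norm x - 1))))))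
    \<longlonglongrightarrow> measure (monge_ampere u) (cball 0 1)"
proof -
  let ?\<phi> = "\<lambda>k x::complex^'n. max 0 (1 - real k * max 0 (norm x - 1))"
  note m = monge_ampere_props[OF u]
  note r = radon_measure_cball[OF m(1,2)]
  have c: "?\<phi> (Suc k) \<in> Cc_fun" for k by (rule r(2)) simp_all
  have "Re (ddc_power u CARD('n) (form0 (?\<phi> (Suc k)))) = (LINT x|monge_ampere u. ?\<phi> (Suc k) x)" for k
  proof -
    have "ddc_power u CARD('n) (form0 (?\<phi> (Suc k))) = (LINT x|monge_ampere u. of_real (?\<phi> (Suc k) x))"
      using m(3)[OF form0_Cc[OF c]] by (simp only: form0_Nil)
    also have "\<dots> = of_real (LINT x|monge_ampere u. ?\<phi> (Suc k) x)"
      by (rule integral_of_real[OF Cc_fun_integrable[OF m(1,2) c]])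
    finally show ?thesis by (simp only: Re_complex_of_real)
  qed
  then show ?thesis using LIMSEQ_Suc[OF r(1)] by (simp only:)
qed

section \<open>The ring identity for smooth factors\<close>

lemma cur_perm: "mset us = mset ws \<Longrightarrow> cur us \<phi> = cur ws \<phi>"
  unfolding cur_def using levis_cong_mset by metis

lemma hess_add:
  assumes "smooth_fun u" "smooth_fun v"
  shows "hess (\<lambda>x. u x + v x) x a b = hess u x a b + hess v x a b"
proof -
  have "dir_deriv b (\<lambda>x. u x + v x) = (\<lambda>x. dir_deriv b u x + dir_deriv b v x)"
    by (rule ext) (rule dir_deriv_add[OF assms])
  then show ?thesis
    unfolding hess_def using dir_deriv_add[OF smooth_dir_deriv[OF assms(1)] smooth_dir_deriv[OF assms(2)]] by simp
qed

lemma levi_add_left: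
  assumes "smooth_fun u" "smooth_fun v"
  shows "levi (\<lambda>x. u x + v x) \<omega> x vs = levi u \<omega> x vs + levi v \<omega> x vs"
  by (simp add: levi_def levi_at_def hess_add[OF assms] distrib_right sum.distrib)

lemma cur_add_left:
  assumes "smooth_fun u" "smooth_fun v" "\<And>w. w \<in> set ws \<Longrightarrow> smooth_fun w" "\<phi> \<in> Cc_forms d"
  shows "cur ((\<lambda>x. u x + v x) # ws) \<phi> = cur (u # ws) \<phi> + cur (v # ws) \<phi>"
  unfolding cur_def levis_simps levi_add_left[OF assms(1,2)]
proof (rule Bochner_Integration.integral_add)
  show "integrable lborel (\<lambda>x. levi u (levis ws \<phi>) x std_frame)"
    using cur_integrable[of "u # ws", OF _ assms(4)] assms by auto
  show "integrable lborel (\<lambda>x. levi v (levis ws \<phi>) x std_frame)"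
    using cur_integrable[of "v # ws", OF _ assms(4)] assms by auto
qed

text \<open>The additional factors \<open>cs\<close> collect the \<open>U\<close> and
  \<open>V\<close> that the recursion splits off; products are available only as expressions
  evaluated on a form, not as elements of a ring.\<close>

definition defect where
  "defect X Y U V k cs \<phi> = cur (replicate k X @ cs) \<phi> + cur (replicate k Y @ cs) \<phi>
     - cur (replicate k U @ cs) \<phi> - cur (replicate k V @ cs) \<phi>"

text \<open>If \<open>x + y = u + v\<close> in a commutative ring, then \<open>x y - u v = - f g\<close> for \<open>f = x - u\<close>, \<open>g = x - v\<close>, and the
  defects \<open>e\<^sub>k = x\<^sup>k + y\<^sup>k - u\<^sup>k - v\<^sup>k\<close> satisfy \<open>e\<^sub>k\<^sub>+\<^sub>2 = (u + v) e\<^sub>k\<^sub>+\<^sub>1 - u v e\<^sub>k + f g (x\<^sup>k + y\<^sup>k)\<close>.\<close>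

lemma defect_recursion:
  assumes s: "smooth_fun X" "smooth_fun Y" "smooth_fun U" "smooth_fun V" "smooth_fun F" "smooth_fun G"
    and cs: "\<And>c. c \<in> set cs \<Longrightarrow> smooth_fun c" and \<phi>: "\<phi> \<in> Cc_forms d"
    and eq: "X = (\<lambda>x. U x + F x)" "V = (\<lambda>x. Y x + F x)" "X = (\<lambda>x. V x + G x)" "U = (\<lambda>x. Y x + G x)"
  shows "defect X Y U V 0 cs \<phi> = 0" "defect X Y U V 1 cs \<phi> = 0"
    "defect X Y U V (Suc (Suc k)) cs \<phi> = defect X Y U V (Suc k) (U # cs) \<phi> + defect X Y U V (Suc k) (V # cs) \<phi>
      - defect X Y U V k (U # V # cs) \<phi> + cur (F # G # replicate k X @ cs) \<phi> + cur (F # G # replicate k Y @ cs) \<phi>"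
proof -
  show "defect X Y U V 0 cs \<phi> = 0" by (simp add: defect_def)
  have lin: "cur (X # P) \<phi> = cur (U # P) \<phi> + cur (F # P) \<phi>" "cur (V # P) \<phi> = cur (Y # P) \<phi> + cur (F # P) \<phi>"
    "cur (X # P) \<phi> = cur (V # P) \<phi> + cur (G # P) \<phi>" "cur (U # P) \<phi> = cur (Y # P) \<phi> + cur (G # P) \<phi>"
    if "\<And>c. c \<in> set P \<Longrightarrow> smooth_fun c" for P
  proof -
    note l = cur_add_left[OF _ _ that \<phi>]
    show "cur (X # P) \<phi> = cur (U # P) \<phi> + cur (F # P) \<phi>"
      using l[OF s(3) s(5)] unfolding eq(1)[symmetric] .
    show "cur (V # P) \<phi> = cur (Y # P) \<phi> + cur (F # P) \<phi>"
      using l[OF s(2) s(5)] unfolding eq(2)[symmetric] .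
    show "cur (X # P) \<phi> = cur (V # P) \<phi> + cur (G # P) \<phi>"
      using l[OF s(4) s(6)] unfolding eq(3)[symmetric] .
    show "cur (U # P) \<phi> = cur (Y # P) \<phi> + cur (G # P) \<phi>"
      using l[OF s(2) s(6)] unfolding eq(4)[symmetric] .
  qed
  show "defect X Y U V 1 cs \<phi> = 0"
    using lin(1,2)[OF cs] by (simp add: defect_def)
  have sw: "cur (a # b # P) \<phi> = cur (b # a # P) \<phi>" for a b P
    by (rule cur_perm) simp
  have mv: "cur (a # replicate j b @ c # cs) \<phi> = cur (c # a # replicate j b @ cs) \<phi>"
    "cur (replicate j b @ c # cs) \<phi> = cur (c # replicate j b @ cs) \<phi>"
    "cur (replicate j b @ c # e # cs) \<phi> = cur (c # e # replicate j b @ cs) \<phi>" for a b c e j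
    by (rule cur_perm, simp)+
  \<comment> \<open>The relations \<open>X Y = U V - F G\<close>,
    \<open>(U + V) X = X X + X Y\<close> and \<open>(U + V) Y = X Y + Y Y\<close>, each multiplied
    by arbitrary further factors \<open>P\<close>.\<close>
  have XY: "cur (X # Y # P) \<phi> = cur (U # V # P) \<phi> - cur (F # G # P) \<phi>"
    and UVX: "cur (U # X # P) \<phi> + cur (V # X # P) \<phi> = cur (X # X # P) \<phi> + cur (X # Y # P) \<phi>"
    and UVY: "cur (U # Y # P) \<phi> + cur (V # Y # P) \<phi> = cur (X # Y # P) \<phi> + cur (Y # Y # P) \<phi>"
    if P: "\<And>c. c \<in> set P \<Longrightarrow> smooth_fun c" for P
  proof -
    have sm: "\<And>c. c \<in> set (Y # P) \<Longrightarrow> smooth_fun c" "\<And>c. c \<in> set (V # P) \<Longrightarrow> smooth_fun c"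
      "\<And>c. c \<in> set (X # P) \<Longrightarrow> smooth_fun c" "\<And>c. c \<in> set (G # P) \<Longrightarrow> smooth_fun c"
      using s P by auto
    show "cur (X # Y # P) \<phi> = cur (U # V # P) \<phi> - cur (F # G # P) \<phi>"
      using lin(3)[of "Y # P", OF sm(1)] lin(4)[of "V # P", OF sm(2)] lin(2)[of "G # P", OF sm(4)] sw[of V Y P] sw[of G V P] sw[of G Y P] sw[of G F P]
      by (simp add: algebra_simps)
    show "cur (U # X # P) \<phi> + cur (V # X # P) \<phi> = cur (X # X # P) \<phi> + cur (X # Y # P) \<phi>"
      using lin(1)[of "X # P", OF sm(3)] lin(2)[of "X # P", OF sm(3)] sw[of X Y P] by (simp add: algebra_simps)
    show "cur (U # Y # P) \<phi> + cur (V # Y # P) \<phi> = cur (X # Y # P) \<phi> + cur (Y # Y # P) \<phi>"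
      using lin(1)[of "Y # P", OF sm(1)] lin(2)[of "Y # P", OF sm(1)] by (simp add: algebra_simps)
  qed
  have PX: "\<And>c. c \<in> set (replicate k X @ cs) \<Longrightarrow> smooth_fun c"
    and PY: "\<And>c. c \<in> set (replicate k Y @ cs) \<Longrightarrow> smooth_fun c"
    using s cs by auto
  show "defect X Y U V (Suc (Suc k)) cs \<phi> = defect X Y U V (Suc k) (U # cs) \<phi> + defect X Y U V (Suc k) (V # cs) \<phi>
      - defect X Y U V k (U # V # cs) \<phi> + cur (F # G # replicate k X @ cs) \<phi> + cur (F # G # replicate k Y @ cs) \<phi>"
  proof -
    let ?P = "replicate k X @ cs" and ?R = "replicate k Y @ cs"
    have e1: "cur (X # X # ?P) \<phi> = cur (U # X # ?P) \<phi> + cur (V # X # ?P) \<phi> - (cur (U # V # ?P) \<phi> - cur (F # G # ?P) \<phi>)"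
      by (simp only: XY[of ?P, OF PX, symmetric] UVX[of ?P, OF PX] add_diff_cancel_right')
    have e2: "cur (Y # Y # ?R) \<phi> = cur (U # Y # ?R) \<phi> + cur (V # Y # ?R) \<phi> - (cur (U # V # ?R) \<phi> - cur (F # G # ?R) \<phi>)"
      by (simp only: XY[of ?R, OF PY, symmetric] UVY[of ?R, OF PY] add_diff_cancel_left')
    show ?thesis
      unfolding defect_def replicate_Suc append_Cons mv e1 e2 sw[of V U] by (simp add: algebra_simps)
  qed
qed

section \<open>Vanishing of the mixed term\<close>

lemma hess_zero_local:
  assumes "r > 0" "\<And>y. dist x y < r \<Longrightarrow> f y = 0"
  shows "hess f x a b = 0"
proof -
  have d: "dir_deriv c g y = 0" if "dist x y < r" "\<And>y. dist x y < r \<Longrightarrow> g y = 0" for c g y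
  proof -
    have "(g has_derivative (\<lambda>v. 0)) (at y)"
      by (rule has_derivative_transform_within_open[of "\<lambda>x. 0" _ _ UNIV "ball x r"]) (use that in auto)
    then show ?thesis by (rule dir_deriv_eq)
  qed
  show ?thesis
    unfolding hess_def by (rule d) (use assms d[of _ f] in auto)
qed

lemma mseq_diff:
  assumes "continuous_on UNIV u" "continuous_on UNIV v"
  shows "mseq u m x - mseq v m x = mseq (\<lambda>x. u x - v x) m x"
  unfolding mseq_def using mollify_diff[of "\<lambda>x. of_real (u x)" "\<lambda>x. of_real (v x)" m x] assms
  by (simp add: continuous_on_of_real)

lemma mseq_add:
  assumes "continuous_on UNIV u" "continuous_on UNIV v"
  shows "mseq u m x + mseq v m x = mseq (\<lambda>x. u x + v x) m x"
  unfolding mseq_def using mollify_add[of "\<lambda>x. of_real (u x)" "\<lambda>x. of_real (v x)" m x] assms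
  by (simp add: continuous_on_of_real)

text \<open>Let \<open>\<delta>\<close> be the mollification radius. If
  \<open>f x > 2 * C * \<delta>\<close>, then \<open>f\<close> is positive and \<open>g\<close> is
  zero within distance \<open>2 * \<delta>\<close> of \<open>x\<close>, so the mollified
  \<open>g\<close> vanishes within \<open>\<delta>\<close> and its Hessian at \<open>x\<close> is 0.
  The third \<open>C * \<delta>\<close> is the error of mollifying \<open>f\<close>.\<close>

lemma disjoint_support_small:
  fixes f g :: "complex^'n::finite \<Rightarrow> real"
  assumes f: "\<And>x y. \<bar>f x - f y\<bar> \<le> C * dist x y" "continuous_on UNIV f" "\<And>x. 0 \<le> f x"
    and g: "continuous_on UNIV g" and fg: "\<And>x. f x * g x = 0" and C: "C \<ge> 0"
    and nz: "hess (mseq g m) x a b \<noteq> 0"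
  shows "norm (mseq f m x) \<le> 3 * C * inverse (real (Suc m))"
proof -
  let ?\<delta> = "inverse (real (Suc m))"
  have \<delta>: "?\<delta> > 0" by simp
  have "f x \<le> 2 * C * ?\<delta>"
  proof (rule ccontr)
    assume "\<not> ?thesis"
    then have big: "f x > 2 * C * ?\<delta>" by simp
    have g0: "g y = 0" if "dist x y \<le> 2 * ?\<delta>" for y
    proof -
      have "C * dist x y \<le> C * (2 * ?\<delta>)" using that C by (rule mult_left_mono)
      then have "f y > 0" using f(1)[of x y] big by (simp add: mult_ac)
      then show ?thesis using fg[of y] by simp
    qed
    have "mseq g m z = 0" if z: "dist x z < ?\<delta>" for z
    proof -
      have "norm (mseq g m z - of_real (g z)) \<le> 0"
        unfolding mseq_def
      proof (rule mollify_close)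
        show "continuous_on UNIV (\<lambda>x. complex_of_real (g x))" using g by (intro continuous_intros)
        fix y assume y: "dist z y \<le> ?\<delta>"
        have "dist x y \<le> 2 * ?\<delta>" using dist_triangle[of x y z] z y by linarith
        moreover have "dist x z \<le> 2 * ?\<delta>" using z \<delta> by linarith
        ultimately show "norm (complex_of_real (g z) - complex_of_real (g y)) \<le> 0" using g0 by simp
      qed
      moreover have "dist x z \<le> 2 * ?\<delta>" using z \<delta> by linarith
      ultimately show ?thesis using g0[of z] by simp
    qed
    then have "hess (mseq g m) x a b = 0" by (rule hess_zero_local[OF \<delta>])
    with nz show False by simp
  qed
  moreover have "norm (mseq f m x - of_real (f x)) \<le> C * ?\<delta>"
    by (rule mseq_close[OF f(1,2) C])
  moreover have "norm (mseq f m x) \<le> norm (mseq f m x - of_real (f x)) + \<bar>f x\<bar>"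
    using norm_triangle_ineq[of "mseq f m x - of_real (f x)" "of_real (f x)"] by simp
  ultimately show ?thesis using f(3)[of x] by simp
qed

text \<open>The key estimate: the Lipschitz functions \<open>max u v - u\<close> and \<open>max u v - v\<close> have product zero. So the
  mollification of either is uniformly small wherever that of the other is not locally zero, and
  integration by parts removes the second derivatives of the small factor.\<close>

lemma mixed_term_vanishes:
  fixes u v w :: "complex^'n::finite \<Rightarrow> real"
  assumes u: "convex_lipschitz L u" and v: "convex_lipschitz L v" and w: "convex_lipschitz L w"
    and wuv: "\<And>x. w x = max (u x) (v x)"
    and rest: "\<And>f. f \<in> set rest \<Longrightarrow> psd_seq f" "length rest + 2 \<le> CARD('n)"
    and \<phi>: "\<phi> \<in> test_forms d"
  shows "(\<lambda>m. cur ((\<lambda>x. mseq w m x - mseq u m x) # (\<lambda>x. mseq w m x - mseq v m x) # map (\<lambda>f. f m) rest) \<phi>) \<longlonglongrightarrow> 0"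
proof -
  let ?K = "real (2 * CARD('n)) ^ (2 * CARD('n))"
  have L0: "L \<ge> 0"
  proof -
    obtain b :: "complex^'n" where "b \<in> Basis" using nonempty_Basis by blast
    then have "dist b 0 = 1" by simp
    then have "\<bar>u b - u 0\<bar> \<le> L * 1" using u unfolding convex_lipschitz_def by metis
    then show ?thesis by linarith
  qed
  note cu = convex_lipschitz_continuous[OF u] and cv = convex_lipschitz_continuous[OF v] and cw = convex_lipschitz_continuous[OF w]
  define f where "f x = w x - u x" for x
  define g where "g x = w x - v x" for x
  have lip: "\<bar>f x - f y\<bar> \<le> 2 * L * dist x y" for x y
  proof -
    have "\<bar>w x - w y\<bar> \<le> L * dist x y" "\<bar>u x - u y\<bar> \<le> L * dist x y"
      using u w by (auto simp: convex_lipschitz_def)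
    then show ?thesis unfolding f_def by linarith
  qed
  have cf: "continuous_on UNIV f" "continuous_on UNIV g"
    unfolding f_def[abs_def] g_def[abs_def] by (intro continuous_intros cu cv cw)+
  have f0: "0 \<le> f x" and fg: "f x * g x = 0" for x
    unfolding f_def g_def wuv by (auto simp: max_def)
  define F where "F m = (\<lambda>x. mseq w m x - mseq u m x)" for m
  define G where "G m = (\<lambda>x. mseq w m x - mseq v m x)" for m
  have F: "F m = mseq f m" and G: "G m = mseq g m" for m
    unfolding F_def G_def f_def[abs_def] g_def[abs_def] using mseq_diff[OF cw cu] mseq_diff[OF cw cv] by auto
  have sm: "smooth_fun (mseq u m)" "smooth_fun (mseq v m)" "smooth_fun (mseq w m)" for m
    unfolding mseq_def by (intro smooth_mollify continuous_intros cu cv cw)+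
  have sF: "smooth_fun (F m)" and sG: "smooth_fun (G m)" for m
    unfolding F_def G_def by (intro smooth_diff sm)+
  let ?R = "\<lambda>m. map (\<lambda>f. f m) rest"
  have sR: "smooth_fun c" if "c \<in> set (?R m)" for c m
    using that rest(1) by (auto simp: psd_seq_def psd_smoothD)
  obtain r where r: "\<And>x. x \<notin> cball 0 r \<Longrightarrow> \<phi> x = (\<lambda>_. 0)"
    using Cc_formsD(3)[OF test_formsD(2)[OF \<phi>]] by blast
  note out = ddc_outside[OF test_formsD(1)[OF \<phi>] compact_cball[of 0 r] r]
  have "(\<lambda>x vs. 1 * ddc \<phi> x vs) \<in> Cc_forms (d + 2)"
    by (rule mult_ddc_in_Cc_forms[OF \<phi>]) simp
  then have "ddc \<phi> \<in> Cc_forms (d + 2)" by simp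
  then obtain M where M: "M > 0" "bounded_form M (ddc \<phi>)" by (rule Cc_forms_bounded)
  have psdw: "psd_seq (mseq w)" "psd_seq (mseq v)" using mseq_convex_lipschitz(1) w v by auto
  have ps: "psd_smooth c" if "c \<in> set (mseq h m # ?R m)" "psd_seq (mseq h)" for c h m
    using that rest(1) by (auto simp: psd_seq_def)
  let ?D = "\<lambda>h m x. indicator (cball 0 r) x * dens (mseq h m # ?R m) x"
  obtain D1 where D1: "\<And>m. (LINT x|lborel. ?D w m x) \<le> D1"
    using mass_bound[of "mseq w # rest" r] rest psdw by auto
  obtain D2 where D2: "\<And>m. (LINT x|lborel. ?D v m x) \<le> D2"
    using mass_bound[of "mseq v # rest" r] rest psdw by auto
  \<comment> \<open>The constant is 6 = 3 * 2, as the difference \<open>f\<close> of two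
    \<open>L\<close>-Lipschitz functions has Lipschitz constant \<open>2 * L\<close>.\<close>
  have bound: "norm (cur (F m # G m # ?R m) \<phi>) \<le> (6 * L * ?K * M * (D1 + D2)) * inverse (real (Suc m))" for m
  proof -
    let ?\<delta> = "inverse (real (Suc m))"
    let ?c = "6 * L * ?\<delta> * ?K * M"
    have c0: "?c \<ge> 0" using L0 M(1) by simp
    have "cur (F m # G m # ?R m) \<phi> = cur ((G m # ?R m) @ [F m]) \<phi>"
      by (rule cur_perm) simp
    also have "\<dots> = cur (G m # ?R m) (\<lambda>x vs. F m x * ddc \<phi> x vs)"
      by (rule cur_ddc[symmetric, OF _ sF \<phi>]) (use sG sR in auto)
    finally have eq: "cur (F m # G m # ?R m) \<phi> = (LINT x|lborel. F m x * levis (G m # ?R m) (ddc \<phi>) x std_frame)"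
      unfolding cur_def levis_scale .
    have int: "integrable lborel (?D h m)" if "psd_seq (mseq h)" for h
      by (rule dens_integrable) (use ps[OF _ that] psd_smoothD in blast)
    \<comment> \<open>The function \<open>G m\<close> is a difference of convex functions and has no
      sign. Splitting it yields two products with positive factors, to which the domination by
      densities applies.\<close>
    have dec: "levis (G m # ?R m) (ddc \<phi>) x std_frame
        = levis (mseq w m # ?R m) (ddc \<phi>) x std_frame - levis (mseq v m # ?R m) (ddc \<phi>) x std_frame" for x
    proof -
      have "mseq w m = (\<lambda>x. G m x + mseq v m x)" by (simp add: G_def)
      then show ?thesis
        using levi_add_left[OF sG sm(2), of m m "levis (?R m) (ddc \<phi>)" x std_frame] by simp
    qed
    have pt: "norm (F m x * levis (G m # ?R m) (ddc \<phi>) x std_frame) \<le> ?c * (?D w m x + ?D v m x)" for x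
    \<comment> \<open>Off the support of the test form, or where the Hessian of \<open>G m\<close>
      is zero, the integrand vanishes. Elsewhere \<open>F m\<close> is small.\<close>
    proof (cases "x \<in> cball 0 r \<and> (\<exists>a b. hess (G m) x a b \<noteq> 0)")
      case True
      then obtain a b where "hess (mseq g m) x a b \<noteq> 0" unfolding G by blast
      from disjoint_support_small[OF lip cf(1) f0 cf(2) fg _ this] L0
      have Fx: "norm (F m x) \<le> 6 * L * ?\<delta>" unfolding F by simp
      have bb: "norm (levis (mseq h m # ?R m) (ddc \<phi>) x std_frame) \<le> ?K * M * dens (mseq h m # ?R m) x"
        if h: "psd_seq (mseq h)" for h
        by (rule dens_dominates(3)) (use ps[OF _ h] rest(2) M(2) in \<open>auto simp: bounded_form_def\<close>)
      have "norm (levis (G m # ?R m) (ddc \<phi>) x std_frame)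
          \<le> norm (levis (mseq w m # ?R m) (ddc \<phi>) x std_frame) + norm (levis (mseq v m # ?R m) (ddc \<phi>) x std_frame)"
        unfolding dec by (rule norm_triangle_ineq4)
      also have "\<dots> \<le> ?K * M * dens (mseq w m # ?R m) x + ?K * M * dens (mseq v m # ?R m) x"
        by (intro add_mono bb psdw)
      finally have "norm (levis (G m # ?R m) (ddc \<phi>) x std_frame)
          \<le> ?K * M * (dens (mseq w m # ?R m) x + dens (mseq v m # ?R m) x)"
        by (simp add: distrib_left)
      from mult_mono[OF Fx this] show ?thesis
        using True L0 by (simp add: norm_mult mult_ac)
    next
      case False
      have "levis (G m # ?R m) (ddc \<phi>) x std_frame = 0"
      proof (cases "x \<in> cball 0 r")
        case True
        then have "hess (G m) x a b = 0" for a b using False by blast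
        then show ?thesis by (simp add: levi_def levi_at_def)
      next
        case False
        have "ddc \<phi> x = (\<lambda>_. 0)" by (rule out) (use False in auto)
        then show ?thesis using levis_zero[of "ddc \<phi>" x "G m # ?R m"] by simp
      qed
      moreover have "0 \<le> ?D h m x" if h: "psd_seq (mseq h)" for h
      proof -
        have "0 \<le> dens (mseq h m # ?R m) x"
          by (rule dens_dominates(1)) (use ps[OF _ h] rest(2) in auto)
        then show ?thesis by simp
      qed
      ultimately show ?thesis using c0 psdw by (simp add: mult_nonneg_nonneg add_nonneg_nonneg)
    qed
    have iD: "integrable lborel (\<lambda>x. ?c * (?D w m x + ?D v m x))"
      by (intro integrable_mult_right Bochner_Integration.integrable_add int psdw)
    have "norm (cur (F m # G m # ?R m) \<phi>) \<le> (LINT x|lborel. norm (F m x * levis (G m # ?R m) (ddc \<phi>) x std_frame))"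
      unfolding eq by (rule Bochner_Integration.integral_norm_bound)
    also have "\<dots> \<le> (LINT x|lborel. ?c * (?D w m x + ?D v m x))"
      by (rule integral_mono'[OF iD pt order_trans[OF norm_ge_zero pt]])
    also have "\<dots> = ?c * ((LINT x|lborel. ?D w m x) + (LINT x|lborel. ?D v m x))"
      using int[OF psdw(1)] int[OF psdw(2)] by simp
    also have "\<dots> \<le> ?c * (D1 + D2)"
      by (intro mult_left_mono add_mono D1 D2 c0)
    finally show ?thesis by (simp only: mult_ac)
  qed
  have "(\<lambda>m. (6 * L * ?K * M * (D1 + D2)) * inverse (real (Suc m))) \<longlonglongrightarrow> 0"
    by (intro tendsto_mult_right_zero LIMSEQ_inverse_real_of_nat)
  from Lim_null_comparison[OF always_eventually this, of "\<lambda>m. cur (F m # G m # ?R m) \<phi>"] bound show ?thesis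
    unfolding F_def G_def by blast
qed

text \<open>For the mollified functions the defects satisfy an exact recursion whose inhomogeneous
  terms are mixed terms tending to 0, so all defects tend to 0 on test forms. The relation then
  extends to continuous forms by mollifying them.\<close>

lemma monge_ampere_valuation:
  fixes u v w z :: "complex^'n::finite \<Rightarrow> real"
  assumes u: "convex_lipschitz L u" and v: "convex_lipschitz L v" and w: "convex_lipschitz L w" and z: "convex_lipschitz L z"
    and wuv: "\<And>x. w x = max (u x) (v x)" and zuv: "\<And>x. z x = min (u x) (v x)"
    and \<omega>: "\<omega> \<in> Cc_forms 0"
  shows "ddc_power w CARD('n) \<omega> + ddc_power z CARD('n) \<omega> = ddc_power u CARD('n) \<omega> + ddc_power v CARD('n) \<omega>"
proof -
  note c = convex_lipschitz_continuous
  have sm: "smooth_fun (mseq h m)" if "convex_lipschitz L h" for h :: "complex^'n \<Rightarrow> real" and m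
    unfolding mseq_def by (intro smooth_mollify continuous_intros c[OF that])
  have psd: "psd_seq (mseq h)" if "convex_lipschitz L h" for h :: "complex^'n \<Rightarrow> real"
    by (rule mseq_convex_lipschitz(1)[OF that])
  define F where "F m = (\<lambda>x. mseq w m x - mseq u m x)" for m
  define G where "G m = (\<lambda>x. mseq w m x - mseq v m x)" for m
  have sF: "smooth_fun (F m)" and sG: "smooth_fun (G m)" for m
    unfolding F_def G_def by (intro smooth_diff sm u v w)+
  have sum: "mseq w m x + mseq z m x = mseq u m x + mseq v m x" for m x
  proof -
    have "(\<lambda>x. w x + z x) = (\<lambda>x. u x + v x)" by (auto simp: wuv zuv)
    then show ?thesis
      using mseq_add[OF c[OF w] c[OF z], of m x] mseq_add[OF c[OF u] c[OF v], of m x] by simp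
  qed
  have eq: "mseq w m = (\<lambda>x. mseq u m x + F m x)" "mseq v m = (\<lambda>x. mseq z m x + F m x)"
    "mseq w m = (\<lambda>x. mseq v m x + G m x)" "mseq u m = (\<lambda>x. mseq z m x + G m x)" for m
    using sum[of m] by (auto simp: F_def G_def fun_eq_iff algebra_simps)
  have test: "ddc_power w CARD('n) \<phi> + ddc_power z CARD('n) \<phi> = ddc_power u CARD('n) \<phi> + ddc_power v CARD('n) \<phi>"
    if \<phi>: "\<phi> \<in> test_forms 0" for \<phi>
  proof -
    note \<phi>C = test_formsD(2)[OF \<phi>]
    let ?E = "\<lambda>k cs m. defect (mseq w m) (mseq z m) (mseq u m) (mseq v m) k (map (\<lambda>f. f m) cs) \<phi>"
    \<comment> \<open>The bound on \<open>k + length cs\<close> is inherited in the recursion, as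
      each factor added to \<open>cs\<close> is taken from \<open>k\<close>. It keeps the mixed
      terms within the range of the mass bounds.\<close>
    have E: "(\<lambda>m. ?E k cs m) \<longlonglongrightarrow> 0"
      if "\<And>f. f \<in> set cs \<Longrightarrow> psd_seq f" "k + length cs \<le> CARD('n)" for k cs
      using that
    proof (induction k arbitrary: cs rule: less_induct)
      case (less k)
      have rec: "?E 0 cs m = 0" "?E 1 cs m = 0"
        "?E (Suc (Suc j)) cs m = ?E (Suc j) (mseq u # cs) m + ?E (Suc j) (mseq v # cs) m - ?E j (mseq u # mseq v # cs) m
            + cur (F m # G m # map (\<lambda>f. f m) (replicate j (mseq w) @ cs)) \<phi>
            + cur (F m # G m # map (\<lambda>f. f m) (replicate j (mseq z) @ cs)) \<phi>" for m j
      proof -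
        have scs: "\<And>c. c \<in> set (map (\<lambda>f. f m) cs) \<Longrightarrow> smooth_fun c"
          using less.prems(1) by (auto simp: psd_seq_def psd_smoothD)
        note r = defect_recursion[where X = "mseq w m" and Y = "mseq z m" and U = "mseq u m" and V = "mseq v m"
            and F = "F m" and G = "G m" and cs = "map (\<lambda>f. f m) cs",
            OF sm[OF w] sm[OF z] sm[OF u] sm[OF v] sF sG scs \<phi>C eq]
        show "?E 0 cs m = 0" by (rule r(1))
        show "?E 1 cs m = 0" by (rule r(2))
        show "?E (Suc (Suc j)) cs m = ?E (Suc j) (mseq u # cs) m + ?E (Suc j) (mseq v # cs) m - ?E j (mseq u # mseq v # cs) m
            + cur (F m # G m # map (\<lambda>f. f m) (replicate j (mseq w) @ cs)) \<phi>
            + cur (F m # G m # map (\<lambda>f. f m) (replicate j (mseq z) @ cs)) \<phi>"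
          using r(3)[of j] by simp
      qed
      consider "k = 0" | "k = 1" | j where "k = Suc (Suc j)"
        by (metis One_nat_def not0_implies_Suc)
      then show ?case
      proof cases
        case 1
        then show ?thesis unfolding 1 rec(1) by simp
      next
        case 2
        then show ?thesis unfolding 2 rec(2) by simp
      next
        case 3
        have p: "psd_seq f" if "f \<in> set (mseq u # cs) \<or> f \<in> set (mseq v # cs) \<or> f \<in> set (mseq u # mseq v # cs)
            \<or> f \<in> set (replicate j (mseq w) @ cs) \<or> f \<in> set (replicate j (mseq z) @ cs)" for f
          using that less.prems(1) psd u v w z by (auto split: if_splits)
        have len: "Suc j + length (mseq u # cs) \<le> CARD('n)" "j + length (mseq u # mseq v # cs) \<le> CARD('n)"
          "length (replicate j (mseq w) @ cs) + 2 \<le> CARD('n)" "length (replicate j (mseq z) @ cs) + 2 \<le> CARD('n)"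
          using less.prems(2) 3 by auto
        have l1: "(\<lambda>m. ?E (Suc j) (mseq u # cs) m) \<longlonglongrightarrow> 0"
          by (rule less.IH) (use 3 p len in auto)
        have l2: "(\<lambda>m. ?E (Suc j) (mseq v # cs) m) \<longlonglongrightarrow> 0"
          by (rule less.IH) (use 3 p len in auto)
        have l3: "(\<lambda>m. ?E j (mseq u # mseq v # cs) m) \<longlonglongrightarrow> 0"
          by (rule less.IH) (use 3 p len in auto)
        have l4: "(\<lambda>m. cur (F m # G m # map (\<lambda>f. f m) (replicate j (mseq w) @ cs)) \<phi>) \<longlonglongrightarrow> 0"
          unfolding F_def G_def by (rule mixed_term_vanishes[OF u v w wuv _ len(3) \<phi>]) (use p in blast)
        have l5: "(\<lambda>m. cur (F m # G m # map (\<lambda>f. f m) (replicate j (mseq z) @ cs)) \<phi>) \<longlonglongrightarrow> 0"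
          unfolding F_def G_def by (rule mixed_term_vanishes[OF u v w wuv _ len(4) \<phi>]) (use p in blast)
        show ?thesis
          unfolding 3 rec(3)
          using tendsto_add[OF tendsto_add[OF tendsto_diff[OF tendsto_add[OF l1 l2] l3] l4] l5] by simp
      qed
    qed
    have "(\<lambda>m. ?E CARD('n) [] m) \<longlonglongrightarrow> ddc_power w CARD('n) \<phi> + ddc_power z CARD('n) \<phi>
        - ddc_power u CARD('n) \<phi> - ddc_power v CARD('n) \<phi>"
      unfolding defect_def
      using tendsto_diff[OF tendsto_diff[OF tendsto_add[OF top_power(2)[OF w \<phi>C] top_power(2)[OF z \<phi>C]]
          top_power(2)[OF u \<phi>C]] top_power(2)[OF v \<phi>C]] by simp
    from LIMSEQ_unique[OF this E[of "[]" "CARD('n)"]] show ?thesis by (simp add: algebra_simps)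
  qed
  obtain R where R: "\<And>x. x \<notin> cball 0 R \<Longrightarrow> \<omega> x = (\<lambda>_. 0)" using Cc_formsD(3)[OF \<omega>] by blast
  have "mollify_form m \<omega> \<in> test_forms 0" for m
    by (rule mollify_form_test(1)[OF \<omega>, of R]) (rule R)
  note t = test[OF this]
  note l = current_mollify_tendsto[OF top_power(1) \<omega>]
  have "(\<lambda>m. ddc_power w CARD('n) (mollify_form m \<omega>) + ddc_power z CARD('n) (mollify_form m \<omega>))
      \<longlonglongrightarrow> ddc_power w CARD('n) \<omega> + ddc_power z CARD('n) \<omega>"
    by (rule tendsto_add[OF l[OF w] l[OF z]])
  moreover have "(\<lambda>m. ddc_power u CARD('n) (mollify_form m \<omega>) + ddc_power v CARD('n) (mollify_form m \<omega>))
      \<longlonglongrightarrow> ddc_power u CARD('n) \<omega> + ddc_power v CARD('n) \<omega>"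
    by (rule tendsto_add[OF l[OF u] l[OF v]])
  ultimately show ?thesis
    unfolding t using LIMSEQ_unique by blast
qed

section \<open>Support functions\<close>

lemma Re_herm: "Re (herm z v) = z \<bullet> v"
  by (simp add: herm_def inner_vec_def inner_complex_def)

lemma support_fun_attained:
  fixes A :: "(complex^'n::finite) set"
  assumes "convex_body A"
  obtains v where "v \<in> A" "support_fun A z = z \<bullet> v" "\<And>w. w \<in> A \<Longrightarrow> z \<bullet> w \<le> z \<bullet> v"
proof -
  have "compact A" "A \<noteq> {}" using assms by (auto simp: convex_body_def)
  moreover have "continuous_on A (\<lambda>v. z \<bullet> v)" by (intro continuous_intros)
  ultimately obtain v where v: "v \<in> A" "\<And>w. w \<in> A \<Longrightarrow> z \<bullet> w \<le> z \<bullet> v"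
    using continuous_attains_sup by metis
  have "support_fun A z = z \<bullet> v"
    unfolding support_fun_def Re_herm using v by (intro cSup_eq_maximum) auto
  then show ?thesis using v that by blast
qed

lemma support_fun_upper:
  assumes "convex_body A" "w \<in> A"
  shows "z \<bullet> w \<le> support_fun A z"
  using support_fun_attained[OF assms(1), of z] assms(2) by metis

lemma support_fun_convex_lipschitz:
  fixes A :: "(complex^'n::finite) set"
  assumes A: "convex_body A" and B: "\<And>v. v \<in> A \<Longrightarrow> norm v \<le> B"
  shows "convex_lipschitz B (support_fun A)"
  unfolding convex_lipschitz_def
proof (intro conjI allI)
  show "convex_on UNIV (support_fun A)"
  proof (rule convex_onI)
    fix t :: real and x y :: "complex^'n" assume t: "0 < t" "t < 1"
    obtain v where v: "v \<in> A" "support_fun A ((1 - t) *\<^sub>R x + t *\<^sub>R y) = ((1 - t) *\<^sub>R x + t *\<^sub>R y) \<bullet> v"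
      using support_fun_attained[OF A] by metis
    have "(1 - t) * (x \<bullet> v) + t * (y \<bullet> v) \<le> (1 - t) * support_fun A x + t * support_fun A y"
      using t by (intro add_mono mult_left_mono support_fun_upper[OF A v(1)]) auto
    then show "support_fun A ((1 - t) *\<^sub>R x + t *\<^sub>R y) \<le> (1 - t) * support_fun A x + t * support_fun A y"
      by (simp add: v(2) inner_add_left)
  qed simp
  have le: "support_fun A x - support_fun A y \<le> B * dist x y" for x y
  proof -
    obtain v where v: "v \<in> A" "support_fun A x = x \<bullet> v"
      using support_fun_attained[OF A] by metis
    have "support_fun A x - support_fun A y \<le> (x - y) \<bullet> v"
      using support_fun_upper[OF A v(1), of y] by (simp add: v(2) inner_diff_left)
    also have "\<dots> \<le> norm (x - y) * norm v" by (rule norm_cauchy_schwarz)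
    also have "\<dots> \<le> norm (x - y) * B" by (intro mult_left_mono B v) simp
    finally show ?thesis by (simp add: dist_norm mult.commute)
  qed
  show "\<bar>support_fun A x - support_fun A y\<bar> \<le> B * dist x y" for x y
    using le[of x y] le[of y x] by (simp add: dist_commute abs_le_iff)
qed

lemma support_fun_union:
  assumes "convex_body A" "convex_body P" "convex_body N" "A = P \<union> N"
  shows "support_fun A x = max (support_fun P x) (support_fun N x)"
proof (rule antisym)
  obtain v where v: "v \<in> A" "support_fun A x = x \<bullet> v"
    using support_fun_attained[OF assms(1)] by metis
  then show "support_fun A x \<le> max (support_fun P x) (support_fun N x)"
    using support_fun_upper[OF assms(2), of v x] support_fun_upper[OF assms(3), of v x] assms(4) by auto
  obtain p where p: "p \<in> P" "support_fun P x = x \<bullet> p" using support_fun_attained[OF assms(2)] by metis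
  obtain q where q: "q \<in> N" "support_fun N x = x \<bullet> q" using support_fun_attained[OF assms(3)] by metis
  show "max (support_fun P x) (support_fun N x) \<le> support_fun A x"
    using support_fun_upper[OF assms(1), of p x] support_fun_upper[OF assms(1), of q x] p q assms(4) by auto
qed

text \<open>A segment from a maximiser in one half to a maximiser in the other one crosses the cutting hyperplane.\<close>

lemma support_fun_cut:
  fixes A :: "(complex^'n::finite) set"
  assumes "convex A" "convex_body (A \<inter> {z. a \<bullet> z \<ge> b})" "convex_body (A \<inter> {z. a \<bullet> z \<le> b})" "convex_body (A \<inter> {z. a \<bullet> z = b})"
  shows "support_fun (A \<inter> {z. a \<bullet> z = b}) x
    = min (support_fun (A \<inter> {z. a \<bullet> z \<ge> b}) x) (support_fun (A \<inter> {z. a \<bullet> z \<le> b}) x)"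
proof (rule antisym)
  obtain v where v: "v \<in> A \<inter> {z. a \<bullet> z = b}" "support_fun (A \<inter> {z. a \<bullet> z = b}) x = x \<bullet> v"
    using support_fun_attained[OF assms(4)] by metis
  show "support_fun (A \<inter> {z. a \<bullet> z = b}) x
      \<le> min (support_fun (A \<inter> {z. a \<bullet> z \<ge> b}) x) (support_fun (A \<inter> {z. a \<bullet> z \<le> b}) x)"
    using support_fun_upper[OF assms(2), of v x] support_fun_upper[OF assms(3), of v x] v by auto
  obtain p where p: "p \<in> A" "a \<bullet> p \<ge> b" "support_fun (A \<inter> {z. a \<bullet> z \<ge> b}) x = x \<bullet> p"
    using support_fun_attained[OF assms(2)] by (metis IntD1 IntD2 mem_Collect_eq)
  obtain q where q: "q \<in> A" "a \<bullet> q \<le> b" "support_fun (A \<inter> {z. a \<bullet> z \<le> b}) x = x \<bullet> q"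
    using support_fun_attained[OF assms(3)] by (metis IntD1 IntD2 mem_Collect_eq)
  obtain t where t: "0 \<le> t" "t \<le> 1" "(1 - t) * (a \<bullet> q) + t * (a \<bullet> p) = b"
  \<comment> \<open>If the two values coincide, both are \<open>b\<close> and any \<open>t\<close>
    works; otherwise \<open>t\<close> solves a linear equation with positive leading
    coefficient.\<close>
  proof (cases "a \<bullet> p = a \<bullet> q")
    case True
    then show ?thesis using p q that[of 0] by simp
  next
    case False
    then have pos: "a \<bullet> p - a \<bullet> q > 0" using p q by simp
    show ?thesis
    proof (rule that)
      show "0 \<le> (b - a \<bullet> q) / (a \<bullet> p - a \<bullet> q)" using pos q by simp
      show "(b - a \<bullet> q) / (a \<bullet> p - a \<bullet> q) \<le> 1" using pos p by simp
      show "(1 - (b - a \<bullet> q) / (a \<bullet> p - a \<bullet> q)) * (a \<bullet> q) + (b - a \<bullet> q) / (a \<bullet> p - a \<bullet> q) * (a \<bullet> p) = b"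
      proof -
        have "(b - a \<bullet> q) / (a \<bullet> p - a \<bullet> q) * (a \<bullet> p - a \<bullet> q) = b - a \<bullet> q" using pos by simp
        then show ?thesis by (simp add: left_diff_distrib right_diff_distrib)
      qed
    qed
  qed
  let ?r = "(1 - t) *\<^sub>R q + t *\<^sub>R p"
  have "?r \<in> A \<inter> {z. a \<bullet> z = b}"
    using t convexD_alt[OF assms(1) q(1) p(1), of t] by (simp add: inner_add_right)
  from support_fun_upper[OF assms(4) this, of x]
  have "(1 - t) * (x \<bullet> q) + t * (x \<bullet> p) \<le> support_fun (A \<inter> {z. a \<bullet> z = b}) x"
    by (simp add: inner_add_right)
  moreover have "min (x \<bullet> p) (x \<bullet> q) \<le> (1 - t) * (x \<bullet> q) + t * (x \<bullet> p)"
  proof -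
    have "(1 - t) * min (x \<bullet> p) (x \<bullet> q) + t * min (x \<bullet> p) (x \<bullet> q) \<le> (1 - t) * (x \<bullet> q) + t * (x \<bullet> p)"
      using t by (intro add_mono mult_left_mono) auto
    then show ?thesis by (simp add: algebra_simps)
  qed
  ultimately show "min (support_fun (A \<inter> {z. a \<bullet> z \<ge> b}) x) (support_fun (A \<inter> {z. a \<bullet> z \<le> b}) x)
      \<le> support_fun (A \<inter> {z. a \<bullet> z = b}) x"
    using p q by simp
qed

text \<open>Mollification commutes with translations and preserves constants, so the mollified
  function obeys the same translation law. Its derivative along \<open>\<nu>\<close> is then the
  constant \<open>c\<close>.\<close>

lemma hess_affine_direction:
  fixes u :: "complex^'n::finite \<Rightarrow> real"
  assumes u: "continuous_on UNIV u" and aff: "\<And>x t. u (x + t *\<^sub>R \<nu>) = u x + t * c"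
  shows "hess (mseq u m) x \<nu> \<nu> = 0"
proof -
  have uc: "continuous_on UNIV (\<lambda>x. complex_of_real (u x))" using u by (intro continuous_intros)
  have sm: "smooth_fun (mseq u m)" unfolding mseq_def by (rule smooth_mollify[OF uc])
  have tr: "mseq u m (x + t *\<^sub>R \<nu>) = mseq u m x + of_real (t * c)" for x t
  proof -
    have "mseq u m (x + t *\<^sub>R \<nu>) = (LINT y|lborel. of_real (moll m y) * of_real (u (x + t *\<^sub>R \<nu> - y)))"
      unfolding mseq_def by (rule mollify_eq[OF uc])
    also have "\<dots> = (LINT y|lborel. of_real (moll m y) * of_real (u (x - y)) + of_real (moll m y) * of_real (t * c))"
    proof (intro Bochner_Integration.integral_cong refl)
      fix y
      have "x + t *\<^sub>R \<nu> - y = (x - y) + t *\<^sub>R \<nu>" by simp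
      then have "u (x + t *\<^sub>R \<nu> - y) = u (x - y) + t * c" by (simp only: aff)
      then show "complex_of_real (moll m y) * of_real (u (x + t *\<^sub>R \<nu> - y))
          = of_real (moll m y) * of_real (u (x - y)) + of_real (moll m y) * of_real (t * c)"
        by (simp add: distrib_left)
    qed
    also have "\<dots> = (LINT y|lborel. of_real (moll m y) * of_real (u (x - y))) + (LINT y|lborel. of_real (moll m (y::complex^'n)) * of_real (t * c))"
      by (rule Bochner_Integration.integral_add[OF mollify_integrable[OF uc]])
        (use moll_integral(1)[where 'n='n, of m] in simp)
    also have "\<dots> = mseq u m x + of_real (t * c)"
      unfolding mollify_const mseq_def mollify_eq[OF uc] ..
    finally show ?thesis .
  qed
  have "dir_deriv \<nu> (mseq u m) x = of_real c" for x
  proof -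
    have 1: "((\<lambda>s. Re (mseq u m (x + s *\<^sub>R \<nu>))) has_real_derivative Re (dir_deriv \<nu> (mseq u m) x)) (at 0)"
      "((\<lambda>s. Im (mseq u m (x + s *\<^sub>R \<nu>))) has_real_derivative Im (dir_deriv \<nu> (mseq u m) x)) (at 0)"
      using dir_deriv_line[OF sm bounded_linear_Re, of x \<nu> 0] dir_deriv_line[OF sm bounded_linear_Im, of x \<nu> 0] by simp_all
    have 2: "((\<lambda>s. Re (mseq u m (x + s *\<^sub>R \<nu>))) has_real_derivative c) (at 0)"
      "((\<lambda>s. Im (mseq u m (x + s *\<^sub>R \<nu>))) has_real_derivative 0) (at 0)"
      unfolding tr by (auto intro!: derivative_eq_intros)
    show ?thesis
      using DERIV_unique[OF 1(1) 2(1)] DERIV_unique[OF 1(2) 2(2)] by (simp add: complex_eq_iff)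
  qed
  then have "dir_deriv \<nu> (mseq u m) = (\<lambda>x. of_real c)" by blast
  then show ?thesis by (simp add: hess_def)
qed

text \<open>The Hessians of the mollified functions vanish in the directions \<open>\<nu>\<close>
  and \<open>\<i> *s \<nu>\<close>, so all vectors of the rank one expansion are orthogonal to one
  complex line. Already the approximating densities are zero, before any limit.\<close>

lemma top_power_degenerate:
  fixes u :: "complex^'n::finite \<Rightarrow> real"
  assumes u: "convex_lipschitz L u" and \<nu>: "\<nu> \<noteq> 0"
    and aff: "\<And>x t. u (x + t *\<^sub>R \<nu>) = u x + t * c" "\<And>x t. u (x + t *\<^sub>R (\<i> *s \<nu>)) = u x + t * c'"
    and \<omega>: "\<omega> \<in> Cc_forms 0"
  shows "ddc_power u CARD('n) \<omega> = 0"
proof -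
  note cu = convex_lipschitz_continuous[OF u]
  have "cur (replicate CARD('n) (mseq u m)) \<omega> = 0" for m
  proof -
    let ?us = "replicate CARD('n) (mseq u m)"
    have "levis ?us \<omega> x std_frame = 0" for x
    proof -
      have "psd_smooth w" if "w \<in> set ?us" for w
        using that mseq_convex_lipschitz(1)[OF u] by (auto simp: psd_seq_def)
      then obtain pss where pss: "\<And>ps. ps \<in> set pss \<Longrightarrow> length ps = length ?us"
        "\<And>\<omega> vs. levis ?us \<omega> x vs = (\<Sum>ps\<leftarrow>pss. epairs ps (\<omega> x) vs)"
        "\<And>ps q v. ps \<in> set pss \<Longrightarrow> q \<in> set ps \<Longrightarrow> (\<And>u. u \<in> set ?us \<Longrightarrow> hess u x v v = 0) \<Longrightarrow> q \<bullet> v = 0"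
        by (rule levis_psd[of ?us x]) blast+
      have "epairs ps (\<omega> x) std_frame = 0" if ps: "ps \<in> set pss" for ps
      proof (rule epairs_degenerate[OF _ \<nu>])
        show "length ps = CARD('n)" using pss(1)[OF ps] by simp
        show "q \<bullet> \<nu> = 0 \<and> q \<bullet> (\<i> *s \<nu>) = 0" if "q \<in> set ps" for q
          using pss(3)[OF ps that] hess_affine_direction[OF cu aff(1)] hess_affine_direction[OF cu aff(2)] by simp
      qed
      then have "map (\<lambda>ps. epairs ps (\<omega> x) std_frame) pss = map (\<lambda>ps. 0) pss" by (intro map_cong refl)
      then show ?thesis unfolding pss(2) by (simp only: sum_list_0)
    qed
    then show ?thesis by (simp add: cur_def)
  qed
  then show ?thesis
    using top_power(2)[OF u \<omega>] by (simp add: LIMSEQ_const_iff)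
qed

section \<open>Cutting a convex body by a real hyperplane\<close>

lemma convex_body_cut:
  assumes "convex_body A" "closed S" "convex S" "A \<inter> S \<noteq> {}"
  shows "convex_body (A \<inter> S)"
  using assms by (auto simp: convex_body_def intro: convex_Int)

lemma pseudovolume_nonneg: "pseudovolume A \<ge> 0"
  by (simp add: pseudovolume_def)

lemma parallel_spaceI: "x \<in> S \<Longrightarrow> y \<in> S \<Longrightarrow> x - y \<in> parallel_space S"
  unfolding parallel_space_def by (auto intro: hull_inc)

theorem lemma11p3:
  fixes A :: "(complex^'n::finite) set"
    and H Hplus Hminus :: "(complex^'n) set"
    and a :: "complex^'n" and b :: real
  assumes "convex_body A"
    and "real_dim A = 2 * CARD('n) - 1"
    and "a \<noteq> 0"
    and "H = {z. a \<bullet> z = b}"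
    and "Hplus = {z. a \<bullet> z \<ge> b}"
    and "Hminus = {z. a \<bullet> z \<le> b}"
    and "parallel_space A \<inter> parallel_space H = complex_part A"
  shows "pseudovolume (A \<inter> H) = 0
       \<and> pseudovolume A = pseudovolume (A \<inter> Hplus) + pseudovolume (A \<inter> Hminus)
       \<and> pseudovolume A \<ge> max (pseudovolume (A \<inter> Hplus)) (pseudovolume (A \<inter> Hminus))"
proof -
  note A = assms(1)
  have main: "pseudovolume (A \<inter> H) = 0 \<and> pseudovolume A = pseudovolume (A \<inter> Hplus) + pseudovolume (A \<inter> Hminus)"
  \<comment> \<open>If \<open>H\<close> misses \<open>A\<close>, connectedness puts \<open>A\<close>
    on one side, and the other piece is empty with value 0 by convention. The argument with support
    functions requires a non-empty section.\<close>
  proof (cases "A \<inter> H = {}")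
    case True
    have "A \<inter> Hplus = {} \<and> A \<inter> Hminus = A \<or> A \<inter> Hplus = A \<and> A \<inter> Hminus = {}"
    proof -
      have "\<not> (p \<in> A \<and> q \<in> A \<and> a \<bullet> q \<le> b \<and> b \<le> a \<bullet> p)" for p q
      proof
        assume pq: "p \<in> A \<and> q \<in> A \<and> a \<bullet> q \<le> b \<and> b \<le> a \<bullet> p"
        have "connected A" using A by (simp add: convex_body_def convex_connected)
        then obtain r where "r \<in> A" "a \<bullet> r = b"
          using connected_ivt_hyperplane[of A q p a b] pq by blast
        then show False using True assms(4) by blast
      qed
      then have "A \<inter> Hplus = {} \<or> A \<inter> Hminus = {}" unfolding assms(5,6) by blast
      moreover have "A = (A \<inter> Hplus) \<union> (A \<inter> Hminus)" unfolding assms(5,6) by auto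
      ultimately show ?thesis by blast
    qed
    then show ?thesis using True by (auto simp: pseudovolume_def)
  next
    case False
    have sub: "A \<inter> H \<subseteq> A \<inter> Hplus" "A \<inter> H \<subseteq> A \<inter> Hminus" unfolding assms(4-6) by auto
    have cl: "closed H" "closed Hplus" "closed Hminus" and cv: "convex H" "convex Hplus" "convex Hminus"
      unfolding assms(4-6)
      by (simp_all add: closed_hyperplane closed_halfspace_ge closed_halfspace_le convex_hyperplane
          convex_halfspace_ge convex_halfspace_le)
    have cb: "convex_body (A \<inter> H)" "convex_body (A \<inter> Hplus)" "convex_body (A \<inter> Hminus)"
      using convex_body_cut[OF A cl(1) cv(1)] convex_body_cut[OF A cl(2) cv(2)] convex_body_cut[OF A cl(3) cv(3)]
        False sub by auto
    obtain B where B: "\<And>v. v \<in> A \<Longrightarrow> norm v \<le> B"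
    proof -
      have "bounded A" using A by (simp add: convex_body_def compact_imp_bounded)
      then show ?thesis using that unfolding bounded_iff by blast
    qed
    let ?w = "support_fun A" and ?u = "support_fun (A \<inter> Hplus)" and ?v = "support_fun (A \<inter> Hminus)"
      and ?z = "support_fun (A \<inter> H)"
    have lip: "convex_lipschitz B (support_fun C)" if "convex_body C" "C \<subseteq> A" for C
      using that B by (intro support_fun_convex_lipschitz) auto
    have L: "convex_lipschitz B ?w" "convex_lipschitz B ?u" "convex_lipschitz B ?v" "convex_lipschitz B ?z"
      using A cb by (simp_all add: lip)
    have wuv: "?w x = max (?u x) (?v x)" for x
      by (rule support_fun_union[OF A cb(2,3)]) (auto simp: assms(5,6))
    have zuv: "?z x = min (?u x) (?v x)" for x
      using support_fun_cut[where A=A and a=a and b=b and x=x] A cb unfolding assms(4-6) by (simp add: convex_body_def)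
    \<comment> \<open>A normal exists since the parallel space has real dimension 2n - 1 < 2n; the
      truncated subtraction is harmless because n is positive.\<close>
    obtain \<nu> where \<nu>: "\<nu> \<noteq> 0" "\<And>y. y \<in> parallel_space A \<Longrightarrow> \<nu> \<bullet> y = 0"
    proof -
      have "CARD('n) > 0" by simp
      then have "2 * CARD('n) - 1 < 2 * CARD('n)" by linarith
      then have "dim (parallel_space A) < DIM(complex^'n)"
        using assms(2) by (simp add: real_dim_def mult.commute)
      then obtain \<nu> where "\<nu> \<noteq> 0" "\<And>y. y \<in> span (parallel_space A) \<Longrightarrow> orthogonal \<nu> y"
        by (rule orthogonal_to_subspace_exists) auto
      then show ?thesis using that span_base unfolding orthogonal_def by metis
    qed
    \<comment> \<open>The hypothesis on the parallel spaces writes \<open>v - w\<close> as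
      \<open>\<i> *s e\<close> with \<open>e\<close> parallel to \<open>A\<close>. Multiplication by
      \<open>\<i>\<close> preserves the real inner product, so \<open>\<i> *s \<nu>\<close> is
      orthogonal to \<open>v - w\<close> because \<open>\<nu>\<close> is orthogonal to
      \<open>e\<close>.\<close>
    have const: "\<nu> \<bullet> v = \<nu> \<bullet> w \<and> (\<i> *s \<nu>) \<bullet> v = (\<i> *s \<nu>) \<bullet> w" if "v \<in> A \<inter> H" "w \<in> A \<inter> H" for v w
    proof -
      have d: "v - w \<in> parallel_space A" using that by (auto intro: parallel_spaceI)
      moreover have "v - w \<in> parallel_space H" using that by (auto intro: parallel_spaceI)
      ultimately have "v - w \<in> complex_part A" using assms(7) by blast
      then obtain e where e: "e \<in> parallel_space A" "v - w = \<i> *s e" by (auto simp: complex_part_def)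
      have "(\<i> *s \<nu>) \<bullet> (v - w) = 0" unfolding e(2) using \<nu>(2)[OF e(1)] by simp
      then show ?thesis using \<nu>(2)[OF d] by (simp add: inner_diff_right)
    qed
    obtain v0 where v0: "v0 \<in> A \<inter> H" using False by blast
    \<comment> \<open>A direction with constant inner product on the section changes all competing
      values by the same amount and does not affect the maximisers. It is used for
      \<open>\<nu>\<close> and \<open>\<i> *s \<nu>\<close>.\<close>
    have aff: "?z (x + t *\<^sub>R \<mu>) = ?z x + t * (\<mu> \<bullet> v0)" if "\<And>v. v \<in> A \<inter> H \<Longrightarrow> \<mu> \<bullet> v = \<mu> \<bullet> v0" for \<mu> x t
    proof (rule antisym)
      obtain v where v: "v \<in> A \<inter> H" "?z (x + t *\<^sub>R \<mu>) = (x + t *\<^sub>R \<mu>) \<bullet> v"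
        using support_fun_attained[OF cb(1)] by metis
      show "?z (x + t *\<^sub>R \<mu>) \<le> ?z x + t * (\<mu> \<bullet> v0)"
        using support_fun_upper[OF cb(1) v(1), of x] that[OF v(1)] by (simp add: v(2) inner_add_left)
      obtain v' where v': "v' \<in> A \<inter> H" "?z x = x \<bullet> v'"
        using support_fun_attained[OF cb(1)] by metis
      show "?z x + t * (\<mu> \<bullet> v0) \<le> ?z (x + t *\<^sub>R \<mu>)"
        using support_fun_upper[OF cb(1) v'(1), of "x + t *\<^sub>R \<mu>"] that[OF v'(1)] by (simp add: v'(2) inner_add_left)
    qed
    have zero: "ddc_power ?z CARD('n) \<omega> = 0" if "\<omega> \<in> Cc_forms 0" for \<omega>
      by (rule top_power_degenerate[OF L(4) \<nu>(1) aff aff that]) (use const v0 in blast)+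
    let ?\<psi> = "\<lambda>k x::complex^'n. max 0 (1 - real (Suc k) * max 0 (norm x - 1))"
    have c: "form0 (?\<psi> k) \<in> Cc_forms 0" for k
      by (rule form0_Cc, rule radon_measure_cball(2)[OF monge_ampere_props(1,2)[OF L(1)]]) simp_all
    have "ddc_power ?w CARD('n) (form0 (?\<psi> k)) = ddc_power ?u CARD('n) (form0 (?\<psi> k)) + ddc_power ?v CARD('n) (form0 (?\<psi> k))" for k
      using monge_ampere_valuation[OF L(2,3,1,4) wuv zuv c[of k]] zero[OF c[of k]] by simp
    then have "(\<lambda>k. Re (ddc_power ?w CARD('n) (form0 (?\<psi> k)))) \<longlonglongrightarrow>
        measure (monge_ampere ?u) (cball 0 1) + measure (monge_ampere ?v) (cball 0 1)"
      using tendsto_add[OF monge_ampere_cball[OF L(2)] monge_ampere_cball[OF L(3)]] by simp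
    from LIMSEQ_unique[OF monge_ampere_cball[OF L(1)] this]
    have "measure (monge_ampere ?w) (cball 0 1)
        = measure (monge_ampere ?u) (cball 0 1) + measure (monge_ampere ?v) (cball 0 1)" .
    moreover have "measure (monge_ampere ?z) (cball 0 1) = 0"
      using monge_ampere_cball[OF L(4)] zero[OF c] by (simp add: LIMSEQ_const_iff)
    moreover have "A \<noteq> {}" "A \<inter> Hplus \<noteq> {}" "A \<inter> Hminus \<noteq> {}"
      using False sub by auto
    ultimately show ?thesis
      using False by (simp add: pseudovolume_def add_divide_distrib)
  qed
  then show ?thesis
    using pseudovolume_nonneg[of "A \<inter> Hplus"] pseudovolume_nonneg[of "A \<inter> Hminus"] by simp
qed

end
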